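(* Let $G$ be a countable group admitting a normal series $G = G_0 \rhd G_1 \rhd \cdots \rhd G_n = \{1_G\}$ where each quotient of consecutive terms $G_k/G_{k+1}$ is a finite group, an increasing union of characteristic finite subgroups, or a torsion-free abelian group with finite $\mathbb{Q}$-rank, except the top quotient $G_0/G_1$ can be any group of uniform local polynomial volume-growth or the lamplighter group $\mathbb{Z}_2 \wr \mathbb{Z}$. If $X$ is a standard Borel space and $G \curvearrowright X$ is a free Borel action, then $\mathrm{asdim}_{\mathbf{B}}(G\curvearrowright X) = \mathrm{asdim}(G) < \infty$. Additionally, if $X$ is a locally compact $0$-dimensional second countable Hausdorff space and $G$ acts freely and continuously on $X$, then the dynamic asymptotic dimension of $G\curvearrowright X$ is at most $\mathrm{asdim}(G) < \infty$.
   Context: A normal series of $G$ is a finite sequence $G = G_0 \rhd G_1 \rhd\cdots\rhd G_n=\{1_G\}$ of subgroups each of which is normal in $G$. A subgroup is characteristic if it is invariant under all automorphisms. The lamplighter group is $\mathbb{Z}_2\wr\mathbb{Z}=(\bigoplus_{n\in\mathbb{Z}}\mathbb{Z}_2)\rtimes\mathbb{Z}$, with $\mathbb{Z}$ acting by shifting coordinates. The $\mathbb{Q}$-rank of an abelian group $A$ is $\dim_{\mathbb{Q}}(\mathbb{Q}\otimes A)$. A finitely generated group has polynomial volume-growth of degree $d$ if $d\in\mathbb{N}$ is least such that for any (equivalently every) finite symmetric generating set $B$ containing the identity there is $c>0$ with $|B^r|\le c r^d$ for all $r\ge 1$. A group has uniform local polynomial volume-growth if there is $d\in\mathbb{N}$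 such that every finitely generated subgroup has polynomial volume-growth of degree at most $d$. An action is free if $g\cdot x\ne x$ for all $x$ and all $g\neq 1_G$. Asymptotic dimensions. An extended metric is a metric allowed to take the value $+\infty$; it is proper if balls of finite radius are finite; $B(x;r)$ denotes a closed ball; an equivalence relation is uniformly bounded if there is a finite uniform bound on the diameters of its classes. For an extended metric space $(X,\rho)$, $\mathrm{asdim}(X,\rho)$ is the least $d\in\mathbb{N}$ such that for every $r>0$ there is a uniformly bounded equivalence relation $E$ on $X$ such that every ball $B(x;r)$ meets at most $d+1$ classes of $E$ ($\infty$ if no such $d$ exists). If $X$ is standard Borel, $\rho$ is Borel and every class of $\{(x,y):\rho(x,y)<\infty\}$ is countable, $\mathrm{asdim}_{\mathbf{B}}(X,\rho)$ is defined in the same way but with $E$ required to be Borel. Every countable group $G$ admits a proper right-invariant metric $\tau$. Set $\mathrm{asdim}(G)=\mathrm{asdim}(G,\tau)$. For an action $G\curvearrowright X$ let $\rho_\tau(x,y)=\min\{\tau(1_G,g): g\in G,\ g\cdot x=y\}$ if this set is nonempty and $+\infty$ otherwise, and for a Borel action set $\mathrm{asdim}_{\mathbf{B}}(G\curvearrowright X)=\mathrm{asdim}_{\mathbf{B}}(X,\rho_\tau)$. These quantities do not depend on the choice of $\tau$. Dynamic asymptotic dimension. For a discrete group $G$ acting continuously on a locally compact Hausdorff space $X$, the dynamic asymptotic dimension is the least $d\in\mathbb{N}$ such that for every compact $K\subseteq X$ and finite $B\subseteq G$ there are open sets $U_0,\dots,U_d$ covering $K$ such that for every $i$ the set $T_B^{U_i}$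 is finite, where $g\in T_B^{U}$ iff there are $x\in U$, $m\ge1$ and $b_1,\dots,b_m\in B\cup B^{-1}$ with $g=b_m\cdots b_1$ and $b_k b_{k-1}\cdots b_1\cdot x\in U$ for all $1\le k\le m$; it is $\infty$ if no such $d$ exists. A space is $0$-dimensional if it has a base of clopen sets. *)

theory Defs
  imports
    "HOL-Analysis.Analysis"
    "HOL-Algebra.Free_Abelian_Groups"
    "HOL-Algebra.Group_Action"
    "Jordan_Normal_Form.Missing_VectorSpace"
begin

section \<open>Group-theoretic notions\<close>

definition characteristic :: "'a set \<Rightarrow> ('a, 'm) monoid_scheme \<Rightarrow> bool" where
  "characteristic N G \<longleftrightarrow> subgroup N G \<and> (\<forall>\<alpha>\<in>auto G. \<alpha> ` N = N)"

definition union_of_characteristic_finite_subgroups :: "('a, 'm) monoid_scheme \<Rightarrow> bool" where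
  "union_of_characteristic_finite_subgroups G \<longleftrightarrow>
     (\<exists>F :: nat \<Rightarrow> 'a set.
        (\<forall>i. characteristic (F i) G \<and> finite (F i) \<and> F i \<subseteq> F (Suc i)) \<and>
        (\<Union>i. F i) = carrier G)"

definition torsion_free :: "('a, 'm) monoid_scheme \<Rightarrow> bool" where
  "torsion_free G \<longleftrightarrow>
     (\<forall>x\<in>carrier G. \<forall>n::nat. n \<ge> 1 \<longrightarrow> x [^]\<^bsub>G\<^esub> n = \<one>\<^bsub>G\<^esub> \<longrightarrow> x = \<one>\<^bsub>G\<^esub>)"

subsection \<open>Rational rank\<close>

definition rat_field :: "rat ring" where
  "rat_field = \<lparr>carrier = UNIV, monoid.mult = (*), one = 1, ring.zero = 0, add = (+)\<rparr>"

text \<open>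
  The tensor product of the additive group of rationals with an abelian group \<open>A\<close> (written
  multiplicatively): the free abelian group on pairs \<open>(p, a)\<close> modulo the subgroup generated by
  the biadditivity relations.
\<close>

abbreviation rat_tensor_free :: "('a, 'm) monoid_scheme \<Rightarrow> (rat \<times> 'a \<Rightarrow>\<^sub>0 int) monoid" where
  "rat_tensor_free A \<equiv> free_Abelian_group (UNIV \<times> carrier A)"

definition rat_tensor_relations :: "('a, 'm) monoid_scheme \<Rightarrow> (rat \<times> 'a \<Rightarrow>\<^sub>0 int) set" where
  "rat_tensor_relations A = generate (rat_tensor_free A)
     ({frag_of (p + q, a) - frag_of (p, a) - frag_of (q, a) | p q a. a \<in> carrier A} \<union>
      {frag_of (p, a \<otimes>\<^bsub>A\<^esub> b) - frag_of (p, a) - frag_of (p, b) | p a b.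
         a \<in> carrier A \<and> b \<in> carrier A})"

text \<open>
  The scalar \<open>q\<close> acts by sending the class of \<open>(p, a)\<close> to the class of \<open>(q * p, a)\<close>; the union
  below is over representatives of one class, all of which give the same coset.
  The ring multiplication fields of the module record carry no meaning.
\<close>

abbreviation rat_scale :: "rat \<Rightarrow> (rat \<times> 'a \<Rightarrow>\<^sub>0 int) \<Rightarrow> (rat \<times> 'a \<Rightarrow>\<^sub>0 int)" where
  "rat_scale q \<equiv> frag_extend (\<lambda>(p, a). frag_of (q * p, a))"

definition rat_tensor ::
    "('a, 'm) monoid_scheme \<Rightarrow> (rat, (rat \<times> 'a \<Rightarrow>\<^sub>0 int) set) module" where
  "rat_tensor A =
     (let T = rat_tensor_free A Mod rat_tensor_relations A in
      \<lparr>carrier = carrier T, mult = undefined, one = undefined,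
       zero = \<one>\<^bsub>T\<^esub>, add = (\<otimes>\<^bsub>T\<^esub>),
       smult = (\<lambda>q C. \<Union>x\<in>C. rat_tensor_relations A #>\<^bsub>rat_tensor_free A\<^esub>
                 rat_scale q x)\<rparr>)"

lemma rat_tensor_relations_generators:
  assumes "monoid A"
  shows "{frag_of (p + q, a) - frag_of (p, a) - frag_of (q, a) | p q a. a \<in> carrier A} \<union>
      {frag_of (p, a \<otimes>\<^bsub>A\<^esub> b) - frag_of (p, a) - frag_of (p, b) | p a b.
         a \<in> carrier A \<and> b \<in> carrier A} \<subseteq> carrier (rat_tensor_free A)"
proof -
  have "Poly_Mapping.keys (frag_of x - frag_of y - frag_of z) \<subseteq> UNIV \<times> carrier A"
    if "snd x \<in> carrier A" "snd y \<in> carrier A" "snd z \<in> carrier A" for x y z :: "rat \<times> 'a"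
  proof -
    have "Poly_Mapping.keys (frag_of x - frag_of y - frag_of z) \<subseteq> {x, y, z}"
      using keys_diff[of "frag_of x - frag_of y" "frag_of z"] keys_diff[of "frag_of x" "frag_of y"]
      by auto
    then show ?thesis using that by (auto simp: mem_Times_iff)
  qed
  note keys = this
  have "frag_of x - frag_of y - frag_of z \<in> carrier (rat_tensor_free A)"
    if "snd x \<in> carrier A" "snd y \<in> carrier A" "snd z \<in> carrier A" for x y z :: "rat \<times> 'a"
    using keys[OF that] by (simp only: carrier_free_Abelian_group_iff)
  from this[of "(_, _)" "(_, _)" "(_, _)"] show ?thesis
    using monoid.m_closed[OF assms] unfolding snd_conv by blast
qed

lemma subgroup_rat_tensor_relations:
  assumes "monoid A"
  shows "subgroup (rat_tensor_relations A) (rat_tensor_free A)"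
  unfolding rat_tensor_relations_def
  by (rule group.generate_is_subgroup[OF group_free_Abelian_group
        rat_tensor_relations_generators[OF assms]])

lemma keys_rat_scale:
  "Poly_Mapping.keys x \<subseteq> UNIV \<times> C \<Longrightarrow> Poly_Mapping.keys (rat_scale q x) \<subseteq> UNIV \<times> C"
  using keys_frag_extend[of "\<lambda>(p, a). frag_of (q * p, a)" x] by force

lemma rat_scale_relations:
  assumes "monoid A" and "c \<in> rat_tensor_relations A"
  shows "rat_scale q c \<in> rat_tensor_relations A"
proof -
  let ?R = "{frag_of (p + q, a) - frag_of (p, a) - frag_of (q, a) | p q a. a \<in> carrier A} \<union>
      {frag_of (p, a \<otimes>\<^bsub>A\<^esub> b) - frag_of (p, a) - frag_of (p, b) | p a b.
         a \<in> carrier A \<and> b \<in> carrier A}"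
  let ?F = "rat_tensor_free A"
  interpret N: subgroup "rat_tensor_relations A" ?F
    by (rule subgroup_rat_tensor_relations[OF assms(1)])
  have R: "?R \<subseteq> carrier ?F"
    by (rule rat_tensor_relations_generators[OF assms(1)])
  have f: "rat_scale q h \<in> rat_tensor_relations A" if "h \<in> ?R" for h
  proof -
    have "rat_scale q h \<in> ?R"
      using that
    proof
      assume "h \<in> {frag_of (p + q, a) - frag_of (p, a) - frag_of (q, a) | p q a. a \<in> carrier A}"
      then obtain p r a where h: "h = frag_of (p + r, a) - frag_of (p, a) - frag_of (r, a)"
        "a \<in> carrier A"
        by blast
      then have "rat_scale q h = frag_of (q * p + q * r, a) - frag_of (q * p, a) - frag_of (q * r, a)"
        by (simp add: frag_extend_diff distrib_left)
      then show ?thesis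
        using h by blast
    next
      assume "h \<in> {frag_of (p, a \<otimes>\<^bsub>A\<^esub> b) - frag_of (p, a) - frag_of (p, b) | p a b.
           a \<in> carrier A \<and> b \<in> carrier A}"
      then obtain p a b where h: "h = frag_of (p, a \<otimes>\<^bsub>A\<^esub> b) - frag_of (p, a) - frag_of (p, b)"
        "a \<in> carrier A" "b \<in> carrier A"
        by blast
      then have "rat_scale q h = frag_of (q * p, a \<otimes>\<^bsub>A\<^esub> b) - frag_of (q * p, a) - frag_of (q * p, b)"
        by (simp add: frag_extend_diff)
      then show ?thesis
        using h by blast
    qed
    then show ?thesis
      unfolding rat_tensor_relations_def by (rule generate.incl)
  qed
  from assms(2) show ?thesis
    unfolding rat_tensor_relations_def[of A]
  proof (induction c rule: generate.induct)
    case one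
    then show ?case
      using N.one_closed by (simp add: rat_tensor_relations_def)
  next
    case (incl h)
    then show ?case
      using f by (simp add: rat_tensor_relations_def)
  next
    case (inv h)
    then have k: "Poly_Mapping.keys h \<subseteq> UNIV \<times> carrier A"
      using R by (meson carrier_free_Abelian_group_iff subsetD)
    have "inv\<^bsub>?F\<^esub> rat_scale q h \<in> rat_tensor_relations A"
      using f[OF inv] by (rule N.m_inv_closed)
    then show ?case
      unfolding inv_free_Abelian_group[OF k] frag_extend_minus
        inv_free_Abelian_group[OF keys_rat_scale[OF k]] rat_tensor_relations_def .
  next
    case (eng h1 h2)
    then show ?case
      using N.m_closed by (simp add: rat_tensor_relations_def frag_extend_add)
  qed
qed

lemma rat_tensor_smult_coset:
  assumes "monoid A" and "Poly_Mapping.keys x \<subseteq> UNIV \<times> carrier A"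
  shows "q \<odot>\<^bsub>rat_tensor A\<^esub> (rat_tensor_relations A #>\<^bsub>rat_tensor_free A\<^esub> x) =
     rat_tensor_relations A #>\<^bsub>rat_tensor_free A\<^esub> rat_scale q x"
proof -
  let ?F = "rat_tensor_free A" and ?N = "rat_tensor_relations A"
  interpret F: group ?F by simp
  interpret N: subgroup ?N ?F
    by (rule subgroup_rat_tensor_relations[OF assms(1)])
  have "?N #>\<^bsub>?F\<^esub> rat_scale q y = ?N #>\<^bsub>?F\<^esub> rat_scale q x" if y: "y \<in> ?N #>\<^bsub>?F\<^esub> x" for y
  proof -
    obtain c where c: "c \<in> ?N" "y = c + x"
      using y by (auto simp: r_coset_def)
    have "rat_scale q y \<in> ?N #>\<^bsub>?F\<^esub> rat_scale q x"
      using c rat_scale_relations[OF assms(1) c(1), of q]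
      by (auto simp: r_coset_def frag_extend_add)
    then show ?thesis
      using F.repr_independence N.subgroup_axioms keys_rat_scale[OF assms(2)] by simp
  qed
  moreover have "x \<in> ?N #>\<^bsub>?F\<^esub> x"
    using F.rcos_self N.subgroup_axioms assms(2) by simp
  ultimately show ?thesis
    unfolding rat_tensor_def Let_def module.simps by blast
qed

lemma field_rat_field: "field rat_field"
proof -
  have "cring rat_field"
    unfolding rat_field_def
    by (unfold_locales) (auto simp: Units_def algebra_simps intro: exI[of _ "- x" for x])
  then show ?thesis
  proof (rule cring.cring_fieldI2)
    show "\<zero>\<^bsub>rat_field\<^esub> \<noteq> \<one>\<^bsub>rat_field\<^esub>"
      by (simp add: rat_field_def)
    show "\<exists>b\<in>carrier rat_field. a \<otimes>\<^bsub>rat_field\<^esub> b = \<one>\<^bsub>rat_field\<^esub>"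
      if "a \<noteq> \<zero>\<^bsub>rat_field\<^esub>" for a
      using that by (intro bexI[of _ "inverse a"]) (simp_all add: rat_field_def)
  qed
qed

lemma vectorspace_rat_tensor:
  assumes "comm_group A"
  shows "vectorspace rat_field (rat_tensor A)"
proof -
  interpret A: comm_group A by fact
  let ?F = "rat_tensor_free A" and ?N = "rat_tensor_relations A" and ?V = "rat_tensor A"
  let ?c = "\<lambda>x. ?N #>\<^bsub>?F\<^esub> x" and ?S = "UNIV \<times> carrier A"
  interpret F: comm_group ?F by (rule abelian_free_Abelian_group)
  have sub: "subgroup ?N ?F"
    by (rule subgroup_rat_tensor_relations) (rule A.monoid_axioms)
  interpret N: normal ?N ?F
    using sub by (simp add: F.normal_iff_subgroup)
  interpret T: comm_group "?F Mod ?N"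
    by (rule F.abelian_FactGroup[OF sub])
  have carr: "carrier ?V = ?c ` carrier ?F"
    by (simp add: rat_tensor_def Let_def carrier_FactGroup)
  have obt: "\<exists>x. Poly_Mapping.keys x \<subseteq> ?S \<and> X = ?c x" if "X \<in> carrier ?V" for X
    using that unfolding carr by (elim imageE) (auto simp only: carrier_free_Abelian_group_iff)
  have add: "?c x \<oplus>\<^bsub>?V\<^esub> ?c y = ?c (x + y)"
    if "Poly_Mapping.keys x \<subseteq> ?S" "Poly_Mapping.keys y \<subseteq> ?S" for x y
    using that N.rcos_sum[of x y] by (simp add: rat_tensor_def Let_def)
  have smult: "q \<odot>\<^bsub>?V\<^esub> ?c x = ?c (rat_scale q x)" if "Poly_Mapping.keys x \<subseteq> ?S" for q x
    using rat_tensor_smult_coset[OF A.monoid_axioms that] .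
  have cl: "Poly_Mapping.keys (x + y) \<subseteq> ?S"
    if "Poly_Mapping.keys x \<subseteq> ?S" "Poly_Mapping.keys y \<subseteq> ?S" for x y :: "rat \<times> 'a \<Rightarrow>\<^sub>0 int"
    using that F.m_closed by simp
  have cdiff: "Poly_Mapping.keys (x - y) \<subseteq> ?S"
    if "Poly_Mapping.keys x \<subseteq> ?S" "Poly_Mapping.keys y \<subseteq> ?S" for x y :: "rat \<times> 'a \<Rightarrow>\<^sub>0 int"
    using cl[of x "- y"] that by simp
  have ab: "abelian_group ?V"
  proof (rule abelian_groupI)
    fix X assume "X \<in> carrier ?V"
    then show "\<exists>Y\<in>carrier ?V. Y \<oplus>\<^bsub>?V\<^esub> X = \<zero>\<^bsub>?V\<^esub>"
      using T.l_inv_ex by (simp add: rat_tensor_def Let_def)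
  next
    fix X Y Z assume "X \<in> carrier ?V" "Y \<in> carrier ?V" "Z \<in> carrier ?V"
    then show "X \<oplus>\<^bsub>?V\<^esub> Y \<oplus>\<^bsub>?V\<^esub> Z = X \<oplus>\<^bsub>?V\<^esub> (Y \<oplus>\<^bsub>?V\<^esub> Z)"
      using T.m_assoc by (simp add: rat_tensor_def Let_def)
  next
    fix X Y assume "X \<in> carrier ?V" "Y \<in> carrier ?V"
    then show "X \<oplus>\<^bsub>?V\<^esub> Y \<in> carrier ?V" "X \<oplus>\<^bsub>?V\<^esub> Y = Y \<oplus>\<^bsub>?V\<^esub> X"
      using T.m_closed T.m_comm by (simp_all add: rat_tensor_def Let_def)
  next
    show "\<zero>\<^bsub>?V\<^esub> \<in> carrier ?V"
      using T.one_closed by (simp add: rat_tensor_def Let_def)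
    fix X assume "X \<in> carrier ?V"
    then show "\<zero>\<^bsub>?V\<^esub> \<oplus>\<^bsub>?V\<^esub> X = X"
      using T.l_one by (simp add: rat_tensor_def Let_def)
  qed
  have distr: "?c (rat_scale (p + q) x) = ?c (rat_scale p x + rat_scale q x)"
    if "Poly_Mapping.keys x \<subseteq> ?S" for p q and x :: "rat \<times> 'a \<Rightarrow>\<^sub>0 int"
  proof -
    have "rat_scale (p + q) x - (rat_scale p x + rat_scale q x) \<in> ?N"
      using that
    proof (induction x rule: free_Abelian_group_induct[consumes 1])
      case 1
      then show ?case using N.one_closed by simp
    next
      case (2 x y)
      have "(rat_scale (p + q) x - (rat_scale p x + rat_scale q x)) +
         - (rat_scale (p + q) y - (rat_scale p y + rat_scale q y)) \<in> ?N"
        using N.m_closed[OF 2(3) N.m_inv_closed[OF 2(4)]] N.mem_carrier[OF 2(4)] by simp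
      then show ?case
        by (simp add: frag_extend_diff algebra_simps)
    next
      case (3 a)
      obtain r b where [simp]: "a = (r, b)" by (cases a)
      have "frag_of (p * r + q * r, b) - frag_of (p * r, b) - frag_of (q * r, b) \<in> ?N"
        unfolding rat_tensor_relations_def using 3 by (intro generate.incl) auto
      then show ?case
        by (simp add: algebra_simps)
    qed
    moreover have "rat_scale (p + q) x = (rat_scale (p + q) x - (rat_scale p x + rat_scale q x))
        \<otimes>\<^bsub>?F\<^esub> (rat_scale p x + rat_scale q x)"
      by simp
    ultimately have "rat_scale (p + q) x \<in> ?c (rat_scale p x + rat_scale q x)"
      unfolding r_coset_def by blast
    then show ?thesis
      using F.repr_independence[OF _ _ sub] cl[OF keys_rat_scale[OF that] keys_rat_scale[OF that]] by simp
  qed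
  have "module rat_field ?V"
  proof (rule moduleI)
    show "cring rat_field"
      using field_rat_field by (simp add: field_def domain_def)
    show "abelian_group ?V" by (rule ab)
  next
    fix q X assume X: "X \<in> carrier ?V"
    obtain x where x: "Poly_Mapping.keys x \<subseteq> ?S" "X = ?c x"
      using obt[OF X] by (elim exE conjE) (rule that)
    then have "q \<odot>\<^bsub>?V\<^esub> X = ?c (rat_scale q x)"
      by (simp only: smult)
    then show "q \<odot>\<^bsub>?V\<^esub> X \<in> carrier ?V"
      unfolding carr using keys_rat_scale[OF x(1), of q]
      by (intro rev_image_eqI[of "rat_scale q x"]) (simp_all only: carrier_free_Abelian_group_iff)
  next
    fix p q X assume X: "X \<in> carrier ?V"
    obtain x where x: "Poly_Mapping.keys x \<subseteq> ?S" "X = ?c x"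
      using obt[OF X] by (elim exE conjE) (rule that)
    show "(p \<oplus>\<^bsub>rat_field\<^esub> q) \<odot>\<^bsub>?V\<^esub> X = p \<odot>\<^bsub>?V\<^esub> X \<oplus>\<^bsub>?V\<^esub> q \<odot>\<^bsub>?V\<^esub> X"
      using x distr by (simp add: rat_field_def smult add keys_rat_scale)
    have "rat_scale (p * q) x = rat_scale p (rat_scale q x)"
      using subset_UNIV[of "Poly_Mapping.keys x"]
      by (induction x rule: frag_induction) (auto simp: frag_extend_diff mult.assoc)
    then show "(p \<otimes>\<^bsub>rat_field\<^esub> q) \<odot>\<^bsub>?V\<^esub> X = p \<odot>\<^bsub>?V\<^esub> (q \<odot>\<^bsub>?V\<^esub> X)"
      using x by (simp add: rat_field_def smult keys_rat_scale)
  next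
    fix q X Y assume XY: "X \<in> carrier ?V" "Y \<in> carrier ?V"
    obtain x y where "Poly_Mapping.keys x \<subseteq> ?S" "X = ?c x" "Poly_Mapping.keys y \<subseteq> ?S" "Y = ?c y"
      using obt[OF XY(1)] obt[OF XY(2)] by (elim exE conjE) (rule that)
    then show "q \<odot>\<^bsub>?V\<^esub> (X \<oplus>\<^bsub>?V\<^esub> Y) = q \<odot>\<^bsub>?V\<^esub> X \<oplus>\<^bsub>?V\<^esub> q \<odot>\<^bsub>?V\<^esub> Y"
      by (simp add: smult add keys_rat_scale cl frag_extend_add)
  next
    fix X assume X: "X \<in> carrier ?V"
    obtain x where x: "Poly_Mapping.keys x \<subseteq> ?S" "X = ?c x"
      using obt[OF X] by (elim exE conjE) (rule that)
    have "rat_scale 1 x = x"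
      using subset_UNIV[of "Poly_Mapping.keys x"]
      by (induction x rule: frag_induction) (auto simp: frag_extend_diff)
    then show "\<one>\<^bsub>rat_field\<^esub> \<odot>\<^bsub>?V\<^esub> X = X"
      using x by (simp add: rat_field_def smult)
  qed
  then show ?thesis
    using field_rat_field by (simp add: vectorspace_def)
qed

definition rational_rank :: "('a, 'm) monoid_scheme \<Rightarrow> enat" where
  "rational_rank A =
     (if vectorspace.fin_dim rat_field (rat_tensor A)
      then enat (vectorspace.dim rat_field (rat_tensor A)) else \<infinity>)"

subsection \<open>Volume growth\<close>

definition finitely_generated_group :: "('a, 'm) monoid_scheme \<Rightarrow> bool" where
  "finitely_generated_group G \<longleftrightarrow>
     (\<exists>S. finite S \<and> S \<subseteq> carrier G \<and> generate G S = carrier G)"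

definition symmetric_generating_set :: "('a, 'm) monoid_scheme \<Rightarrow> 'a set \<Rightarrow> bool" where
  "symmetric_generating_set G B \<longleftrightarrow>
     B \<subseteq> carrier G \<and> generate G B = carrier G \<and> \<one>\<^bsub>G\<^esub> \<in> B \<and> (\<forall>b\<in>B. inv\<^bsub>G\<^esub> b \<in> B)"

primrec set_power :: "('a, 'm) monoid_scheme \<Rightarrow> 'a set \<Rightarrow> nat \<Rightarrow> 'a set" where
  "set_power G B 0 = {\<one>\<^bsub>G\<^esub>}"
| "set_power G B (Suc r) = set_power G B r <#>\<^bsub>G\<^esub> B"

definition volume_growth_bound :: "('a, 'm) monoid_scheme \<Rightarrow> nat \<Rightarrow> bool" where
  "volume_growth_bound G d \<longleftrightarrow>
     (\<forall>B. finite B \<and> symmetric_generating_set G B \<longrightarrow>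
        (\<exists>c::real. c > 0 \<and> (\<forall>r\<ge>1. real (card (set_power G B r)) \<le> c * real r ^ d)))"

definition polynomial_growth_degree :: "('a, 'm) monoid_scheme \<Rightarrow> nat \<Rightarrow> bool" where
  "polynomial_growth_degree G d \<longleftrightarrow>
     finitely_generated_group G \<and> volume_growth_bound G d \<and>
     (\<forall>e. volume_growth_bound G e \<longrightarrow> d \<le> e)"

definition uniform_local_polynomial_growth :: "('a, 'm) monoid_scheme \<Rightarrow> bool" where
  "uniform_local_polynomial_growth G \<longleftrightarrow>
     (\<exists>d. \<forall>H. subgroup H G \<and> finitely_generated_group (G\<lparr>carrier := H\<rparr>) \<longrightarrow>
        (\<exists>e\<le>d. polynomial_growth_degree (G\<lparr>carrier := H\<rparr>) e))"

subsection \<open>The lamplighter group\<close>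

definition semidirect_product ::
    "('a, 'm) monoid_scheme \<Rightarrow> ('b, 'n) monoid_scheme \<Rightarrow> ('b \<Rightarrow> 'a \<Rightarrow> 'a) \<Rightarrow> ('a \<times> 'b) monoid" where
  "semidirect_product N K \<theta> =
     \<lparr>carrier = carrier N \<times> carrier K,
      mult = (\<lambda>(x, h) (y, k). (x \<otimes>\<^bsub>N\<^esub> \<theta> h y, h \<otimes>\<^bsub>K\<^esub> k)),
      one = (\<one>\<^bsub>N\<^esub>, \<one>\<^bsub>K\<^esub>)\<rparr>"

definition lamplighter_group :: "((int \<Rightarrow> int) \<times> int) monoid" where
  "lamplighter_group =
     semidirect_product (sum_group UNIV (\<lambda>_::int. integer_mod_group 2)) integer_group
       (\<lambda>k f i. f (i - k))"

lemma group_lamplighter_group: "group lamplighter_group"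
proof -
  let ?S = "sum_group UNIV (\<lambda>_::int. integer_mod_group 2)"
  interpret S: group ?S by simp
  have car: "f \<in> carrier ?S \<longleftrightarrow> range f \<subseteq> {0..<2} \<and> finite {i. f i \<noteq> 0}" for f :: "int \<Rightarrow> int"
    by (simp add: carrier_sum_group PiE_iff carrier_integer_mod_group image_subset_iff)
  have shift: "(\<lambda>i. f (i - k)) \<in> carrier ?S" if "f \<in> carrier ?S" for f :: "int \<Rightarrow> int" and k
  proof -
    have "{i. f (i - k) \<noteq> 0} \<subseteq> (\<lambda>i. i + k) ` {i. f i \<noteq> 0}"
      by (force intro: image_eqI[of _ _ "x - k" for x])
    then show ?thesis
      using that unfolding car by (auto intro: finite_subset)
  qed
  have sm: "(\<lambda>i. (f \<otimes>\<^bsub>?S\<^esub> g) (i - k)) = (\<lambda>i. f (i - k)) \<otimes>\<^bsub>?S\<^esub> (\<lambda>i. g (i - k))"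
    for f g :: "int \<Rightarrow> int" and k
    by auto
  have so: "(\<lambda>i. \<one>\<^bsub>?S\<^esub> (i - k)) = \<one>\<^bsub>?S\<^esub>" for k
    by auto
  show ?thesis
    unfolding lamplighter_group_def semidirect_product_def
  proof (rule groupI, goal_cases)
    case (1 x y)
    then show ?case
      using shift S.m_closed by (force simp del: mult_sum_group split: prod.splits)
  next
    case 2
    then show ?case using S.one_closed by (simp del: one_sum_group)
  next
    case (3 x y z)
    show ?case
    proof -
      obtain f k g l h m where [simp]: "x = (f, k)" "y = (g, l)" "z = (h, m)"
        by (metis surj_pair)
      have "f \<in> carrier ?S" "g \<in> carrier ?S" "h \<in> carrier ?S"
        using 3 by auto
      then have "f \<otimes>\<^bsub>?S\<^esub> (\<lambda>i. g (i - k)) \<otimes>\<^bsub>?S\<^esub> (\<lambda>i. h (i - k - l)) =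
          f \<otimes>\<^bsub>?S\<^esub> (\<lambda>i. (g \<otimes>\<^bsub>?S\<^esub> (\<lambda>i. h (i - l))) (i - k))"
        using S.m_assoc shift[of g k] shift[OF shift[of h l], of k] sm[of g "\<lambda>i. h (i - l)" k]
        by metis
      then show ?thesis
        by (simp del: mult_sum_group add: diff_diff_eq)
    qed
  next
    case (4 x)
    then show ?case
      using S.l_one by (auto simp del: mult_sum_group one_sum_group split: prod.splits)
  next
    case (5 x)
    then obtain f k where x: "x = (f, k)" "f \<in> carrier ?S" by auto
    have "(\<lambda>i. (inv\<^bsub>?S\<^esub> f) (i + k)) \<otimes>\<^bsub>?S\<^esub> (\<lambda>i. f (i + k)) = \<one>\<^bsub>?S\<^esub>"
      using sm[of "inv\<^bsub>?S\<^esub> f" f "- k"] so[of "- k"] S.l_inv[OF x(2)]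
      by (simp del: mult_sum_group one_sum_group)
    then show ?case
      using x shift[OF S.inv_closed[OF x(2)], of "- k"]
      by (intro bexI[of _ "(\<lambda>i. (inv\<^bsub>?S\<^esub> f) (i + k), - k)"])
         (auto simp del: mult_sum_group one_sum_group)
  qed
qed

subsection \<open>Normal series\<close>

definition normal_series :: "('a, 'm) monoid_scheme \<Rightarrow> nat \<Rightarrow> (nat \<Rightarrow> 'a set) \<Rightarrow> bool" where
  "normal_series G n H \<longleftrightarrow>
     H 0 = carrier G \<and> H n = {\<one>\<^bsub>G\<^esub>} \<and>
     (\<forall>k\<le>n. H k \<lhd> G) \<and> (\<forall>k<n. H (Suc k) \<subseteq> H k)"

definition series_factor :: "('a, 'm) monoid_scheme \<Rightarrow> (nat \<Rightarrow> 'a set) \<Rightarrow> nat \<Rightarrow> 'a set monoid" where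
  "series_factor G H k = (G\<lparr>carrier := H k\<rparr>) Mod H (Suc k)"

definition admissible_factor :: "('a, 'm) monoid_scheme \<Rightarrow> bool" where
  "admissible_factor Q \<longleftrightarrow>
     finite (carrier Q) \<or>
     union_of_characteristic_finite_subgroups Q \<or>
     comm_group Q \<and> torsion_free Q \<and> rational_rank Q < \<infinity>"

definition admissible_top_factor :: "('a, 'm) monoid_scheme \<Rightarrow> bool" where
  "admissible_top_factor Q \<longleftrightarrow>
     admissible_factor Q \<or> uniform_local_polynomial_growth Q \<or> Q \<cong> lamplighter_group"

section \<open>Asymptotic dimension\<close>

text \<open>Extended metrics on a set take values in \<^typ>\<open>ennreal\<close>.\<close>

definition ext_cball :: "'x set \<Rightarrow> ('x \<Rightarrow> 'x \<Rightarrow> ennreal) \<Rightarrow> 'x \<Rightarrow> real \<Rightarrow> 'x set" where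
  "ext_cball X \<rho> x r = {y \<in> X. \<rho> x y \<le> ennreal r}"

definition ext_diameter :: "('x \<Rightarrow> 'x \<Rightarrow> ennreal) \<Rightarrow> 'x set \<Rightarrow> ennreal" where
  "ext_diameter \<rho> C = (SUP x\<in>C. SUP y\<in>C. \<rho> x y)"

definition uniformly_bounded ::
    "'x set \<Rightarrow> ('x \<Rightarrow> 'x \<Rightarrow> ennreal) \<Rightarrow> ('x \<times> 'x) set \<Rightarrow> bool" where
  "uniformly_bounded X \<rho> E \<longleftrightarrow> (\<exists>D<\<infinity>. \<forall>C\<in>X // E. ext_diameter \<rho> C \<le> D)"

text \<open>The predicate \<open>P\<close> restricts the equivalence relations that may be used.\<close>

definition asdim_at_most ::
    "(('x \<times> 'x) set \<Rightarrow> bool) \<Rightarrow> 'x set \<Rightarrow> ('x \<Rightarrow> 'x \<Rightarrow> ennreal) \<Rightarrow> nat \<Rightarrow> bool" where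
  "asdim_at_most P X \<rho> d \<longleftrightarrow>
     (\<forall>r::real. r > 0 \<longrightarrow>
        (\<exists>E. P E \<and> equiv X E \<and> uniformly_bounded X \<rho> E \<and>
           (\<forall>x\<in>X. finite {C \<in> X // E. C \<inter> ext_cball X \<rho> x r \<noteq> {}} \<and>
                  card {C \<in> X // E. C \<inter> ext_cball X \<rho> x r \<noteq> {}} \<le> d + 1)))"

text \<open>In \<^typ>\<open>enat\<close> the infimum of a nonempty set is its least element, and that of the empty
  set is \<open>\<infinity>\<close>.\<close>

definition asdim :: "'x set \<Rightarrow> ('x \<Rightarrow> 'x \<Rightarrow> ennreal) \<Rightarrow> enat" where
  "asdim X \<rho> = Inf {enat d | d. asdim_at_most (\<lambda>_. True) X \<rho> d}"

definition borel_asdim :: "'x measure \<Rightarrow> ('x \<Rightarrow> 'x \<Rightarrow> ennreal) \<Rightarrow> enat" where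
  "borel_asdim M \<rho> = Inf {enat d | d. asdim_at_most (\<lambda>E. E \<in> sets (M \<Otimes>\<^sub>M M)) (space M) \<rho> d}"

definition proper_right_invariant_metric ::
    "('a, 'm) monoid_scheme \<Rightarrow> ('a \<Rightarrow> 'a \<Rightarrow> real) \<Rightarrow> bool" where
  "proper_right_invariant_metric G \<tau> \<longleftrightarrow>
     Metric_space (carrier G) \<tau> \<and>
     (\<forall>x\<in>carrier G. \<forall>r. finite (Metric_space.mcball (carrier G) \<tau> x r)) \<and>
     (\<forall>x\<in>carrier G. \<forall>y\<in>carrier G. \<forall>g\<in>carrier G. \<tau> (x \<otimes>\<^bsub>G\<^esub> g) (y \<otimes>\<^bsub>G\<^esub> g) = \<tau> x y)"

lemma proper_right_invariant_metric_exists: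
  fixes G :: "('a, 'm) monoid_scheme" (structure)
  assumes "group G" and "countable (carrier G)"
  shows "\<exists>\<tau>. proper_right_invariant_metric G \<tau>"
proof -
  interpret group G by fact
  obtain f :: "'a \<Rightarrow> nat" where f: "inj_on f (carrier G)"
    using assms(2) unfolding countable_def by blast
  define w where "w g = 1 + min (f g) (f (inv g))" for g
  define p where "p xs = foldr (\<otimes>) xs \<one>" for xs
  define R where "R n g \<longleftrightarrow> (\<exists>xs. set xs \<subseteq> carrier G \<and> p xs = g \<and> sum_list (map w xs) = n)" for n g
  define N where "N g = (LEAST n. R n g)" for g
  have p_closed: "p xs \<in> carrier G" if "set xs \<subseteq> carrier G" for xs
    using that by (induction xs) (auto simp: p_def)
  have p_append: "p (xs @ ys) = p xs \<otimes> p ys" if "set xs \<subseteq> carrier G" "set ys \<subseteq> carrier G" for xs ys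
    using that
  proof (induction xs)
    case Nil
    then show ?case using p_closed[of ys] by (simp add: p_def)
  next
    case (Cons a xs)
    have "p (a # xs @ ys) = a \<otimes> p (xs @ ys)" "p (a # xs) = a \<otimes> p xs"
      by (simp_all add: p_def)
    then show ?case
      using Cons p_closed[of xs] p_closed[of ys] by (simp add: m_assoc)
  qed
  have p_inv: "p (rev (map (\<lambda>x. inv x) xs)) = inv (p xs)" if "set xs \<subseteq> carrier G" for xs
    using that
  proof (induction xs)
    case Nil
    then show ?case by (simp add: p_def)
  next
    case (Cons a xs)
    have "p [inv a] = inv a" "p (a # xs) = a \<otimes> p xs"
      using Cons by (auto simp: p_def)
    moreover have "p (rev (map (\<lambda>x. inv x) xs) @ [inv a]) = p (rev (map (\<lambda>x. inv x) xs)) \<otimes> p [inv a]"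
      using Cons.prems by (intro p_append) auto
    ultimately show ?case
      using Cons p_closed[of xs] by (simp add: inv_mult_group)
  qed
  have w_inv: "w (inv g) = w g" if "g \<in> carrier G" for g
    using that by (simp add: w_def min.commute)
  have R_ex: "R (w g) g" if "g \<in> carrier G" for g
    unfolding R_def using that by (intro exI[of _ "[g]"]) (simp add: p_def)
  have R_N: "R (N g) g" if "g \<in> carrier G" for g
    unfolding N_def using R_ex[OF that] by (rule LeastI)
  have N_le: "N g \<le> n" if "R n g" for n g
    unfolding N_def using that by (rule Least_le)
  have N_mult: "N (g \<otimes> h) \<le> N g + N h" if gh: "g \<in> carrier G" "h \<in> carrier G" for g h
  proof -
    obtain xs ys where "set xs \<subseteq> carrier G" "p xs = g" "sum_list (map w xs) = N g"
      "set ys \<subseteq> carrier G" "p ys = h" "sum_list (map w ys) = N h"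
      using R_N[OF gh(1)] R_N[OF gh(2)] unfolding R_def by blast
    then have "R (N g + N h) (g \<otimes> h)"
      unfolding R_def by (intro exI[of _ "xs @ ys"]) (simp add: p_append)
    then show ?thesis by (rule N_le)
  qed
  have N_inv_le: "N (inv g) \<le> N g" if g: "g \<in> carrier G" for g
  proof -
    obtain xs where xs: "set xs \<subseteq> carrier G" "p xs = g" "sum_list (map w xs) = N g"
      using R_N[OF g] unfolding R_def by blast
    have "map w (map (\<lambda>x. inv x) xs) = map w xs"
      using xs(1) w_inv by (induction xs) auto
    then have "sum_list (map w (rev (map (\<lambda>x. inv x) xs))) = N g"
      using xs(3) by (simp only: rev_map[symmetric] sum_list_rev)
    then have "R (N g) (inv g)"
      unfolding R_def using xs p_inv[OF xs(1)]
      by (intro exI[of _ "rev (map (\<lambda>x. inv x) xs)"]) auto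
    then show ?thesis by (rule N_le)
  qed
  have N_inv: "N (inv g) = N g" if "g \<in> carrier G" for g
    using N_inv_le[OF that] N_inv_le[OF inv_closed[OF that]] that by simp
  have N_0: "N g = 0 \<longleftrightarrow> g = \<one>" if g: "g \<in> carrier G" for g
  proof
    assume "N g = 0"
    then obtain xs where "p xs = g" "sum_list (map w xs) = 0"
      using R_N[OF g] unfolding R_def by auto
    then show "g = \<one>"
      by (cases xs) (auto simp: w_def p_def)
  next
    assume "g = \<one>"
    then have "R 0 g"
      unfolding R_def by (intro exI[of _ "[]"]) (simp add: p_def)
    then show "N g = 0" using N_le by fastforce
  qed
  have fin: "finite {g \<in> carrier G. N g \<le> n}" for n
  proof -
    have fw: "finite {g \<in> carrier G. f g \<le> n}"
      by (rule finite_imageD[of f]) (auto intro: finite_subset[of _ "{..n}"] inj_on_subset[OF f])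
    let ?W = "{g \<in> carrier G. w g \<le> n}"
    have "?W \<subseteq> {g \<in> carrier G. f g \<le> n} \<union> (\<lambda>x. inv x) ` {g \<in> carrier G. f g \<le> n}"
    proof
      fix g assume g: "g \<in> ?W"
      then have "g = inv (inv g)" "inv g \<in> carrier G" by auto
      with g show "g \<in> {g \<in> carrier G. f g \<le> n} \<union> (\<lambda>x. inv x) ` {g \<in> carrier G. f g \<le> n}"
      proof (cases "f g \<le> n")
        case False
        with g have "f (inv g) \<le> n" by (auto simp: w_def)
        then show ?thesis
          using \<open>g = inv (inv g)\<close> \<open>inv g \<in> carrier G\<close> by blast
      qed (use g in auto)
    qed
    then have "finite ?W"
      using fw by (meson finite_UnI finite_imageI finite_subset)
    then have "finite (p ` {xs. set xs \<subseteq> ?W \<and> length xs \<le> n})"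
      by (intro finite_imageI finite_lists_length_le)
    moreover have "{g \<in> carrier G. N g \<le> n} \<subseteq> p ` {xs. set xs \<subseteq> ?W \<and> length xs \<le> n}"
    proof
      fix g assume g: "g \<in> {g \<in> carrier G. N g \<le> n}"
      then obtain xs where xs: "set xs \<subseteq> carrier G" "p xs = g" "sum_list (map w xs) \<le> n"
        using R_N[of g] unfolding R_def by auto
      have "length xs \<le> sum_list (map w xs)"
        by (induction xs) (auto simp: w_def)
      moreover have "w x \<le> sum_list (map w xs)" if "x \<in> set xs" for x
        using that by (intro member_le_sum_list) auto
      ultimately show "g \<in> p ` {xs. set xs \<subseteq> ?W \<and> length xs \<le> n}"
        using xs by (intro image_eqI[of _ _ xs]) (auto intro: order_trans)
    qed
    ultimately show ?thesis by (rule rev_finite_subset)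
  qed
  define \<tau> where
    "\<tau> x y = (if x \<in> carrier G \<and> y \<in> carrier G then real (N (x \<otimes> inv y)) else 0)" for x y
  interpret M: Metric_space "carrier G" \<tau>
  proof
    fix x y
    show "0 \<le> \<tau> x y" by (simp add: \<tau>_def)
    show "\<tau> x y = \<tau> y x"
      using N_inv[of "x \<otimes> inv y"] by (auto simp: \<tau>_def inv_mult_group)
  next
    fix x y assume xy: "x \<in> carrier G" "y \<in> carrier G"
    then have "x \<otimes> inv y = \<one> \<longleftrightarrow> x = y"
      using inv_equality[of x "inv y"] by auto
    then show "\<tau> x y = 0 \<longleftrightarrow> x = y"
      using xy by (simp add: \<tau>_def N_0)
  next
    fix x y z assume xyz: "x \<in> carrier G" "y \<in> carrier G" "z \<in> carrier G"
    then have "(x \<otimes> inv y) \<otimes> (y \<otimes> inv z) = x \<otimes> inv z"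
      by (simp add: m_assoc inv_solve_left flip: m_assoc[of "inv y" y])
    then show "\<tau> x z \<le> \<tau> x y + \<tau> y z"
      using N_mult[of "x \<otimes> inv y" "y \<otimes> inv z"] xyz by (simp add: \<tau>_def)
  qed
  have "finite (M.mcball x r)" if x: "x \<in> carrier G" for x r
  proof -
    have "M.mcball x r \<subseteq> (\<lambda>g. inv g \<otimes> x) ` {g \<in> carrier G. N g \<le> nat \<lfloor>r\<rfloor>}"
    proof
      fix y assume y: "y \<in> M.mcball x r"
      then have "real (N (x \<otimes> inv y)) \<le> r" and yG: "y \<in> carrier G"
        using x by (auto simp: \<tau>_def)
      then have "N (x \<otimes> inv y) \<le> nat \<lfloor>r\<rfloor>"
        by linarith
      moreover have "y = inv (x \<otimes> inv y) \<otimes> x"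
        using x yG by (simp add: inv_mult_group m_assoc)
      ultimately show "y \<in> (\<lambda>g. inv g \<otimes> x) ` {g \<in> carrier G. N g \<le> nat \<lfloor>r\<rfloor>}"
        using x yG by blast
    qed
    then show ?thesis
      using fin by (meson finite_imageI finite_subset)
  qed
  moreover have "\<tau> (x \<otimes> g) (y \<otimes> g) = \<tau> x y"
    if "x \<in> carrier G" "y \<in> carrier G" "g \<in> carrier G" for x y g
  proof -
    have "(x \<otimes> g) \<otimes> inv (y \<otimes> g) = x \<otimes> inv y"
      using that by (simp add: inv_mult_group m_assoc flip: m_assoc[of g "inv g"])
    then show ?thesis using that by (simp add: \<tau>_def)
  qed
  ultimately show ?thesis
    unfolding proper_right_invariant_metric_def using M.Metric_space_axioms by blast
qed

definition group_asdim :: "('a, 'm) monoid_scheme \<Rightarrow> ('a \<Rightarrow> 'a \<Rightarrow> real) \<Rightarrow> enat" where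
  "group_asdim G \<tau> = asdim (carrier G) (\<lambda>g h. ennreal (\<tau> g h))"

text \<open>For proper \<open>\<tau>\<close> the infimum is attained whenever \<open>x\<close> and \<open>y\<close> lie in one orbit; otherwise it
  is an infimum over the empty set, that is \<open>\<infinity>\<close>.\<close>

definition orbit_metric ::
    "('a, 'm) monoid_scheme \<Rightarrow> ('a \<Rightarrow> 'a \<Rightarrow> real) \<Rightarrow> ('a \<Rightarrow> 'x \<Rightarrow> 'x) \<Rightarrow> 'x \<Rightarrow> 'x \<Rightarrow> ennreal" where
  "orbit_metric G \<tau> \<phi> x y = (INF g\<in>{g \<in> carrier G. \<phi> g x = y}. ennreal (\<tau> \<one>\<^bsub>G\<^esub> g))"

definition action_borel_asdim ::
    "('a, 'm) monoid_scheme \<Rightarrow> ('a \<Rightarrow> 'a \<Rightarrow> real) \<Rightarrow> 'x measure \<Rightarrow> ('a \<Rightarrow> 'x \<Rightarrow> 'x) \<Rightarrow> enat" where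
  "action_borel_asdim G \<tau> M \<phi> = borel_asdim M (orbit_metric G \<tau> \<phi>)"

section \<open>Borel and continuous actions\<close>

definition polish_space :: "'x topology \<Rightarrow> bool" where
  "polish_space X \<longleftrightarrow> completely_metrizable_space X \<and> separable_space X"

text \<open>Only the measurable structure of \<open>M\<close> is used; its measure is irrelevant.\<close>

definition standard_borel :: "'x measure \<Rightarrow> bool" where
  "standard_borel M \<longleftrightarrow>
     (\<exists>X. polish_space X \<and> topspace X = space M \<and>
        sets M = sigma_sets (space M) {U. openin X U})"

definition free_action :: "('a, 'm) monoid_scheme \<Rightarrow> 'x set \<Rightarrow> ('a \<Rightarrow> 'x \<Rightarrow> 'x) \<Rightarrow> bool" where
  "free_action G X \<phi> \<longleftrightarrow>
     group_action G X \<phi> \<and> (\<forall>g\<in>carrier G. g \<noteq> \<one>\<^bsub>G\<^esub> \<longrightarrow> (\<forall>x\<in>X. \<phi> g x \<noteq> x))"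

definition borel_action :: "('a, 'm) monoid_scheme \<Rightarrow> 'x measure \<Rightarrow> ('a \<Rightarrow> 'x \<Rightarrow> 'x) \<Rightarrow> bool" where
  "borel_action G M \<phi> \<longleftrightarrow>
     group_action G (space M) \<phi> \<and>
     (\<lambda>(g, x). \<phi> g x) \<in> (count_space (carrier G) \<Otimes>\<^sub>M M) \<rightarrow>\<^sub>M M"

definition continuous_action ::
    "('a, 'm) monoid_scheme \<Rightarrow> 'x topology \<Rightarrow> ('a \<Rightarrow> 'x \<Rightarrow> 'x) \<Rightarrow> bool" where
  "continuous_action G X \<phi> \<longleftrightarrow>
     group_action G (topspace X) \<phi> \<and>
     continuous_map (prod_topology (discrete_topology (carrier G)) X) X (\<lambda>(g, x). \<phi> g x)"

definition zero_dimensional_space :: "'x topology \<Rightarrow> bool" where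
  "zero_dimensional_space X \<longleftrightarrow>
     (\<exists>\<B>. (\<forall>V\<in>\<B>. openin X V \<and> closedin X V) \<and>
          (\<forall>U x. openin X U \<and> x \<in> U \<longrightarrow> (\<exists>V\<in>\<B>. x \<in> V \<and> V \<subseteq> U)))"

section \<open>Dynamic asymptotic dimension\<close>

text \<open>\<open>left_word G b k\<close> is the product of \<open>b k\<close>, \<dots>, \<open>b 1\<close> in this order.\<close>

primrec left_word :: "('a, 'm) monoid_scheme \<Rightarrow> (nat \<Rightarrow> 'a) \<Rightarrow> nat \<Rightarrow> 'a" where
  "left_word G b 0 = \<one>\<^bsub>G\<^esub>"
| "left_word G b (Suc k) = b (Suc k) \<otimes>\<^bsub>G\<^esub> left_word G b k"

definition chain_elements ::
    "('a, 'm) monoid_scheme \<Rightarrow> ('a \<Rightarrow> 'x \<Rightarrow> 'x) \<Rightarrow> 'a set \<Rightarrow> 'x set \<Rightarrow> 'a set" where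
  "chain_elements G \<phi> B U =
     {g. \<exists>x\<in>U. \<exists>m\<ge>1. \<exists>b.
        (\<forall>k\<in>{1..m}. b k \<in> B \<union> (\<lambda>h. inv\<^bsub>G\<^esub> h) ` B) \<and> g = left_word G b m \<and>
        (\<forall>k\<in>{1..m}. \<phi> (left_word G b k) x \<in> U)}"

definition dad_at_most ::
    "('a, 'm) monoid_scheme \<Rightarrow> 'x topology \<Rightarrow> ('a \<Rightarrow> 'x \<Rightarrow> 'x) \<Rightarrow> nat \<Rightarrow> bool" where
  "dad_at_most G X \<phi> d \<longleftrightarrow>
     (\<forall>K B. compactin X K \<and> finite B \<and> B \<subseteq> carrier G \<longrightarrow>
        (\<exists>U :: nat \<Rightarrow> 'x set.
           (\<forall>i\<le>d. openin X (U i)) \<and> K \<subseteq> (\<Union>i\<le>d. U i) \<and>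
           (\<forall>i\<le>d. finite (chain_elements G \<phi> B (U i)))))"

definition dynamic_asdim ::
    "('a, 'm) monoid_scheme \<Rightarrow> 'x topology \<Rightarrow> ('a \<Rightarrow> 'x \<Rightarrow> 'x) \<Rightarrow> enat" where
  "dynamic_asdim G X \<phi> = Inf {enat d | d. dad_at_most G X \<phi> d}"

end

theory Submission
  imports Defs
begin

text \<open>
  Call a group contractible of degree \<open>D\<close> if for every finite \<open>F\<close> there is a rule that reads a
  sufficiently proper colouring of a free action through a finite window and moves each point by a
  bounded amount so that every set \<open>F x\<close> has at most \<open>D\<close> images. This property passes to extensions whose
  kernel \<open>N\<close> is exhausted by boxes of polynomial size that pack well under conjugation: one tiles
  the \<open>N\<close>-orbits by boxes around a maximal separated set, choosing the radii one colour class after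
  the other so that few walls come close to any point, and then contracts each tile to its centre
  before applying the rule of the quotient. All factors allowed in the normal series have such
  boxes, so by induction along the series \<open>G\<close> is contractible.

  A contraction to \<open>D\<close> images gives a cover by \<open>D\<close> sets whose chains are finite. Such covers
  exist in every invariant algebra of sets in which proper colourings exist, in particular for
  Borel sets and for clopen sets. Finally, any number of such sets can be traded for
  \<open>asdim G + 1\<close>: on a single set the finite components are charted in \<open>G\<close> itself, and the covers
  of the charts are merged by adding one set at a time.
\<close>

section \<open>Finitary functions on coloured spaces\<close>

text \<open>A rule may only read a finite window of colours because Borel and clopen sets have in
  common closure under finite Boolean operations and translations; functions of this kind are
  available in both. The number \<open>D\<close> of images must not depend on \<open>F\<close>: a
  cover is extracted by pigeonhole over \<open>D + 1\<close> nested scales, so \<open>D\<close> has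
  to be known before the scales are. The delicate point of the extension step is a circle of
  dependences. The rule of the quotient wants a proper colouring with a known number of colours; the
  colours sit on tile centres, so their number is a packing constant; tiles must be large compared
  with the window of the rule, and this window depends on the number of colours. Two uniformities
  break the circle: the separation scale of a rule is fixed before the number of colours, and
  packing constants depend on the conjugating element but not on the size of the boxes. Polynomial
  size of the boxes enters through the walls: with \<open>J\<close> radii to choose from,
  proportional to the scale \<open>m\<close>, the power \<open>J ^ Suc d\<close> eventually beats
  the number of points of a box, of order \<open>m ^ d\<close>.\<close>

locale gspace = group G for G :: "('a, 'm) monoid_scheme" (structure) +
  fixes X :: "'x set" and \<phi> :: "'a \<Rightarrow> 'x \<Rightarrow> 'x"
  assumes act_closed [simp, intro]: "\<lbrakk>g \<in> carrier G; x \<in> X\<rbrakk> \<Longrightarrow> \<phi> g x \<in> X"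
    and act_one [simp]: "x \<in> X \<Longrightarrow> \<phi> \<one> x = x"
    and act_act [simp]: "\<lbrakk>g \<in> carrier G; h \<in> carrier G; x \<in> X\<rbrakk> \<Longrightarrow> \<phi> g (\<phi> h x) = \<phi> (g \<otimes> h) x"

lemma (in group) gspace_self: "gspace G (carrier G) (\<otimes>)"
  by unfold_locales (auto simp: m_assoc)

lemma gspace_if_group_action:
  assumes "group_action G X \<phi>"
  shows "gspace G X \<phi>"
proof -
  interpret group_action G X \<phi> by fact
  interpret group G using group_hom group_hom_def by blast
  show ?thesis
  proof
    show "\<phi> g x \<in> X" if "g \<in> carrier G" "x \<in> X" for g x
      using element_image[OF that refl] by simp
    show "\<phi> \<one>\<^bsub>G\<^esub> x = x" if "x \<in> X" for x
      using fun_cong[OF id_eq_one, of x] that by simp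
    show "\<phi> g (\<phi> h x) = \<phi> (g \<otimes>\<^bsub>G\<^esub> h) x" if "g \<in> carrier G" "h \<in> carrier G" "x \<in> X" for g h x
      using composition_rule[OF that(3,1,2)] by simp
  qed
qed

locale coloured = gspace G X \<phi> for G :: "('a, 'm) monoid_scheme" (structure)
    and X :: "'x set" and \<phi> +
  fixes \<gamma> :: "'x \<Rightarrow> nat"
begin

text \<open>These are the local rules of symbolic dynamics. The window \<open>W\<close> is one
  finite set for all points, so if the colouring has finitely many values, then so has
  \<open>f\<close>, and its fibres are finite Boolean combinations of translated colour
  classes.\<close>

definition finitary :: "('x \<Rightarrow> 'v) \<Rightarrow> bool" where
  "finitary f \<longleftrightarrow> (\<exists>W. finite W \<and> W \<subseteq> carrier G \<and>
     (\<forall>x\<in>X. \<forall>y\<in>X. (\<forall>w\<in>W. \<gamma> (\<phi> w x) = \<gamma> (\<phi> w y)) \<longrightarrow> f x = f y))"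

lemma finitaryI:
  assumes "finite W" "W \<subseteq> carrier G"
    "\<And>x y. \<lbrakk>x \<in> X; y \<in> X; \<forall>w\<in>W. \<gamma> (\<phi> w x) = \<gamma> (\<phi> w y)\<rbrakk> \<Longrightarrow> f x = f y"
  shows "finitary f"
  unfolding finitary_def using assms by (intro exI[of _ W] conjI ballI impI)

lemma finitaryE:
  assumes "finitary f"
  obtains W where "finite W" "W \<subseteq> carrier G"
    "\<And>x y. \<lbrakk>x \<in> X; y \<in> X; \<forall>w\<in>W. \<gamma> (\<phi> w x) = \<gamma> (\<phi> w y)\<rbrakk> \<Longrightarrow> f x = f y"
  proof -
  obtain W where W: "finite W \<and> W \<subseteq> carrier G \<and>
     (\<forall>x\<in>X. \<forall>y\<in>X. (\<forall>w\<in>W. \<gamma> (\<phi> w x) = \<gamma> (\<phi> w y)) \<longrightarrow> f x = f y)"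
    using assms unfolding finitary_def by (elim exE)
  show ?thesis
  proof (rule that[of W])
    show "finite W" "W \<subseteq> carrier G" using W by simp_all
    show "f x = f y" if "x \<in> X" "y \<in> X" "\<forall>w\<in>W. \<gamma> (\<phi> w x) = \<gamma> (\<phi> w y)" for x y
      using W that by meson
  qed
qed

lemma finitary_colour: "finitary \<gamma>"
  by (rule finitaryI[of "{\<one>}"]) auto

text \<open>Local rules compose: reading \<open>f\<close> along \<open>T\<close> means reading
  colours along the products \<open>w \<otimes> t\<close>. The dependence of \<open>h\<close> is
  stated as a congruence, so that no explicit function of the pattern has to be produced.\<close>

lemma finitary_shift:
  assumes f: "finitary f" and T: "finite T" "T \<subseteq> carrier G"
    and h: "\<And>x y. \<lbrakk>x \<in> X; y \<in> X; \<forall>t\<in>T. f (\<phi> t x) = f (\<phi> t y)\<rbrakk> \<Longrightarrow> h x = h y"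
  shows "finitary h"
proof -
  obtain W where W: "finite W" "W \<subseteq> carrier G"
    "\<And>x y. \<lbrakk>x \<in> X; y \<in> X; \<forall>w\<in>W. \<gamma> (\<phi> w x) = \<gamma> (\<phi> w y)\<rbrakk> \<Longrightarrow> f x = f y"
    by (rule finitaryE[OF f]) (rule that)
  let ?W = "(\<lambda>(w, t). w \<otimes> t) ` (W \<times> T)"
  show ?thesis
  proof (rule finitaryI[of ?W])
    show "finite ?W" "?W \<subseteq> carrier G" using W T by auto
    fix x y assume xy: "x \<in> X" "y \<in> X" and *: "\<forall>w\<in>?W. \<gamma> (\<phi> w x) = \<gamma> (\<phi> w y)"
    show "h x = h y"
    proof (rule h[OF xy], rule ballI)
      fix t assume t: "t \<in> T"
      have "\<gamma> (\<phi> w (\<phi> t x)) = \<gamma> (\<phi> w (\<phi> t y))" if "w \<in> W" for w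
      proof -
        have "w \<otimes> t \<in> ?W" using that t by force
        then have "\<gamma> (\<phi> (w \<otimes> t) x) = \<gamma> (\<phi> (w \<otimes> t) y)" using * by blast
        then show ?thesis using that t W T xy by (simp add: subsetD)
      qed
      then show "f (\<phi> t x) = f (\<phi> t y)"
        using xy t T by (intro W(3)) auto
    qed
  qed
qed

lemma finitary_Pair:
  assumes "finitary f" "finitary g"
  shows "finitary (\<lambda>x. (f x, g x))"
proof -
  obtain V where V: "finite V" "V \<subseteq> carrier G"
    "\<And>x y. \<lbrakk>x \<in> X; y \<in> X; \<forall>w\<in>V. \<gamma> (\<phi> w x) = \<gamma> (\<phi> w y)\<rbrakk> \<Longrightarrow> f x = f y"
    by (rule finitaryE[OF assms(1)]) (rule that)
  obtain W where W: "finite W" "W \<subseteq> carrier G"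
    "\<And>x y. \<lbrakk>x \<in> X; y \<in> X; \<forall>w\<in>W. \<gamma> (\<phi> w x) = \<gamma> (\<phi> w y)\<rbrakk> \<Longrightarrow> g x = g y"
    by (rule finitaryE[OF assms(2)]) (rule that)
  show ?thesis
  proof (rule finitaryI[of "V \<union> W"])
    fix x y assume xy: "x \<in> X" "y \<in> X" "\<forall>w\<in>V \<union> W. \<gamma> (\<phi> w x) = \<gamma> (\<phi> w y)"
    then show "(f x, g x) = (f y, g y)"
      using V(3)[of x y] W(3)[of x y] by simp
  qed (use V W in auto)
qed

lemma finitary_compose:
  assumes "finitary f" and "\<And>x y. \<lbrakk>x \<in> X; y \<in> X; f x = f y\<rbrakk> \<Longrightarrow> h x = h y"
  shows "finitary h"
  by (rule finitary_shift[OF assms(1), of "{\<one>}"]) (auto intro: assms(2))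

text \<open>Greedy recursion: the value at a point may depend on the values at those neighbours that
  have a smaller colour.\<close>

lemma finitary_greedy:
  fixes \<Phi> :: "'u \<Rightarrow> ('a \<Rightarrow> 'v option) \<Rightarrow> 'v"
  assumes \<gamma>': "finitary \<gamma>'" "\<forall>x\<in>X. \<gamma>' x < (p::nat)" and d: "finitary d"
    and T: "finite T" "T \<subseteq> carrier G"
  shows "\<exists>f. finitary f \<and> (\<forall>x\<in>X. f x =
    \<Phi> (d x) (\<lambda>t. if t \<in> T \<and> \<gamma>' (\<phi> t x) < \<gamma>' x then Some (f (\<phi> t x)) else None))"
proof -
  \<comment> \<open>Rounds of the recursion from an arbitrary start. After \<open>n\<close> rounds
    the value is settled wherever \<open>\<gamma>' x < n\<close>, so round \<open>p\<close> solves
    the recursion everywhere and still has a finite window.\<close>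
  define F where "F = rec_nat (\<lambda>x. undefined) (\<lambda>n f x. \<Phi> (d x)
    (\<lambda>t. if t \<in> T \<and> \<gamma>' (\<phi> t x) < \<gamma>' x then Some (f (\<phi> t x)) else None))"
  have F_Suc: "F (Suc n) x = \<Phi> (d x)
    (\<lambda>t. if t \<in> T \<and> \<gamma>' (\<phi> t x) < \<gamma>' x then Some (F n (\<phi> t x)) else None)" for n x
    unfolding F_def by (simp only: old.nat.simps(7))
  have fin: "finitary (F n)" for n
  proof (induction n)
    case 0
    show ?case by (rule finitaryI[of "{}"]) (simp_all add: F_def)
  next
    case (Suc n)
    have "finitary (\<lambda>x. (F n x, \<gamma>' x, d x))"
      by (rule finitary_Pair[OF Suc finitary_Pair[OF \<gamma>'(1) d]])
    then show ?case
    proof (rule finitary_shift[where T = "insert \<one> T"])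
      fix x y assume xy: "x \<in> X" "y \<in> X"
        and *: "\<forall>t\<in>insert \<one> T. (F n (\<phi> t x), \<gamma>' (\<phi> t x), d (\<phi> t x)) =
          (F n (\<phi> t y), \<gamma>' (\<phi> t y), d (\<phi> t y))"
      have eq: "F n (\<phi> t x) = F n (\<phi> t y)" "\<gamma>' (\<phi> t x) = \<gamma>' (\<phi> t y)" "d (\<phi> t x) = d (\<phi> t y)"
        if "t \<in> insert \<one> T" for t
        using bspec[OF * that] by simp_all
      have "d x = d y" "\<gamma>' x = \<gamma>' y"
        using eq(2,3)[of \<one>] xy by simp_all
      moreover have "(\<lambda>t. if t \<in> T \<and> \<gamma>' (\<phi> t x) < \<gamma>' x then Some (F n (\<phi> t x)) else None) =
        (\<lambda>t. if t \<in> T \<and> \<gamma>' (\<phi> t y) < \<gamma>' y then Some (F n (\<phi> t y)) else None)"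
        using eq(1,2) \<open>\<gamma>' x = \<gamma>' y\<close> by (intro ext) (simp cong: conj_cong)
      ultimately show "F (Suc n) x = F (Suc n) y"
        unfolding F_Suc by simp
    qed (use T in auto)
  qed
  have stable: "F n x = F m x" if "x \<in> X" "\<gamma>' x < n" "\<gamma>' x < m" for n m x
    using that
  proof (induction "\<gamma>' x" arbitrary: n m x rule: less_induct)
    case less
    obtain n' m' where nm: "n = Suc n'" "m = Suc m'"
      using less.prems by (cases n; cases m) auto
    have "F n' (\<phi> t x) = F m' (\<phi> t x)" if "t \<in> T" "\<gamma>' (\<phi> t x) < \<gamma>' x" for t
      using that less.prems nm T by (intro less.hyps) auto
    then have "(\<lambda>t. if t \<in> T \<and> \<gamma>' (\<phi> t x) < \<gamma>' x then Some (F n' (\<phi> t x)) else None) =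
      (\<lambda>t. if t \<in> T \<and> \<gamma>' (\<phi> t x) < \<gamma>' x then Some (F m' (\<phi> t x)) else None)"
      by auto
    then show ?case unfolding nm F_Suc by simp
  qed
  have "F p x = F (Suc p) x" if "x \<in> X" for x
    using \<gamma>'(2) that by (intro stable) auto
  then show ?thesis
    using fin F_Suc by (intro exI[of _ "F p"]) auto
qed

text \<open>A point joins \<open>Y\<close> unless a \<open>T\<close>-neighbour of smaller colour has
  joined. Neighbours have different colours by \<open>proper\<close>, so of two neighbours in
  \<open>Y\<close> the one with the larger colour would have seen the other; closure of
  \<open>T\<close> under inverses makes being neighbours symmetric.\<close>

lemma finitary_maximal_separated:
  assumes bnd: "\<forall>x\<in>X. \<gamma> x < p"
    and T: "finite T" "T \<subseteq> carrier G" "\<forall>t\<in>T. inv t \<in> T"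
    and proper: "\<forall>t\<in>T. t \<noteq> \<one> \<longrightarrow> (\<forall>x\<in>X. \<gamma> (\<phi> t x) \<noteq> \<gamma> x)"
  shows "\<exists>Y. finitary Y \<and> (\<forall>x\<in>X. Y x \<longrightarrow> (\<forall>t\<in>T. t \<noteq> \<one> \<longrightarrow> \<not> Y (\<phi> t x))) \<and>
    (\<forall>x\<in>X. Y x \<or> (\<exists>t\<in>T. Y (\<phi> t x)))"
proof -
  obtain Y where *: "finitary Y \<and> (\<forall>x\<in>X. Y x = (\<forall>t. (if t \<in> T \<and> \<gamma> (\<phi> t x) < \<gamma> x
      then Some (Y (\<phi> t x)) else None) \<noteq> Some True))"
    using finitary_greedy[OF finitary_colour bnd finitary_colour T(1,2),
        of "\<lambda>_ h. \<forall>t. h t \<noteq> Some True"] by (elim exE)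
  note Y = conjunct1[OF *] bspec[OF conjunct2[OF *]]
  have Y_iff: "Y x \<longleftrightarrow> (\<forall>t\<in>T. \<gamma> (\<phi> t x) < \<gamma> x \<longrightarrow> \<not> Y (\<phi> t x))" if "x \<in> X" for x
    using Y(2)[OF that] by auto
  have lt: False if "x \<in> X" "Y x" "t \<in> T" "Y (\<phi> t x)" "\<gamma> (\<phi> t x) < \<gamma> x" for x t
    using that Y_iff by blast
  have "\<not> Y (\<phi> t x)" if "x \<in> X" "Y x" "t \<in> T" "t \<noteq> \<one>" for x t
  proof
    assume *: "Y (\<phi> t x)"
    have neq: "\<gamma> (\<phi> t x) \<noteq> \<gamma> x" using proper that by blast
    consider "\<gamma> (\<phi> t x) < \<gamma> x" | "\<gamma> x < \<gamma> (\<phi> t x)"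
      using neq by linarith
    then show False
    proof cases
      case 1
      then show False using lt that * by blast
    next
      case 2
      have "\<phi> (inv t) (\<phi> t x) = x" "\<phi> t x \<in> X" "inv t \<in> T"
        using that(1) bspec[OF T(3) that(3)] subsetD[OF T(2) that(3)] by simp_all
      then show False using lt[of "\<phi> t x" "inv t"] that * 2 by auto
    qed
  qed
  moreover have "Y x \<or> (\<exists>t\<in>T. Y (\<phi> t x))" if "x \<in> X" for x
    using Y_iff[OF that] by blast
  ultimately show ?thesis
    using Y(1) by (intro exI[of _ Y] conjI) simp_all
qed

text \<open>Pigeonhole: the values \<open>Some c\<close> taken by \<open>h\<close> on
  \<open>S\<close> exclude at most \<open>k\<close> of the \<open>k + 1\<close> candidates up to
  \<open>k\<close>, and \<open>None\<close> excludes nothing.\<close>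

lemma Least_avoid_le:
  assumes "finite S" "card S \<le> k"
  shows "(LEAST c::nat. \<forall>t\<in>S. h t \<noteq> Some c) \<le> k"
    and "\<forall>t\<in>S. h t \<noteq> Some (LEAST c::nat. \<forall>t\<in>S. h t \<noteq> Some c)"
proof -
  have "card (the ` h ` S) \<le> k"
    using assms by (meson card_image_le finite_imageI order_trans)
  then have "\<not> {..k} \<subseteq> the ` h ` S"
    using card_mono[of "the ` h ` S" "{..k}"] assms by auto
  then obtain c where c: "c \<le> k" "c \<notin> the ` h ` S" by auto
  then have *: "\<forall>t\<in>S. h t \<noteq> Some c" by force
  show "(LEAST c::nat. \<forall>t\<in>S. h t \<noteq> Some c) \<le> k"
    using Least_le[of "\<lambda>c. \<forall>t\<in>S. h t \<noteq> Some c", OF *] c by linarith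
  show "\<forall>t\<in>S. h t \<noteq> Some (LEAST c::nat. \<forall>t\<in>S. h t \<noteq> Some c)"
    by (rule LeastI[of "\<lambda>c. \<forall>t\<in>S. h t \<noteq> Some c", OF *])
qed

text \<open>Replaces the \<open>p\<close> colours by \<open>k + 1\<close> on the sparse set
  \<open>Y\<close>, where \<open>k\<close> is a degree bound. Later estimates can then be made in
  terms of \<open>k\<close> alone, which keeps them independent of \<open>p\<close>.\<close>

lemma finitary_recolouring:
  assumes bnd: "\<forall>x\<in>X. \<gamma> x < p"
    and T: "finite T" "T \<subseteq> carrier G" "\<forall>t\<in>T. inv t \<in> T"
    and proper: "\<forall>t\<in>T. t \<noteq> \<one> \<longrightarrow> (\<forall>x\<in>X. \<gamma> (\<phi> t x) \<noteq> \<gamma> x)"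
    and Y: "finitary Y" and deg: "\<forall>x\<in>X. Y x \<longrightarrow> card {t \<in> T. Y (\<phi> t x)} \<le> k"
  shows "\<exists>\<kappa>. finitary \<kappa> \<and> (\<forall>x\<in>X. \<kappa> x \<le> k) \<and>
     (\<forall>x\<in>X. Y x \<longrightarrow> (\<forall>t\<in>T. t \<noteq> \<one> \<longrightarrow> Y (\<phi> t x) \<longrightarrow> \<kappa> (\<phi> t x) \<noteq> \<kappa> x))"
proof -
  define d where "d x = {t \<in> T. Y (\<phi> t x)}" for x
  have d: "finitary d"
    by (rule finitary_shift[OF Y T(1,2)]) (simp add: d_def cong: conj_cong)
  obtain \<kappa> :: "'x \<Rightarrow> nat" where *: "finitary \<kappa> \<and> (\<forall>x\<in>X. \<kappa> x = (LEAST c. \<forall>t\<in>d x. (if t \<in> T \<and> \<gamma> (\<phi> t x) < \<gamma> x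
      then Some (\<kappa> (\<phi> t x)) else None) \<noteq> Some c))"
    using finitary_greedy[OF finitary_colour bnd d T(1,2),
        of "\<lambda>S h. LEAST c. \<forall>t\<in>S. h t \<noteq> Some c"] by (elim exE)
  note \<kappa> = conjunct1[OF *] bspec[OF conjunct2[OF *]]
  have deg: "card (d x) \<le> k" if "x \<in> X" "Y x" for x
    using deg that by (simp add: d_def)
  have fd: "finite (d x)" for x using T(1) by (simp add: d_def)
  have le: "\<kappa> x \<le> k" if "x \<in> X" "Y x" for x
    unfolding \<kappa>(2)[OF that(1)] using Least_avoid_le(1)[OF fd deg[OF that]] .
  have lt: False if "x \<in> X" "Y x" "t \<in> T" "Y (\<phi> t x)" "\<gamma> (\<phi> t x) < \<gamma> x" "\<kappa> (\<phi> t x) = \<kappa> x" for x t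
  proof -
    let ?h = "\<lambda>t. if t \<in> T \<and> \<gamma> (\<phi> t x) < \<gamma> x then Some (\<kappa> (\<phi> t x)) else None"
    have "t \<in> d x" using that(3,4) by (simp add: d_def)
    then have "?h t \<noteq> Some (LEAST c. \<forall>t\<in>d x. ?h t \<noteq> Some c)"
      by (rule bspec[OF Least_avoid_le(2)[OF fd deg[OF that(1,2)]]])
    then have "?h t \<noteq> Some (\<kappa> x)"
      using \<kappa>(2)[OF that(1)] by argo
    then show False using that(3,5,6) by simp
  qed
  have ne: "\<kappa> (\<phi> t x) \<noteq> \<kappa> x" if "x \<in> X" "Y x" "t \<in> T" "t \<noteq> \<one>" "Y (\<phi> t x)" for x t
  proof
    assume *: "\<kappa> (\<phi> t x) = \<kappa> x"
    have neq: "\<gamma> (\<phi> t x) \<noteq> \<gamma> x" using proper that by blast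
    consider "\<gamma> (\<phi> t x) < \<gamma> x" | "\<gamma> x < \<gamma> (\<phi> t x)"
      using neq by linarith
    then show False
    proof cases
      case 1
      show False by (rule lt[OF that(1,2,3,5) 1 *])
    next
      case 2
      have inv: "\<phi> (inv t) (\<phi> t x) = x" "\<phi> t x \<in> X" "inv t \<in> T"
        using that(1) bspec[OF T(3) that(3)] subsetD[OF T(2) that(3)] by simp_all
      show False
        by (rule lt[of "\<phi> t x" "inv t", unfolded inv(1), OF inv(2) that(5) inv(3) that(2) 2 *[symmetric]])
    qed
  qed
  \<comment> \<open>The degree bound is known on \<open>Y\<close> only; elsewhere the least free
    colour is uncontrolled and is replaced by 0.\<close>
  define \<kappa>' where "\<kappa>' x = (if Y x then \<kappa> x else 0)" for x
  have "finitary \<kappa>'"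
    by (rule finitary_compose[OF finitary_Pair[OF \<kappa>(1) Y]]) (simp add: \<kappa>'_def)
  then show ?thesis
  proof (intro exI[of _ \<kappa>'] conjI ballI impI)
    show "\<kappa>' x \<le> k" if "x \<in> X" for x
      using le[OF that] by (simp add: \<kappa>'_def)
    show "\<kappa>' (\<phi> t x) \<noteq> \<kappa>' x" if "x \<in> X" "Y x" "t \<in> T" "t \<noteq> \<one>" "Y (\<phi> t x)" for x t
      using ne[OF that] that(2,5) by (simp add: \<kappa>'_def)
  qed
qed

end

section \<open>Tilings by boxes in general position\<close>

lemma (in group) mult_inv_cancel:
  "\<lbrakk>a \<in> carrier G; b \<in> carrier G; c \<in> carrier G\<rbrakk> \<Longrightarrow> (a \<otimes> inv b) \<otimes> (b \<otimes> c) = a \<otimes> c"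
  "\<lbrakk>a \<in> carrier G; b \<in> carrier G\<rbrakk> \<Longrightarrow> (a \<otimes> inv b) \<otimes> b = a"
  "\<lbrakk>a \<in> carrier G; b \<in> carrier G\<rbrakk> \<Longrightarrow> (a \<otimes> b) \<otimes> inv b = a"
  by (simp_all add: m_assoc flip: m_assoc[of "inv b" b])

lemma (in group) neq_inv_mult:
  "\<lbrakk>a \<in> carrier G; b \<in> carrier G; a \<noteq> b\<rbrakk> \<Longrightarrow> b \<otimes> inv a \<noteq> \<one>"
  by (metis inv_closed inv_equality inv_inv)

lemma finite_arg_max:
  fixes f :: "'b \<Rightarrow> nat"
  assumes "finite A" "A \<noteq> {}"
  shows "\<exists>a\<in>A. \<forall>b\<in>A. f b \<le> f a"
proof -
  obtain a where a: "a \<in> A" "f a = Max (f ` A)"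
    using obtains_MAX[OF assms, of f] by metis
  show ?thesis
    using a assms by (intro bexI[OF _ a(1)]) simp
qed

lemma finite_arg_min:
  fixes f :: "'b \<Rightarrow> nat"
  assumes "A \<noteq> {}"
  shows "\<exists>a\<in>A. \<forall>b\<in>A. f a \<le> f b"
proof -
  obtain a where "a \<in> A" using assms by blast
  then have "arg_min f (\<lambda>a. a \<in> A) \<in> A \<and> (\<forall>b. b \<in> A \<longrightarrow> f (arg_min f (\<lambda>a. a \<in> A)) \<le> f b)"
    by (rule arg_min_nat_lemma)
  then show ?thesis by blast
qed

text \<open>The \<open>N\<close>-orbits of the points \<open>\<phi> w x\<close> with
  \<open>w \<in> W\<close> are to be tiled; \<open>W\<close> represents distinct cosets of
  \<open>N\<close>, and \<open>M\<close> is the set of moves that should rarely change the tile. The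
  radii are \<open>m + 3 * j\<close> with \<open>j < J\<close>, below \<open>2 * m\<close> by
  \<open>3 * J \<le> m\<close>, so that \<open>P\<close> contains the elements leading from
  \<open>x\<close> to the relevant centres. The last inequality on \<open>J\<close> is the one that
  bounds the number of walls by \<open>d\<close>.\<close>

locale box_tiling = coloured G X \<phi> \<gamma>
  for G :: "('a, 'm) monoid_scheme" (structure)
    and X :: "'x set" and \<phi> \<gamma> +
  fixes N :: "'a set" and B :: "nat \<Rightarrow> 'a set" and W M P :: "'a set" and m k d J p :: nat
  assumes N: "subgroup N G"
    and B_fin: "finite (B i)" and B_N: "B i \<subseteq> N" and B_one: "\<one> \<in> B i"
    and B_inv: "b \<in> B i \<Longrightarrow> inv b \<in> B i" and B_mono: "i \<le> j \<Longrightarrow> B i \<subseteq> B j"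
    and B_M: "\<lbrakk>b \<in> B i; n \<in> M\<rbrakk> \<Longrightarrow> b \<otimes> n \<in> B (Suc i)"
    and M: "finite M" "M \<subseteq> N" and M_inv: "n \<in> M \<Longrightarrow> inv n \<in> M"
    and W: "finite W" "W \<subseteq> carrier G" "\<one> \<in> W"
    and W_coset: "\<lbrakk>w \<in> W; w' \<in> W; w' \<otimes> inv w \<in> N\<rbrakk> \<Longrightarrow> w = w'"
    and P_def: "P = (\<lambda>(b, w). b \<otimes> w) ` (B (2 * m) \<times> W)"
    and packing: "\<lbrakk>Z \<subseteq> (\<lambda>(g', g). g' \<otimes> inv g) ` (P \<times> P);
       \<forall>z\<in>Z. \<forall>z'\<in>Z. z \<noteq> z' \<longrightarrow> z' \<otimes> inv z \<notin> B m\<rbrakk> \<Longrightarrow> card Z \<le> k"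
    and J: "0 < J" "3 * J \<le> m" "2 * card P * (1 + 2 * k) ^ k < J ^ Suc d"
    and bnd: "\<forall>x\<in>X. \<gamma> x < p"
    and proper: "\<lbrakk>t \<in> (\<lambda>(g', g). g' \<otimes> inv g) ` (P \<times> P); t \<noteq> \<one>; x \<in> X\<rbrakk> \<Longrightarrow> \<gamma> (\<phi> t x) \<noteq> \<gamma> x"
begin

definition "T = (\<lambda>(g', g). g' \<otimes> inv g) ` (P \<times> P)"

lemma N_sub: "N \<subseteq> carrier G" using N by (rule subgroup.subset)

lemma B_carrier: "b \<in> B i \<Longrightarrow> b \<in> carrier G" using B_N N_sub by blast

lemma M_carrier: "n \<in> M \<Longrightarrow> n \<in> carrier G" using M N_sub by blast

lemma W_carrier: "w \<in> W \<Longrightarrow> w \<in> carrier G" using W by blast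

lemma P_fin: "finite P" using B_fin W unfolding P_def by auto

lemma P_carrier: "g \<in> P \<Longrightarrow> g \<in> carrier G"
  unfolding P_def using B_carrier W_carrier by auto

lemma P_I: "\<lbrakk>b \<in> B i; i \<le> 2 * m; w \<in> W\<rbrakk> \<Longrightarrow> b \<otimes> w \<in> P"
  unfolding P_def using B_mono by blast

lemma B_P: "i \<le> 2 * m \<Longrightarrow> b \<in> B i \<Longrightarrow> b \<in> P"
  using P_I[of b i \<one>] W B_carrier by simp

lemma T_fin: "finite T" using P_fin by (auto simp: T_def)

lemma T_I: "\<lbrakk>g \<in> P; g' \<in> P\<rbrakk> \<Longrightarrow> g' \<otimes> inv g \<in> T" by (force simp: T_def)

lemma T_carrier: "t \<in> T \<Longrightarrow> t \<in> carrier G" using P_carrier by (auto simp: T_def)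

lemma T_inv: "t \<in> T \<Longrightarrow> inv t \<in> T"
proof -
  assume "t \<in> T"
  then obtain g g' where "g \<in> P" "g' \<in> P" "t = g' \<otimes> inv g" by (auto simp: T_def)
  then show "inv t \<in> T"
    using T_I[of g' g] P_carrier by (simp add: inv_mult_group)
qed

lemma proper_T: "\<lbrakk>t \<in> T; t \<noteq> \<one>; x \<in> X\<rbrakk> \<Longrightarrow> \<gamma> (\<phi> t x) \<noteq> \<gamma> x"
  unfolding T_def by (rule proper)

lemma B_T: "b \<in> B m \<Longrightarrow> b \<in> T"
  using T_I[of \<one> b] B_P[of m b] B_P[OF _ B_one, of m] B_carrier by force

text \<open>The centre \<open>\<phi> g x\<close> equals
  \<open>\<phi> (g \<otimes> inv w) (\<phi> w x)\<close>, so \<open>g \<otimes> inv w\<close> is the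
  offset from the point \<open>\<phi> w x\<close> to it. The predicate says that for some
  \<open>w\<close> this offset lies in the boundary layer of the box of radius
  \<open>m + 3 * j\<close>. The layer extends one step to each side, as far as a move from
  \<open>M\<close> can carry a point; radii 3 apart have disjoint layers, whence
  \<open>ann_unique\<close>.\<close>

definition ann :: "'a \<Rightarrow> nat \<Rightarrow> bool" where
  "ann g j \<longleftrightarrow> (\<exists>w\<in>W. g \<otimes> inv w \<in> B (m + 3 * j + 1) \<and> g \<otimes> inv w \<notin> B (m + 3 * j - 1))"

lemma W_unique:
  assumes "g \<in> carrier G" "w \<in> W" "w' \<in> W" "g \<otimes> inv w \<in> N" "g \<otimes> inv w' \<in> N"
  shows "w = w'"
proof (rule W_coset[OF assms(2,3)])
  have "inv (g \<otimes> inv w') \<otimes> (g \<otimes> inv w) \<in> N"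
    using assms subgroup.m_closed[OF N] subgroup.m_inv_closed[OF N] by simp
  moreover have "inv (g \<otimes> inv w') \<otimes> (g \<otimes> inv w) = w' \<otimes> inv w"
    using assms(1) W_carrier[OF assms(2)] W_carrier[OF assms(3)]
    by (simp add: inv_mult_group m_assoc flip: m_assoc[of "inv g" g])
  ultimately show "w' \<otimes> inv w \<in> N" by simp
qed

lemma ann_unique:
  assumes g: "g \<in> carrier G" "ann g i" "ann g j"
  shows "i = j"
proof -
  have *: False if "i < j" "ann g i" "ann g j" for i j
  proof -
    obtain w w' where w: "w \<in> W" "g \<otimes> inv w \<in> B (m + 3 * i + 1)"
      "w' \<in> W" "g \<otimes> inv w' \<in> B (m + 3 * j + 1)" "g \<otimes> inv w' \<notin> B (m + 3 * j - 1)"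
      using \<open>ann g i\<close> \<open>ann g j\<close> unfolding ann_def by blast
    then have "w = w'" using W_unique[OF g(1)] B_N by blast
    moreover have "m + 3 * i + 1 \<le> m + 3 * j - 1" using \<open>i < j\<close> by linarith
    ultimately show False using w B_mono by blast
  qed
  show ?thesis using *[of i j] *[of j i] g by (meson linorder_neqE_nat)
qed

text \<open>For fixed \<open>g\<close> at most one \<open>j\<close> has the factor \<open>J\<close>,
  so the factors add up to at most \<open>2 * J\<close> over all \<open>j < J\<close>. The mean over
  \<open>j\<close> of the weighted sums is then at most twice the plain sum, and some
  \<open>j\<close> does not exceed the mean.\<close>

lemma averaging:
  fixes a :: "'a \<Rightarrow> nat"
  shows "\<exists>j<J. (\<Sum>g\<in>P. a g * (if ann g j then J else 1)) \<le> 2 * (\<Sum>g\<in>P. a g)"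
proof (rule ccontr)
  assume "\<not> ?thesis"
  then have "(\<Sum>j<J. 2 * (\<Sum>g\<in>P. a g)) < (\<Sum>j<J. \<Sum>g\<in>P. a g * (if ann g j then J else 1))"
    using J(1) by (intro sum_strict_mono) (auto simp: not_le)
  also have "\<dots> = (\<Sum>g\<in>P. \<Sum>j<J. a g * (if ann g j then J else 1))"
    by (rule sum.swap)
  also have "\<dots> \<le> (\<Sum>g\<in>P. 2 * J * a g)"
  proof (rule sum_mono)
    fix g assume g: "g \<in> P"
    have "(\<Sum>j<J. if ann g j then J else 1) \<le> (\<Sum>j<J. (if ann g j then J else 0) + 1)"
      by (intro sum_mono) auto
    also have "\<dots> = (\<Sum>j\<in>{j\<in>{..<J}. ann g j}. J) + J"
      unfolding sum.distrib by (simp add: sum.If_cases Int_def)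
    also have "card {j\<in>{..<J}. ann g j} \<le> 1"
      using ann_unique[OF P_carrier[OF g]] by (subst One_nat_def, subst card_le_Suc0_iff_eq) auto
    then have "(\<Sum>j\<in>{j\<in>{..<J}. ann g j}. J) + J \<le> 2 * J" by simp
    finally have "(\<Sum>j<J. if ann g j then J else 1) \<le> 2 * J" .
    then show "(\<Sum>j<J. a g * (if ann g j then J else 1)) \<le> 2 * J * a g"
      using mult_le_mono2[of _ "2 * J" "a g"] by (simp only: sum_distrib_left[symmetric] mult.commute[of "2 * J"])
  qed
  also have "\<dots> = (\<Sum>j<J. 2 * (\<Sum>g\<in>P. a g))"
    by (simp only: sum_distrib_left[symmetric] sum_constant card_lessThan) (simp add: mult_ac)
  finally show False by (rule less_irrefl[THEN notE])
qed


text \<open>The radii are chosen one colour class after the other. Averaging over the \<open>J\<close> candidate radii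
  keeps the sum of \<open>J ^ (number of walls at x)\<close> over a window bounded independently of \<open>J ^ Suc d\<close>,
  so at most \<open>d\<close> walls meet at a point.\<close>

lemma wall_structure:
  "\<exists>Y \<kappa> r. finitary Y \<and> finitary \<kappa> \<and> finitary r \<and>
     (\<forall>x\<in>X. Y x \<longrightarrow> (\<forall>t\<in>B m. t \<noteq> \<one> \<longrightarrow> \<not> Y (\<phi> t x))) \<and>
     (\<forall>x\<in>X. \<exists>t\<in>B m. Y (\<phi> t x)) \<and>
     (\<forall>x\<in>X. \<kappa> x \<le> k) \<and>
     (\<forall>x\<in>X. Y x \<longrightarrow> (\<forall>t\<in>T. t \<noteq> \<one> \<longrightarrow> Y (\<phi> t x) \<longrightarrow> \<kappa> (\<phi> t x) \<noteq> \<kappa> x)) \<and>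
     (\<forall>x\<in>X. Y x \<longrightarrow> r x < J) \<and>
     (\<forall>x\<in>X. card {g \<in> P. Y (\<phi> g x) \<and> ann g (r (\<phi> g x))} \<le> d)"
proof -
  have Bm: "finite (B m)" "B m \<subseteq> carrier G" "\<forall>t\<in>B m. inv t \<in> B m"
    "\<forall>t\<in>B m. t \<noteq> \<one> \<longrightarrow> (\<forall>x\<in>X. \<gamma> (\<phi> t x) \<noteq> \<gamma> x)"
    using B_fin B_carrier B_inv proper_T B_T by (simp_all add: subsetI)
  obtain Y where Y: "finitary Y" "\<forall>x\<in>X. Y x \<longrightarrow> (\<forall>t\<in>B m. t \<noteq> \<one> \<longrightarrow> \<not> Y (\<phi> t x))"
    "\<forall>x\<in>X. Y x \<or> (\<exists>t\<in>B m. Y (\<phi> t x))"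
    using finitary_maximal_separated[OF bnd Bm] by (elim exE conjE) (rule that)
  have Y_ex: "\<exists>t\<in>B m. Y (\<phi> t x)" if "x \<in> X" for x
  proof (cases "Y x")
    case True
    then show ?thesis using B_one[of m] that by (intro bexI[of _ \<one>]) simp_all
  next
    case False
    then show ?thesis using bspec[OF Y(3) that] by simp
  qed
  have deg: "\<forall>x\<in>X. Y x \<longrightarrow> card {t \<in> T. Y (\<phi> t x)} \<le> k"
  proof (intro ballI impI)
    fix x assume that: "x \<in> X" "Y x"
    show "card {t \<in> T. Y (\<phi> t x)} \<le> k"
  proof (rule packing)
    show "{t \<in> T. Y (\<phi> t x)} \<subseteq> (\<lambda>(g', g). g' \<otimes> inv g) ` (P \<times> P)"
      unfolding T_def by (rule Collect_restrict)
    show "\<forall>z\<in>{t \<in> T. Y (\<phi> t x)}. \<forall>z'\<in>{t \<in> T. Y (\<phi> t x)}. z \<noteq> z' \<longrightarrow> z' \<otimes> inv z \<notin> B m"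
    proof (intro ballI impI notI)
      fix z z' assume "z \<in> {t \<in> T. Y (\<phi> t x)}" "z' \<in> {t \<in> T. Y (\<phi> t x)}" "z \<noteq> z'" and b: "z' \<otimes> inv z \<in> B m"
      then have z: "z \<in> carrier G" "z' \<in> carrier G" "Y (\<phi> z x)" "Y (\<phi> z' x)" "z \<noteq> z'"
        using T_carrier by simp_all
      have "z' \<otimes> inv z \<noteq> \<one>"
        using z(1,2,5) by (simp add: neq_inv_mult)
      moreover have "\<phi> (z' \<otimes> inv z) (\<phi> z x) = \<phi> z' x"
        using z that(1) by (simp add: m_assoc)
      moreover have "\<phi> z x \<in> X" using z(1) that(1) by simp
      ultimately show False
        using bspec[OF bspec[OF Y(2), THEN mp, OF _ z(3)] b] z(4) by simp
    qed
  qed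
  qed
  have T_sub: "T \<subseteq> carrier G" using T_carrier by (simp add: subsetI)
  have T': "\<forall>t\<in>T. inv t \<in> T" "\<forall>t\<in>T. t \<noteq> \<one> \<longrightarrow> (\<forall>x\<in>X. \<gamma> (\<phi> t x) \<noteq> \<gamma> x)"
    using T_inv proper_T by simp_all
  obtain \<kappa> where \<kappa>: "finitary \<kappa>" "\<forall>x\<in>X. \<kappa> x \<le> k"
    "\<forall>x\<in>X. Y x \<longrightarrow> (\<forall>t\<in>T. t \<noteq> \<one> \<longrightarrow> Y (\<phi> t x) \<longrightarrow> \<kappa> (\<phi> t x) \<noteq> \<kappa> x)"
    using finitary_recolouring[OF bnd T_fin T_sub T' Y(1) deg] by (elim exE conjE) (rule that)
  \<comment> \<open>From here on \<open>x\<close> is a centre choosing its radius, and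
    \<open>g \<in> P\<close> is the position of \<open>x\<close> in the window of the point
    \<open>\<phi> (inv g) x\<close>. Counted are the walls at that point whose centres chose before
    \<open>x\<close>: \<open>S\<close> tells where the centres are, \<open>h\<close> which radii
    were taken.\<close>
  define wcount where "wcount S h g = card {g' \<in> P. g' \<otimes> inv g \<in> S \<and>
     (case h (g' \<otimes> inv g) of Some j \<Rightarrow> ann g' j | None \<Rightarrow> False)}"
    for S :: "'a set" and h :: "'a \<Rightarrow> nat option" and g
  define \<Phi> where "\<Phi> S h = (SOME j. j < J \<and> (\<Sum>g\<in>P. J ^ wcount S h g * (if ann g j then J else 1))
     \<le> 2 * (\<Sum>g\<in>P. J ^ wcount S h g))" for S h
  have \<Phi>: "\<Phi> S h < J \<and> (\<Sum>g\<in>P. J ^ wcount S h g * (if ann g (\<Phi> S h) then J else 1))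
     \<le> 2 * (\<Sum>g\<in>P. J ^ wcount S h g)" for S h
    unfolding \<Phi>_def by (rule someI_ex) (rule averaging)
  define D where "D x = {t \<in> T. Y (\<phi> t x)}" for x
  have D: "finitary D"
    by (rule finitary_shift[OF Y(1) T_fin T_sub]) (simp add: D_def cong: conj_cong)
  have \<kappa>_bnd: "\<forall>x\<in>X. \<kappa> x < Suc k" using \<kappa>(2) by (simp add: less_Suc_eq_le)
  obtain r where *: "finitary r \<and> (\<forall>x\<in>X. r x = \<Phi> (D x)
      (\<lambda>t. if t \<in> T \<and> \<kappa> (\<phi> t x) < \<kappa> x then Some (r (\<phi> t x)) else None))"
    using finitary_greedy[OF \<kappa>(1) \<kappa>_bnd D T_fin T_sub, of \<Phi>] by (elim exE)
  note r = conjunct1[OF *] bspec[OF conjunct2[OF *]]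
  define wc where "wc i x = card {g \<in> P. Y (\<phi> g x) \<and> \<kappa> (\<phi> g x) < i \<and> ann g (r (\<phi> g x))}" for i x
  have wcount_eq: "wcount (D x) (\<lambda>t. if t \<in> T \<and> \<kappa> (\<phi> t x) < \<kappa> x then Some (r (\<phi> t x)) else None) g
     = wc (\<kappa> x) (\<phi> (inv g) x)" if "x \<in> X" "g \<in> P" for x g
  proof -
    have "(g' \<otimes> inv g \<in> D x \<and> (case if g' \<otimes> inv g \<in> T \<and> \<kappa> (\<phi> (g' \<otimes> inv g) x) < \<kappa> x
        then Some (r (\<phi> (g' \<otimes> inv g) x)) else None of None \<Rightarrow> False | Some j \<Rightarrow> ann g' j)) \<longleftrightarrow>
      (Y (\<phi> g' (\<phi> (inv g) x)) \<and> \<kappa> (\<phi> g' (\<phi> (inv g) x)) < \<kappa> x \<and> ann g' (r (\<phi> g' (\<phi> (inv g) x))))"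
      if "g' \<in> P" for g'
    proof -
      have "\<phi> g' (\<phi> (inv g) x) = \<phi> (g' \<otimes> inv g) x"
        using P_carrier \<open>g \<in> P\<close> \<open>x \<in> X\<close> that by simp
      moreover have "g' \<otimes> inv g \<in> T" using T_I \<open>g \<in> P\<close> that by blast
      ultimately show ?thesis by (simp add: D_def)
    qed
    then show ?thesis
      unfolding wcount_def wc_def
      by (intro arg_cong[where f = card] Collect_cong conj_cong[OF refl])
  qed
  \<comment> \<open>Potential of the point \<open>\<phi> (inv g) x\<close> after the choice of
    \<open>x\<close>: its weight \<open>J ^ walls\<close> gains a factor \<open>J\<close> exactly if
    the new wall passes there. \<open>S x\<close> is the total just before the choice, and
    \<open>a_le\<close> is the averaging bound.\<close>
  define a where "a x g = J ^ wc (\<kappa> x) (\<phi> (inv g) x) * (if ann g (r x) then J else 1)" for x g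
  define S where "S x = (\<Sum>g\<in>P. J ^ wc (\<kappa> x) (\<phi> (inv g) x))" for x
  have r_lt: "r x < J" and a_le: "(\<Sum>g\<in>P. a x g) \<le> 2 * S x" if "x \<in> X" for x
  proof -
    let ?h = "\<lambda>t. if t \<in> T \<and> \<kappa> (\<phi> t x) < \<kappa> x then Some (r (\<phi> t x)) else None"
    have eq: "r x = \<Phi> (D x) ?h" by (rule r(2)[OF that])
    show "r x < J" using \<Phi>[of "D x" ?h] unfolding eq[symmetric] by blast
    have "(\<Sum>g\<in>P. J ^ wcount (D x) ?h g * (if ann g (r x) then J else 1)) = (\<Sum>g\<in>P. a x g)"
      unfolding a_def by (intro sum.cong refl) (simp only: wcount_eq[OF that])
    moreover have "(\<Sum>g\<in>P. J ^ wcount (D x) ?h g) = S x"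
      unfolding S_def by (intro sum.cong refl) (simp only: wcount_eq[OF that])
    ultimately show "(\<Sum>g\<in>P. a x g) \<le> 2 * S x"
      using \<Phi>[of "D x" ?h] unfolding eq[symmetric] by linarith
  qed
  \<comment> \<open>Of the counted walls at \<open>x\<close>, take the one whose centre has the
    largest \<open>\<kappa>\<close>. All others have strictly smaller colour by properness and were
    there before it, so the whole weight \<open>J ^ wc i x\<close> occurs as one term of the sum
    \<open>a\<close> at that centre.\<close>
  have top: "\<exists>g\<in>P. Y (\<phi> g x) \<and> \<kappa> (\<phi> g x) < i \<and> J ^ wc i x = a (\<phi> g x) g"
    if x: "x \<in> X" and pos: "wc i x \<noteq> 0" for x i
  proof -
    define A where "A = {g \<in> P. Y (\<phi> g x) \<and> \<kappa> (\<phi> g x) < i \<and> ann g (r (\<phi> g x))}"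
    have A: "finite A" "A \<noteq> {}" "card A = wc i x"
      using P_fin pos unfolding A_def wc_def by (auto simp: card_gt_0_iff)
    obtain g where g: "g \<in> A" "\<And>g'. g' \<in> A \<Longrightarrow> \<kappa> (\<phi> g' x) \<le> \<kappa> (\<phi> g x)"
      using finite_arg_max[OF A(1,2), of "\<lambda>g. \<kappa> (\<phi> g x)"] by (elim bexE) (rule that, assumption, erule bspec)
    have gP: "g \<in> P" "Y (\<phi> g x)" "\<kappa> (\<phi> g x) < i" "ann g (r (\<phi> g x))"
      using g(1) by (auto simp: A_def)
    have "A - {g} = {g' \<in> P. Y (\<phi> g' x) \<and> \<kappa> (\<phi> g' x) < \<kappa> (\<phi> g x) \<and> ann g' (r (\<phi> g' x))}"
    proof (intro equalityI subsetI)
      fix g' assume g': "g' \<in> A - {g}"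
      then have g'P: "g' \<in> P" "Y (\<phi> g' x)" by (auto simp: A_def)
      have c: "g \<in> carrier G" "g' \<in> carrier G" using gP g'P P_carrier by blast+
      have "g' \<otimes> inv g \<noteq> \<one>"
        using g' by (intro neq_inv_mult[OF c]) auto
      moreover have "\<phi> (g' \<otimes> inv g) (\<phi> g x) = \<phi> g' x"
        using c x by (simp add: m_assoc)
      ultimately have "\<kappa> (\<phi> g' x) \<noteq> \<kappa> (\<phi> g x)"
        using bspec[OF \<kappa>(3), of "\<phi> g x"] T_I[OF gP(1) g'P(1)] gP(2) g'P(2) c x by force
      moreover have "\<kappa> (\<phi> g' x) \<le> \<kappa> (\<phi> g x)" using g' g(2) by blast
      ultimately show "g' \<in> {g' \<in> P. Y (\<phi> g' x) \<and> \<kappa> (\<phi> g' x) < \<kappa> (\<phi> g x) \<and> ann g' (r (\<phi> g' x))}"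
        using g' by (simp add: A_def)
    next
      fix g' assume "g' \<in> {g' \<in> P. Y (\<phi> g' x) \<and> \<kappa> (\<phi> g' x) < \<kappa> (\<phi> g x) \<and> ann g' (r (\<phi> g' x))}"
      then show "g' \<in> A - {g}" using gP by (auto simp: A_def)
    qed
    then have "wc i x = Suc (wc (\<kappa> (\<phi> g x)) x)"
      using A g(1) unfolding wc_def[of "\<kappa> (\<phi> g x)"] by (metis card.remove)
    moreover have "\<phi> (inv g) (\<phi> g x) = x" using P_carrier gP x by simp
    ultimately have "J ^ wc i x = a (\<phi> g x) g"
      using gP(4) by (simp add: a_def)
    then show ?thesis using gP by blast
  qed
  \<comment> \<open>Induction on the colour. A point of the window without earlier walls contributes
    1; any other weight occurs, by \<open>top\<close>, in the sum of a centre
    \<open>\<phi> t x\<close> of smaller colour, which is at most \<open>2 * S (\<phi> t x)\<close>.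
    There are at most \<open>k\<close> such centres, so each colour costs a factor
    \<open>1 + 2 * k\<close>.\<close>
  have S_le: "S x \<le> card P * (1 + 2 * k) ^ \<kappa> x" if "x \<in> X" "Y x" for x
    using that
  proof (induction "\<kappa> x" arbitrary: x rule: less_induct)
    case less
    define L where "L = {t \<in> T. Y (\<phi> t x) \<and> \<kappa> (\<phi> t x) < \<kappa> x}"
    have L: "finite L" "card L \<le> k"
    proof -
      show "finite L" using T_fin by (simp add: L_def)
      have "card L \<le> card {t \<in> T. Y (\<phi> t x)}"
        using T_fin by (intro card_mono) (auto simp: L_def)
      then show "card L \<le> k" using deg less.prems by force
    qed
    define U where "U t g = (if t \<otimes> g \<in> P then a (\<phi> t x) (t \<otimes> g) else 0)" for t g
    have summand: "J ^ wc (\<kappa> x) (\<phi> (inv g) x) \<le> 1 + (\<Sum>t\<in>L. U t g)" if g: "g \<in> P" for g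
    proof (cases "wc (\<kappa> x) (\<phi> (inv g) x) = 0")
      case True
      then show ?thesis by simp
    next
      case False
      have gc: "g \<in> carrier G" using g P_carrier by blast
      obtain g' where g': "g' \<in> P" "Y (\<phi> g' (\<phi> (inv g) x))" "\<kappa> (\<phi> g' (\<phi> (inv g) x)) < \<kappa> x"
        "J ^ wc (\<kappa> x) (\<phi> (inv g) x) = a (\<phi> g' (\<phi> (inv g) x)) g'"
        using top[OF _ False] gc less.prems by blast
      define t where "t = g' \<otimes> inv g"
      have t: "\<phi> g' (\<phi> (inv g) x) = \<phi> t x" "t \<otimes> g = g'" "t \<in> T"
        using P_carrier[OF g'(1)] gc less.prems T_I[OF g g'(1)] by (simp_all add: t_def m_assoc)
      have tL: "t \<in> L" using g' t by (simp add: L_def)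
      have "J ^ wc (\<kappa> x) (\<phi> (inv g) x) = U t g"
        using g' t by (simp add: U_def)
      also have "\<dots> \<le> (\<Sum>t\<in>L. U t g)"
        using L(1) tL by (intro member_le_sum) auto
      finally show ?thesis by simp
    qed
    have U_sum: "(\<Sum>g\<in>P. U t g) \<le> 2 * S (\<phi> t x)" if t: "t \<in> L" for t
    proof -
      have tc: "t \<in> carrier G" using t T_carrier by (auto simp: L_def)
      have "(\<Sum>g\<in>P. U t g) = (\<Sum>g\<in>{g\<in>P. t \<otimes> g \<in> P}. a (\<phi> t x) (t \<otimes> g))"
        unfolding U_def using P_fin by (simp add: sum.If_cases Int_def)
      also have "\<dots> = sum (a (\<phi> t x)) ((\<otimes>) t ` {g\<in>P. t \<otimes> g \<in> P})"
      proof (subst sum.reindex)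
        show "inj_on ((\<otimes>) t) {g \<in> P. t \<otimes> g \<in> P}"
          using tc P_carrier by (intro inj_onI) auto
      qed (simp add: comp_def)
      also have "\<dots> \<le> sum (a (\<phi> t x)) P"
        using P_fin by (intro sum_mono2) auto
      also have "\<dots> \<le> 2 * S (\<phi> t x)"
        using a_le[of "\<phi> t x"] tc less.prems by simp
      finally show ?thesis .
    qed
    have "S x \<le> (\<Sum>g\<in>P. 1 + (\<Sum>t\<in>L. U t g))"
      unfolding S_def by (rule sum_mono) (rule summand)
    also have "\<dots> = card P + (\<Sum>t\<in>L. \<Sum>g\<in>P. U t g)"
      by (subst sum.distrib, subst sum.swap) simp
    also have "\<dots> \<le> card P * (1 + 2 * k) ^ \<kappa> x"
    proof (cases "L = {}")
      case True
      then show ?thesis by simp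
    next
      case False
      then obtain i where i: "\<kappa> x = Suc i" unfolding L_def by (cases "\<kappa> x") auto
      have "(\<Sum>t\<in>L. \<Sum>g\<in>P. U t g) \<le> (\<Sum>t\<in>L. 2 * (card P * (1 + 2 * k) ^ i))"
      proof (rule sum_mono)
        fix t assume t: "t \<in> L"
        then have t': "t \<in> carrier G" "Y (\<phi> t x)" "\<kappa> (\<phi> t x) < \<kappa> x"
          using T_carrier by (auto simp: L_def)
        have "S (\<phi> t x) \<le> card P * (1 + 2 * k) ^ \<kappa> (\<phi> t x)"
          using t' less.prems by (intro less.hyps) auto
        also have "\<dots> \<le> card P * (1 + 2 * k) ^ i"
          using t'(3) i by (intro mult_le_mono2 power_increasing) auto
        finally show "(\<Sum>g\<in>P. U t g) \<le> 2 * (card P * (1 + 2 * k) ^ i)"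
          using U_sum[OF t] by linarith
      qed
      also have "\<dots> = card L * (2 * (card P * (1 + 2 * k) ^ i))" by simp
      also have "\<dots> \<le> k * (2 * (card P * (1 + 2 * k) ^ i))"
        using L(2) by (intro mult_le_mono1)
      finally have "card P + (\<Sum>t\<in>L. \<Sum>g\<in>P. U t g) \<le> card P * 1 + k * (2 * (card P * (1 + 2 * k) ^ i))"
        by simp
      also have "\<dots> \<le> card P * (1 + 2 * k) ^ i + k * (2 * (card P * (1 + 2 * k) ^ i))"
        by (intro add_mono mult_le_mono2) auto
      also have "\<dots> = card P * (1 + 2 * k) ^ \<kappa> x"
        unfolding i by (simp add: algebra_simps)
      finally show ?thesis .
    qed
    finally show ?case .
  qed
  have walls: "card {g \<in> P. Y (\<phi> g x) \<and> ann g (r (\<phi> g x))} \<le> d" if x: "x \<in> X" for x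
  proof -
    have eq: "card {g \<in> P. Y (\<phi> g x) \<and> ann g (r (\<phi> g x))} = wc (Suc k) x"
      unfolding wc_def using \<kappa>_bnd x P_carrier
      by (intro arg_cong[where f = card] Collect_cong conj_cong refl) auto
    show ?thesis
    proof (cases "wc (Suc k) x = 0")
      case True
      then show ?thesis using eq by simp
    next
      case False
      obtain g where g: "g \<in> P" "Y (\<phi> g x)" "J ^ wc (Suc k) x = a (\<phi> g x) g"
        using top[OF x False] by blast
      have gx: "\<phi> g x \<in> X" using P_carrier g x by blast
      have "J ^ wc (Suc k) x \<le> sum (a (\<phi> g x)) P"
        unfolding g(3) using P_fin g(1) by (intro member_le_sum) auto
      also have "\<dots> \<le> 2 * S (\<phi> g x)" by (rule a_le[OF gx])
      also have "\<dots> \<le> 2 * (card P * (1 + 2 * k) ^ \<kappa> (\<phi> g x))"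
        using S_le[OF gx g(2)] by simp
      also have "\<dots> \<le> 2 * (card P * (1 + 2 * k) ^ k)"
        using \<kappa>(2) gx by (intro mult_le_mono2 power_increasing) auto
      also have "\<dots> < J ^ Suc d" using J(3) by (simp add: mult.assoc)
      finally have "wc (Suc k) x < Suc d"
        using power_increasing[of "Suc d" "wc (Suc k) x" J] J(1) by (cases "Suc d \<le> wc (Suc k) x") simp_all
      then show ?thesis using eq by simp
    qed
  qed
  have "\<forall>x\<in>X. \<exists>t\<in>B m. Y (\<phi> t x)" "\<forall>x\<in>X. Y x \<longrightarrow> r x < J"
    "\<forall>x\<in>X. card {g \<in> P. Y (\<phi> g x) \<and> ann g (r (\<phi> g x))} \<le> d"
    using Y_ex r_lt walls by simp_all
  then show ?thesis
    by (intro exI[of _ Y] exI[of _ \<kappa>] exI[of _ r] conjI Y(1,2) \<kappa> r(1))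
qed

end

lemma (in group) inv_cancel:
  "\<lbrakk>a \<in> carrier G; b \<in> carrier G\<rbrakk> \<Longrightarrow> inv a \<otimes> (a \<otimes> b) = b"
  "\<lbrakk>a \<in> carrier G; b \<in> carrier G\<rbrakk> \<Longrightarrow> a \<otimes> (inv a \<otimes> b) = b"
  by (simp_all flip: m_assoc)

lemma (in gspace) separated_translates:
  assumes "\<forall>x\<in>X. Y x \<longrightarrow> (\<forall>t\<in>S. t \<noteq> \<one> \<longrightarrow> \<not> Y (\<phi> t x))" and "x \<in> X"
    and "z \<in> carrier G" "z' \<in> carrier G" "Y (\<phi> z x)" "Y (\<phi> z' x)" "z \<noteq> z'"
  shows "z' \<otimes> inv z \<notin> S"
proof
  assume b: "z' \<otimes> inv z \<in> S"
  have ne: "z' \<otimes> inv z \<noteq> \<one>"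
    using assms(3,4,7) by (rule neq_inv_mult)
  have eq: "\<phi> (z' \<otimes> inv z) (\<phi> z x) = \<phi> z' x"
    using assms(2-4) by (simp add: m_assoc)
  have "\<phi> z x \<in> X" using assms(2,3) by simp
  then have "\<forall>t\<in>S. t \<noteq> \<one> \<longrightarrow> \<not> Y (\<phi> t (\<phi> z x))"
    using assms(1,5) by blast
  then show False
    using b ne eq assms(6) by metis
qed

context box_tiling
begin

text \<open>The tile of a point changes along \<open>M\<close> only across a wall, and each of the at most \<open>d\<close> walls at
  most doubles the product.\<close>

lemma tiles:
  "\<exists>Y \<tau>. finitary Y \<and> finitary \<tau> \<and>
     (\<forall>x\<in>X. Y x \<longrightarrow> (\<forall>t\<in>B m. t \<noteq> \<one> \<longrightarrow> \<not> Y (\<phi> t x))) \<and>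
     (\<forall>x\<in>X. \<tau> x \<in> B (2 * m) \<and> Y (\<phi> (\<tau> x) x)) \<and>
     (\<forall>x\<in>X. (\<Prod>w\<in>W. card ((\<lambda>n. \<tau> (\<phi> (n \<otimes> w) x) \<otimes> (n \<otimes> w)) ` M)) \<le> 2 ^ d)"
proof -
  obtain Y \<kappa> r where Y: "finitary Y" and \<kappa>: "finitary \<kappa>" and r: "finitary r"
    and sep: "\<forall>x\<in>X. Y x \<longrightarrow> (\<forall>t\<in>B m. t \<noteq> \<one> \<longrightarrow> \<not> Y (\<phi> t x))"
    and cover: "\<forall>x\<in>X. \<exists>t\<in>B m. Y (\<phi> t x)"
    and "\<forall>x\<in>X. \<kappa> x \<le> k"
    and \<kappa>_proper: "\<forall>x\<in>X. Y x \<longrightarrow> (\<forall>t\<in>T. t \<noteq> \<one> \<longrightarrow> Y (\<phi> t x) \<longrightarrow> \<kappa> (\<phi> t x) \<noteq> \<kappa> x)"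
    and r_lt: "\<forall>x\<in>X. Y x \<longrightarrow> r x < J"
    and walls: "\<forall>x\<in>X. card {g \<in> P. Y (\<phi> g x) \<and> ann g (r (\<phi> g x))} \<le> d"
    using wall_structure by (elim exE conjE) (rule that)
  \<comment> \<open>Elements leading from \<open>x\<close> to the centres whose box contains
    \<open>x\<close>; \<open>best\<close> resolves overlaps in favour of the smallest
    \<open>\<kappa>\<close>, so a tile is a box minus the boxes of smaller colour.\<close>
  define A where "A x = {g \<in> B (2 * m). Y (\<phi> g x) \<and> g \<in> B (m + 3 * r (\<phi> g x))}" for x
  have A_ne: "A x \<noteq> {}" if x: "x \<in> X" for x
  proof -
    obtain t where t: "t \<in> B m" "Y (\<phi> t x)" using bspec[OF cover x] by blast
    have "t \<in> B (2 * m)" "t \<in> B (m + 3 * r (\<phi> t x))"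
      using t(1) B_mono[of m "2 * m"] B_mono[of m "m + 3 * r (\<phi> t x)"] by auto
    then show ?thesis using t unfolding A_def by blast
  qed
  define best where "best x g \<longleftrightarrow> g \<in> A x \<and> (\<forall>g'\<in>A x. \<kappa> (\<phi> g x) \<le> \<kappa> (\<phi> g' x))" for x g
  define \<tau> where "\<tau> x = (SOME g. best x g)" for x
  have best: "best x (\<tau> x)" if x: "x \<in> X" for x
    unfolding \<tau>_def by (rule someI_ex)
      (use finite_arg_min[OF A_ne[OF x], of "\<lambda>g. \<kappa> (\<phi> g x)"] in \<open>unfold best_def, blast\<close>)
  have \<tau>: "finitary \<tau>"
  proof (rule finitary_shift[OF finitary_Pair[OF Y finitary_Pair[OF r \<kappa>]] B_fin[of "2 * m"]])
    show "B (2 * m) \<subseteq> carrier G" using B_carrier by (rule subsetI)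
    fix x y assume xy: "x \<in> X" "y \<in> X" and *: "\<forall>t\<in>B (2 * m). (Y (\<phi> t x), r (\<phi> t x), \<kappa> (\<phi> t x)) =
       (Y (\<phi> t y), r (\<phi> t y), \<kappa> (\<phi> t y))"
    have eq: "Y (\<phi> t x) = Y (\<phi> t y)" "r (\<phi> t x) = r (\<phi> t y)" "\<kappa> (\<phi> t x) = \<kappa> (\<phi> t y)"
      if "t \<in> B (2 * m)" for t
      using bspec[OF * that] by simp_all
    have A_eq: "A x = A y"
      unfolding A_def by (rule Collect_cong) (simp add: eq(1,2) cong: conj_cong)
    have "best x g = best y g" for g
    proof (cases "g \<in> A y")
      case True
      have sub: "t \<in> B (2 * m)" if "t \<in> A y" for t using that by (simp add: A_def)
      have "(\<forall>g'\<in>A y. \<kappa> (\<phi> g x) \<le> \<kappa> (\<phi> g' x)) = (\<forall>g'\<in>A y. \<kappa> (\<phi> g y) \<le> \<kappa> (\<phi> g' y))"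
        by (rule ball_cong[OF refl]) (simp only: eq(3)[OF sub] eq(3)[OF sub[OF True]])
      then show ?thesis unfolding best_def A_eq by simp
    next
      case False
      then show ?thesis by (simp add: best_def A_eq)
    qed
    then have "best x = best y" by (rule ext)
    then show "\<tau> x = \<tau> y" unfolding \<tau>_def by (rule arg_cong)
  qed
  have \<tau>_Y: "\<tau> x \<in> B (2 * m) \<and> Y (\<phi> (\<tau> x) x)" if "x \<in> X" for x
    using best[OF that] by (simp add: best_def A_def)
  have prod_le: "(\<Prod>w\<in>W. card ((\<lambda>n. \<tau> (\<phi> (n \<otimes> w) x) \<otimes> (n \<otimes> w)) ` M)) \<le> 2 ^ d" if x: "x \<in> X" for x
  proof -
    have unique: "g = g'" if g: "g \<in> P" "g' \<in> P" "Y (\<phi> g x)" "Y (\<phi> g' x)" "\<kappa> (\<phi> g x) = \<kappa> (\<phi> g' x)" for g g'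
    proof (rule ccontr)
      assume "g \<noteq> g'"
      have c: "g \<in> carrier G" "g' \<in> carrier G" using g P_carrier by blast+
      have t: "g' \<otimes> inv g \<in> T" "g' \<otimes> inv g \<noteq> \<one>" "\<phi> (g' \<otimes> inv g) (\<phi> g x) = \<phi> g' x"
        using T_I[OF g(1,2)] neq_inv_mult[OF c \<open>g \<noteq> g'\<close>] c x by (simp_all add: m_assoc)
      have "\<phi> g x \<in> X" using c x by simp
      from bspec[OF mp[OF bspec[OF \<kappa>_proper this] g(3)] t(1)]
      have "\<kappa> (\<phi> (g' \<otimes> inv g) (\<phi> g x)) \<noteq> \<kappa> (\<phi> g x)"
        using g(4) t(2,3) by simp
      then show False using t(3) g(5) by simp
    qed
    \<comment> \<open>\<open>Q n w g\<close> means that the box around the centre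
      \<open>\<phi> g x\<close> contains the point \<open>\<phi> (n \<otimes> w) x\<close>;
      \<open>wall w\<close> collects the centres that have \<open>\<phi> w x\<close> in their
      boundary layer.\<close>
    define Q where "Q n w g \<longleftrightarrow> g \<in> P \<and> Y (\<phi> g x) \<and> g \<otimes> inv (n \<otimes> w) \<in> B (m + 3 * r (\<phi> g x))" for n w g
    define wall where "wall w = {g \<in> P. Y (\<phi> g x) \<and> g \<otimes> inv w \<in> B (m + 3 * r (\<phi> g x) + 1) \<and>
        g \<otimes> inv w \<notin> B (m + 3 * r (\<phi> g x) - 1)}" for w
    define tile where "tile w n = \<tau> (\<phi> (n \<otimes> w) x) \<otimes> (n \<otimes> w)" for n w
    have r_le: "m + 3 * r (\<phi> g x) + 1 \<le> 2 * m" if "g \<in> carrier G" "Y (\<phi> g x)" for g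
    proof -
      have "r (\<phi> g x) < J" using r_lt that x by simp
      then show ?thesis using J(2) by linarith
    qed
    have tile_Q: "Q n w (tile w n) \<and> (\<forall>g. Q n w g \<longrightarrow> \<kappa> (\<phi> (tile w n) x) \<le> \<kappa> (\<phi> g x))"
      if nw: "n \<in> M" "w \<in> W" for n w
    proof -
      have c: "n \<in> carrier G" "w \<in> carrier G" using nw M_carrier W_carrier by blast+
      then have nwx: "\<phi> (n \<otimes> w) x \<in> X" using x by simp
      note b = best[OF nwx]
      define b where "b = \<tau> (\<phi> (n \<otimes> w) x)"
      have bA: "b \<in> A (\<phi> (n \<otimes> w) x)" "\<And>g'. g' \<in> A (\<phi> (n \<otimes> w) x) \<Longrightarrow>
          \<kappa> (\<phi> b (\<phi> (n \<otimes> w) x)) \<le> \<kappa> (\<phi> g' (\<phi> (n \<otimes> w) x))"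
        using b unfolding best_def b_def[symmetric] by blast+
      have bc: "b \<in> carrier G" using bA(1) B_carrier by (auto simp: A_def)
      have g: "tile w n = b \<otimes> (n \<otimes> w)" by (simp add: tile_def b_def)
      have act: "\<phi> b (\<phi> (n \<otimes> w) x) = \<phi> (tile w n) x" unfolding g using bc c x by simp
      have bB: "b \<in> B (m + 3 * r (\<phi> (tile w n) x))" and Yb: "Y (\<phi> (tile w n) x)"
        using bA(1) unfolding A_def act[symmetric] by simp_all
      have "b \<otimes> n \<in> B (m + 3 * r (\<phi> (tile w n) x) + 1)"
        using B_M[OF bB nw(1)] by simp
      moreover have "m + 3 * r (\<phi> (tile w n) x) + 1 \<le> 2 * m"
        using Yb bc c by (intro r_le) (simp_all add: g)
      ultimately have "(b \<otimes> n) \<otimes> w \<in> P"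
        using nw(2) by (rule P_I)
      then have P: "tile w n \<in> P" using bc c by (simp add: g m_assoc)
      have "tile w n \<otimes> inv (n \<otimes> w) = b" using bc c by (simp add: g mult_inv_cancel)
      then have "Q n w (tile w n)" using P Yb bB by (simp add: Q_def)
      moreover have "\<kappa> (\<phi> (tile w n) x) \<le> \<kappa> (\<phi> g' x)" if g': "Q n w g'" for g'
      proof -
        have gc: "g' \<in> carrier G" using g' P_carrier by (simp add: Q_def)
        have act': "\<phi> (g' \<otimes> inv (n \<otimes> w)) (\<phi> (n \<otimes> w) x) = \<phi> g' x"
          using gc c x by (simp add: mult_inv_cancel)
        have "m + 3 * r (\<phi> g' x) \<le> 2 * m" using r_le[OF gc] g' by (simp add: Q_def)
        then have "g' \<otimes> inv (n \<otimes> w) \<in> B (2 * m)"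
          using g' B_mono unfolding Q_def by blast
        then have "g' \<otimes> inv (n \<otimes> w) \<in> A (\<phi> (n \<otimes> w) x)"
          using g' unfolding A_def by (simp only: act' Q_def mem_Collect_eq simp_thms)
        then show ?thesis using bA(2) unfolding act act'[symmetric] by blast
      qed
      ultimately show ?thesis by blast
    qed
    \<comment> \<open>Undoing the move \<open>n\<close> puts \<open>g \<otimes> inv w\<close> into
      the box of the next radius, being off the wall pushes it into the previous one, and the move
      to \<open>n'\<close> then stays within the box. This uses \<open>m > 0\<close>, since radii
      are natural numbers and 1 is subtracted.\<close>
    have Q_wall: "Q n' w g" if nw: "n \<in> M" "w \<in> W" "n' \<in> M" and g: "Q n w g" "g \<notin> wall w" for n n' w g
    proof -
      have c: "n \<in> carrier G" "w \<in> carrier G" "n' \<in> carrier G" "g \<in> carrier G"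
        using nw g M_carrier W_carrier P_carrier by (simp_all add: Q_def)
      let ?\<rho> = "m + 3 * r (\<phi> g x)"
      have "g \<otimes> inv (n \<otimes> w) \<otimes> n \<in> B (Suc ?\<rho>)"
        using g(1) nw(1) by (intro B_M) (simp_all add: Q_def)
      moreover have "g \<otimes> inv (n \<otimes> w) \<otimes> n = g \<otimes> inv w"
        using c by (simp add: inv_mult_group m_assoc)
      ultimately have "g \<otimes> inv w \<in> B (?\<rho> - 1)"
        using g by (auto simp: wall_def Q_def)
      then have "g \<otimes> inv w \<otimes> inv n' \<in> B (Suc (?\<rho> - 1))"
        using M_inv nw(3) by (intro B_M)
      moreover have "Suc (?\<rho> - 1) = ?\<rho>" using J by linarith
      moreover have "g \<otimes> inv w \<otimes> inv n' = g \<otimes> inv (n' \<otimes> w)"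
        using c by (simp add: inv_mult_group m_assoc)
      ultimately show ?thesis using g(1) by (simp add: Q_def)
    qed
    \<comment> \<open>Two choices off the wall are admissible at both points by
      \<open>Q_wall\<close>; minimality gives them the same \<open>\<kappa>\<close>, and properness
      makes them equal. So all values off the wall coincide, which accounts for the
      \<open>Suc\<close>.\<close>
    have card_tile: "card (tile w ` M) \<le> Suc (card (wall w))" if w: "w \<in> W" for w
    proof -
      have fin: "finite (wall w)" using P_fin by (simp add: wall_def)
      have "card (tile w ` M - wall w) \<le> Suc 0"
      proof (subst card_le_Suc0_iff_eq)
        show "finite (tile w ` M - wall w)" using M(1) by simp
        show "\<forall>g\<in>tile w ` M - wall w. \<forall>g'\<in>tile w ` M - wall w. g = g'"
        proof (intro ballI)
          fix g g' assume "g \<in> tile w ` M - wall w" "g' \<in> tile w ` M - wall w"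
          then obtain n n' where n: "n \<in> M" "g = tile w n" "g \<notin> wall w" and n': "n' \<in> M" "g' = tile w n'" "g' \<notin> wall w"
            by blast
          have q: "Q n w g" "Q n' w g'" using tile_Q w n n' by blast+
          have q': "Q n' w g" "Q n w g'" using Q_wall q w n n' by blast+
          have "\<kappa> (\<phi> g x) \<le> \<kappa> (\<phi> g' x)" "\<kappa> (\<phi> g' x) \<le> \<kappa> (\<phi> g x)"
            using tile_Q w n n' q' by blast+
          then show "g = g'" using q by (intro unique) (simp_all add: Q_def)
        qed
      qed
      moreover have "card (tile w ` M) \<le> card ((tile w ` M - wall w) \<union> wall w)"
        using fin M(1) by (intro card_mono) auto
      moreover have "card ((tile w ` M - wall w) \<union> wall w) \<le> card (tile w ` M - wall w) + card (wall w)"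
        by (rule card_Un_le)
      ultimately show ?thesis by linarith
    qed
    have "(\<Sum>w\<in>W. card (wall w)) = card (\<Union>w\<in>W. wall w)"
    proof (subst card_UN_disjoint)
      show "\<forall>w\<in>W. \<forall>w'\<in>W. w \<noteq> w' \<longrightarrow> wall w \<inter> wall w' = {}"
      proof (intro ballI impI, rule ccontr)
        fix w w' assume w: "w \<in> W" "w' \<in> W" "w \<noteq> w'" "wall w \<inter> wall w' \<noteq> {}"
        then obtain g where g: "g \<in> P" "g \<otimes> inv w \<in> N" "g \<otimes> inv w' \<in> N"
          using B_N unfolding wall_def by blast
        then show False using W_unique[OF P_carrier[OF g(1)] w(1,2)] w(3) by blast
      qed
    qed (use W P_fin in \<open>simp_all add: wall_def\<close>)
    also have "\<dots> \<le> card {g \<in> P. Y (\<phi> g x) \<and> ann g (r (\<phi> g x))}"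
      using P_fin by (intro card_mono) (auto simp: wall_def ann_def)
    also have "\<dots> \<le> d" using walls x by simp
    finally have sum_le: "(\<Sum>w\<in>W. card (wall w)) \<le> d" .
    have "(\<Prod>w\<in>W. card (tile w ` M)) \<le> (\<Prod>w\<in>W. 2 ^ card (wall w))"
    proof (rule prod_mono)
      fix w assume w: "w \<in> W"
      have "Suc (card (wall w)) \<le> 2 ^ card (wall w)"
        by (simp add: Suc_leI)
      then show "0 \<le> card (tile w ` M) \<and> card (tile w ` M) \<le> 2 ^ card (wall w)"
        using card_tile[OF w] by linarith
    qed
    also have "\<dots> = 2 ^ (\<Sum>w\<in>W. card (wall w))" by (simp add: power_sum)
    also have "\<dots> \<le> 2 ^ d" using sum_le by (intro power_increasing) auto
    finally show ?thesis unfolding tile_def .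
  qed
  show ?thesis
    by (intro exI[of _ Y] exI[of _ \<tau>] conjI Y \<tau> sep ballI prod_le) (use \<tau>_Y in simp_all)
qed

end

section \<open>Contracting rules\<close>

text \<open>The recursion of \<open>finitary_greedy\<close> along an index that may be unbounded:
  the number of rounds varies with the point, and no finite window results. The recursive equation
  is part of the conclusion because membership of the colour classes in an algebra is later proved
  from it.\<close>

lemma (in gspace) greedy_colouring:
  fixes idx :: "'x \<Rightarrow> nat"
  assumes T: "finite T" "T \<subseteq> carrier G" "\<forall>t\<in>T. inv t \<in> T"
    and idx: "\<forall>x\<in>X. \<forall>t\<in>T. t \<noteq> \<one> \<longrightarrow> idx (\<phi> t x) \<noteq> idx x"
  shows "\<exists>c. \<forall>x\<in>X. c x \<le> card T \<and> (\<forall>t\<in>T. t \<noteq> \<one> \<longrightarrow> c (\<phi> t x) \<noteq> c x) \<and>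
    c x = (LEAST k::nat. \<forall>t\<in>T. idx (\<phi> t x) < idx x \<longrightarrow> c (\<phi> t x) \<noteq> k)"
proof -
  define F where "F = rec_nat (\<lambda>x. 0::nat)
    (\<lambda>n f x. LEAST k. \<forall>t\<in>T. idx (\<phi> t x) < idx x \<longrightarrow> f (\<phi> t x) \<noteq> k)"
  have F_Suc: "F (Suc n) x = (LEAST k. \<forall>t\<in>T. idx (\<phi> t x) < idx x \<longrightarrow> F n (\<phi> t x) \<noteq> k)" for n x
    unfolding F_def by (simp only: old.nat.simps(7))
  have stable: "F n x = F m x" if "x \<in> X" "idx x < n" "idx x < m" for n m x
    using that
  proof (induction "idx x" arbitrary: n m x rule: less_induct)
    case less
    obtain n' m' where nm: "n = Suc n'" "m = Suc m'"
      using less.prems by (cases n; cases m) auto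
    have eq: "F n' (\<phi> t x) = F m' (\<phi> t x)" if "t \<in> T" "idx (\<phi> t x) < idx x" for t
      using that less.prems nm T by (intro less.hyps) auto
    have "(\<forall>t\<in>T. idx (\<phi> t x) < idx x \<longrightarrow> F n' (\<phi> t x) \<noteq> k) =
      (\<forall>t\<in>T. idx (\<phi> t x) < idx x \<longrightarrow> F m' (\<phi> t x) \<noteq> k)" for k
      by (intro ball_cong imp_cong refl) (simp only: eq)
    then show ?case unfolding nm F_Suc by (rule arg_cong[OF ext])
  qed
  define c where "c x = F (Suc (idx x)) x" for x
  have c_eq: "c x = (LEAST k. \<forall>t\<in>T. idx (\<phi> t x) < idx x \<longrightarrow> c (\<phi> t x) \<noteq> k)" if x: "x \<in> X" for x
  proof -
    have eq: "F (idx x) (\<phi> t x) = c (\<phi> t x)" if "t \<in> T" "idx (\<phi> t x) < idx x" for t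
      unfolding c_def using that x T by (intro stable) auto
    have "(\<forall>t\<in>T. idx (\<phi> t x) < idx x \<longrightarrow> F (idx x) (\<phi> t x) \<noteq> k) =
      (\<forall>t\<in>T. idx (\<phi> t x) < idx x \<longrightarrow> c (\<phi> t x) \<noteq> k)" for k
      by (intro ball_cong imp_cong refl) (simp only: eq)
    then show ?thesis unfolding c_def[of x] F_Suc by (rule arg_cong[OF ext])
  qed
  have c: "c x \<le> card T" "\<forall>t\<in>T. idx (\<phi> t x) < idx x \<longrightarrow> c (\<phi> t x) \<noteq> c x" if x: "x \<in> X" for x
  proof -
    let ?P = "\<lambda>k. \<forall>t\<in>T. idx (\<phi> t x) < idx x \<longrightarrow> c (\<phi> t x) \<noteq> k"
    have "card ((\<lambda>t. c (\<phi> t x)) ` T) \<le> card T"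
      using T(1) by (rule card_image_le)
    then have "\<not> {..card T} \<subseteq> (\<lambda>t. c (\<phi> t x)) ` T"
      using card_mono[of "(\<lambda>t. c (\<phi> t x)) ` T" "{..card T}"] T(1) by auto
    then obtain k where k: "k \<le> card T" "?P k" by auto
    show "c x \<le> card T"
      using Least_le[of ?P k] k c_eq[OF x] by linarith
    have "?P (LEAST k. ?P k)" using k(2) by (rule LeastI)
    then show "?P (c x)" unfolding c_eq[OF x, symmetric] .
  qed
  have ne: "c (\<phi> t x) \<noteq> c x" if x: "x \<in> X" and t: "t \<in> T" "t \<noteq> \<one>" for x t
  proof -
    have tc: "t \<in> carrier G" using T(2) t(1) by blast
    have "idx (\<phi> t x) < idx x \<or> idx x < idx (\<phi> t x)"
      using idx x t by (simp add: nat_neq_iff)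
    then show ?thesis
    proof
      assume "idx (\<phi> t x) < idx x"
      then show ?thesis using c(2)[OF x] t by blast
    next
      assume lt: "idx x < idx (\<phi> t x)"
      have eq: "\<phi> (inv t) (\<phi> t x) = x" and "\<phi> t x \<in> X" "inv t \<in> T"
        using x tc T(3) t(1) by simp_all
      then show ?thesis
        using bspec[OF c(2)[of "\<phi> t x"], of "inv t"] lt by (simp add: eq)
    qed
  qed
  show ?thesis
    by (intro exI[of _ c] ballI conjI c(1) c_eq) (use ne in simp_all)
qed

definition proper_colouring :: "('a, 'm) monoid_scheme \<Rightarrow> 'a set \<Rightarrow> nat \<Rightarrow> ('a \<Rightarrow> nat) \<Rightarrow> bool" where
  "proper_colouring G L p c \<longleftrightarrow> (\<forall>g\<in>carrier G. c g < p \<and>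
     (\<forall>l\<in>L. l \<noteq> \<one>\<^bsub>G\<^esub> \<longrightarrow> c (l \<otimes>\<^bsub>G\<^esub> g) \<noteq> c g))"

lemma (in group) proper_colouring_exists:
  assumes "countable (carrier G)" "finite L" "L \<subseteq> carrier G"
  shows "\<exists>p c. proper_colouring G L p c"
proof -
  interpret gspace G "carrier G" "(\<otimes>)" by (rule gspace_self)
  obtain idx :: "'a \<Rightarrow> nat" where idx: "inj_on idx (carrier G)"
    using assms(1) unfolding countable_def by blast
  let ?T = "L \<union> (\<lambda>l. inv l) ` L"
  have T: "finite ?T" "?T \<subseteq> carrier G" "\<forall>t\<in>?T. inv t \<in> ?T"
    using assms by (auto simp: subset_iff)
  have "idx (t \<otimes> x) \<noteq> idx x" if "x \<in> carrier G" "t \<in> ?T" "t \<noteq> \<one>" for x t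
  proof
    assume "idx (t \<otimes> x) = idx x"
    moreover have t: "t \<in> carrier G" using T(2) that(2) by blast
    ultimately have "t \<otimes> x = x" using idx that(1) by (simp add: inj_on_eq_iff)
    then show False using t that(1,3) by simp
  qed
  then have "\<forall>x\<in>carrier G. \<forall>t\<in>?T. t \<noteq> \<one> \<longrightarrow> idx (t \<otimes> x) \<noteq> idx x" by blast
  from greedy_colouring[OF T this] obtain c where
    c: "\<forall>x\<in>carrier G. c x \<le> card ?T \<and> (\<forall>t\<in>?T. t \<noteq> \<one> \<longrightarrow> c (t \<otimes> x) \<noteq> c x)" by meson
  then have "proper_colouring G L (Suc (card ?T)) c"
    unfolding proper_colouring_def by (auto simp: less_Suc_eq_le)
  then show ?thesis by blast
qed

text \<open>A rule \<open>z\<close> reading a colouring through a finite window moves the points of every suitably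
  coloured space so that \<open>F\<close>-balls are mapped to at most \<open>D\<close> points. The scale \<open>L\<close> must not depend
  on the number of colours \<open>p\<close>.\<close>

definition coarsely_contractible :: "('a, 'm) monoid_scheme \<Rightarrow> nat \<Rightarrow> bool" where
  "coarsely_contractible G D \<longleftrightarrow> (\<forall>F. finite F \<and> F \<subseteq> carrier G \<longrightarrow> (\<exists>L. finite L \<and> L \<subseteq> carrier G \<and>
     (\<forall>p. \<exists>W z. finite W \<and> W \<subseteq> carrier G \<and>
        (\<forall>c c'. (\<forall>w\<in>W. c w = c' w) \<longrightarrow> z c = z c') \<and> (\<forall>c. z c \<in> W) \<and>
        (\<forall>c. proper_colouring G L p c \<longrightarrow>
           card ((\<lambda>f. z (\<lambda>g. c (g \<otimes>\<^bsub>G\<^esub> f)) \<otimes>\<^bsub>G\<^esub> f) ` F) \<le> D))))"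

lemma coarsely_contractibleE:
  assumes "coarsely_contractible G D" "finite F" "F \<subseteq> carrier G"
  obtains L where "finite L" "L \<subseteq> carrier G"
    "\<And>p. \<exists>W z. finite W \<and> W \<subseteq> carrier G \<and>
        (\<forall>c c'. (\<forall>w\<in>W. c w = c' w) \<longrightarrow> z c = z c') \<and> (\<forall>c. z c \<in> W) \<and>
        (\<forall>c. proper_colouring G L p c \<longrightarrow>
           card ((\<lambda>f. z (\<lambda>g. c (g \<otimes>\<^bsub>G\<^esub> f)) \<otimes>\<^bsub>G\<^esub> f) ` F) \<le> D)"
proof -
  have "\<exists>L. finite L \<and> L \<subseteq> carrier G \<and>
     (\<forall>p. \<exists>W z. finite W \<and> W \<subseteq> carrier G \<and>
        (\<forall>c c'. (\<forall>w\<in>W. c w = c' w) \<longrightarrow> z c = z c') \<and> (\<forall>c. z c \<in> W) \<and>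
        (\<forall>c. proper_colouring G L p c \<longrightarrow>
           card ((\<lambda>f. z (\<lambda>g. c (g \<otimes>\<^bsub>G\<^esub> f)) \<otimes>\<^bsub>G\<^esub> f) ` F) \<le> D))"
    using assms(1)[unfolded coarsely_contractible_def, rule_format, OF conjI[OF assms(2,3)]] .
  then show ?thesis
    by (elim exE conjE) (rule that, assumption, assumption, erule spec)
qed

definition (in coloured) contracts :: "'a set \<Rightarrow> nat \<Rightarrow> bool" where
  "contracts F D \<longleftrightarrow> (\<exists>Z W. finite W \<and> W \<subseteq> carrier G \<and> finitary Z \<and> (\<forall>x\<in>X. Z x \<in> W) \<and>
     (\<forall>x\<in>X. card ((\<lambda>f. Z (\<phi> f x) \<otimes> f) ` F) \<le> D))"

text \<open>A point \<open>x\<close> is replaced by its colour pattern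
  \<open>g \<mapsto> \<gamma> (\<phi> g x)\<close>, a proper colouring of the group to which the
  rule applies; passing from \<open>x\<close> to \<open>\<phi> f x\<close> translates the pattern by
  \<open>f\<close> on the right.\<close>

lemma coarsely_contractible_contracts:
  assumes "coarsely_contractible G D" "finite F" "F \<subseteq> carrier G"
  obtains L where "finite L" "L \<subseteq> carrier G"
    "\<And>p X \<phi> \<gamma>. \<lbrakk>coloured G X \<phi>; \<forall>x\<in>X. \<gamma> x < p; \<forall>l\<in>L. l \<noteq> \<one>\<^bsub>G\<^esub> \<longrightarrow> (\<forall>x\<in>X. \<gamma> (\<phi> l x) \<noteq> \<gamma> x)\<rbrakk>
       \<Longrightarrow> coloured.contracts G X \<phi> \<gamma> F D"
proof -
  obtain L where L: "finite L" "L \<subseteq> carrier G"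
    "\<And>p. \<exists>W z. finite W \<and> W \<subseteq> carrier G \<and>
        (\<forall>c c'. (\<forall>w\<in>W. c w = c' w) \<longrightarrow> z c = z c') \<and> (\<forall>c. z c \<in> W) \<and>
        (\<forall>c. proper_colouring G L p c \<longrightarrow>
           card ((\<lambda>f. z (\<lambda>g. c (g \<otimes>\<^bsub>G\<^esub> f)) \<otimes>\<^bsub>G\<^esub> f) ` F) \<le> D)"
    by (rule coarsely_contractibleE[OF assms]) (rule that)
  show ?thesis
  proof (rule that[OF L(1,2)])
    fix p :: nat and X \<phi> and \<gamma> :: "'c \<Rightarrow> nat"
    assume "coloured G X \<phi>" and bnd: "\<forall>x\<in>X. \<gamma> x < p"
      and proper: "\<forall>l\<in>L. l \<noteq> \<one>\<^bsub>G\<^esub> \<longrightarrow> (\<forall>x\<in>X. \<gamma> (\<phi> l x) \<noteq> \<gamma> x)"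
    interpret coloured G X \<phi> \<gamma> by fact
    obtain W z where W: "finite W" "W \<subseteq> carrier G"
      and local: "\<forall>c c'. (\<forall>w\<in>W. c w = c' w) \<longrightarrow> z c = z c'" and zW: "\<forall>c. z c \<in> W"
      and card: "\<forall>c. proper_colouring G L p c \<longrightarrow> card ((\<lambda>f. z (\<lambda>g. c (g \<otimes>\<^bsub>G\<^esub> f)) \<otimes>\<^bsub>G\<^esub> f) ` F) \<le> D"
      using L(3)[of p] by (elim exE conjE) (rule that)
    have z_eq: "z c = z c'" if "\<And>w. w \<in> W \<Longrightarrow> c w = c' w" for c c'
      using local that by simp
    define Z where "Z x = z (\<lambda>g. \<gamma> (\<phi> g x))" for x
    have "finitary Z"
      unfolding Z_def by (rule finitaryI[OF W], rule z_eq) simp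
    moreover have "card ((\<lambda>f. Z (\<phi> f x) \<otimes>\<^bsub>G\<^esub> f) ` F) \<le> D" if x: "x \<in> X" for x
    proof -
      have "proper_colouring G L p (\<lambda>g. \<gamma> (\<phi> g x))"
        unfolding proper_colouring_def
      proof (intro ballI conjI impI)
        fix g assume g: "g \<in> carrier G"
        show "\<gamma> (\<phi> g x) < p" using bnd g x by simp
        fix l assume l: "l \<in> L" "l \<noteq> \<one>\<^bsub>G\<^esub>"
        have "\<gamma> (\<phi> l (\<phi> g x)) \<noteq> \<gamma> (\<phi> g x)" using proper l g x by simp
        then show "\<gamma> (\<phi> (l \<otimes>\<^bsub>G\<^esub> g) x) \<noteq> \<gamma> (\<phi> g x)" using l L(2) g x by (simp add: subset_iff)
      qed
      then have "card ((\<lambda>f. z (\<lambda>g. \<gamma> (\<phi> (g \<otimes>\<^bsub>G\<^esub> f) x)) \<otimes>\<^bsub>G\<^esub> f) ` F) \<le> D"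
        using card by blast
      moreover have "Z (\<phi> f x) = z (\<lambda>g. \<gamma> (\<phi> (g \<otimes>\<^bsub>G\<^esub> f) x))" if "f \<in> F" for f
        unfolding Z_def
      proof (rule z_eq)
        fix w assume "w \<in> W"
        then have "w \<in> carrier G" "f \<in> carrier G" using W(2) assms(3) that by blast+
        then show "\<gamma> (\<phi> w (\<phi> f x)) = \<gamma> (\<phi> (w \<otimes>\<^bsub>G\<^esub> f) x)" using x by simp
      qed
      ultimately show ?thesis by (simp cong: image_cong)
    qed
    ultimately show "contracts F D"
      unfolding contracts_def using W zW by (intro exI[of _ Z] exI[of _ W]) (simp add: Z_def)
  qed
qed

text \<open>The proper colourings of \<open>G\<close> themselves form a coloured space under right
  translation, with the value at the unit as colour, and a contraction of this universal example is
  a rule for all. Hence it suffices to treat spaces of functions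
  \<open>'a \<Rightarrow> nat\<close>.\<close>

lemma (in group) coarsely_contractibleI:
  assumes "\<And>F. \<lbrakk>finite F; F \<subseteq> carrier G\<rbrakk> \<Longrightarrow> \<exists>L. finite L \<and> L \<subseteq> carrier G \<and>
    (\<forall>p (X :: ('a \<Rightarrow> nat) set) \<phi> \<gamma>. coloured G X \<phi> \<longrightarrow> (\<forall>x\<in>X. \<gamma> x < p) \<longrightarrow>
       (\<forall>l\<in>L. l \<noteq> \<one> \<longrightarrow> (\<forall>x\<in>X. \<gamma> (\<phi> l x) \<noteq> \<gamma> x)) \<longrightarrow> coloured.contracts G X \<phi> \<gamma> F D)"
  shows "coarsely_contractible G D"
  unfolding coarsely_contractible_def
proof (intro allI impI, elim conjE)
  fix F assume F: "finite F" "F \<subseteq> carrier G"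
  obtain L where L: "finite L" "L \<subseteq> carrier G"
    and *: "\<forall>p (X :: ('a \<Rightarrow> nat) set) \<phi> \<gamma>. coloured G X \<phi> \<longrightarrow> (\<forall>x\<in>X. \<gamma> x < p) \<longrightarrow>
       (\<forall>l\<in>L. l \<noteq> \<one> \<longrightarrow> (\<forall>x\<in>X. \<gamma> (\<phi> l x) \<noteq> \<gamma> x)) \<longrightarrow> coloured.contracts G X \<phi> \<gamma> F D"
    using assms[OF F] by (elim exE conjE) (rule that)
  have "\<exists>W z. finite W \<and> W \<subseteq> carrier G \<and> (\<forall>c c'. (\<forall>w\<in>W. c w = c' w) \<longrightarrow> z c = z c') \<and> (\<forall>c. z c \<in> W) \<and>
      (\<forall>c. proper_colouring G L p c \<longrightarrow> card ((\<lambda>f. z (\<lambda>g. c (g \<otimes> f)) \<otimes> f) ` F) \<le> D)" for p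
  proof -
    \<comment> \<open>Values off the carrier are fixed to 0; otherwise \<open>\<phi> \<one>\<close>
      would not be the identity on \<open>X\<close>.\<close>
    define X where "X = {c. proper_colouring G L p c \<and> (\<forall>g. g \<notin> carrier G \<longrightarrow> c g = 0)}"
    define \<phi> where "\<phi> g c = (\<lambda>h. if h \<in> carrier G then c (h \<otimes> g) else 0)" for g and c :: "'a \<Rightarrow> nat"
    define \<gamma> where "\<gamma> c = c \<one>" for c :: "'a \<Rightarrow> nat"
    have \<gamma>\<phi>: "\<gamma> (\<phi> g c) = c g" if "g \<in> carrier G" for g c
      using that by (simp add: \<gamma>_def \<phi>_def)
    interpret coloured G X \<phi> \<gamma>
    proof unfold_locales
      fix g c assume g: "g \<in> carrier G" and c: "c \<in> X"
      have "proper_colouring G L p (\<phi> g c)"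
        using c g L(2) unfolding proper_colouring_def \<phi>_def X_def
        by (simp add: subset_iff m_assoc)
      then show "\<phi> g c \<in> X" by (simp add: X_def \<phi>_def)
    next
      fix c assume "c \<in> X"
      then show "\<phi> \<one> c = c" by (auto simp: X_def \<phi>_def)
    next
      fix g h c assume "g \<in> carrier G" "h \<in> carrier G" "c \<in> X"
      then show "\<phi> g (\<phi> h c) = \<phi> (g \<otimes> h) c" by (auto simp: \<phi>_def m_assoc)
    qed
    have "coloured G X \<phi>" ..
    moreover have "\<forall>x\<in>X. \<gamma> x < p" by (simp add: X_def \<gamma>_def proper_colouring_def)
    moreover have "\<forall>l\<in>L. l \<noteq> \<one> \<longrightarrow> (\<forall>x\<in>X. \<gamma> (\<phi> l x) \<noteq> \<gamma> x)"
    proof (intro ballI impI)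
      fix l x assume l: "l \<in> L" "l \<noteq> \<one>" "x \<in> X"
      then have lc: "l \<in> carrier G" using L(2) by blast
      have "x (l \<otimes> \<one>) \<noteq> x \<one>" using l unfolding X_def proper_colouring_def by blast
      then show "\<gamma> (\<phi> l x) \<noteq> \<gamma> x" using lc unfolding \<gamma>\<phi>[OF lc] by (simp add: \<gamma>_def)
    qed
    ultimately have "contracts F D" using * by simp
    then obtain Z W1 where Z: "finite W1" "W1 \<subseteq> carrier G" "finitary Z" "\<forall>x\<in>X. Z x \<in> W1"
      "\<forall>x\<in>X. card ((\<lambda>f. Z (\<phi> f x) \<otimes> f) ` F) \<le> D"
      unfolding contracts_def by (elim exE conjE) (rule that)
    obtain W2 where W2: "finite W2" "W2 \<subseteq> carrier G"
      "\<And>x y. \<lbrakk>x \<in> X; y \<in> X; \<forall>w\<in>W2. \<gamma> (\<phi> w x) = \<gamma> (\<phi> w y)\<rbrakk> \<Longrightarrow> Z x = Z y"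
      by (rule finitaryE[OF Z(3)]) (rule that)
    define W where "W = insert \<one> (W1 \<union> W2)"
    define ext where "ext c c' \<longleftrightarrow> c' \<in> X \<and> (\<forall>w\<in>W. c w = c' w)" for c c'
    \<comment> \<open>The rule completes the colours seen in \<open>W\<close> to some member of
      \<open>X\<close> and applies \<open>Z\<close>; by \<open>z_Z\<close> the choice of the
      completion does not affect the value. The default \<open>\<one>\<close> is for patterns that
      no member of \<open>X\<close> extends.\<close>
    define z where "z c = (if \<exists>c'. ext c c' then Z (SOME c'. ext c c') else \<one>)" for c
    have W: "finite W" "W \<subseteq> carrier G" using Z(1,2) W2(1,2) by (simp_all add: W_def)
    have z_local: "z c = z c'" if "\<forall>w\<in>W. c w = c' w" for c c'
    proof -
      have "ext c d = ext c' d" for d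
        unfolding ext_def by (intro conj_cong ball_cong refl) (simp only: bspec[OF that])
      then have "ext c = ext c'" by (rule HOL.ext)
      then show ?thesis by (simp only: z_def)
    qed
    have z_Z: "z c = Z c'" if "ext c c'" for c c'
    proof -
      define s where "s = (SOME c'. ext c c')"
      have "ext c s" unfolding s_def by (rule someI[of "ext c", OF that])
      then have s: "s \<in> X" "\<And>w. w \<in> W \<Longrightarrow> c w = s w" by (simp_all only: ext_def)
      have c': "c' \<in> X" "\<And>w. w \<in> W \<Longrightarrow> c w = c' w" using that by (simp_all only: ext_def)
      have "\<forall>w\<in>W2. \<gamma> (\<phi> w s) = \<gamma> (\<phi> w c')"
      proof
        fix w assume w: "w \<in> W2"
        then have wc: "w \<in> carrier G" and wW: "w \<in> W" using W2(2) by (auto simp: W_def)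
        show "\<gamma> (\<phi> w s) = \<gamma> (\<phi> w c')"
          unfolding \<gamma>\<phi>[OF wc] s(2)[OF wW, symmetric] by (rule c'(2)[OF wW])
      qed
      then have "Z s = Z c'" by (rule W2(3)[OF s(1) c'(1)])
      moreover have "\<exists>c'. ext c c'" using that by (rule exI[of "ext c"])
      ultimately show ?thesis unfolding z_def s_def by simp
    qed
    have zW: "z c \<in> W" for c
    proof (cases "\<exists>c'. ext c c'")
      case True
      then obtain c' where c': "ext c c'" ..
      then show ?thesis using z_Z[OF c'] Z(4) by (simp add: ext_def W_def)
    next
      case False
      then show ?thesis by (simp add: z_def W_def)
    qed
    have "card ((\<lambda>f. z (\<lambda>g. c (g \<otimes> f)) \<otimes> f) ` F) \<le> D" if c: "proper_colouring G L p c" for c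
    proof -
      define c0 where "c0 g = (if g \<in> carrier G then c g else 0)" for g
      have "proper_colouring G L p c0"
        using c L(2) by (simp add: proper_colouring_def c0_def subset_iff)
      then have c0: "c0 \<in> X" by (simp add: X_def c0_def)
      have "z (\<lambda>g. c (g \<otimes> f)) = Z (\<phi> f c0)" if f: "f \<in> F" for f
      proof (rule z_Z)
        have fc: "f \<in> carrier G" using f F by blast
        have "c (w \<otimes> f) = \<phi> f c0 w" if "w \<in> W" for w
          using that W(2) fc by (simp add: \<phi>_def c0_def subset_iff)
        then show "ext (\<lambda>g. c (g \<otimes> f)) (\<phi> f c0)"
          using fc c0 by (simp add: ext_def)
      qed
      then have "(\<lambda>f. z (\<lambda>g. c (g \<otimes> f)) \<otimes> f) ` F = (\<lambda>f. Z (\<phi> f c0) \<otimes> f) ` F"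
        by (simp cong: image_cong)
      then show ?thesis using Z(5) c0 by simp
    qed
    then show ?thesis
      using W z_local zW by (intro exI[of _ W] exI[of _ z]) simp
  qed
  then show "\<exists>L. finite L \<and> L \<subseteq> carrier G \<and> (\<forall>p. \<exists>W z. finite W \<and> W \<subseteq> carrier G \<and>
      (\<forall>c c'. (\<forall>w\<in>W. c w = c' w) \<longrightarrow> z c = z c') \<and> (\<forall>c. z c \<in> W) \<and>
      (\<forall>c. proper_colouring G L p c \<longrightarrow> card ((\<lambda>f. z (\<lambda>g. c (g \<otimes> f)) \<otimes> f) ` F) \<le> D))"
    using L by (intro exI[of _ L]) simp
qed

section \<open>Extensions by uniformly boxed kernels\<close>

definition box_sequence :: "'a set \<Rightarrow> ('a, 'm) monoid_scheme \<Rightarrow> 'a set \<Rightarrow> (nat \<Rightarrow> 'a set) \<Rightarrow> bool" where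
  "box_sequence N G M B \<longleftrightarrow> (\<forall>i. finite (B i) \<and> B i \<subseteq> N \<and> \<one>\<^bsub>G\<^esub> \<in> B i \<and>
     (\<forall>b\<in>B i. inv\<^bsub>G\<^esub> b \<in> B i) \<and> B i \<subseteq> B (Suc i) \<and> (\<forall>b\<in>B i. \<forall>n\<in>M. b \<otimes>\<^bsub>G\<^esub> n \<in> B (Suc i)))"

text \<open>Differences between tile centres over cosets that differ by \<open>l\<close> have the
  form \<open>b \<otimes> l \<otimes> b'\<close>. Radius \<open>3 * m\<close> leaves room for the
  window of radius \<open>2 * m\<close> and a few correction steps on either side, while the centres
  are separated at radius \<open>m\<close>.\<close>

definition packing_bound :: "('a, 'm) monoid_scheme \<Rightarrow> (nat \<Rightarrow> 'a set) \<Rightarrow> nat \<Rightarrow> 'a \<Rightarrow> nat \<Rightarrow> bool" where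
  "packing_bound G B m l k \<longleftrightarrow> (\<forall>Z. Z \<subseteq> (\<lambda>(b, b'). b \<otimes>\<^bsub>G\<^esub> l \<otimes>\<^bsub>G\<^esub> b') ` (B (3 * m) \<times> B (3 * m)) \<and>
     (\<forall>z\<in>Z. \<forall>z'\<in>Z. z \<noteq> z' \<longrightarrow> z' \<otimes>\<^bsub>G\<^esub> inv\<^bsub>G\<^esub> z \<notin> B m) \<longrightarrow> card Z \<le> k)"

text \<open>Boxes in \<open>N\<close> of polynomial size whose conjugates pack with a constant \<open>K l\<close> that depends only
  on the conjugating element \<open>l\<close>, not on the scale \<open>M\<close>.\<close>

definition uniformly_boxed :: "'a set \<Rightarrow> ('a, 'm) monoid_scheme \<Rightarrow> bool" where
  "uniformly_boxed N G \<longleftrightarrow> (\<exists>d K. \<forall>M W. finite M \<and> M \<subseteq> N \<and> finite W \<and> W \<subseteq> carrier G \<longrightarrow>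
     (\<exists>B C. box_sequence N G M B \<and> (\<forall>i. card (B i) \<le> C * Suc i ^ d) \<and>
        (\<forall>m0. \<exists>m\<ge>m0. \<forall>l\<in>W. packing_bound G B m l (K l))))"

lemma packing_bound_sum:
  assumes "finite V" "\<forall>l\<in>V. packing_bound G B m l (K l)" "finite (B (3 * m))"
    and Z: "Z \<subseteq> (\<Union>l\<in>V. (\<lambda>(b, b'). b \<otimes>\<^bsub>G\<^esub> l \<otimes>\<^bsub>G\<^esub> b') ` (B (3 * m) \<times> B (3 * m)))"
    and sep: "\<forall>z\<in>Z. \<forall>z'\<in>Z. z \<noteq> z' \<longrightarrow> z' \<otimes>\<^bsub>G\<^esub> inv\<^bsub>G\<^esub> z \<notin> B m"
  shows "card Z \<le> (\<Sum>l\<in>V. K l)"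
proof -
  define S where "S l = (\<lambda>(b, b'). b \<otimes>\<^bsub>G\<^esub> l \<otimes>\<^bsub>G\<^esub> b') ` (B (3 * m) \<times> B (3 * m))" for l
  have "Z = (\<Union>l\<in>V. Z \<inter> S l)" using Z unfolding S_def by blast
  then have "card Z \<le> (\<Sum>l\<in>V. card (Z \<inter> S l))"
    using card_UN_le[OF assms(1), of "\<lambda>l. Z \<inter> S l"] by simp
  also have "\<dots> \<le> (\<Sum>l\<in>V. K l)"
  proof (rule sum_mono)
    fix l assume "l \<in> V"
    then have "packing_bound G B m l (K l)" using assms(2) by blast
    then have "Z \<inter> S l \<subseteq> S l \<and> (\<forall>z\<in>Z \<inter> S l. \<forall>z'\<in>Z \<inter> S l. z \<noteq> z' \<longrightarrow> z' \<otimes>\<^bsub>G\<^esub> inv\<^bsub>G\<^esub> z \<notin> B m)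
        \<longrightarrow> card (Z \<inter> S l) \<le> K l"
      unfolding packing_bound_def S_def[symmetric] by (rule spec)
    then show "card (Z \<inter> S l) \<le> K l"
      using sep by simp
  qed
  finally show ?thesis .
qed

text \<open>The order of choices is: \<open>L\<close> for the quotient; its lifts \<open>V1\<close>
  with the packing constant \<open>k1\<close>; the rule \<open>z\<close> with window
  \<open>WQ\<close> for \<open>Suc k1 + p0\<close> colours; representatives \<open>W\<close> and
  moves \<open>M\<close> that cover this window; boxes for \<open>M\<close>; and last the scale
  \<open>m\<close>. The bound \<open>2 ^ d * D\<close> comes from sorting the elements
  \<open>f\<close> of \<open>F\<close> by the pattern of tile centres around
  \<open>\<phi> f x\<close>: the walls allow at most \<open>2 ^ d\<close> patterns, and for each of
  them the rule of the quotient leaves at most \<open>D\<close> images.\<close>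

theorem coarsely_contractible_extension:
  fixes G :: "('a, 'm) monoid_scheme" (structure) and Q :: "('b, 'n) monoid_scheme"
  assumes "group G" "group Q" and \<pi>: "\<pi> \<in> hom G Q" "\<pi> ` carrier G = carrier Q"
    and "countable (carrier Q)" and good: "coarsely_contractible Q D"
    and boxed: "uniformly_boxed (kernel G Q \<pi>) G"
  shows "\<exists>D'. coarsely_contractible G D'"
proof -
  interpret G: group G by fact
  interpret Q: group Q by fact
  interpret \<pi>: group_hom G Q \<pi> by unfold_locales (rule \<pi>(1))
  define N where "N = kernel G Q \<pi>"
  have N_sub: "subgroup N G" unfolding N_def by (rule \<pi>.subgroup_kernel)
  have N_I: "g \<in> N" if "g \<in> carrier G" "\<pi> g = \<one>\<^bsub>Q\<^esub>" for g
    using that by (simp add: N_def kernel_def)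
  have N_D: "g \<in> carrier G" "\<pi> g = \<one>\<^bsub>Q\<^esub>" if "g \<in> N" for g
    using that by (simp_all add: N_def kernel_def)
  obtain d K where boxes: "\<forall>M W. finite M \<and> M \<subseteq> N \<and> finite W \<and> W \<subseteq> carrier G \<longrightarrow>
     (\<exists>B C. box_sequence N G M B \<and> (\<forall>i. card (B i) \<le> C * Suc i ^ d) \<and>
        (\<forall>m0. \<exists>m\<ge>m0. \<forall>l\<in>W. packing_bound G B m l (K l)))"
    using boxed unfolding uniformly_boxed_def N_def[symmetric] by (elim exE) (rule that)
  \<comment> \<open>A set-theoretic section of \<open>\<pi>\<close>, normalised at the unit so that
    \<open>\<one>\<close> becomes one of the representatives in \<open>W\<close>.\<close>
  define \<sigma> where "\<sigma> q = (if q = \<one>\<^bsub>Q\<^esub> then \<one> else SOME g. g \<in> carrier G \<and> \<pi> g = q)" for q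
  have \<sigma>: "\<sigma> q \<in> carrier G" "\<pi> (\<sigma> q) = q" if "q \<in> carrier Q" for q
  proof -
    have "q \<in> \<pi> ` carrier G" using that \<pi>(2) by simp
    then have "\<exists>g. g \<in> carrier G \<and> \<pi> g = q" by blast
    then have "(SOME g. g \<in> carrier G \<and> \<pi> g = q) \<in> carrier G \<and> \<pi> (SOME g. g \<in> carrier G \<and> \<pi> g = q) = q"
      by (rule someI_ex)
    then show "\<sigma> q \<in> carrier G" "\<pi> (\<sigma> q) = q" by (simp_all add: \<sigma>_def)
  qed
  have "coarsely_contractible G (2 ^ d * D)"
  proof (rule G.coarsely_contractibleI)
    fix F assume F: "finite F" "F \<subseteq> carrier G"
    have piF: "finite (\<pi> ` F)" "\<pi> ` F \<subseteq> carrier Q" using F by auto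
    obtain L where L: "finite L" "L \<subseteq> carrier Q"
      and rule: "\<And>p. \<exists>W z. finite W \<and> W \<subseteq> carrier Q \<and>
        (\<forall>c c'. (\<forall>w\<in>W. c w = c' w) \<longrightarrow> z c = z c') \<and> (\<forall>c. z c \<in> W) \<and>
        (\<forall>c. proper_colouring Q L p c \<longrightarrow>
           card ((\<lambda>f. z (\<lambda>g. c (g \<otimes>\<^bsub>Q\<^esub> f)) \<otimes>\<^bsub>Q\<^esub> f) ` \<pi> ` F) \<le> D)"
      by (rule coarsely_contractibleE[OF good piF]) (rule that)
    \<comment> \<open>Only finitely many elements of \<open>Q\<close> will be coloured by tile
      centres, whereas the bound for a rule is about proper colourings of all of \<open>Q\<close>;
      \<open>c0\<close> fills the rest.\<close>
    obtain p0 c0 where c0: "proper_colouring Q L p0 c0"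
      using Q.proper_colouring_exists[OF assms(5) L] by (elim exE)
    define V1 where "V1 = \<sigma> ` (L - {\<one>\<^bsub>Q\<^esub>}) \<union> (\<lambda>l. inv \<sigma> l) ` (L - {\<one>\<^bsub>Q\<^esub>})"
    have V1: "finite V1" "V1 \<subseteq> carrier G" "\<And>v. v \<in> V1 \<Longrightarrow> inv v \<in> V1"
      using L \<sigma> by (auto simp: V1_def subset_iff)
    define k1 where "k1 = (\<Sum>l\<in>V1. K l)"
    \<comment> \<open>Colours up to \<open>k1\<close> are for tile centres, the \<open>p0\<close>
      colours above them for the filler \<open>c0\<close>.\<close>
    obtain WQ z where WQ: "finite WQ" "WQ \<subseteq> carrier Q"
      and z_local: "\<forall>c c'. (\<forall>w\<in>WQ. c w = c' w) \<longrightarrow> z c = z c'" and z_W: "\<forall>c. z c \<in> WQ"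
      and z_card: "\<forall>c. proper_colouring Q L (Suc k1 + p0) c \<longrightarrow>
           card ((\<lambda>f. z (\<lambda>g. c (g \<otimes>\<^bsub>Q\<^esub> f)) \<otimes>\<^bsub>Q\<^esub> f) ` \<pi> ` F) \<le> D"
      using rule[of "Suc k1 + p0"] by (elim exE conjE) (rule that)
    define W' where "W' = insert \<one>\<^bsub>Q\<^esub> ((\<lambda>(q, f). q \<otimes>\<^bsub>Q\<^esub> \<pi> f) ` (WQ \<times> F))"
    have W': "finite W'" "W' \<subseteq> carrier Q"
      using WQ F by (auto simp: W'_def subset_iff)
    define W where "W = \<sigma> ` W'"
    have W: "finite W" "W \<subseteq> carrier G" "\<one> \<in> W"
    proof -
      show "finite W" "W \<subseteq> carrier G" using W' \<sigma>(1) unfolding W_def by auto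
      have "\<one>\<^bsub>Q\<^esub> \<in> W'" "\<sigma> \<one>\<^bsub>Q\<^esub> = \<one>" by (simp_all add: W'_def \<sigma>_def)
      then show "\<one> \<in> W" unfolding W_def by force
    qed
    \<comment> \<open>The section is not a homomorphism; \<open>n1\<close> and \<open>n2\<close>
      measure its defects, which lie in the kernel. They are put among the moves \<open>M\<close>,
      so that correcting one of them costs a single step in the sequence of boxes.\<close>
    define n1 where "n1 f q = \<sigma> (q \<otimes>\<^bsub>Q\<^esub> inv\<^bsub>Q\<^esub> \<pi> f) \<otimes> f \<otimes> inv \<sigma> q" for f q
    define n2 where "n2 l q = \<sigma> (l \<otimes>\<^bsub>Q\<^esub> q) \<otimes> inv \<sigma> q \<otimes> inv \<sigma> l" for l q
    have n1: "n1 f q \<in> N" "\<sigma> (q \<otimes>\<^bsub>Q\<^esub> inv\<^bsub>Q\<^esub> \<pi> f) \<otimes> f = n1 f q \<otimes> \<sigma> q"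
      if "f \<in> carrier G" "q \<in> carrier Q" for f q
    proof -
      show "n1 f q \<in> N"
        using that \<sigma> by (intro N_I) (simp_all add: n1_def Q.m_assoc)
      show "\<sigma> (q \<otimes>\<^bsub>Q\<^esub> inv\<^bsub>Q\<^esub> \<pi> f) \<otimes> f = n1 f q \<otimes> \<sigma> q"
        using that \<sigma> by (simp add: n1_def G.m_assoc)
    qed
    have n2: "n2 l q \<in> N" "\<sigma> (l \<otimes>\<^bsub>Q\<^esub> q) \<otimes> inv \<sigma> q = n2 l q \<otimes> \<sigma> l"
      if "l \<in> carrier Q" "q \<in> carrier Q" for l q
    proof -
      show "n2 l q \<in> N"
        using that \<sigma> by (intro N_I) (simp_all add: n2_def Q.m_assoc)
      show "\<sigma> (l \<otimes>\<^bsub>Q\<^esub> q) \<otimes> inv \<sigma> q = n2 l q \<otimes> \<sigma> l"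
        using that \<sigma> by (simp add: n2_def G.m_assoc)
    qed
    define M0 where "M0 = (\<lambda>(f, q). n1 f q) ` (F \<times> W') \<union> (\<lambda>(l, q). n2 l q) ` (L \<times> W')"
    define M where "M = M0 \<union> (\<lambda>n. inv n) ` M0"
    have M0: "finite M0" "M0 \<subseteq> N"
      using F L W' n1(1) n2(1) by (auto simp: M0_def subset_iff)
    have M: "finite M" "M \<subseteq> N" "\<And>n. n \<in> M \<Longrightarrow> inv n \<in> M"
      using M0 N_D(1) subgroup.m_inv_closed[OF N_sub] by (auto simp: M_def subset_iff)
    have n1_M: "n1 f q \<in> M" if "f \<in> F" "q \<in> W'" for f q
      using that by (auto simp: M_def M0_def)
    have n2_M: "n2 l q \<in> M" if "l \<in> L" "q \<in> W'" for l q
      using that by (auto simp: M_def M0_def)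
    define V2 where "V2 = (\<lambda>(w', w). w' \<otimes> inv w) ` (W \<times> W)"
    have V2: "finite V2" "V2 \<subseteq> carrier G" using W by (auto simp: V2_def subset_iff)
    define k2 where "k2 = (\<Sum>l\<in>V2. K l)"
    have MV: "finite M \<and> M \<subseteq> N \<and> finite (V1 \<union> V2) \<and> V1 \<union> V2 \<subseteq> carrier G"
      using M(1,2) V1(1,2) V2 by simp
    from mp[OF spec[OF spec[OF boxes, of M], of "V1 \<union> V2"] MV] obtain B C where B: "box_sequence N G M B" and B_card: "\<forall>i. card (B i) \<le> C * Suc i ^ d"
      and B_pack: "\<forall>m0. \<exists>m\<ge>m0. \<forall>l\<in>V1 \<union> V2. packing_bound G B m l (K l)"
      by (elim exE conjE) (rule that)
    have B_fin: "finite (B i)" and B_N: "B i \<subseteq> N" and B_one: "\<one> \<in> B i" for i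
      using B unfolding box_sequence_def by blast+
    have B_inv: "inv b \<in> B i" if "b \<in> B i" for b i
      using B that unfolding box_sequence_def by blast
    have B_M: "b \<otimes> n \<in> B (Suc i)" if "b \<in> B i" "n \<in> M" for b n i
      using B that unfolding box_sequence_def by blast
    have B_Suc: "B i \<subseteq> B (Suc i)" for i
      using B unfolding box_sequence_def by blast
    have B_mono: "B i \<subseteq> B j" if "i \<le> j" for i j
      using B_Suc that by (rule lift_Suc_mono_le)
    have Bc: "b \<in> carrier G" if "b \<in> B i" for b i using B_N N_D(1) that by blast
    have Mc: "n \<in> carrier G" if "n \<in> M" for n using M(2) N_D(1) that by blast
    \<comment> \<open>Chosen so that \<open>2 * card P * (1 + 2 * k2) ^ k2 \<le> A * J ^ d\<close>.
      The 11 comes from \<open>2 * m + 1 \<le> 11 * J\<close>, valid for \<open>J = m div 3\<close>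
      once \<open>J\<close> is positive, and the lower bound on \<open>m\<close> gives
      \<open>A < J\<close>.\<close>
    define A where "A = 2 * (C * card W) * 11 ^ d * (1 + 2 * k2) ^ k2"
    obtain m where m: "m \<ge> 3 * Suc A + 3" "\<forall>l\<in>V1 \<union> V2. packing_bound G B m l (K l)"
      using B_pack by blast
    define J where "J = m div 3"
    obtain r where "m = 3 * J + r" "r < 3"
      by (rule that[of "m mod 3"]) (simp_all add: J_def)
    then have J: "A < J" "3 * J \<le> m" "2 * m + 1 \<le> 11 * J" using m(1) by simp_all
    define P where "P = (\<lambda>(b, w). b \<otimes> w) ` (B (2 * m) \<times> W)"
    have P_fin: "finite P" using B_fin W by (simp add: P_def)
    have card_P: "2 * card P * (1 + 2 * k2) ^ k2 < J ^ Suc d"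
    proof -
      have "card P \<le> card (B (2 * m) \<times> W)"
        unfolding P_def using B_fin W by (intro card_image_le) simp
      also have "\<dots> \<le> C * Suc (2 * m) ^ d * card W"
        using B_card by (simp add: card_cartesian_product)
      also have "\<dots> \<le> C * (11 * J) ^ d * card W"
        using J(3) by (intro mult_le_mono1 mult_le_mono2 power_mono) auto
      finally have "2 * card P * (1 + 2 * k2) ^ k2 \<le> 2 * (C * (11 * J) ^ d * card W) * (1 + 2 * k2) ^ k2"
        by (intro mult_le_mono1 mult_le_mono2)
      also have "\<dots> = A * J ^ d" by (simp add: A_def power_mult_distrib mult_ac)
      also have "\<dots> < J * J ^ d" using J(1) by (intro mult_strict_right_mono) auto
      finally show ?thesis by simp
    qed
    define T where "T = (\<lambda>(g', g). g' \<otimes> inv g) ` (P \<times> P)"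
    \<comment> \<open>Contains the differences between centres over \<open>L\<close>-neighbours in
      the quotient. Centres will be coloured properly along \<open>T1\<close>, so that their colours
      are proper along \<open>L\<close> in \<open>Q\<close>.\<close>
    define T1 where "T1 = (\<Union>l\<in>V1. (\<lambda>(b, b'). b \<otimes> l \<otimes> b') ` (B (3 * m) \<times> B (3 * m)))"
    have T_sub: "T \<subseteq> (\<Union>l\<in>V2. (\<lambda>(b, b'). b \<otimes> l \<otimes> b') ` (B (3 * m) \<times> B (3 * m)))"
    proof
      fix t assume "t \<in> T"
      then obtain b w b' w' where t: "b \<in> B (2 * m)" "w \<in> W" "b' \<in> B (2 * m)" "w' \<in> W"
        "t = (b' \<otimes> w') \<otimes> inv (b \<otimes> w)" by (auto simp: T_def P_def)
      have "B (2 * m) \<subseteq> B (3 * m)" by (rule B_mono) simp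
      then have "b' \<in> B (3 * m)" "inv b \<in> B (3 * m)" using t B_inv by blast+
      moreover have "t = b' \<otimes> (w' \<otimes> inv w) \<otimes> inv b"
        using t(1-4) Bc W(2) unfolding t(5) by (simp add: G.m_assoc G.inv_mult_group subset_iff)
      moreover have "w' \<otimes> inv w \<in> V2" using t by (auto simp: V2_def)
      ultimately show "t \<in> (\<Union>l\<in>V2. (\<lambda>(b, b'). b \<otimes> l \<otimes> b') ` (B (3 * m) \<times> B (3 * m)))"
        by (intro UN_I[of "w' \<otimes> inv w"] image_eqI[of _ _ "(b', inv b)"]) auto
    qed
    have T_fin: "finite T" and T1_fin: "finite T1"
      using P_fin B_fin V1(1) by (simp_all add: T_def T1_def)
    have T_c: "T \<subseteq> carrier G" and T1_c: "T1 \<subseteq> carrier G"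
      using Bc W(2) V1(2) by (auto simp: T_def P_def T1_def subset_iff)
    have T1_inv: "inv t \<in> T1" if "t \<in> T1" for t
    proof -
      from that obtain l b b' where t: "l \<in> V1" "b \<in> B (3 * m)" "b' \<in> B (3 * m)" "t = b \<otimes> l \<otimes> b'"
        unfolding T1_def by (elim UN_E imageE SigmaE) simp
      then have "inv t = inv b' \<otimes> inv l \<otimes> inv b"
        using Bc V1(2) by (simp add: G.m_assoc G.inv_mult_group subset_iff)
      then show ?thesis
        unfolding T1_def using t V1(3) B_inv
        by (intro UN_I[of "inv l"] image_eqI[of _ _ "(inv b', inv b)"]) auto
    qed
    have T1_I: "b \<otimes> \<sigma> l \<otimes> b' \<in> T1" if "l \<in> L" "l \<noteq> \<one>\<^bsub>Q\<^esub>" "b \<in> B (3 * m)" "b' \<in> B (3 * m)" for l b b'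
      unfolding T1_def using that by (intro UN_I[of "\<sigma> l"] image_eqI[of _ _ "(b, b')"]) (auto simp: V1_def)
    show "\<exists>L. finite L \<and> L \<subseteq> carrier G \<and>
      (\<forall>p (X :: ('a \<Rightarrow> nat) set) \<phi> \<gamma>. coloured G X \<phi> \<longrightarrow> (\<forall>x\<in>X. \<gamma> x < p) \<longrightarrow>
       (\<forall>l\<in>L. l \<noteq> \<one> \<longrightarrow> (\<forall>x\<in>X. \<gamma> (\<phi> l x) \<noteq> \<gamma> x)) \<longrightarrow> coloured.contracts G X \<phi> \<gamma> F (2 ^ d * D))"
    proof (intro exI[of _ "T \<union> T1"] conjI allI impI)
      show "finite (T \<union> T1)" "T \<union> T1 \<subseteq> carrier G" using T_fin T1_fin T_c T1_c by auto
      fix p and X :: "('a \<Rightarrow> nat) set" and \<phi> and \<gamma> :: "('a \<Rightarrow> nat) \<Rightarrow> nat"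
      assume cX: "coloured G X \<phi>" and bnd: "\<forall>x\<in>X. \<gamma> x < p"
        and proper: "\<forall>l\<in>T \<union> T1. l \<noteq> \<one> \<longrightarrow> (\<forall>x\<in>X. \<gamma> (\<phi> l x) \<noteq> \<gamma> x)"
      interpret coloured G X \<phi> \<gamma> by (rule cX)
      have J0: "0 < J" using J(1) by simp
      have "box_tiling_axioms G X \<phi> \<gamma> N B W M P m k2 d J p"
      proof (rule box_tiling_axioms.intro)
        show "w = w'" if "w \<in> W" "w' \<in> W" "w' \<otimes> inv w \<in> N" for w w'
        proof -
          obtain q q' where q: "q \<in> W'" "w = \<sigma> q" "q' \<in> W'" "w' = \<sigma> q'"
            using \<open>w \<in> W\<close> \<open>w' \<in> W\<close> by (auto simp: W_def)
          then have qc: "q \<in> carrier Q" "q' \<in> carrier Q" using W'(2) by blast+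
          have "q' \<otimes>\<^bsub>Q\<^esub> inv\<^bsub>Q\<^esub> q = \<one>\<^bsub>Q\<^esub>" using N_D(2)[OF that(3)] q \<sigma> qc by simp
          then show "w = w'" using Q.neq_inv_mult[OF qc] q by auto
        qed
        show "card Z \<le> k2" if "Z \<subseteq> (\<lambda>(g', g). g' \<otimes> inv g) ` (P \<times> P)"
          "\<forall>z\<in>Z. \<forall>z'\<in>Z. z \<noteq> z' \<longrightarrow> z' \<otimes> inv z \<notin> B m" for Z
          unfolding k2_def
        proof (rule packing_bound_sum[where B = B and m = m, OF V2(1) _ B_fin _ that(2)])
          show "\<forall>l\<in>V2. packing_bound G B m l (K l)" using m(2) by blast
          show "Z \<subseteq> (\<Union>l\<in>V2. (\<lambda>(b, b'). b \<otimes> l \<otimes> b') ` (B (3 * m) \<times> B (3 * m)))"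
            using that(1) T_sub unfolding T_def by (rule subset_trans)
        qed
        show "\<gamma> (\<phi> t x) \<noteq> \<gamma> x" if "t \<in> (\<lambda>(g', g). g' \<otimes> inv g) ` (P \<times> P)" "t \<noteq> \<one>" "x \<in> X" for t x
          using proper that unfolding T_def by simp
      qed (fact N_sub B_fin B_N B_one B_inv B_mono B_M M W P_def card_P bnd J(2) J0)+
      then interpret box: box_tiling G X \<phi> \<gamma> N B W M P m k2 d J p
        by (rule box_tiling.intro[OF cX])
      obtain Y \<tau> where Y: "finitary Y" and \<tau>: "finitary \<tau>"
        and sep: "\<forall>x\<in>X. Y x \<longrightarrow> (\<forall>t\<in>B m. t \<noteq> \<one> \<longrightarrow> \<not> Y (\<phi> t x))"
        and \<tau>_Y: "\<forall>x\<in>X. \<tau> x \<in> B (2 * m) \<and> Y (\<phi> (\<tau> x) x)"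
        and prod_le: "\<forall>x\<in>X. (\<Prod>w\<in>W. card ((\<lambda>n. \<tau> (\<phi> (n \<otimes> w) x) \<otimes> (n \<otimes> w)) ` M)) \<le> 2 ^ d"
        using box.tiles by (elim exE conjE) (rule that)
      have deg: "\<forall>x\<in>X. Y x \<longrightarrow> card {t \<in> T1. Y (\<phi> t x)} \<le> k1"
        unfolding k1_def
      proof (intro ballI impI, rule packing_bound_sum[OF V1(1) _ B_fin])
        fix x assume x: "x \<in> X" "Y x"
        show "\<forall>l\<in>V1. packing_bound G B m l (K l)" using m(2) by blast
        show "{t \<in> T1. Y (\<phi> t x)} \<subseteq> (\<Union>l\<in>V1. (\<lambda>(b, b'). b \<otimes> l \<otimes> b') ` (B (3 * m) \<times> B (3 * m)))"
          unfolding T1_def by (rule Collect_restrict)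
        show "\<forall>z\<in>{t \<in> T1. Y (\<phi> t x)}. \<forall>z'\<in>{t \<in> T1. Y (\<phi> t x)}. z \<noteq> z' \<longrightarrow> z' \<otimes> inv z \<notin> B m"
        proof (intro ballI impI)
          fix z z' assume "z \<in> {t \<in> T1. Y (\<phi> t x)}" "z' \<in> {t \<in> T1. Y (\<phi> t x)}" "z \<noteq> z'"
          then show "z' \<otimes> inv z \<notin> B m"
            using T1_c by (intro separated_translates[OF sep x(1)]) (simp_all add: subset_iff)
        qed
      qed
      have T1': "\<forall>t\<in>T1. inv t \<in> T1" "\<forall>t\<in>T1. t \<noteq> \<one> \<longrightarrow> (\<forall>x\<in>X. \<gamma> (\<phi> t x) \<noteq> \<gamma> x)"
        using T1_inv proper by simp_all
      obtain \<kappa> where \<kappa>: "finitary \<kappa>" "\<forall>x\<in>X. \<kappa> x \<le> k1"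
        and \<kappa>_proper: "\<forall>x\<in>X. Y x \<longrightarrow> (\<forall>t\<in>T1. t \<noteq> \<one> \<longrightarrow> Y (\<phi> t x) \<longrightarrow> \<kappa> (\<phi> t x) \<noteq> \<kappa> x)"
        using finitary_recolouring[OF bnd T1_fin T1_c T1' Y deg] by (elim exE conjE) (rule that)
      have \<tau>c: "\<tau> x \<in> carrier G" if "x \<in> X" for x using \<tau>_Y Bc that by blast
      \<comment> \<open>\<open>tile x q\<close> carries \<open>x\<close> to the centre of the tile
        containing \<open>\<phi> (\<sigma> q) x\<close>, and \<open>col x\<close> is the resulting
        colouring of the quotient. The rule picks the coset \<open>z (col x)\<close>, and
        \<open>Z\<close> moves \<open>x\<close> to the centre of the tile found there.\<close>
      define tile where "tile x q = \<tau> (\<phi> (\<sigma> q) x) \<otimes> \<sigma> q" for x q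
      define col where "col x q = \<kappa> (\<phi> (tile x q) x)" for x q
      define Z where "Z x = tile x (z (col x))" for x
      have z_eq: "z c = z c'" if "\<And>w. w \<in> WQ \<Longrightarrow> c w = c' w" for c c'
        using z_local that by simp
      have WQc: "q \<in> carrier Q" if "q \<in> WQ" for q using that WQ(2) by blast
      have Fc: "f \<in> carrier G" "\<pi> f \<in> carrier Q" if "f \<in> F" for f using that F(2) by auto
      have f1: "finitary (\<lambda>x. (\<tau> x, \<kappa> (\<phi> (\<tau> x) x)))"
      proof (rule finitary_shift[OF finitary_Pair[OF \<tau> \<kappa>(1)], of "insert \<one> (B (2 * m))"])
        show "finite (insert \<one> (B (2 * m)))" using B_fin by simp
        show "insert \<one> (B (2 * m)) \<subseteq> carrier G" using Bc by auto
        fix x y assume xy: "x \<in> X" "y \<in> X"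
          and *: "\<forall>t\<in>insert \<one> (B (2 * m)). (\<tau> (\<phi> t x), \<kappa> (\<phi> t x)) = (\<tau> (\<phi> t y), \<kappa> (\<phi> t y))"
        have \<tau>_eq: "\<tau> x = \<tau> y" using bspec[OF *, of \<one>] xy by simp
        have "\<tau> y \<in> B (2 * m)" using \<tau>_Y xy by simp
        then have "\<kappa> (\<phi> (\<tau> y) x) = \<kappa> (\<phi> (\<tau> y) y)" using bspec[OF *, of "\<tau> y"] by simp
        then show "(\<tau> x, \<kappa> (\<phi> (\<tau> x) x)) = (\<tau> y, \<kappa> (\<phi> (\<tau> y) y))" by (simp only: \<tau>_eq)
      qed
      have col_eq: "col x q = \<kappa> (\<phi> (\<tau> (\<phi> (\<sigma> q) x)) (\<phi> (\<sigma> q) x))" if "x \<in> X" "q \<in> carrier Q" for x q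
        using that \<sigma>(1) \<tau>c by (simp add: col_def tile_def)
      have Z_fin: "finitary Z"
      proof (rule finitary_shift[OF f1, of "\<sigma> ` WQ"])
        show "finite (\<sigma> ` WQ)" "\<sigma> ` WQ \<subseteq> carrier G" using WQ \<sigma>(1) by auto
        fix x y assume xy: "x \<in> X" "y \<in> X"
          and *: "\<forall>t\<in>\<sigma> ` WQ. (\<tau> (\<phi> t x), \<kappa> (\<phi> (\<tau> (\<phi> t x)) (\<phi> t x))) =
             (\<tau> (\<phi> t y), \<kappa> (\<phi> (\<tau> (\<phi> t y)) (\<phi> t y)))"
        have eq: "\<tau> (\<phi> (\<sigma> q) x) = \<tau> (\<phi> (\<sigma> q) y)" "col x q = col y q" if "q \<in> WQ" for q
        proof -
          note p = bspec[OF *, OF imageI[OF that]]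
          show "\<tau> (\<phi> (\<sigma> q) x) = \<tau> (\<phi> (\<sigma> q) y)" using p by (elim Pair_inject)
          show "col x q = col y q"
            unfolding col_eq[OF xy(1) WQc[OF that]] col_eq[OF xy(2) WQc[OF that]]
            using p by (elim Pair_inject)
        qed
        have "z (col x) = z (col y)" by (rule z_eq) (rule eq(2))
        moreover have "z (col y) \<in> WQ" using z_W by simp
        ultimately show "Z x = Z y" unfolding Z_def tile_def by (simp only: eq(1))
      qed
      have Z_card: "card ((\<lambda>f. Z (\<phi> f x) \<otimes> f) ` F) \<le> 2 ^ d * D" if x: "x \<in> X" for x
      proof -
        define G' where "G' w = (\<lambda>n. \<tau> (\<phi> (n \<otimes> w) x) \<otimes> (n \<otimes> w)) ` M" for w
        \<comment> \<open>The centres reached from \<open>\<phi> f x\<close>, seen from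
          \<open>x\<close> and indexed by representatives; \<open>n1\<close> corrects for
          \<open>\<sigma> q \<otimes> f\<close> not being a representative. Such functions are few
          by \<open>prod_le\<close>, and by \<open>K1\<close> they determine every tile that
          \<open>Z\<close> may choose at \<open>\<phi> f x\<close>.\<close>
        define pat where "pat f = (\<lambda>w\<in>W. \<tau> (\<phi> (n1 f (\<pi> w) \<otimes> w) x) \<otimes> (n1 f (\<pi> w) \<otimes> w))" for f
        have pat_\<sigma>: "pat f (\<sigma> q) = \<tau> (\<phi> (n1 f q \<otimes> \<sigma> q) x) \<otimes> (n1 f q \<otimes> \<sigma> q)" if "q \<in> W'" for f q
        proof -
          have "\<sigma> q \<in> W" "\<pi> (\<sigma> q) = q" using that W'(2) \<sigma>(2) by (auto simp: W_def)
          then show ?thesis by (simp add: pat_def)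
        qed
        have pat_in: "pat f \<in> PiE W G'" if f: "f \<in> F" for f
        proof (rule PiE_I)
          fix w assume "w \<in> W"
          then obtain q where q: "q \<in> W'" "w = \<sigma> q" by (auto simp: W_def)
          show "pat f w \<in> G' w"
            unfolding q(2) pat_\<sigma>[OF q(1)] G'_def by (rule imageI) (rule n1_M[OF f q(1)])
        qed (simp add: pat_def)
        have "card (pat ` F) \<le> card (PiE W G')"
          using pat_in W(1) M(1) by (intro card_mono finite_PiE) (auto simp: G'_def)
        also have "\<dots> \<le> 2 ^ d"
          using prod_le x W(1) by (simp add: card_PiE G'_def)
        finally have pat_card: "card (pat ` F) \<le> 2 ^ d" .
        have qf: "q \<otimes>\<^bsub>Q\<^esub> \<pi> f \<in> W'" if "q \<in> WQ" "f \<in> F" for q f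
          using that by (auto simp: W'_def)
        have K1: "pat f (\<sigma> (q \<otimes>\<^bsub>Q\<^esub> \<pi> f)) = tile (\<phi> f x) q \<otimes> f" if q: "q \<in> WQ" and f: "f \<in> F" for q f
        proof -
          have c: "q \<in> carrier Q" "f \<in> carrier G" "\<pi> f \<in> carrier Q" using WQc q Fc f by blast+
          have "n1 f (q \<otimes>\<^bsub>Q\<^esub> \<pi> f) \<otimes> \<sigma> (q \<otimes>\<^bsub>Q\<^esub> \<pi> f) = \<sigma> (q \<otimes>\<^bsub>Q\<^esub> \<pi> f \<otimes>\<^bsub>Q\<^esub> inv\<^bsub>Q\<^esub> \<pi> f) \<otimes> f"
            using n1(2)[OF c(2), of "q \<otimes>\<^bsub>Q\<^esub> \<pi> f"] c by simp
          also have "q \<otimes>\<^bsub>Q\<^esub> \<pi> f \<otimes>\<^bsub>Q\<^esub> inv\<^bsub>Q\<^esub> \<pi> f = q" using c by (simp add: Q.m_assoc)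
          finally have eq: "n1 f (q \<otimes>\<^bsub>Q\<^esub> \<pi> f) \<otimes> \<sigma> (q \<otimes>\<^bsub>Q\<^esub> \<pi> f) = \<sigma> q \<otimes> f" .
          have tc: "\<tau> (\<phi> (\<sigma> q \<otimes> f) x) \<in> carrier G" using \<tau>c \<sigma>(1) c x by simp
          have "\<phi> (\<sigma> q) (\<phi> f x) = \<phi> (\<sigma> q \<otimes> f) x" using \<sigma>(1) c x by simp
          then show ?thesis
            unfolding pat_\<sigma>[OF qf[OF q f]] eq tile_def using tc \<sigma>(1) c by (simp add: G.m_assoc)
        qed
        have K2: "col (\<phi> f x) q = \<kappa> (\<phi> (pat f (\<sigma> (q \<otimes>\<^bsub>Q\<^esub> \<pi> f))) x)" if q: "q \<in> WQ" and f: "f \<in> F" for q f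
        proof -
          have c: "q \<in> carrier Q" "f \<in> carrier G" using WQc q Fc f by blast+
          have "tile (\<phi> f x) q \<in> carrier G" using \<tau>c \<sigma>(1) c x by (simp add: tile_def)
          then show ?thesis unfolding K1[OF q f] col_def using c x by simp
        qed
        \<comment> \<open>The colouring of all of \<open>Q\<close> induced by a pattern. Outside
          \<open>W'\<close> the filler is shifted above \<open>k1\<close>, so the colour of a centre
          never agrees with a filler value.\<close>
        define cl where "cl \<psi> q = (if q \<in> W' then \<kappa> (\<phi> (\<psi> (\<sigma> q)) x) else Suc k1 + c0 q)" for \<psi> q
        have pat_c: "pat f (\<sigma> q) \<in> carrier G" "Y (\<phi> (pat f (\<sigma> q)) x)"
          "pat f (\<sigma> q) = \<tau> (\<phi> (n1 f q \<otimes> \<sigma> q) x) \<otimes> n1 f q \<otimes> \<sigma> q"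
          "\<tau> (\<phi> (n1 f q \<otimes> \<sigma> q) x) \<in> B (2 * m)" "n1 f q \<in> M"
          if q: "q \<in> W'" and f: "f \<in> F" for f q
        proof -
          have c: "n1 f q \<in> carrier G" "\<sigma> q \<in> carrier G"
            using n1_M[OF f q] Mc \<sigma>(1) q W'(2) by blast+
          have y: "\<phi> (n1 f q \<otimes> \<sigma> q) x \<in> X" using c x by simp
          note \<tau>y = bspec[OF \<tau>_Y y] and \<tau>cy = \<tau>c[OF y]
          show "pat f (\<sigma> q) \<in> carrier G" unfolding pat_\<sigma>[OF q] using \<tau>cy c by simp
          have "\<phi> (pat f (\<sigma> q)) x = \<phi> (\<tau> (\<phi> (n1 f q \<otimes> \<sigma> q) x)) (\<phi> (n1 f q \<otimes> \<sigma> q) x)"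
            unfolding pat_\<sigma>[OF q] using \<tau>cy c x by simp
          then show "Y (\<phi> (pat f (\<sigma> q)) x)" using \<tau>y by simp
          show "pat f (\<sigma> q) = \<tau> (\<phi> (n1 f q \<otimes> \<sigma> q) x) \<otimes> n1 f q \<otimes> \<sigma> q"
            unfolding pat_\<sigma>[OF q] using \<tau>cy c by (simp add: G.m_assoc)
          show "\<tau> (\<phi> (n1 f q \<otimes> \<sigma> q) x) \<in> B (2 * m)" "n1 f q \<in> M" using \<tau>y n1_M[OF f q] by simp_all
        qed
        have \<pi>_pat: "\<pi> (pat f (\<sigma> q)) = q" if q: "q \<in> W'" and f: "f \<in> F" for f q
        proof -
          have c: "\<tau> (\<phi> (n1 f q \<otimes> \<sigma> q) x) \<in> N" "n1 f q \<in> N" "q \<in> carrier Q"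
            using pat_c(4,5)[OF q f] B_N M(2) W'(2) q by blast+
          then show ?thesis unfolding pat_c(3)[OF q f] using N_D \<sigma> by simp
        qed
        have cl_proper: "proper_colouring Q L (Suc k1 + p0) (cl (pat f))" if f: "f \<in> F" for f
          unfolding proper_colouring_def
        proof (intro ballI conjI impI)
          fix q assume q: "q \<in> carrier Q"
          have \<kappa>_le: "\<kappa> (\<phi> (pat f (\<sigma> q)) x) \<le> k1" if "q \<in> W'" for q
            using \<kappa>(2) pat_c(1)[OF that f] x by simp
          show "cl (pat f) q < Suc k1 + p0"
            using c0 q \<kappa>_le[of q] by (auto simp: cl_def proper_colouring_def)
          fix l assume l: "l \<in> L" "l \<noteq> \<one>\<^bsub>Q\<^esub>"
          then have lc: "l \<in> carrier Q" using L(2) by blast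
          consider "q \<in> W'" "l \<otimes>\<^bsub>Q\<^esub> q \<in> W'" | "q \<notin> W'" "l \<otimes>\<^bsub>Q\<^esub> q \<notin> W'" | "q \<in> W'" "l \<otimes>\<^bsub>Q\<^esub> q \<notin> W'"
            | "q \<notin> W'" "l \<otimes>\<^bsub>Q\<^esub> q \<in> W'" by blast
          then show "cl (pat f) (l \<otimes>\<^bsub>Q\<^esub> q) \<noteq> cl (pat f) q"
          proof cases
            case 1
            \<comment> \<open>Centres over \<open>q\<close> and over its neighbour: their difference
              is \<open>\<sigma> l\<close> between two box elements of radius at most
              \<open>2 * m + 2\<close>, hence in \<open>T1\<close>. It is not \<open>\<one>\<close>,
              since the centres have different images in \<open>Q\<close>, so
              \<open>\<kappa>\<close> separates them.\<close>
            let ?q' = "l \<otimes>\<^bsub>Q\<^esub> q"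
            define g where "g = pat f (\<sigma> q)"
            define g' where "g' = pat f (\<sigma> ?q')"
            define b where "b = \<tau> (\<phi> (n1 f q \<otimes> \<sigma> q) x)"
            define b' where "b' = \<tau> (\<phi> (n1 f ?q' \<otimes> \<sigma> ?q') x)"
            have g: "g \<in> carrier G" "Y (\<phi> g x)" "g = b \<otimes> n1 f q \<otimes> \<sigma> q" "b \<in> B (2 * m)" "n1 f q \<in> M"
              unfolding g_def b_def by (rule pat_c[OF 1(1) f])+
            have g': "g' \<in> carrier G" "Y (\<phi> g' x)" "g' = b' \<otimes> n1 f ?q' \<otimes> \<sigma> ?q'" "b' \<in> B (2 * m)" "n1 f ?q' \<in> M"
              unfolding g'_def b'_def by (rule pat_c[OF 1(2) f])+
            have c: "b \<in> carrier G" "n1 f q \<in> carrier G" "\<sigma> q \<in> carrier G" "b' \<in> carrier G"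
              "n1 f ?q' \<in> carrier G" "\<sigma> ?q' \<in> carrier G" "\<sigma> l \<in> carrier G" "n2 l q \<in> carrier G"
              using g g' Bc Mc \<sigma>(1) q lc n2_M[OF l(1) 1(1)] by auto
            define u where "u = b' \<otimes> n1 f ?q' \<otimes> n2 l q"
            define v where "v = inv (b \<otimes> n1 f q)"
            have "g' \<otimes> inv g = b' \<otimes> n1 f ?q' \<otimes> (\<sigma> ?q' \<otimes> inv \<sigma> q) \<otimes> inv (b \<otimes> n1 f q)"
              unfolding g(3) g'(3) using c by (simp add: G.m_assoc G.inv_mult_group)
            also have "\<dots> = u \<otimes> \<sigma> l \<otimes> v"
              unfolding n2(2)[OF lc q] u_def v_def using c by (simp add: G.m_assoc)
            finally have eq: "g' \<otimes> inv g = u \<otimes> \<sigma> l \<otimes> v" .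
            have "u \<in> B (Suc (Suc (2 * m)))" "v \<in> B (Suc (2 * m))"
              unfolding u_def v_def using g g' n2_M[OF l(1) 1(1)] by (simp_all add: B_M B_inv)
            moreover have "B (Suc (Suc (2 * m))) \<subseteq> B (3 * m)" "B (Suc (2 * m)) \<subseteq> B (3 * m)"
              using m(1) by (intro B_mono; linarith)+
            ultimately have t1: "g' \<otimes> inv g \<in> T1" unfolding eq using l by (intro T1_I) auto
            have ne: "g' \<otimes> inv g \<noteq> \<one>"
            proof
              assume eq1: "g' \<otimes> inv g = \<one>"
              have "g = g'"
                by (rule ccontr) (rule notE[OF G.neq_inv_mult[OF g(1) g'(1)] eq1])
              then have "\<pi> g' = \<pi> g" by (rule arg_cong[OF sym])
              then have "?q' = q"
                unfolding g_def g'_def \<pi>_pat[OF 1(1) f] \<pi>_pat[OF 1(2) f] .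
              then show False using l(2) Q.r_cancel_one[OF q lc] by blast
            qed
            have act: "\<phi> (g' \<otimes> inv g) (\<phi> g x) = \<phi> g' x" using g(1) g'(1) x by (simp add: G.m_assoc)
            have "\<phi> g x \<in> X" using g(1) x by simp
            from bspec[OF mp[OF bspec[OF \<kappa>_proper this] g(2)] t1] have "\<kappa> (\<phi> g' x) \<noteq> \<kappa> (\<phi> g x)"
              using ne g'(2) by (simp add: act)
            then show ?thesis using 1 by (simp add: cl_def g_def g'_def)
          next
            case 2
            then show ?thesis using c0 q l by (simp add: cl_def proper_colouring_def)
          next
            case 3
            then show ?thesis using \<kappa>_le[of q] by (simp add: cl_def)
          next
            case 4
            then show ?thesis using \<kappa>_le[of "l \<otimes>\<^bsub>Q\<^esub> q"] by (simp add: cl_def)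
          qed
        qed
        \<comment> \<open>For a fixed pattern the image of \<open>f\<close> is read off from the
          pattern at the element of \<open>Q\<close> that the rule chooses for
          \<open>\<pi> f\<close>, and the rule leaves at most \<open>D\<close> such
          elements.\<close>
        define S where "S \<psi> = (\<lambda>r. \<psi> (\<sigma> r)) ` (\<lambda>f. z (\<lambda>q. cl \<psi> (q \<otimes>\<^bsub>Q\<^esub> f)) \<otimes>\<^bsub>Q\<^esub> f) ` \<pi> ` F" for \<psi>
        have S_fin: "finite (S \<psi>)" for \<psi> using F(1) by (simp add: S_def)
        have S_card: "card (S (pat f)) \<le> D" if "f \<in> F" for f
        proof -
          have "card (S (pat f)) \<le> card ((\<lambda>f'. z (\<lambda>q. cl (pat f) (q \<otimes>\<^bsub>Q\<^esub> f')) \<otimes>\<^bsub>Q\<^esub> f') ` \<pi> ` F)"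
            unfolding S_def using F(1) by (intro card_image_le) simp
          also have "\<dots> \<le> D" using z_card cl_proper[OF that] by blast
          finally show ?thesis .
        qed
        have in_S: "Z (\<phi> f x) \<otimes> f \<in> S (pat f)" if f: "f \<in> F" for f
        proof -
          have "z (col (\<phi> f x)) = z (\<lambda>q. cl (pat f) (q \<otimes>\<^bsub>Q\<^esub> \<pi> f))"
          proof (rule z_eq)
            fix q assume q: "q \<in> WQ"
            show "col (\<phi> f x) q = cl (pat f) (q \<otimes>\<^bsub>Q\<^esub> \<pi> f)"
              unfolding K2[OF q f] cl_def using qf[OF q f] by simp
          qed
          moreover have "Z (\<phi> f x) \<otimes> f = pat f (\<sigma> (z (col (\<phi> f x)) \<otimes>\<^bsub>Q\<^esub> \<pi> f))"
            unfolding Z_def using z_W f by (intro K1[symmetric]) auto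
          ultimately show ?thesis using f by (simp add: S_def)
        qed
        have "card ((\<lambda>f. Z (\<phi> f x) \<otimes> f) ` F) \<le> card (\<Union>\<psi>\<in>pat ` F. S \<psi>)"
          using F(1) S_fin in_S by (intro card_mono) auto
        also have "\<dots> \<le> (\<Sum>\<psi>\<in>pat ` F. card (S \<psi>))"
          using F(1) by (intro card_UN_le) simp
        also have "\<dots> \<le> (\<Sum>\<psi>\<in>pat ` F. D)"
          using S_card by (intro sum_mono) auto
        also have "\<dots> = card (pat ` F) * D" by simp
        also have "\<dots> \<le> 2 ^ d * D" using pat_card by (rule mult_le_mono1)
        finally show ?thesis .
      qed
      have "\<forall>x\<in>X. Z x \<in> (\<lambda>(b, q). b \<otimes> \<sigma> q) ` (B (2 * m) \<times> WQ)"
      proof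
        fix x assume x: "x \<in> X"
        have q: "z (col x) \<in> WQ" using z_W by simp
        then have "\<phi> (\<sigma> (z (col x))) x \<in> X" using \<sigma>(1) WQc x by simp
        then have "\<tau> (\<phi> (\<sigma> (z (col x))) x) \<in> B (2 * m)" using \<tau>_Y by simp
        then show "Z x \<in> (\<lambda>(b, q). b \<otimes> \<sigma> q) ` (B (2 * m) \<times> WQ)"
          using q unfolding Z_def tile_def by force
      qed
      moreover have "finite ((\<lambda>(b, q). b \<otimes> \<sigma> q) ` (B (2 * m) \<times> WQ))"
        using B_fin WQ(1) by simp
      moreover have "(\<lambda>(b, q). b \<otimes> \<sigma> q) ` (B (2 * m) \<times> WQ) \<subseteq> carrier G"
        using Bc \<sigma>(1) WQc by auto
      ultimately show "contracts F (2 ^ d * D)"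
        unfolding contracts_def using Z_fin Z_card
        by (intro exI[of _ Z] exI[of _ "(\<lambda>(b, q). b \<otimes> \<sigma> q) ` (B (2 * m) \<times> WQ)"] conjI ballI) simp_all
    qed
  qed
  then show ?thesis by blast
qed

section \<open>Uniformly boxed subgroups\<close>

text \<open>A finite subgroup containing \<open>M\<close> absorbs every move, so a constant sequence
  of boxes works with degree 0, and the packing bound at every scale is the hypothesis
  \<open>pack\<close> at one index.\<close>

lemma uniformly_boxed_finite_subgroups:
  fixes G :: "('a, 'm) monoid_scheme" (structure)
  assumes "group G" and F: "\<And>i. subgroup (F i) G" "\<And>i::nat. finite (F i)" "\<And>i. F i \<subseteq> F (Suc i)" "N = (\<Union>i. F i)"
    and pack: "\<And>l. l \<in> carrier G \<Longrightarrow> \<exists>k. \<forall>i Z. Z \<subseteq> (\<lambda>(b, b'). b \<otimes> l \<otimes> b') ` (F i \<times> F i) \<and>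
       (\<forall>z\<in>Z. \<forall>z'\<in>Z. z \<noteq> z' \<longrightarrow> z' \<otimes> inv z \<notin> F i) \<longrightarrow> card Z \<le> k"
  shows "uniformly_boxed N G"
proof -
  interpret group G by fact
  obtain K where K: "\<And>l i Z. \<lbrakk>l \<in> carrier G; Z \<subseteq> (\<lambda>(b, b'). b \<otimes> l \<otimes> b') ` (F i \<times> F i);
       \<forall>z\<in>Z. \<forall>z'\<in>Z. z \<noteq> z' \<longrightarrow> z' \<otimes> inv z \<notin> F i\<rbrakk> \<Longrightarrow> card Z \<le> K l"
    using pack by metis
  have mono: "F i \<subseteq> F j" if "i \<le> j" for i j using F(3) that by (rule lift_Suc_mono_le)
  show ?thesis
    unfolding uniformly_boxed_def
  proof (intro exI[of _ 0] exI[of _ K] allI impI)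
    fix M W assume MW: "finite M \<and> M \<subseteq> N \<and> finite W \<and> W \<subseteq> carrier G"
    have "\<exists>j. M \<subseteq> F j"
      using MW(1)[THEN conjunct1] MW[THEN conjunct2, THEN conjunct1]
    proof (induction M rule: finite_induct)
      case (insert x M)
      then obtain i j where "x \<in> F i" "M \<subseteq> F j" unfolding F(4) by blast
      then have "insert x M \<subseteq> F (max i j)" using mono[of i "max i j"] mono[of j "max i j"] by auto
      then show ?case by blast
    qed simp
    then obtain j where j: "M \<subseteq> F j" ..
    interpret Fj: subgroup "F j" G by (rule F(1))
    show "\<exists>B C. box_sequence N G M B \<and> (\<forall>i. card (B i) \<le> C * Suc i ^ 0) \<and>
        (\<forall>m0. \<exists>m\<ge>m0. \<forall>l\<in>W. packing_bound G B m l (K l))"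
    proof (rule exI[of _ "\<lambda>_. F j"], rule exI[of _ "card (F j)"], intro conjI allI)
      show "box_sequence N G M (\<lambda>_. F j)"
        unfolding box_sequence_def using F(2,4) j by auto
      show "\<exists>m\<ge>m0. \<forall>l\<in>W. packing_bound G (\<lambda>_. F j) m l (K l)" for m0
      proof (rule exI[of _ m0], intro conjI ballI)
        fix l assume "l \<in> W"
        then have "l \<in> carrier G" using MW by blast
        then show "packing_bound G (\<lambda>_. F j) m0 l (K l)"
          unfolding packing_bound_def by (intro allI impI, elim conjE) (rule K)
      qed simp
    qed simp
  qed
qed

text \<open>For normal \<open>F i\<close> the double coset of \<open>l\<close> is a single coset, in
  which any two points differ by an element of \<open>F i\<close>; a separated set has at most one
  point.\<close>

lemma uniformly_boxed_finite_normal: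
  fixes G :: "('a, 'm) monoid_scheme" (structure)
  assumes "\<And>i. F i \<lhd> G" "\<And>i::nat. finite (F i)" "\<And>i. F i \<subseteq> F (Suc i)" "N = (\<Union>i. F i)"
  shows "uniformly_boxed N G"
proof -
  interpret F0: normal "F 0" G by (rule assms(1))
  have sub: "subgroup (F i) G" for i using assms(1) by (rule normal_imp_subgroup)
  show ?thesis
  proof (rule uniformly_boxed_finite_subgroups[OF F0.is_group sub assms(2-4)])
    fix l assume l: "l \<in> carrier G"
    have same: "z' \<otimes> inv z \<in> F i" if z: "z \<in> (\<lambda>(b, b'). b \<otimes> l \<otimes> b') ` (F i \<times> F i)"
      "z' \<in> (\<lambda>(b, b'). b \<otimes> l \<otimes> b') ` (F i \<times> F i)" for z z' i
    proof -
      interpret F: normal "F i" G by (rule assms(1))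
      from z(1) obtain b c where 1: "b \<in> F i" "c \<in> F i" "z = b \<otimes> l \<otimes> c"
        by (elim imageE SigmaE) simp
      from z(2) obtain b' c' where 2: "b' \<in> F i" "c' \<in> F i" "z' = b' \<otimes> l \<otimes> c'"
        by (elim imageE SigmaE) simp
      note b = 1 2
      have c: "b \<in> carrier G" "c \<in> carrier G" "b' \<in> carrier G" "c' \<in> carrier G"
        using b F.subset by blast+
      have "z' \<otimes> inv z = b' \<otimes> (l \<otimes> (c' \<otimes> inv c) \<otimes> inv l) \<otimes> inv b"
        unfolding b(3,6) using l c by (simp add: F0.m_assoc F0.inv_mult_group)
      moreover have "l \<otimes> (c' \<otimes> inv c) \<otimes> inv l \<in> F i"
        using b l by (intro F.inv_op_closed2 F.m_closed F.m_inv_closed)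
      ultimately show ?thesis using b by simp
    qed
    have "card Z \<le> 1" if "Z \<subseteq> (\<lambda>(b, b'). b \<otimes> l \<otimes> b') ` (F i \<times> F i)"
      "\<forall>z\<in>Z. \<forall>z'\<in>Z. z \<noteq> z' \<longrightarrow> z' \<otimes> inv z \<notin> F i" for Z i
    proof -
      have "\<forall>z\<in>Z. \<forall>z'\<in>Z. z = z'"
      proof (intro ballI, rule ccontr)
        fix z z' assume z: "z \<in> Z" "z' \<in> Z" "z \<noteq> z'"
        then have "z' \<otimes> inv z \<in> F i" using that(1) by (intro same) blast+
        then show False using that(2) z by blast
      qed
      moreover have "finite Z" using that(1) assms(2)[of i] by (meson finite_SigmaI finite_imageI finite_subset)
      ultimately show ?thesis by (simp add: card_le_Suc0_iff_eq)
    qed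
    then show "\<exists>k. \<forall>i Z. Z \<subseteq> (\<lambda>(b, b'). b \<otimes> l \<otimes> b') ` (F i \<times> F i) \<and>
       (\<forall>z\<in>Z. \<forall>z'\<in>Z. z \<noteq> z' \<longrightarrow> z' \<otimes> inv z \<notin> F i) \<longrightarrow> card Z \<le> k" by blast
  qed
qed

lemma card_le_if_keyed:
  assumes "finite K" "key ` Z \<subseteq> K" "\<And>z z'. \<lbrakk>z \<in> Z; z' \<in> Z; key z = key z'\<rbrakk> \<Longrightarrow> z = z'"
  shows "card Z \<le> card K"
  using assms by (intro card_inj_on_le[of key]) (auto simp: inj_on_def)

subsection \<open>The lamplighter group\<close>

lemma lamplighter_simps:
  "carrier lamplighter_group = {f. range f \<subseteq> {0..<2} \<and> finite {i. f i \<noteq> 0}} \<times> UNIV"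
  "(f, k) \<otimes>\<^bsub>lamplighter_group\<^esub> (g, l) = ((\<lambda>i. (f i + g (i - k)) mod 2), k + l)"
  "\<one>\<^bsub>lamplighter_group\<^esub> = ((\<lambda>i. 0), 0)"
  by (auto simp: lamplighter_group_def semidirect_product_def carrier_sum_group
      carrier_integer_mod_group integer_group_def image_subset_iff restrict_def PiE_iff)

text \<open>The finite subgroup \<open>F n\<close> of lamps lit between \<open>-n\<close> and
  \<open>n\<close> is not normal: conjugation by a shift \<open>t\<close> moves the interval.
  Elements of the double coset of \<open>l\<close> with the same lamps on the two margins of width
  \<open>\<bar>t\<bar>\<close> differ by an element of \<open>F n\<close>, whence the constant
  \<open>2 ^ nat \<bar>t\<bar> * 2 ^ nat \<bar>t\<bar>\<close>, independent of
  \<open>n\<close>.\<close>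

lemma uniformly_boxed_lamplighter:
  "uniformly_boxed (kernel lamplighter_group integer_group snd) lamplighter_group"
proof -
  let ?G = "lamplighter_group"
  interpret group ?G by (rule group_lamplighter_group)
  define F where "F n = {f :: int \<Rightarrow> int. range f \<subseteq> {0..<2} \<and> {i. f i \<noteq> 0} \<subseteq> {- int n..int n}} \<times> {0::int}" for n
  have F_iff: "(f, k) \<in> F n \<longleftrightarrow> k = 0 \<and> (\<forall>i. f i \<in> {0..<2}) \<and> (\<forall>i. f i \<noteq> 0 \<longrightarrow> i \<in> {- int n..int n})" for f k n
    unfolding F_def by (auto simp: image_subset_iff)
  have F_car: "F n \<subseteq> carrier ?G" for n
    unfolding F_def lamplighter_simps by (auto intro: finite_subset[of _ "{- int n..int n}"])
  have inv_F: "inv\<^bsub>?G\<^esub> x = x" if "x \<in> F n" for x n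
  proof (rule inv_equality)
    show "x \<otimes>\<^bsub>?G\<^esub> x = \<one>\<^bsub>?G\<^esub>" using that by (cases x) (auto simp: lamplighter_simps F_iff)
  qed (use that F_car in auto)
  show ?thesis
  proof (rule uniformly_boxed_finite_subgroups[OF group_lamplighter_group, where F = F])
    show "subgroup (F n) ?G" for n
    proof (rule subgroupI)
      show "F n \<subseteq> carrier ?G" by (rule F_car)
      have "((\<lambda>_. 0), 0) \<in> F n" by (simp add: F_iff)
      then show "F n \<noteq> {}" by blast
      show "inv\<^bsub>?G\<^esub> a \<in> F n" if "a \<in> F n" for a using that inv_F by simp
      show "a \<otimes>\<^bsub>?G\<^esub> b \<in> F n" if ab: "a \<in> F n" "b \<in> F n" for a b
      proof -
        obtain f g where fg: "a = (f, 0)" "b = (g, 0)" using ab by (cases a; cases b) (auto simp: F_iff)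
        have "i \<in> {- int n..int n}" if "(f i + g i) mod 2 \<noteq> 0" for i
        proof -
          have "f i \<noteq> 0 \<or> g i \<noteq> 0" using that by auto
          then show ?thesis using ab unfolding fg F_iff by blast
        qed
        then show ?thesis unfolding fg lamplighter_simps F_iff by simp
      qed
    qed
    show "finite (F n)" for n
    proof -
      have "finite {f. \<forall>x. (x \<in> {- int n..int n} \<longrightarrow> f x \<in> {0..<2::int}) \<and> (x \<notin> {- int n..int n} \<longrightarrow> f x = 0)}"
        by (rule finite_set_of_finite_funs) auto
      moreover have "{f :: int \<Rightarrow> int. range f \<subseteq> {0..<2} \<and> {i. f i \<noteq> 0} \<subseteq> {- int n..int n}} \<subseteq>
        {f. \<forall>x. (x \<in> {- int n..int n} \<longrightarrow> f x \<in> {0..<2::int}) \<and> (x \<notin> {- int n..int n} \<longrightarrow> f x = 0)}"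
        by (auto simp: image_subset_iff)
      ultimately show ?thesis unfolding F_def by (auto intro: finite_subset)
    qed
    show "F n \<subseteq> F (Suc n)" for n by (auto simp: F_def)
    show "kernel ?G integer_group snd = (\<Union>n. F n)"
    proof (intro equalityI subsetI)
      fix x assume "x \<in> kernel ?G integer_group snd"
      then obtain f where x: "x = (f, 0)" and f: "range f \<subseteq> {0..<2}" "finite {i. f i \<noteq> 0}"
        by (cases x) (auto simp: kernel_def lamplighter_simps integer_group_def)
      define n where "n = nat (Max (insert 0 (abs ` {i. f i \<noteq> 0})))"
      have "\<bar>i\<bar> \<le> int n" if "f i \<noteq> 0" for i
        using f(2) that Max_ge[of "insert 0 (abs ` {i. f i \<noteq> 0})" "\<bar>i\<bar>"] unfolding n_def by auto
      then have "x \<in> F n" using f(1) unfolding x F_iff by (auto simp: abs_le_iff image_subset_iff) force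
      then show "x \<in> (\<Union>n. F n)" by blast
    next
      fix x assume "x \<in> (\<Union>n. F n)"
      then obtain n where n: "x \<in> F n" by blast
      then have "x \<in> carrier ?G" "snd x = 0" using F_car[of n] by (auto simp: F_def)
      then show "x \<in> kernel ?G integer_group snd" by (simp add: kernel_def integer_group_def)
    qed
    fix l assume l: "l \<in> carrier ?G"
    obtain f0 t where lft: "l = (f0, t)" by (cases l)
    have f0: "f0 i \<in> {0..<2}" for i using l by (auto simp: lft lamplighter_simps image_subset_iff)
    show "\<exists>k. \<forall>n Z. Z \<subseteq> (\<lambda>(b, b'). b \<otimes>\<^bsub>?G\<^esub> l \<otimes>\<^bsub>?G\<^esub> b') ` (F n \<times> F n) \<and>
       (\<forall>z\<in>Z. \<forall>z'\<in>Z. z \<noteq> z' \<longrightarrow> z' \<otimes>\<^bsub>?G\<^esub> inv\<^bsub>?G\<^esub> z \<notin> F n) \<longrightarrow> card Z \<le> k"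
    proof (intro exI[of _ "2 ^ nat \<bar>t\<bar> * 2 ^ nat \<bar>t\<bar>"] allI impI, elim conjE)
      fix n Z assume Z: "Z \<subseteq> (\<lambda>(b, b'). b \<otimes>\<^bsub>?G\<^esub> l \<otimes>\<^bsub>?G\<^esub> b') ` (F n \<times> F n)"
        and sep: "\<forall>z\<in>Z. \<forall>z'\<in>Z. z \<noteq> z' \<longrightarrow> z' \<otimes>\<^bsub>?G\<^esub> inv\<^bsub>?G\<^esub> z \<notin> F n"
      define R where "R = {int n<..int n + \<bar>t\<bar>}"
      define L where "L = {- int n - \<bar>t\<bar>..<- int n}"
      define key where "key z = (restrict (fst z) R, restrict (fst z) L)" for z :: "(int \<Rightarrow> int) \<times> int"
      have form: "\<exists>u. z = (u, t) \<and> (\<forall>i. u i \<in> {0..<2}) \<and>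
          (\<forall>i. i \<notin> {- int n - \<bar>t\<bar>..int n + \<bar>t\<bar>} \<longrightarrow> u i = f0 i)" if "z \<in> Z" for z
      proof -
        obtain g g' where g: "(g, 0) \<in> F n" "(g', 0) \<in> F n" "z = (g, 0) \<otimes>\<^bsub>?G\<^esub> l \<otimes>\<^bsub>?G\<^esub> (g', 0)"
        proof -
          from subsetD[OF Z \<open>z \<in> Z\<close>] obtain b b' where "b \<in> F n" "b' \<in> F n" "z = b \<otimes>\<^bsub>?G\<^esub> l \<otimes>\<^bsub>?G\<^esub> b'"
            by (elim imageE SigmaE) simp
          then show thesis using that[of "fst b" "fst b'"] by (cases b; cases b') (auto simp: F_iff)
        qed
        define u where "u i = ((g i + f0 i) mod 2 + g' (i - t)) mod 2" for i
        have "u i = f0 i" if i: "i \<notin> {- int n - \<bar>t\<bar>..int n + \<bar>t\<bar>}" for i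
        proof -
          have "i \<notin> {- int n..int n}" "i - t \<notin> {- int n..int n}" using i by auto
          then have "g i = 0" "g' (i - t) = 0" using g(1,2) unfolding F_iff by blast+
          then show ?thesis using f0[of i] by (simp add: u_def)
        qed
        then show ?thesis unfolding g(3) lft lamplighter_simps
          by (intro exI[of _ u]) (auto simp: u_def)
      qed
      have eq: "z = z'" if z: "z \<in> Z" "z' \<in> Z" "key z = key z'" for z z'
      proof (rule ccontr)
        assume "z \<noteq> z'"
        obtain u where u: "z = (u, t)" "\<And>i. u i \<in> {0..<2}"
          "\<And>i. i \<notin> {- int n - \<bar>t\<bar>..int n + \<bar>t\<bar>} \<Longrightarrow> u i = f0 i" using form[OF z(1)] by blast
        obtain u' where u': "z' = (u', t)" "\<And>i. u' i \<in> {0..<2}"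
          "\<And>i. i \<notin> {- int n - \<bar>t\<bar>..int n + \<bar>t\<bar>} \<Longrightarrow> u' i = f0 i" using form[OF z(2)] by blast
        have R: "u i = u' i" if "i \<in> R" for i
          using z(3) that unfolding key_def u(1) u'(1) by (auto dest: fun_cong[of _ _ i])
        have L: "u i = u' i" if "i \<in> L" for i
          using z(3) that unfolding key_def u(1) u'(1) by (auto dest: fun_cong[of _ _ i])
        have out: "u i = u' i" if i: "i \<notin> {- int n..int n}" for i
        proof (cases "i \<in> R \<or> i \<in> L")
          case True
          then show ?thesis using R L by blast
        next
          case False
          then have "i \<notin> {- int n - \<bar>t\<bar>..int n + \<bar>t\<bar>}" using i by (auto simp: R_def L_def)
          then show ?thesis using u(3) u'(3) by simp
        qed
        \<comment> \<open>This is \<open>z' \<otimes> inv z\<close>: lamps add modulo 2 and the two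
          shifts \<open>t\<close> cancel.\<close>
        define w where "w = ((\<lambda>i. (u' i + u i) mod 2), 0::int)"
        have wF: "w \<in> F n"
          unfolding w_def F_iff
        proof (intro conjI allI impI)
          fix i assume *: "(u' i + u i) mod 2 \<noteq> 0"
          show "i \<in> {- int n..int n}"
          proof (rule ccontr)
            assume "i \<notin> {- int n..int n}"
            then have "u i = u' i" by (rule out)
            then show False using * by simp
          qed
        qed auto
        have "((u' i + u i) mod 2 + u i) mod 2 = u' i" for i
          using u(2)[of i] u'(2)[of i] by (simp add: mod_simps)
        then have wz: "w \<otimes>\<^bsub>?G\<^esub> z = z'"
          unfolding w_def u(1) u'(1) lamplighter_simps by simp
        have zc: "z \<in> carrier ?G"
        proof -
          from subsetD[OF Z z(1)] obtain b b' where b: "b \<in> F n" "b' \<in> F n" "z = b \<otimes>\<^bsub>?G\<^esub> l \<otimes>\<^bsub>?G\<^esub> b'"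
            by (elim imageE SigmaE) simp
          then have "b \<in> carrier ?G" "b' \<in> carrier ?G" using F_car by blast+
          then show ?thesis unfolding b(3) using l by simp
        qed
        have "w \<in> carrier ?G" using wF F_car by blast
        then have "z' \<otimes>\<^bsub>?G\<^esub> inv\<^bsub>?G\<^esub> z = w"
          unfolding wz[symmetric] using zc by (rule mult_inv_cancel(3))
        then show False using sep z \<open>z \<noteq> z'\<close> wF by auto
      qed
      have "card Z \<le> card (PiE R (\<lambda>_. {0..<2::int}) \<times> PiE L (\<lambda>_. {0..<2::int}))"
      proof (rule card_le_if_keyed[where key = key])
        show "finite (PiE R (\<lambda>_. {0..<2::int}) \<times> PiE L (\<lambda>_. {0..<2::int}))"
          by (intro finite_cartesian_product finite_PiE) (auto simp: R_def L_def)
        show "key ` Z \<subseteq> PiE R (\<lambda>_. {0..<2::int}) \<times> PiE L (\<lambda>_. {0..<2::int})"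
          using form unfolding key_def by fastforce
      qed (rule eq)
      also have "\<dots> = 2 ^ nat \<bar>t\<bar> * 2 ^ nat \<bar>t\<bar>"
        by (simp add: card_cartesian_product card_PiE R_def L_def)
      finally show "card Z \<le> 2 ^ nat \<bar>t\<bar> * 2 ^ nat \<bar>t\<bar>" .
    qed
  qed
qed

subsection \<open>Polynomial growth\<close>

lemma (in group) set_power_mult:
  assumes "S \<subseteq> carrier G" "a \<in> set_power G S i" "b \<in> set_power G S j"
  shows "a \<otimes> b \<in> set_power G S (i + j)"
proof -
  have c: "set_power G S i \<subseteq> carrier G" for i
    using assms(1) by (induction i) (auto simp: set_mult_def subset_iff)
  show ?thesis
    using assms(3)
  proof (induction j arbitrary: b)
    case 0
    have "a \<in> carrier G" using assms(2) c by blast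
    then show ?case using 0 assms(2) by simp
  next
    case (Suc j)
    then obtain b' s where b: "b' \<in> set_power G S j" "s \<in> S" "b = b' \<otimes> s"
      by (auto simp: set_mult_def)
    then have "a \<otimes> b' \<in> set_power G S (i + j)" by (intro Suc.IH)
    moreover have "a \<otimes> b = a \<otimes> b' \<otimes> s"
      using b assms c by (simp add: m_assoc subset_iff)
    ultimately show ?case using b by (auto simp: set_mult_def)
  qed
qed

lemma (in group) set_power_basic:
  assumes S: "S \<subseteq> carrier G" "\<one> \<in> S" "\<And>s. s \<in> S \<Longrightarrow> inv s \<in> S" "finite S"
  shows "set_power G S i \<subseteq> carrier G" "finite (set_power G S i)" "\<one> \<in> set_power G S i"
    "a \<in> set_power G S i \<Longrightarrow> inv a \<in> set_power G S i" "i \<le> j \<Longrightarrow> set_power G S i \<subseteq> set_power G S j"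
proof -
  show c: "set_power G S i \<subseteq> carrier G" for i
    using S(1) by (induction i) (auto simp: set_mult_def subset_iff)
  show "finite (set_power G S i)"
    using S(4) by (induction i) (auto simp: set_mult_def)
  have Suc: "set_power G S i \<subseteq> set_power G S (Suc i)" for i
  proof
    fix x assume x: "x \<in> set_power G S i"
    then have "x \<in> carrier G" using c by blast
    then have "x = x \<otimes> \<one>" by simp
    then show "x \<in> set_power G S (Suc i)" using x S(2) by (auto simp: set_mult_def)
  qed
  then show "i \<le> j \<Longrightarrow> set_power G S i \<subseteq> set_power G S j" by (rule lift_Suc_mono_le)
  show "\<one> \<in> set_power G S i" by (induction i) (use Suc in auto)
  show "a \<in> set_power G S i \<Longrightarrow> inv a \<in> set_power G S i"
  proof (induction i arbitrary: a)
    case (Suc i)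
    then obtain b s where b: "b \<in> set_power G S i" "s \<in> S" "a = b \<otimes> s" by (auto simp: set_mult_def)
    then have "inv s \<in> S" "inv b \<in> set_power G S i" "inv a = inv s \<otimes> inv b"
      using S c Suc.IH by (auto simp: inv_mult_group subset_iff)
    moreover from this have "inv s \<in> set_power G S 1" using S(1) by (auto simp: set_mult_def intro!: bexI[of _ "inv s"])
    ultimately show ?case using set_power_mult[OF S(1), of "inv s" 1 "inv b" i] by simp
  qed simp
qed

text \<open>If the inequality failed at all scales beyond \<open>h0\<close>, iteration along
  \<open>16 ^ i * h1\<close> would force growth of degree \<open>d + 1\<close>. The factor 16 suits
  the application, where translates of a ball of radius \<open>h\<close> are packed into one of
  radius \<open>13 * h + 1\<close>.\<close>

lemma polynomial_imp_doubling:
  fixes v :: "nat \<Rightarrow> nat"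
  assumes "\<And>i. 0 < v i" "\<And>i. v i \<le> C * Suc i ^ d"
  shows "\<exists>h\<ge>h0. v (16 * h) \<le> 16 ^ Suc d * v h"
proof (rule ccontr)
  assume "\<not> ?thesis"
  then have grow: "16 ^ Suc d * v h < v (16 * h)" if "h \<ge> h0" for h using that by force
  define h1 where "h1 = Suc h0"
  have "(16 ^ Suc d) ^ i \<le> v (16 ^ i * h1)" for i
  proof (induction i)
    case 0
    then show ?case using assms(1)[of h1] by simp
  next
    case (Suc i)
    have "h1 \<le> 16 ^ i * h1" by simp
    then have "h0 \<le> 16 ^ i * h1" unfolding h1_def by linarith
    from grow[OF this] have "16 ^ Suc d * v (16 ^ i * h1) < v (16 ^ Suc i * h1)" by (simp add: mult.assoc)
    moreover have "16 ^ Suc d * (16 ^ Suc d) ^ i \<le> 16 ^ Suc d * v (16 ^ i * h1)"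
      using Suc by (rule mult_le_mono2)
    ultimately show ?case unfolding power_Suc[of "16 ^ Suc d" i] by (metis less_imp_le order_trans)
  qed
  then have "(16 ^ Suc d) ^ i \<le> C * Suc (16 ^ i * h1) ^ d" for i
    using assms(2) order_trans by blast
  moreover have "C * Suc (16 ^ i * h1) ^ d \<le> C * (16 ^ i * (2 * h1)) ^ d" for i
  proof (intro mult_le_mono2 power_mono)
    have "0 < 16 ^ i * h1" unfolding h1_def by (intro mult_pos_pos) simp_all
    then show "Suc (16 ^ i * h1) \<le> 16 ^ i * (2 * h1)" by linarith
  qed simp
  ultimately have *: "(16 ^ Suc d) ^ i \<le> C * (16 ^ i * (2 * h1)) ^ d" for i
    using order_trans by blast
  define A where "A = C * (2 * h1) ^ d"
  have "16 ^ i * (16 ^ i) ^ d \<le> A * (16 ^ i) ^ d" for i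
  proof -
    have "(16 ^ Suc d) ^ i = (16::nat) ^ i * (16 ^ i) ^ d"
      by (simp add: power_mult_distrib mult.commute[of d i] flip: power_mult)
    moreover have "C * (16 ^ i * (2 * h1)) ^ d = A * (16 ^ i) ^ d"
      unfolding A_def power_mult_distrib by (simp add: mult_ac)
    ultimately show ?thesis using *[of i] by metis
  qed
  from this[of A]
  have "(16::nat) ^ A \<le> A" by simp
  moreover have "A < 16 ^ A" by (rule power_gt_expt) simp
  ultimately show False by simp
qed

text \<open>The boxes are balls of a word metric whose generators include \<open>W\<close>, which is
  possible since \<open>N\<close> is the whole group; each conjugating \<open>l\<close> then has
  length at most 1, and one packing constant serves for all. At a doubling scale \<open>h\<close>,
  with \<open>m = 2 * h\<close>, the translates of \<open>B h\<close> by separated points are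
  disjoint and lie in \<open>B (13 * h + 1)\<close>. The uniform degree makes \<open>d\<close>
  independent of the subgroup generated by \<open>M\<close> and \<open>W\<close>.\<close>

lemma uniformly_boxed_polynomial_growth:
  fixes G :: "('a, 'm) monoid_scheme" (structure)
  assumes "group G" and "uniform_local_polynomial_growth G"
  shows "uniformly_boxed (carrier G) G"
proof -
  interpret group G by fact
  obtain d where d: "\<And>H. \<lbrakk>subgroup H G; finitely_generated_group (G\<lparr>carrier := H\<rparr>)\<rbrakk> \<Longrightarrow>
      \<exists>e\<le>d. polynomial_growth_degree (G\<lparr>carrier := H\<rparr>) e"
    using assms(2) unfolding uniform_local_polynomial_growth_def by blast
  show ?thesis
    unfolding uniformly_boxed_def
  proof (rule exI[of _ d], rule exI[of _ "\<lambda>_. 16 ^ Suc d"], intro allI impI)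
    fix M W assume MW: "finite M \<and> M \<subseteq> carrier G \<and> finite W \<and> W \<subseteq> carrier G"
    define S where "S = insert \<one> (M \<union> W \<union> (\<lambda>x. inv x) ` (M \<union> W))"
    have S: "S \<subseteq> carrier G" "\<one> \<in> S" "\<And>s. s \<in> S \<Longrightarrow> inv s \<in> S" "finite S"
      using MW by (auto simp: S_def subset_iff)
    define B where "B = set_power G S"
    have B_mult: "a \<otimes> b \<in> B (i + j)" if "a \<in> B i" "b \<in> B j" for a b i j
      using set_power_mult[OF S(1)] that by (simp add: B_def)
    have B_car: "B i \<subseteq> carrier G" and B_fin: "finite (B i)" and B_one: "\<one> \<in> B i" for i
      using set_power_basic(1-3)[OF S] by (simp_all add: B_def)
    have B_inv: "inv a \<in> B i" if "a \<in> B i" for a i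
      using set_power_basic(4)[OF S] that by (simp add: B_def)
    have B_mono: "B i \<subseteq> B j" if "i \<le> j" for i j
      using set_power_basic(5)[OF S that] by (simp add: B_def)
    have B_S: "s \<in> B 1" if "s \<in> S" for s
      using that S(1) by (auto simp: B_def set_mult_def intro!: bexI[of _ s])
    define H where "H = generate G S"
    have H: "subgroup H G" unfolding H_def by (rule generate_is_subgroup[OF S(1)])
    interpret H: subgroup H G by (rule H)
    have SH: "S \<subseteq> H" unfolding H_def by (auto intro: generate.incl)
    interpret HG: group "G\<lparr>carrier := H\<rparr>" by (rule H.subgroup_is_group[OF is_group])
    have gen: "generate (G\<lparr>carrier := H\<rparr>) S = carrier (G\<lparr>carrier := H\<rparr>)"
      using generate_consistent[OF SH H] by (simp add: H_def)
    have "finitely_generated_group (G\<lparr>carrier := H\<rparr>)"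
      unfolding finitely_generated_group_def using S(4) SH gen by (intro exI[of _ S]) simp
    from d[OF H this] obtain e where e: "e \<le> d" "volume_growth_bound (G\<lparr>carrier := H\<rparr>) e"
      unfolding polynomial_growth_degree_def by blast
    have "symmetric_generating_set (G\<lparr>carrier := H\<rparr>) S"
      unfolding symmetric_generating_set_def using SH gen S(2,3) m_inv_consistent[OF H] by auto
    then obtain c where c: "c > 0"
      "\<forall>r\<ge>1. real (card (set_power (G\<lparr>carrier := H\<rparr>) S r)) \<le> c * real r ^ e"
      using e(2) S(4) unfolding volume_growth_bound_def by blast
    have same: "set_power (G\<lparr>carrier := H\<rparr>) S r = B r" for r
      unfolding B_def by (induction r) (simp_all add: set_mult_def)
    define C where "C = Suc (nat \<lceil>c\<rceil>)"
    have C: "card (B i) \<le> C * Suc i ^ d" for i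
    proof (cases "i = 0")
      case True
      then show ?thesis by (simp add: B_def C_def)
    next
      case False
      then have "real (card (B i)) \<le> c * real i ^ e" using c(2) same by simp
      also have "\<dots> \<le> c * real (Suc i) ^ d"
      proof (rule mult_left_mono)
        have "real i ^ e \<le> real (Suc i) ^ e" by (rule power_mono) auto
        also have "\<dots> \<le> real (Suc i) ^ d" using e(1) by (rule power_increasing) simp
        finally show "real i ^ e \<le> real (Suc i) ^ d" .
      qed (use c(1) in simp)
      also have "\<dots> \<le> real C * real (Suc i) ^ d"
        using c(1) unfolding C_def by (intro mult_right_mono) (linarith, simp)
      finally have "real (card (B i)) \<le> real (C * Suc i ^ d)" by simp
      then show ?thesis by (simp only: of_nat_le_iff)
    qed
    have pos: "0 < card (B i)" for i
      using B_fin[of i] B_one[of i] by (auto simp: card_gt_0_iff)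
    show "\<exists>B C. box_sequence (carrier G) G M B \<and> (\<forall>i. card (B i) \<le> C * Suc i ^ d) \<and>
        (\<forall>m0. \<exists>m\<ge>m0. \<forall>l\<in>W. packing_bound G B m l (16 ^ Suc d))"
    proof (rule exI[of _ B], rule exI[of _ C], intro conjI allI)
      show "box_sequence (carrier G) G M B"
        unfolding box_sequence_def
      proof (intro allI conjI ballI)
        fix i b n assume "b \<in> B i" "n \<in> M"
        then show "b \<otimes> n \<in> B (Suc i)" using B_mult[of b i n 1] B_S[of n] by (simp add: S_def)
      qed (use B_car B_fin B_one B_inv B_mono[of i "Suc i" for i] in auto)
      show "card (B i) \<le> C * Suc i ^ d" for i by (rule C)
      fix m0
      obtain h where h: "h \<ge> Suc m0" "card (B (16 * h)) \<le> 16 ^ Suc d * card (B h)"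
        using polynomial_imp_doubling[of "\<lambda>i. card (B i)" C d "Suc m0"] pos C by blast
      show "\<exists>m\<ge>m0. \<forall>l\<in>W. packing_bound G B m l (16 ^ Suc d)"
      proof (rule exI[of _ "2 * h"], intro conjI ballI)
        show "m0 \<le> 2 * h" using h(1) by simp
        fix l assume l: "l \<in> W"
        show "packing_bound G B (2 * h) l (16 ^ Suc d)"
          unfolding packing_bound_def
        proof (intro allI impI, elim conjE)
          fix Z assume Z: "Z \<subseteq> (\<lambda>(b, b'). b \<otimes> l \<otimes> b') ` (B (3 * (2 * h)) \<times> B (3 * (2 * h)))"
            and sep: "\<forall>z\<in>Z. \<forall>z'\<in>Z. z \<noteq> z' \<longrightarrow> z' \<otimes> inv z \<notin> B (2 * h)"
          have ZB: "z \<in> B (12 * h + 1)" if "z \<in> Z" for z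
          proof -
            from subsetD[OF Z that] obtain b b' where b: "b \<in> B (6 * h)" "b' \<in> B (6 * h)" "z = b \<otimes> l \<otimes> b'"
              by (elim imageE SigmaE) (simp add: mult.assoc[symmetric])
            have "l \<in> B 1" using l B_S by (simp add: S_def)
            then have "b \<otimes> l \<otimes> b' \<in> B (6 * h + 1 + 6 * h)" using b by (intro B_mult)
            then show ?thesis using b(3) by (simp add: mult.commute)
          qed
          have Zc: "z \<in> carrier G" if "z \<in> Z" for z using ZB[OF that] B_car by blast
          have Bc: "b \<in> carrier G" if "b \<in> B i" for b i using that B_car by blast
          have finZ: "finite Z" using ZB B_fin by (meson finite_subset subsetI)
          have "inj_on (\<lambda>(z, b). b \<otimes> z) (Z \<times> B h)"
          proof (rule inj_onI, clarsimp)
            fix z b z' b' assume z: "z \<in> Z" "b \<in> B h" "z' \<in> Z" "b' \<in> B h" and eq: "b \<otimes> z = b' \<otimes> z'"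
            note cc = Zc[OF z(1)] Zc[OF z(3)] Bc[OF z(2)] Bc[OF z(4)]
            have "z' \<otimes> inv z = inv b' \<otimes> (b' \<otimes> z') \<otimes> inv z" using cc by (simp add: inv_cancel)
            also have "\<dots> = inv b' \<otimes> (b \<otimes> z) \<otimes> inv z" by (simp only: eq)
            also have "\<dots> = inv b' \<otimes> b" using cc by (simp add: m_assoc)
            finally have "z' \<otimes> inv z = inv b' \<otimes> b" .
            moreover have "inv b' \<otimes> b \<in> B (2 * h)"
              using B_mult[OF B_inv[OF z(4)] z(2)] by (simp add: mult_2)
            ultimately have "z' \<otimes> inv z \<in> B (2 * h)" by simp
            then have "z = z'" using sep z(1,3) by blast
            then show "z = z' \<and> b = b'" using eq cc by simp
          qed
          then have "card (Z \<times> B h) = card ((\<lambda>(z, b). b \<otimes> z) ` (Z \<times> B h))"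
            by (rule card_image[symmetric])
          also have "\<dots> \<le> card (B (16 * h))"
          proof (rule card_mono[OF B_fin], clarsimp)
            fix z b assume "z \<in> Z" "b \<in> B h"
            then have "b \<otimes> z \<in> B (h + (12 * h + 1))" using ZB by (intro B_mult)
            moreover have "h + (12 * h + 1) \<le> 16 * h" using h(1) by linarith
            ultimately show "b \<otimes> z \<in> B (16 * h)" using B_mono by blast
          qed
          also have "\<dots> \<le> 16 ^ Suc d * card (B h)" by (rule h(2))
          finally have "card Z * card (B h) \<le> 16 ^ Suc d * card (B h)" by (simp only: card_cartesian_product)
          then show "card Z \<le> 16 ^ Suc d" using pos[of h] by simp
        qed
      qed
    qed
  qed
qed

subsection \<open>Subgroups with rational coordinates\<close>

lemma common_denominator:
  assumes "finite S"
  shows "\<exists>c::nat. 0 < c \<and> (\<forall>q\<in>S. of_nat c * (q::rat) \<in> \<int>)"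
  using assms
proof (induction S rule: finite_induct)
  case empty
  then show ?case by (intro exI[of _ 1]) simp
next
  case (insert q S)
  then obtain c where c: "0 < c" "\<forall>q\<in>S. of_nat c * q \<in> \<int>" by blast
  obtain a b where ab: "q = Fract a b" "b > 0" by (cases q) auto
  have bq: "of_nat (nat b) * q = of_int a"
    using ab by (simp add: Fract_of_int_quotient)
  have "of_nat (nat b * c) * q' \<in> \<int>" if "q' \<in> insert q S" for q'
  proof (cases "q' = q")
    case True
    have eq: "of_nat (nat b * c) * q = of_nat c * (of_nat (nat b) * q)" by (simp only: of_nat_mult mult_ac)
    show ?thesis unfolding True eq bq by simp
  next
    case False
    then have "of_nat c * q' \<in> \<int>" using that c by blast
    then have "of_nat (nat b) * (of_nat c * q') \<in> \<int>" by (rule Ints_mult[OF Ints_of_nat])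
    then show ?thesis by (simp only: of_nat_mult mult.assoc)
  qed
  then show ?case using c(1) ab(2) by (intro exI[of _ "nat b * c"]) simp
qed

lemma common_bound:
  assumes "finite S"
  shows "\<exists>r::nat. 0 < r \<and> (\<forall>q\<in>S. \<bar>q::rat\<bar> \<le> of_nat r)"
  using assms
proof (induction S rule: finite_induct)
  case empty
  then show ?case by (intro exI[of _ 1]) simp
next
  case (insert q S)
  then obtain r where r: "0 < r" "\<forall>q\<in>S. \<bar>q\<bar> \<le> of_nat r" by blast
  obtain n where n: "\<bar>q\<bar> \<le> of_nat n" using real_arch_simple[of "\<bar>q\<bar>"] by blast
  have "\<bar>q'\<bar> \<le> of_nat (r + n)" if "q' \<in> insert q S" for q'
  proof (cases "q' = q")
    case True
    then show ?thesis using n by (simp add: add_increasing)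
  next
    case False
    then have "\<bar>q'\<bar> \<le> of_nat r" using that r by blast
    then show ?thesis by (simp add: add_increasing2)
  qed
  then show ?case using r(1) by (intro exI[of _ "r + n"]) simp
qed

text \<open>The boxes are cubes in the lattice of coordinates with common denominator
  \<open>c\<close>. Conjugation by \<open>l\<close> acts by a rational matrix; its denominator
  \<open>a l\<close> and norm \<open>b l\<close> determine the packing constant, while
  \<open>c\<close> and the side of the cubes scale out. Separated points are told apart by residues
  modulo \<open>a l\<close> and by the cells of a grid of the size of the box.\<close>

lemma uniformly_boxed_coordinates:
  fixes G :: "('a, 'm) monoid_scheme" (structure) and lam :: "nat \<Rightarrow> 'a \<Rightarrow> rat"
  assumes "N \<lhd> G"
    and hom: "\<And>i x y. \<lbrakk>i < k; x \<in> N; y \<in> N\<rbrakk> \<Longrightarrow> lam i (x \<otimes> y) = lam i x + lam i y"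
    and inj: "\<And>x y. \<lbrakk>x \<in> N; y \<in> N; \<And>i. i < k \<Longrightarrow> lam i x = lam i y\<rbrakk> \<Longrightarrow> x = y"
    and conj: "\<And>l. l \<in> carrier G \<Longrightarrow> \<exists>A. \<forall>x\<in>N. \<forall>i<k. lam i (l \<otimes> x \<otimes> inv l) = (\<Sum>j<k. A i j * lam j x)"
  shows "uniformly_boxed N G"
proof -
  interpret normal N G by fact
  have lam_one: "lam i \<one> = 0" if "i < k" for i
    using hom[OF that subgroup.one_closed[OF subgroup_axioms] subgroup.one_closed[OF subgroup_axioms]] by simp
  have lam_inv: "lam i (inv x) = - lam i x" if "i < k" "x \<in> N" for i x
    using hom[OF that m_inv_closed[OF that(2)]] lam_one[OF that(1)] that(2) subset
    by (simp add: subset_iff)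
  obtain A where A': "\<forall>l\<in>carrier G. \<forall>x\<in>N. \<forall>i<k. lam i (l \<otimes> x \<otimes> inv l) = (\<Sum>j<k. A l i j * lam j x)"
    using bchoice[of "carrier G" "\<lambda>l A. \<forall>x\<in>N. \<forall>i<k. lam i (l \<otimes> x \<otimes> inv l) = (\<Sum>j<k. A i j * lam j x)"] conj
    by blast
  have A: "lam i (l \<otimes> x \<otimes> inv l) = (\<Sum>j<k. A l i j * lam j x)"
    if "l \<in> carrier G" "x \<in> N" "i < k" for l x i
    by (rule A'[rule_format, OF that])
  have "\<forall>l. \<exists>a::nat. 0 < a \<and> (\<forall>i<k. \<forall>j<k. of_nat a * A l i j \<in> \<int>)"
  proof
    fix l
    have "finite ((\<lambda>(i, j). A l i j) ` ({..<k} \<times> {..<k}))" by simp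
    from common_denominator[OF this] obtain a :: nat where
      "0 < a" "\<forall>q\<in>(\<lambda>(i, j). A l i j) ` ({..<k} \<times> {..<k}). of_nat a * q \<in> \<int>" by (elim exE conjE)
    then show "\<exists>a::nat. 0 < a \<and> (\<forall>i<k. \<forall>j<k. of_nat a * A l i j \<in> \<int>)"
      by (intro exI[of _ a]) force
  qed
  from choice[OF this] obtain a where "\<forall>l. 0 < (a l :: nat) \<and> (\<forall>i<k. \<forall>j<k. of_nat (a l) * A l i j \<in> \<int>)"
    by (elim exE)
  then have a: "\<And>l. 0 < a l" "\<And>l i j. \<lbrakk>i < k; j < k\<rbrakk> \<Longrightarrow> of_nat (a l) * A l i j \<in> \<int>"
    by simp_all
  have "\<forall>l. \<exists>r::nat. \<forall>i<k. \<bar>\<Sum>j<k. \<bar>A l i j\<bar>\<bar> \<le> of_nat r"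
  proof
    fix l
    have "finite ((\<lambda>i. \<Sum>j<k. \<bar>A l i j\<bar>) ` {..<k})" by simp
    from common_bound[OF this] obtain r :: nat where
      "\<forall>q\<in>(\<lambda>i. \<Sum>j<k. \<bar>A l i j\<bar>) ` {..<k}. \<bar>q\<bar> \<le> of_nat r" by (elim exE conjE)
    then show "\<exists>r::nat. \<forall>i<k. \<bar>\<Sum>j<k. \<bar>A l i j\<bar>\<bar> \<le> of_nat r"
      by (intro exI[of _ r]) simp
  qed
  from choice[OF this] obtain b :: "'a \<Rightarrow> nat" where
    b': "\<forall>l. \<forall>i<k. \<bar>\<Sum>j<k. \<bar>A l i j\<bar>\<bar> \<le> of_nat (b l)" by (elim exE)
  have b: "(\<Sum>j<k. \<bar>A l i j\<bar>) \<le> of_nat (b l)" if "i < k" for l i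
    using spec[OF b', of l] that by (simp add: sum_nonneg)
  \<comment> \<open>A bound for coordinates in units of the radius \<open>w\<close> of the box at
    scale \<open>m0\<close>: radius \<open>3 * m0\<close> counts as at most 3 units, and conjugation
    stretches by at most \<open>b l\<close>.\<close>
  define T where "T l = 3 * (1 + int (b l))" for l
  define K where "K l = (a l * nat (2 * T l + 1)) ^ k" for l
  show ?thesis
    unfolding uniformly_boxed_def
  proof (rule exI[of _ k], rule exI[of _ K], intro allI impI)
    fix M W assume MW: "finite M \<and> M \<subseteq> N \<and> finite W \<and> W \<subseteq> carrier G"
    let ?S = "(\<lambda>(i, n). lam i n) ` ({..<k} \<times> M)"
    have fS: "finite ?S" using MW by simp
    obtain c :: nat where c: "0 < c" "\<forall>q\<in>?S. of_nat c * q \<in> \<int>"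
      using common_denominator[OF fS] by blast
    obtain r :: nat where r: "0 < r" "\<forall>q\<in>?S. \<bar>q\<bar> \<le> of_nat r"
      using common_bound[OF fS] by blast
    have c': "of_nat c * lam i n \<in> \<int>" and r': "\<bar>lam i n\<bar> \<le> of_nat r" if "i < k" "n \<in> M" for i n
      using c(2) r(2) that by auto
    define B where "B i = {x \<in> N. \<forall>j<k. of_nat c * lam j x \<in> \<int> \<and> \<bar>lam j x\<bar> \<le> of_nat (r * Suc i)}" for i
    have B_card: "finite (B i) \<and> card (B i) \<le> (3 * c * r) ^ k * Suc i ^ k" for i
    proof -
      define U where "U = PiE {..<k} (\<lambda>_. {- int (c * r * Suc i)..int (c * r * Suc i)})"
      define f where "f x = restrict (\<lambda>j. \<lfloor>of_nat c * lam j x\<rfloor>) {..<k}" for x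
      have fl: "of_int \<lfloor>of_nat c * lam j x\<rfloor> = of_nat c * lam j x" if "x \<in> B i" "j < k" for x j
        using that by (simp add: B_def)
      have inj_f: "inj_on f (B i)"
      proof (rule inj_onI)
        fix x y assume xy: "x \<in> B i" "y \<in> B i" "f x = f y"
        have "lam j x = lam j y" if j: "j < k" for j
        proof -
          have "\<lfloor>of_nat c * lam j x\<rfloor> = \<lfloor>of_nat c * lam j y\<rfloor>"
            using fun_cong[OF xy(3), of j] j by (simp add: f_def)
          then have "of_nat c * lam j x = of_nat c * lam j y"
            using fl[OF xy(1) j] fl[OF xy(2) j] by metis
          then show ?thesis using c(1) by simp
        qed
        then show "x = y" using xy by (intro inj) (auto simp: B_def)
      qed
      have f_U: "f ` B i \<subseteq> U"
      proof
        fix y assume "y \<in> f ` B i"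
        then obtain x where x: "x \<in> B i" "y = f x" by blast
        have "\<lfloor>of_nat c * lam j x\<rfloor> \<in> {- int (c * r * Suc i)..int (c * r * Suc i)}" if j: "j < k" for j
        proof -
          have "\<bar>of_nat c * lam j x\<bar> \<le> of_nat c * of_nat (r * Suc i)"
            unfolding abs_mult using x j by (intro mult_mono) (auto simp: B_def)
          then have "\<bar>of_int \<lfloor>of_nat c * lam j x\<rfloor> :: rat\<bar> \<le> of_int (int (c * r * Suc i))"
            unfolding fl[OF x(1) j] by (simp add: algebra_simps)
          then have "\<bar>\<lfloor>of_nat c * lam j x\<rfloor>\<bar> \<le> int (c * r * Suc i)"
            by (simp only: of_int_le_iff flip: of_int_abs)
          then show ?thesis by auto
        qed
        then show "y \<in> U" unfolding x(2) f_def U_def by (auto simp: PiE_iff)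
      qed
      have "finite U" unfolding U_def by (rule finite_PiE) simp_all
      then have "finite (B i)" "card (B i) \<le> card U"
        using inj_on_finite[OF inj_f f_U] card_inj_on_le[OF inj_f f_U] by simp_all
      moreover have "card U \<le> (3 * c * r) ^ k * Suc i ^ k"
      proof -
        define s where "s = c * r * Suc i"
        have "0 < s" unfolding s_def using c(1) r(1) by (intro mult_pos_pos) simp_all
        then have "nat (2 * int s + 1) \<le> 3 * s" by linarith
        then have "nat (2 * int (c * r * Suc i) + 1) \<le> 3 * c * r * Suc i"
          unfolding s_def by (simp only: mult.assoc)
        moreover have "card U = nat (2 * int (c * r * Suc i) + 1) ^ k"
          unfolding U_def by (simp add: card_PiE del: of_nat_mult of_nat_Suc)
        ultimately show ?thesis
          unfolding power_mult_distrib[symmetric] by (simp only: power_mono)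
      qed
      ultimately show ?thesis by linarith
    qed
    have B_diff: "y \<otimes> inv x \<in> B i"
      if "x \<in> N" "y \<in> N" "\<And>j. j < k \<Longrightarrow> of_nat c * (lam j y - lam j x) \<in> \<int>"
        "\<And>j. j < k \<Longrightarrow> \<bar>lam j y - lam j x\<bar> \<le> of_nat (r * Suc i)" for x y i
    proof -
      have "lam j (y \<otimes> inv x) = lam j y - lam j x" if "j < k" for j
        using hom[OF that \<open>y \<in> N\<close> m_inv_closed[OF \<open>x \<in> N\<close>]] lam_inv[OF that \<open>x \<in> N\<close>] by simp
      then show ?thesis using that by (simp add: B_def)
    qed
    show "\<exists>B C. box_sequence N G M B \<and> (\<forall>i. card (B i) \<le> C * Suc i ^ k) \<and>
        (\<forall>m0. \<exists>m\<ge>m0. \<forall>l\<in>W. packing_bound G B m l (K l))"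
    proof (rule exI[of _ B], rule exI[of _ "(3 * c * r) ^ k"], intro conjI allI)
      show "box_sequence N G M B"
        unfolding box_sequence_def
      proof (intro allI conjI ballI)
        fix i
        show "finite (B i)" using B_card by simp
        show "B i \<subseteq> N" by (auto simp: B_def)
        show "\<one> \<in> B i" using lam_one by (simp add: B_def)
        show "inv x \<in> B i" if "x \<in> B i" for x using that lam_inv by (simp add: B_def)
        have le: "(of_nat (r * Suc i) :: rat) \<le> of_nat (r * Suc (Suc i))"
          by (simp only: of_nat_le_iff) simp
        show "B i \<subseteq> B (Suc i)"
          unfolding B_def using le by (auto intro: order_trans simp del: of_nat_mult of_nat_Suc)
        show "x \<otimes> n \<in> B (Suc i)" if x: "x \<in> B i" and n: "n \<in> M" for x n
        proof -
          have nN: "n \<in> N" and xN: "x \<in> N" using MW n x by (auto simp: B_def)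
          have "of_nat c * lam j (x \<otimes> n) \<in> \<int> \<and> \<bar>lam j (x \<otimes> n)\<bar> \<le> of_nat (r * Suc (Suc i))" if j: "j < k" for j
          proof
            have e: "lam j (x \<otimes> n) = lam j x + lam j n" by (rule hom[OF j xN nN])
            have "of_nat c * lam j x + of_nat c * lam j n \<in> \<int>"
              using x j c'[OF j n] by (intro Ints_add) (simp_all add: B_def)
            then show "of_nat c * lam j (x \<otimes> n) \<in> \<int>" unfolding e by (simp add: distrib_left)
            have "\<bar>lam j x\<bar> \<le> of_nat (r * Suc i)" using x j by (simp add: B_def)
            moreover have "(of_nat (r * Suc (Suc i)) :: rat) = of_nat (r * Suc i) + of_nat r"
              by (simp add: algebra_simps)
            ultimately show "\<bar>lam j (x \<otimes> n)\<bar> \<le> of_nat (r * Suc (Suc i))"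
              unfolding e using r'[OF j n] by linarith
          qed
          then show ?thesis using xN nN by (simp add: B_def)
        qed
      qed
      show "card (B i) \<le> (3 * c * r) ^ k * Suc i ^ k" for i using B_card by simp
      fix m0
      show "\<exists>m\<ge>m0. \<forall>l\<in>W. packing_bound G B m l (K l)"
      proof (rule exI[of _ m0], intro conjI ballI)
        fix l assume "l \<in> W"
        then have l: "l \<in> carrier G" using MW by blast
        show "packing_bound G B m0 l (K l)"
          unfolding packing_bound_def
        proof (intro allI impI, elim conjE)
          fix Z assume Z: "Z \<subseteq> (\<lambda>(b, b'). b \<otimes> l \<otimes> b') ` (B (3 * m0) \<times> B (3 * m0))"
            and sep: "\<forall>z\<in>Z. \<forall>z'\<in>Z. z \<noteq> z' \<longrightarrow> z' \<otimes> inv z \<notin> B m0"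
          define v where "v z j = lam j (z \<otimes> inv l)" for z j
          define w where "w = (of_nat (r * Suc m0) :: rat)"
          have w: "0 < w" using r(1) unfolding w_def by (simp only: of_nat_0_less_iff) simp
          have form: "z \<in> carrier G \<and> z \<otimes> inv l \<in> N \<and>
            (\<forall>j<k. of_nat (a l) * (of_nat c * v z j) \<in> \<int> \<and> \<bar>v z j\<bar> \<le> of_int (T l) * w)" if "z \<in> Z" for z
          proof -
            from subsetD[OF Z that] obtain x y where xy: "x \<in> B (3 * m0)" "y \<in> B (3 * m0)" "z = x \<otimes> l \<otimes> y"
              by (elim imageE SigmaE) simp
            have N: "x \<in> N" "y \<in> N" using xy by (auto simp: B_def)
            have cc: "x \<in> carrier G" "y \<in> carrier G" using N subset by blast+
            have e: "z \<otimes> inv l = x \<otimes> (l \<otimes> y \<otimes> inv l)" unfolding xy(3) using cc l by (simp add: m_assoc)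
            have yN: "l \<otimes> y \<otimes> inv l \<in> N" using N(2) l by (rule inv_op_closed2[rotated])
            have "of_nat (a l) * (of_nat c * v z j) \<in> \<int> \<and> \<bar>v z j\<bar> \<le> of_int (T l) * w" if j: "j < k" for j
            proof
              have v: "v z j = lam j x + (\<Sum>i<k. A l j i * lam i y)"
                unfolding v_def e using hom[OF j N(1) yN] A[OF l N(2) j] by simp
              have "of_nat (a l) * (of_nat c * v z j) = of_nat (a l) * (of_nat c * lam j x) +
                (\<Sum>i<k. (of_nat (a l) * A l j i) * (of_nat c * lam i y))"
                unfolding v by (simp add: distrib_left sum_distrib_left mult_ac)
              also have "\<dots> \<in> \<int>"
              proof (rule Ints_add)
                show "of_nat (a l) * (of_nat c * lam j x) \<in> \<int>"
                  by (rule Ints_mult[OF Ints_of_nat]) (use xy(1) j in \<open>simp add: B_def\<close>)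
                show "(\<Sum>i<k. (of_nat (a l) * A l j i) * (of_nat c * lam i y)) \<in> \<int>"
                proof (rule Ints_sum)
                  fix i assume "i \<in> {..<k}"
                  then show "(of_nat (a l) * A l j i) * (of_nat c * lam i y) \<in> \<int>"
                    using xy(2) by (intro Ints_mult[OF a(2)[OF j]]) (simp_all add: B_def)
                qed
              qed
              finally show "of_nat (a l) * (of_nat c * v z j) \<in> \<int>" .
              define R where "R = (of_nat (r * Suc (3 * m0)) :: rat)"
              have R0: "0 \<le> R" unfolding R_def by simp
              have "\<bar>\<Sum>i<k. A l j i * lam i y\<bar> \<le> (\<Sum>i<k. \<bar>A l j i\<bar> * R)"
                using xy(2) by (intro order_trans[OF sum_abs] sum_mono) (auto simp: abs_mult B_def R_def intro!: mult_left_mono simp del: of_nat_mult of_nat_Suc)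
              also have "\<dots> = (\<Sum>i<k. \<bar>A l j i\<bar>) * R" by (simp add: sum_distrib_right)
              also have "\<dots> \<le> of_nat (b l) * R" using b[OF j] R0 by (rule mult_right_mono)
              finally have "\<bar>\<Sum>i<k. A l j i * lam i y\<bar> \<le> of_nat (b l) * R" .
              moreover have "\<bar>lam j x\<bar> \<le> R" using xy(1) j by (simp add: B_def R_def)
              ultimately have "\<bar>v z j\<bar> \<le> R + of_nat (b l) * R" unfolding v by linarith
              also have "\<dots> = (1 + of_nat (b l)) * R" by (simp add: distrib_right)
              also have "\<dots> \<le> (1 + of_nat (b l)) * (3 * w)"
              proof (rule mult_left_mono)
                have "r * Suc (3 * m0) \<le> 3 * (r * Suc m0)" by simp
                then have "(of_nat (r * Suc (3 * m0)) :: rat) \<le> of_nat (3 * (r * Suc m0))"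
                  by (simp only: of_nat_le_iff)
                then show "R \<le> 3 * w" unfolding R_def w_def by simp
              qed simp
              also have "\<dots> = of_int (T l) * w" by (simp add: T_def)
              finally show "\<bar>v z j\<bar> \<le> of_int (T l) * w" .
            qed
            then show ?thesis using cc l N(1) yN xy(3) unfolding e by simp
          qed
          \<comment> \<open>Equal residues make a difference of coordinates a multiple of
            \<open>1 / c\<close>, equal cells make it at most \<open>w\<close>; together they put
            the difference of two points into \<open>B m0\<close>.\<close>
          define key where "key z = (\<lambda>j\<in>{..<k}. (\<lfloor>of_nat (a l) * (of_nat c * v z j)\<rfloor> mod int (a l), \<lfloor>v z j / w\<rfloor>))" for z
          have eq: "z = z'" if z: "z \<in> Z" "z' \<in> Z" "key z = key z'" for z z'
          proof (rule ccontr)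
            assume "z \<noteq> z'"
            have cc: "z \<in> carrier G" "z' \<in> carrier G" and N: "z \<otimes> inv l \<in> N" "z' \<otimes> inv l \<in> N"
              using form z by blast+
            have "(z' \<otimes> inv l) \<otimes> inv (z \<otimes> inv l) \<in> B m0"
            proof (rule B_diff[OF N])
              fix j assume j: "j < k"
              have k1: "\<lfloor>of_nat (a l) * (of_nat c * v z j)\<rfloor> mod int (a l) = \<lfloor>of_nat (a l) * (of_nat c * v z' j)\<rfloor> mod int (a l)"
                and k2: "\<lfloor>v z j / w\<rfloor> = \<lfloor>v z' j / w\<rfloor>"
                using fun_cong[OF z(3), of j] j by (simp_all add: key_def)
              have i: "of_int \<lfloor>of_nat (a l) * (of_nat c * v z j)\<rfloor> = of_nat (a l) * (of_nat c * v z j)"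
                "of_int \<lfloor>of_nat (a l) * (of_nat c * v z' j)\<rfloor> = of_nat (a l) * (of_nat c * v z' j)"
                using form[OF z(1)] form[OF z(2)] j by simp_all
              have "int (a l) dvd \<lfloor>of_nat (a l) * (of_nat c * v z' j)\<rfloor> - \<lfloor>of_nat (a l) * (of_nat c * v z j)\<rfloor>"
                using k1[symmetric] by (simp only: mod_eq_dvd_iff)
              then obtain q where "\<lfloor>of_nat (a l) * (of_nat c * v z' j)\<rfloor> - \<lfloor>of_nat (a l) * (of_nat c * v z j)\<rfloor> = int (a l) * q"
                by (elim dvdE)
              then have "of_int (\<lfloor>of_nat (a l) * (of_nat c * v z' j)\<rfloor> - \<lfloor>of_nat (a l) * (of_nat c * v z j)\<rfloor>) =
                (of_int (int (a l) * q) :: rat)" by (simp only:)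
              then have "of_nat (a l) * (of_nat c * (v z' j - v z j)) = of_nat (a l) * of_int q"
                unfolding of_int_diff i by (simp add: algebra_simps)
              then have "of_nat c * (v z' j - v z j) = of_int q" using a(1)[of l] by simp
              then show "of_nat c * (lam j (z' \<otimes> inv l) - lam j (z \<otimes> inv l)) \<in> \<int>"
                unfolding v_def by simp
              have "\<bar>v z' j / w - v z j / w\<bar> \<le> 1"
                using k2 floor_correct[of "v z j / w"] floor_correct[of "v z' j / w"] by linarith
              then have "\<bar>v z' j - v z j\<bar> / w \<le> 1"
                using w by (simp add: diff_divide_distrib[symmetric])
              then show "\<bar>lam j (z' \<otimes> inv l) - lam j (z \<otimes> inv l)\<bar> \<le> of_nat (r * Suc m0)"
                using w unfolding v_def w_def[symmetric] by (simp add: divide_le_eq)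
            qed
            moreover have "(z' \<otimes> inv l) \<otimes> inv (z \<otimes> inv l) = z' \<otimes> inv z"
              using cc l by (simp add: inv_mult_group m_assoc inv_cancel)
            ultimately show False using sep z(1,2) \<open>z \<noteq> z'\<close> by simp
          qed
          have "card Z \<le> card (PiE {..<k} (\<lambda>_. {0..<int (a l)} \<times> {- T l..T l}))"
          proof (rule card_le_if_keyed[where key = key])
            show "finite (PiE {..<k} (\<lambda>_. {0..<int (a l)} \<times> {- T l..T l}))" by (rule finite_PiE) simp_all
            show "key ` Z \<subseteq> PiE {..<k} (\<lambda>_. {0..<int (a l)} \<times> {- T l..T l})"
            proof (rule image_subsetI)
              fix z assume z: "z \<in> Z"
              have "\<lfloor>v z j / w\<rfloor> \<in> {- T l..T l}" if j: "j < k" for j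
              proof -
                have "\<bar>v z j\<bar> \<le> of_int (T l) * w" using form[OF z] j by blast
                then have "\<bar>v z j / w\<bar> \<le> of_int (T l)" using w by (simp add: divide_le_eq)
                then have "of_int (- T l) \<le> v z j / w" "v z j / w \<le> of_int (T l)" by linarith+
                then have "- T l \<le> \<lfloor>v z j / w\<rfloor>" "\<lfloor>v z j / w\<rfloor> \<le> T l"
                  by (simp_all only: le_floor_iff floor_le_iff)
                then show ?thesis by simp
              qed
              then show "key z \<in> PiE {..<k} (\<lambda>_. {0..<int (a l)} \<times> {- T l..T l})"
                unfolding key_def using a(1)[of l] by (auto simp: PiE_iff)
            qed
          qed (rule eq)
          also have "\<dots> = K l"
            by (simp add: card_PiE card_cartesian_product K_def T_def algebra_simps)
          finally show "card Z \<le> K l" .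
        qed
      qed simp
    qed
  qed
qed

subsection \<open>Torsion-free abelian groups of finite rational rank\<close>

text \<open>The elements killed by \<open>a \<mapsto> 1 \<otimes> a\<close> are torsion. In place of
  division in the group, the homomorphism \<open>e m\<close> sends the generator
  \<open>(p, a)\<close> to the power of \<open>a\<close> with exponent
  \<open>\<lfloor>m * p\<rfloor>\<close>. It kills a given relation whenever \<open>m\<close> clears
  the denominators involved, so for each element of the relation subgroup there is some
  \<open>n\<close> such that \<open>e m\<close> kills it for all multiples \<open>m\<close> of
  \<open>n\<close>.\<close>

lemma (in comm_group) rat_tensor_relations_torsion:
  assumes a: "a \<in> carrier G" and rel: "frag_of (1, a) \<in> rat_tensor_relations G"
  shows "\<exists>n::nat. 0 < n \<and> a [^] n = \<one>"
proof -
  let ?F = "rat_tensor_free G"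
  interpret F: comm_group ?F by (rule abelian_free_Abelian_group)
  let ?f = "\<lambda>m (p, a). a [^] \<lfloor>of_nat m * p\<rfloor>"
  have "\<forall>m::nat. \<exists>h. h \<in> hom ?F G \<and> (\<forall>p a. a \<in> carrier G \<longrightarrow> h (frag_of (p, a)) = a [^] \<lfloor>of_nat m * p\<rfloor>)"
  proof
    fix m :: nat
    have "?f m ` (UNIV \<times> carrier G) \<subseteq> carrier G" by auto
    then obtain h where "h \<in> hom ?F G" "\<And>x. x \<in> UNIV \<times> carrier G \<Longrightarrow> h (frag_of x) = ?f m x"
      by (rule free_Abelian_group_universal) blast
    then show "\<exists>h. h \<in> hom ?F G \<and> (\<forall>p a. a \<in> carrier G \<longrightarrow> h (frag_of (p, a)) = a [^] \<lfloor>of_nat m * p\<rfloor>)"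
      by (intro exI[of _ h]) simp
  qed
  from choice[OF this] obtain e where e: "\<forall>m::nat. e m \<in> hom ?F G \<and>
      (\<forall>p a. a \<in> carrier G \<longrightarrow> e m (frag_of (p, a)) = a [^] \<lfloor>of_nat m * p\<rfloor>)" by (elim exE)
  have e_hom: "group_hom ?F G (e m)" for m
    using e by unfold_locales blast
  have e_frag: "e m (frag_of (p, a)) = a [^] \<lfloor>of_nat m * p\<rfloor>" if "a \<in> carrier G" for m p a
    using e that by blast
  have keys: "frag_of (p, a) \<in> carrier ?F" if "a \<in> carrier G" for p a
    using that by simp
  have e_diff: "e m (frag_of (p, x) - frag_of (q, y) - frag_of (r, z)) =
      x [^] \<lfloor>of_nat m * p\<rfloor> \<otimes> inv (y [^] \<lfloor>of_nat m * q\<rfloor>) \<otimes> inv (z [^] \<lfloor>of_nat m * r\<rfloor>)"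
    if "x \<in> carrier G" "y \<in> carrier G" "z \<in> carrier G" for m p q r x y z
  proof -
    interpret e: group_hom ?F G "e m" by (rule e_hom)
    have "frag_of (p, x) - frag_of (q, y) - frag_of (r, z) =
      frag_of (p, x) \<otimes>\<^bsub>?F\<^esub> inv\<^bsub>?F\<^esub> frag_of (q, y) \<otimes>\<^bsub>?F\<^esub> inv\<^bsub>?F\<^esub> frag_of (r, z)"
      using that by (simp add: inv_free_Abelian_group)
    then show ?thesis
      using that keys by (simp only: e.hom_mult e.hom_inv F.m_closed F.inv_closed e_frag)
  qed
  \<comment> \<open>Quantifying over all multiples of \<open>n\<close> makes the claim stable under
    products: two elements share the multiple \<open>n1 * n2\<close>.\<close>
  have "\<exists>n::nat. 0 < n \<and> (\<forall>k::nat. e (n * k) x = \<one>)"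
    if "x \<in> rat_tensor_relations G" for x
  proof -
    note gens = rat_tensor_relations_generators[OF is_monoid]
    have rel_car: "rat_tensor_relations G \<subseteq> carrier ?F"
      using subgroup.subset[OF subgroup_rat_tensor_relations[OF is_monoid]] .
    have g: "\<exists>n::nat. 0 < n \<and> (\<forall>k::nat. e (n * k) h = \<one>)"
      if "h \<in> {frag_of (p + q, a) - frag_of (p, a) - frag_of (q, a) | p q a. a \<in> carrier G} \<union>
       {frag_of (p, a \<otimes> b) - frag_of (p, a) - frag_of (p, b) | p a b. a \<in> carrier G \<and> b \<in> carrier G}" for h
      using that
    proof
      assume "h \<in> {frag_of (p + q, a) - frag_of (p, a) - frag_of (q, a) | p q a. a \<in> carrier G}"
      then obtain p q a where h: "h = frag_of (p + q, a) - frag_of (p, a) - frag_of (q, a)" "a \<in> carrier G"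
        by blast
      obtain n :: nat where n: "0 < n" "\<forall>r\<in>{p, q}. of_nat n * r \<in> \<int>"
        using common_denominator[of "{p, q}"] by (elim meta_impE exE conjE) auto
      have "e (n * k) h = \<one>" for k
      proof -
        have "of_nat (n * k) * r \<in> \<int>" if "r \<in> {p, q}" for r
        proof -
          have "of_nat k * (of_nat n * r) \<in> \<int>" by (rule Ints_mult[OF Ints_of_nat bspec[OF n(2) that]])
          moreover have "of_nat k * (of_nat n * r) = of_nat (n * k) * r" by (simp only: of_nat_mult mult_ac)
          ultimately show ?thesis by simp
        qed
        then obtain i j where ij: "of_nat (n * k) * p = of_int i" "of_nat (n * k) * q = of_int j"
          unfolding Ints_def by blast
        have fl: "\<lfloor>of_nat (n * k) * (p + q)\<rfloor> = j + i"
          unfolding distrib_left ij by simp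
        show ?thesis
          unfolding h(1) e_diff[OF h(2) h(2) h(2)] fl unfolding ij floor_of_int
          using h(2) by (simp add: int_pow_mult mult_inv_cancel)
      qed
      then show ?thesis using n(1) by blast
    next
      assume "h \<in> {frag_of (p, a \<otimes> b) - frag_of (p, a) - frag_of (p, b) | p a b. a \<in> carrier G \<and> b \<in> carrier G}"
      then obtain p a b where h: "h = frag_of (p, a \<otimes> b) - frag_of (p, a) - frag_of (p, b)"
        "a \<in> carrier G" "b \<in> carrier G" by blast
      have "e (1 * k) h = \<one>" for k
      proof -
        have c: "a \<otimes> b \<in> carrier G" using h by simp
        define i where "i = \<lfloor>of_nat (1 * k) * p\<rfloor>"
        have "(a \<otimes> b) [^] i = b [^] i \<otimes> a [^] i"
          using h by (simp add: int_pow_mult_distrib m_comm)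
        then show ?thesis
          unfolding h(1) e_diff[OF c h(2,3)] i_def[symmetric] using h(2,3)
          by (simp add: mult_inv_cancel)
      qed
      then show ?thesis by (intro exI[of _ 1]) blast
    qed
    show ?thesis
      using that unfolding rat_tensor_relations_def
    proof (induction rule: generate.induct)
      case one
      show ?case
        using group_hom.hom_one[OF e_hom] by (intro exI[of _ 1]) blast
    next
      case (incl h)
      then show ?case by (rule g)
    next
      case (inv h)
      have "h \<in> carrier ?F" by (rule subsetD[OF gens inv])
      then have "e m (inv\<^bsub>?F\<^esub> h) = inv (e m h)" for m by (rule group_hom.hom_inv[OF e_hom])
      moreover obtain n :: nat where "0 < n" "\<forall>k. e (n * k) h = \<one>"
        using g[OF inv] by (elim exE conjE)
      ultimately show ?case by (intro exI[of _ n]) simp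
    next
      case (eng h1 h2)
      have c: "h1 \<in> carrier ?F" "h2 \<in> carrier ?F"
        by (rule subsetD[OF rel_car], unfold rat_tensor_relations_def, rule eng.hyps)+
      obtain n1 :: nat where n1: "0 < n1" "\<forall>k. e (n1 * k) h1 = \<one>"
        using eng.IH(1) by (elim exE conjE)
      obtain n2 :: nat where n2: "0 < n2" "\<forall>k. e (n2 * k) h2 = \<one>"
        using eng.IH(2) by (elim exE conjE)
      note n = n1 n2
      have "e (n1 * n2 * k) (h1 \<otimes>\<^bsub>?F\<^esub> h2) = \<one>" for k
      proof -
        have "e (n1 * n2 * k) h1 = \<one>" "e (n1 * n2 * k) h2 = \<one>"
          using spec[OF n(2), of "n2 * k"] spec[OF n(4), of "n1 * k"] by (simp_all add: mult_ac)
        then show ?thesis unfolding group_hom.hom_mult[OF e_hom c] by simp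
      qed
      then show ?case using n(1,3) by (intro exI[of _ "n1 * n2"]) simp
    qed
  qed
  from this[OF rel] obtain n where n: "0 < (n::nat)" "\<forall>k. e (n * k) (frag_of (1, a)) = \<one>" by blast
  then have "a [^] int n = \<one>"
    using e_frag[OF a, of n 1] spec[OF n(2), of 1] by simp
  then show ?thesis using n(1) by (intro exI[of _ n]) (simp add: int_pow_int)
qed

definition (in comm_group) int_independent :: "nat \<Rightarrow> (nat \<Rightarrow> 'a) \<Rightarrow> bool" where
  "int_independent k f \<longleftrightarrow> (\<forall>j<k. f j \<in> carrier G) \<and>
     (\<forall>c::nat \<Rightarrow> int. (\<Otimes>j\<in>{..<k}. f j [^] c j) = \<one> \<longrightarrow> (\<forall>j<k. c j = 0))"

text \<open>The map \<open>\<iota>\<close>, that is \<open>a \<mapsto> 1 \<otimes> a\<close>, is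
  injective for torsion-free \<open>G\<close>. A linear dependence among images becomes an integral
  relation after multiplication by a common denominator, so independent families stay independent
  and a finite spanning set bounds their length.\<close>

lemma (in comm_group) int_independent_bounded:
  assumes tf: "torsion_free G" and rank: "rational_rank G < \<infinity>"
  shows "\<exists>d. \<forall>k f. int_independent k f \<longrightarrow> k \<le> d"
proof -
  let ?V = "rat_tensor G" and ?F = "rat_tensor_free G" and ?R = "rat_tensor_relations G"
  interpret F: comm_group ?F by (rule abelian_free_Abelian_group)
  interpret V: vectorspace rat_field ?V by (rule vectorspace_rat_tensor[OF comm_group_axioms])
  have VA: "group (add_monoid ?V)"
    by (rule abelian_group.a_group) (rule module.axioms(2), rule V.module_axioms)
  have r_cancel: "x = y" if "x \<oplus>\<^bsub>?V\<^esub> z = y \<oplus>\<^bsub>?V\<^esub> z" "x \<in> carrier ?V" "y \<in> carrier ?V" "z \<in> carrier ?V" for x y z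
    using group.right_cancel[OF VA, of z x y] that by simp
  have sub: "subgroup ?R ?F" by (rule subgroup_rat_tensor_relations[OF is_monoid])
  have norm: "?R \<lhd> ?F" using sub by (simp add: F.normal_iff_subgroup)
  have "V.fin_dim"
    using rank unfolding rational_rank_def by (simp split: if_splits)
  then obtain A where A: "finite A" "A \<subseteq> carrier ?V" "V.gen_set A" unfolding V.fin_dim_def by blast
  define \<iota> where "\<iota> a = ?R #>\<^bsub>?F\<^esub> frag_of (1, a)" for a
  have V_carrier: "carrier ?V = (\<lambda>x. ?R #>\<^bsub>?F\<^esub> x) ` carrier ?F"
    by (simp add: rat_tensor_def Let_def carrier_FactGroup)
  have V_add: "(?R #>\<^bsub>?F\<^esub> x) \<oplus>\<^bsub>?V\<^esub> (?R #>\<^bsub>?F\<^esub> y) = ?R #>\<^bsub>?F\<^esub> (x \<otimes>\<^bsub>?F\<^esub> y)"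
    if "x \<in> carrier ?F" "y \<in> carrier ?F" for x y
    using normal.rcos_sum[OF norm that] by (simp add: rat_tensor_def Let_def)
  have \<iota>_closed: "\<iota> a \<in> carrier ?V" if "a \<in> carrier G" for a
    unfolding \<iota>_def V_carrier using that by (intro imageI) simp
  have \<iota>_hom: "\<iota> (a \<otimes> b) = \<iota> a \<oplus>\<^bsub>?V\<^esub> \<iota> b" if ab: "a \<in> carrier G" "b \<in> carrier G" for a b
  proof -
    have c: "frag_of (1, a) \<in> carrier ?F" "frag_of (1, b) \<in> carrier ?F" "frag_of (1, a \<otimes> b) \<in> carrier ?F"
      using ab by simp_all
    have "frag_of (1, a \<otimes> b) - frag_of (1, a) - frag_of (1, b) \<in> ?R"
      unfolding rat_tensor_relations_def using ab by (intro generate.incl) blast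
    then have "(frag_of (1, a \<otimes> b) - frag_of (1, a) - frag_of (1, b)) \<otimes>\<^bsub>?F\<^esub> (frag_of (1, a) \<otimes>\<^bsub>?F\<^esub> frag_of (1, b))
      \<in> ?R #>\<^bsub>?F\<^esub> (frag_of (1, a) \<otimes>\<^bsub>?F\<^esub> frag_of (1, b))"
      unfolding r_coset_def by blast
    then have "frag_of (1, a \<otimes> b) \<in> ?R #>\<^bsub>?F\<^esub> (frag_of (1, a) \<otimes>\<^bsub>?F\<^esub> frag_of (1, b))"
      by simp
    then have "?R #>\<^bsub>?F\<^esub> (frag_of (1, a) \<otimes>\<^bsub>?F\<^esub> frag_of (1, b)) = ?R #>\<^bsub>?F\<^esub> frag_of (1, a \<otimes> b)"
      using F.repr_independence[OF _ F.m_closed[OF c(1,2)] sub] by blast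
    then show ?thesis unfolding \<iota>_def using V_add[OF c(1,2)] by simp
  qed
  have \<iota>_one: "\<iota> \<one> = \<zero>\<^bsub>?V\<^esub>"
  proof -
    have "\<iota> \<one> \<oplus>\<^bsub>?V\<^esub> \<iota> \<one> = \<zero>\<^bsub>?V\<^esub> \<oplus>\<^bsub>?V\<^esub> \<iota> \<one>"
      using \<iota>_hom[of \<one> \<one>] \<iota>_closed[of \<one>] by simp
    then show ?thesis by (rule r_cancel) (simp_all add: \<iota>_closed)
  qed
  have \<iota>_zero: "a = \<one>" if a: "a \<in> carrier G" "\<iota> a = \<zero>\<^bsub>?V\<^esub>" for a
  proof -
    have "?R #>\<^bsub>?F\<^esub> frag_of (1, a) = ?R"
      using a(2) unfolding \<iota>_def by (simp add: rat_tensor_def Let_def)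
    then have "frag_of (1, a) \<in> ?R"
      using F.rcos_self[OF _ sub, of "frag_of (1, a)"] a(1) by simp
    from rat_tensor_relations_torsion[OF a(1) this] obtain n :: nat where "0 < n" "a [^] n = \<one>" by blast
    then show ?thesis using tf a(1) unfolding torsion_free_def by (metis One_nat_def Suc_leI)
  qed
  have \<iota>_inj: "a = b" if "a \<in> carrier G" "b \<in> carrier G" "\<iota> a = \<iota> b" for a b
  proof -
    have "\<iota> (a \<otimes> inv b) \<oplus>\<^bsub>?V\<^esub> \<iota> b = \<iota> a"
      using that \<iota>_hom[of "a \<otimes> inv b" b] by (simp add: mult_inv_cancel)
    then have "\<iota> (a \<otimes> inv b) \<oplus>\<^bsub>?V\<^esub> \<iota> b = \<zero>\<^bsub>?V\<^esub> \<oplus>\<^bsub>?V\<^esub> \<iota> b"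
      using that \<iota>_closed by simp
    then have "\<iota> (a \<otimes> inv b) = \<zero>\<^bsub>?V\<^esub>"
      by (rule r_cancel) (simp_all add: \<iota>_closed that)
    then have "a \<otimes> inv b = \<one>" using \<iota>_zero that by simp
    then show ?thesis using that neq_inv_mult[of b a] by blast
  qed
  have K: "carrier rat_field = UNIV" "\<And>p q. p \<oplus>\<^bsub>rat_field\<^esub> q = p + q" "\<And>p q. p \<otimes>\<^bsub>rat_field\<^esub> q = p * q"
    "\<zero>\<^bsub>rat_field\<^esub> = 0" "\<one>\<^bsub>rat_field\<^esub> = 1" by (simp_all add: rat_field_def)
  have nat_smult: "of_nat n \<odot>\<^bsub>?V\<^esub> v = add_pow ?V n v" if "v \<in> carrier ?V" for n v
  proof (induction n)
    case 0
    then show ?case using V.smult_l_null[OF that] by (simp add: K)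
  next
    case (Suc n)
    have "of_nat (Suc n) \<odot>\<^bsub>?V\<^esub> v = (of_nat n \<oplus>\<^bsub>rat_field\<^esub> \<one>\<^bsub>rat_field\<^esub>) \<odot>\<^bsub>?V\<^esub> v"
      by (simp add: K add.commute)
    also have "\<dots> = of_nat n \<odot>\<^bsub>?V\<^esub> v \<oplus>\<^bsub>?V\<^esub> v"
      using that V.smult_l_distr[of "of_nat n" "\<one>\<^bsub>rat_field\<^esub>" v] by (simp add: K(1))
    finally show ?case using Suc that by simp
  qed
  have nat_\<iota>: "of_nat n \<odot>\<^bsub>?V\<^esub> \<iota> a = \<iota> (a [^] n)" if "a \<in> carrier G" for n :: nat and a
    unfolding nat_smult[OF \<iota>_closed[OF that]]
    using that \<iota>_one by (induction n) (simp_all add: \<iota>_hom)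
  have int_\<iota>: "of_int n \<odot>\<^bsub>?V\<^esub> \<iota> a = \<iota> (a [^] n)" if a: "a \<in> carrier G" for n :: int and a
  proof (cases n)
    case (nonneg m)
    then show ?thesis using nat_\<iota>[OF a, of m] by (simp add: int_pow_int)
  next
    case (neg m)
    have "of_int n \<odot>\<^bsub>?V\<^esub> \<iota> a \<oplus>\<^bsub>?V\<^esub> \<iota> (a [^] Suc m) = (of_int n \<oplus>\<^bsub>rat_field\<^esub> of_nat (Suc m)) \<odot>\<^bsub>?V\<^esub> \<iota> a"
      using V.smult_l_distr[of "of_int n" "of_nat (Suc m)" "\<iota> a"] \<iota>_closed[OF a] nat_\<iota>[OF a, of "Suc m"]
      by (simp only: K(1) UNIV_I simp_thms)
    also have "\<dots> = \<zero>\<^bsub>?V\<^esub>" using neg V.smult_l_null[OF \<iota>_closed[OF a]] by (simp add: K)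
    also have "\<zero>\<^bsub>?V\<^esub> = \<iota> (a [^] n \<otimes> a [^] Suc m)"
      using neg a \<iota>_one by (simp add: int_pow_neg_int del: nat_pow_Suc of_nat_Suc)
    also have "\<dots> = \<iota> (a [^] n) \<oplus>\<^bsub>?V\<^esub> \<iota> (a [^] Suc m)"
      using a by (intro \<iota>_hom) simp_all
    finally show ?thesis
    proof (rule r_cancel)
      show "of_int n \<odot>\<^bsub>?V\<^esub> \<iota> a \<in> carrier ?V"
        using V.smult_closed[of "of_int n" "\<iota> a"] \<iota>_closed[OF a] by (simp add: K(1))
    qed (intro \<iota>_closed int_pow_closed nat_pow_closed a)+
  qed
  have \<iota>_finprod: "\<iota> (\<Otimes>j\<in>{..<k}. g j) = (\<Oplus>\<^bsub>?V\<^esub>j\<in>{..<k}. \<iota> (g j))"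
    if "\<And>j. j < k \<Longrightarrow> g j \<in> carrier G" for g and k :: nat
    using that
  proof (induction k)
    case 0
    then show ?case by (simp add: \<iota>_one)
  next
    case (Suc k)
    then have "\<iota> (g k \<otimes> (\<Otimes>j\<in>{..<k}. g j)) = \<iota> (g k) \<oplus>\<^bsub>?V\<^esub> (\<Oplus>\<^bsub>?V\<^esub>j\<in>{..<k}. \<iota> (g j))"
      by (subst \<iota>_hom) (auto intro: finprod_closed)
    then show ?case using Suc.prems \<iota>_closed by (simp add: lessThan_Suc Pi_def)
  qed
  have "k \<le> card A" if ind: "int_independent k f" for k f
  proof -
    have f: "f j \<in> carrier G" if "j < k" for j using ind that unfolding int_independent_def by blast
    have indep: "c j = 0" if "(\<Otimes>j\<in>{..<k}. f j [^] c j) = \<one>" "j < k" for c :: "nat \<Rightarrow> int" and j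
      using ind that unfolding int_independent_def by blast
    have f_inj: "inj_on f {..<k}"
    proof (rule inj_onI, rule ccontr)
      fix i j assume ij: "i \<in> {..<k}" "j \<in> {..<k}" "f i = f j" "i \<noteq> j"
      define c where "c l = (if l = i then 1 else if l = j then -1 else 0 :: int)" for l
      have "(\<Otimes>l\<in>{..<k}. f l [^] c l) = (\<Otimes>l\<in>{i, j}. f l [^] c l)"
        using ij f by (intro finprod_mono_neutral_cong_right) (auto simp: c_def)
      also have "\<dots> = \<one>" using ij f by (simp add: c_def int_pow_neg Pi_def)
      finally have "c i = 0" using indep[of c i] ij by simp
      then show False by (simp add: c_def)
    qed
    have \<iota>f_inj: "inj_on (\<lambda>j. \<iota> (f j)) {..<k}"
      using f_inj \<iota>_inj f unfolding inj_on_def by auto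
    define S where "S = (\<lambda>j. \<iota> (f j)) ` {..<k}"
    have S: "finite S" "S \<subseteq> carrier ?V" using f \<iota>_closed by (auto simp: S_def)
    have "V.lin_indpt S"
    proof
      assume "V.lin_dep S"
      from V.finite_lin_dep[OF S(1) this S(2)] obtain a v where
        a: "V.lincomb a S = \<zero>\<^bsub>?V\<^esub>" "v \<in> S" "a v \<noteq> 0" by (auto simp: K)
      obtain j0 where j0: "j0 < k" "v = \<iota> (f j0)" using a(2) by (auto simp: S_def)
      have "finite (a ` S)" using S(1) by simp
      from common_denominator[OF this] obtain m :: nat where m: "0 < m" "\<forall>q\<in>a ` S. of_nat m * q \<in> \<int>" by blast
      define c where "c j = \<lfloor>of_nat m * a (\<iota> (f j))\<rfloor>" for j
      have c: "of_int (c j) = of_nat m * a (\<iota> (f j))" if "j < k" for j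
        using m(2) that unfolding c_def S_def by simp
      have "\<zero>\<^bsub>?V\<^esub> = of_nat m \<odot>\<^bsub>?V\<^esub> V.lincomb a S"
        unfolding a(1) using V.smult_r_null[of "of_nat m"] by (simp add: K)
      also have "\<dots> = V.lincomb (\<lambda>u. of_nat m \<otimes>\<^bsub>rat_field\<^esub> a u) S"
        using S(2) by (intro V.lincomb_distrib) (simp_all add: K)
      also have "\<dots> = (\<Oplus>\<^bsub>?V\<^esub>j\<in>{..<k}. (of_nat m * a (\<iota> (f j))) \<odot>\<^bsub>?V\<^esub> \<iota> (f j))"
        unfolding V.lincomb_def S_def K using \<iota>f_inj f \<iota>_closed
        by (subst V.M.finsum_reindex) (auto simp: K Pi_def intro!: V.smult_closed)
      also have "\<dots> = (\<Oplus>\<^bsub>?V\<^esub>j\<in>{..<k}. \<iota> (f j [^] c j))"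
        using f \<iota>_closed by (intro V.M.finsum_cong') (auto simp: c[symmetric] int_\<iota>)
      also have "\<dots> = \<iota> (\<Otimes>j\<in>{..<k}. f j [^] c j)"
        using f by (intro \<iota>_finprod[symmetric]) simp
      finally have "(\<Otimes>j\<in>{..<k}. f j [^] c j) = \<one>"
        using f by (intro \<iota>_zero) (auto intro!: finprod_closed)
      then have "c j0 = 0" using indep j0(1) by blast
      then show False using c[OF j0(1)] m(1) a(3) j0(2) by simp
    qed
    then have "card S \<le> card A" using V.li_smaller_than_gen S A by blast
    moreover have "card S = k" unfolding S_def using \<iota>f_inj by (simp add: card_image)
    ultimately show ?thesis by simp
  qed
  then show ?thesis by blast
qed

lemma (in comm_group) finprod_int_pow_mult:
  assumes "\<And>j. j < k \<Longrightarrow> f j \<in> carrier G"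
  shows "(\<Otimes>j\<in>{..<k::nat}. f j [^] (c j :: int)) \<otimes> (\<Otimes>j\<in>{..<k}. f j [^] (c' j :: int)) =
    (\<Otimes>j\<in>{..<k}. f j [^] (c j + c' j))"
proof -
  have "(\<Otimes>j\<in>{..<k}. f j [^] (c j + c' j)) = (\<Otimes>j\<in>{..<k}. f j [^] c j \<otimes> f j [^] c' j)"
    using assms by (intro finprod_cong') (auto simp: int_pow_mult)
  also have "\<dots> = (\<Otimes>j\<in>{..<k}. f j [^] c j) \<otimes> (\<Otimes>j\<in>{..<k}. f j [^] c' j)"
    using assms by (intro finprod_multf) auto
  finally show ?thesis by simp
qed

lemma (in comm_group) finprod_int_pow_pow:
  assumes "\<And>j. j < k \<Longrightarrow> f j \<in> carrier G"
  shows "(\<Otimes>j\<in>{..<k::nat}. f j [^] (c j :: int)) [^] (n::int) = (\<Otimes>j\<in>{..<k}. f j [^] (c j * n))"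
  using assms
proof (induction k)
  case (Suc k)
  then have c: "f k [^] c k \<in> carrier G" "(\<Otimes>j\<in>{..<k}. f j [^] c j) \<in> carrier G"
    by (auto intro!: finprod_closed)
  have "(\<Otimes>j\<in>{..<Suc k}. f j [^] c j) = f k [^] c k \<otimes> (\<Otimes>j\<in>{..<k}. f j [^] c j)" for c :: "nat \<Rightarrow> int"
    unfolding lessThan_Suc using Suc.prems by (intro finprod_insert) auto
  then show ?case
    using c Suc by (simp add: int_pow_mult_distrib m_comm int_pow_pow)
qed simp

text \<open>With a maximal independent family \<open>f\<close>, each \<open>x\<close> has a positive
  power that is a product of powers of the \<open>f j\<close>; the coordinates of \<open>x\<close>
  are these exponents divided by the exponent of \<open>x\<close>. They determine \<open>x\<close>
  because there is no torsion. An endomorphism is linear in the coordinates, with matrix read off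
  from the images of the \<open>f j\<close>.\<close>

lemma (in comm_group) rational_coordinates:
  assumes tf: "torsion_free G" and bounded: "\<exists>d. \<forall>k f. int_independent k f \<longrightarrow> k \<le> d"
  shows "\<exists>(k::nat) f lam. (\<forall>j<k. f j \<in> carrier G) \<and>
    (\<forall>i<k. \<forall>x\<in>carrier G. \<forall>y\<in>carrier G. lam i (x \<otimes> y) = lam i x + (lam i y :: rat)) \<and>
    (\<forall>x\<in>carrier G. \<forall>y\<in>carrier G. (\<forall>i<k. lam i x = lam i y) \<longrightarrow> x = y) \<and>
    (\<forall>\<alpha>\<in>hom G G. \<forall>x\<in>carrier G. \<forall>i<k. lam i (\<alpha> x) = (\<Sum>j<k. lam i (\<alpha> (f j)) * lam j x))"
proof -
  obtain d where d: "\<And>k f. int_independent k f \<Longrightarrow> k \<le> d" using bounded by blast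
  define k where "k = (LEAST k. \<not> (\<exists>f. int_independent (Suc k) f))"
  have "\<not> (\<exists>f. int_independent (Suc d) f)" using d[of "Suc d"] by auto
  then have max: "\<not> int_independent (Suc k) f" for f
    unfolding k_def using LeastI[of "\<lambda>k. \<not> (\<exists>f. int_independent (Suc k) f)" d] by blast
  have "\<exists>f. int_independent k f"
  proof (cases k)
    case 0
    then show ?thesis by (simp add: int_independent_def)
  next
    case (Suc k')
    then have "k' < k" by simp
    then show ?thesis
      unfolding k_def using not_less_Least[of k' "\<lambda>k. \<not> (\<exists>f. int_independent (Suc k) f)"] Suc
      unfolding k_def by simp
  qed
  then obtain f where f_ind: "int_independent k f" by blast
  have f: "f j \<in> carrier G" if "j < k" for j using f_ind that unfolding int_independent_def by blast
  define Pk where "Pk c = (\<Otimes>j\<in>{..<k}. f j [^] (c j :: int))" for c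
  have Pk_closed: "Pk c \<in> carrier G" for c unfolding Pk_def using f by (auto intro!: finprod_closed)
  have Pk_mult: "Pk c \<otimes> Pk c' = Pk (\<lambda>j. c j + c' j)" for c c'
    unfolding Pk_def using f by (rule finprod_int_pow_mult)
  have Pk_pow: "Pk c [^] (n::int) = Pk (\<lambda>j. c j * n)" for c n
    unfolding Pk_def using f by (rule finprod_int_pow_pow)
  have indep: "c j = 0" if "Pk c = \<one>" "j < k" for c j
    using f_ind that unfolding int_independent_def Pk_def by blast
  have Pk_inj: "c j = c' j" if "Pk c = Pk c'" "j < k" for c c' j
  proof -
    have "Pk (\<lambda>j. c j + c' j * -1) = Pk c \<otimes> Pk c' [^] (-1::int)" by (simp only: Pk_mult Pk_pow)
    also have "\<dots> = \<one>" using Pk_closed that(1) by (simp add: int_pow_neg)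
    finally show ?thesis using indep[of "\<lambda>j. c j + c' j * -1" j] that(2) by simp
  qed
  define rep where "rep x n c \<longleftrightarrow> 0 < (n::int) \<and> x [^] n = Pk c" for x n c
  have rep_ex: "\<exists>n c. rep x n c" if x: "x \<in> carrier G" for x
  proof -
    \<comment> \<open>Appending \<open>x\<close> to \<open>f\<close> breaks independence by
      maximality; independence of \<open>f\<close> then forces the exponent of \<open>x\<close> in
      the relation to be nonzero.\<close>
    let ?g = "\<lambda>j. if j < k then f j else x"
    have "\<not> int_independent (Suc k) ?g" by (rule max)
    moreover have "\<forall>j<Suc k. ?g j \<in> carrier G" using f x by simp
    ultimately obtain c :: "nat \<Rightarrow> int" and j0 where c: "(\<Otimes>j\<in>{..<Suc k}. ?g j [^] c j) = \<one>" "j0 < Suc k" "c j0 \<noteq> 0"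
      unfolding int_independent_def by blast
    have "(\<Otimes>j\<in>{..<Suc k}. ?g j [^] c j) = ?g k [^] c k \<otimes> (\<Otimes>j\<in>{..<k}. ?g j [^] c j)"
      unfolding lessThan_Suc using f x by (intro finprod_insert) auto
    moreover have "(\<Otimes>j\<in>{..<k}. ?g j [^] c j) = Pk c"
      unfolding Pk_def using f by (intro finprod_cong') auto
    ultimately have eq: "x [^] c k \<otimes> Pk c = \<one>" using c(1) by simp
    have ck: "c k \<noteq> 0"
    proof
      assume "c k = 0"
      then have "Pk c = \<one>" using eq Pk_closed by simp
      then have "c j0 = 0 \<or> j0 = k" using indep c(2) by (metis less_SucE)
      then show False using c(3) \<open>c k = 0\<close> by auto
    qed
    have xc: "x [^] c k = Pk (\<lambda>j. c j * -1)"
    proof -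
      have "x [^] c k = inv (Pk c)" using eq Pk_closed x by (intro inv_equality[symmetric]) auto
      then show ?thesis using Pk_closed unfolding Pk_pow[symmetric] by (simp add: int_pow_neg)
    qed
    show ?thesis
    proof (cases "0 < c k")
      case True
      then show ?thesis using xc unfolding rep_def by blast
    next
      case False
      have "x [^] (- c k) = Pk (\<lambda>j. c j * -1) [^] (-1::int)"
        unfolding xc[symmetric] using x by (simp add: int_pow_pow)
      then have "x [^] (- c k) = Pk (\<lambda>j. c j * -1 * -1)" unfolding Pk_pow .
      then show ?thesis using False ck unfolding rep_def by (intro exI[of _ "- c k"]) auto
    qed
  qed
  have rep_unique: "c j * n' = c' j * n" if "x \<in> carrier G" "rep x n c" "rep x n' c'" "j < k" for x n c n' c' j
  proof -
    have "Pk (\<lambda>j. c j * n') = (x [^] n) [^] n'" "Pk (\<lambda>j. c' j * n) = (x [^] n') [^] n"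
      using that(2,3) by (simp_all add: rep_def Pk_pow)
    then have "Pk (\<lambda>j. c j * n') = Pk (\<lambda>j. c' j * n)"
      using that(1) by (simp add: int_pow_pow mult.commute)
    then show ?thesis using Pk_inj that(4) by blast
  qed
  \<comment> \<open>The pair is arbitrary; by \<open>rep_unique\<close> the quotient does not depend
    on it.\<close>
  define lam where "lam i x = (let (n, c) = (SOME (n, c). rep x n c) in of_int (c i) / (of_int n :: rat))" for i x
  have lam: "lam i x = of_int (c i) / of_int n" if x: "x \<in> carrier G" "rep x n c" "i < k" for i x n c
  proof -
    obtain n' c' where nc: "(SOME (n, c). rep x n c) = (n', c')" by (cases "SOME (n, c). rep x n c")
    have "\<exists>p. case p of (n, c) \<Rightarrow> rep x n c" using x(2) by blast
    then have "case (SOME (n, c). rep x n c) of (n, c) \<Rightarrow> rep x n c" by (rule someI_ex)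
    then have r: "rep x n' c'" unfolding nc by simp
    have "c i * n' = c' i * n" by (rule rep_unique[OF x(1,2) r x(3)])
    then have "of_int (c i) * (of_int n' :: rat) = of_int (c' i) * of_int n" by (simp only: flip: of_int_mult)
    moreover have "0 < n" "0 < n'" using x(2) r by (simp_all add: rep_def)
    ultimately show ?thesis unfolding lam_def nc by (simp add: field_simps)
  qed
  have hom: "lam i (x \<otimes> y) = lam i x + lam i y" if xy: "x \<in> carrier G" "y \<in> carrier G" and i: "i < k" for i x y
  proof -
    obtain n c where r: "rep x n c" using rep_ex[OF xy(1)] by blast
    obtain n' c' where r': "rep y n' c'" using rep_ex[OF xy(2)] by blast
    have pos: "0 < n" "0 < n'" using r r' by (simp_all add: rep_def)
    have "(x \<otimes> y) [^] (n * n') = (x [^] n) [^] n' \<otimes> (y [^] n') [^] n"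
      using xy by (simp add: int_pow_mult_distrib m_comm int_pow_pow mult.commute)
    also have "\<dots> = Pk (\<lambda>j. c j * n' + c' j * n)"
      using r r' by (simp add: rep_def Pk_pow Pk_mult)
    finally have "rep (x \<otimes> y) (n * n') (\<lambda>j. c j * n' + c' j * n)" using pos by (simp add: rep_def)
    then show ?thesis using lam[OF xy(1) r i] lam[OF xy(2) r' i] lam[of "x \<otimes> y", OF _ _ i] xy pos
      by (simp add: field_simps)
  qed
  have lam_pow: "lam i (x [^] (m::int)) = of_int m * lam i x" if x: "x \<in> carrier G" and i: "i < k" for i x m
  proof -
    obtain n c where r: "rep x n c" using rep_ex[OF x] by blast
    have "(x [^] m) [^] n = (x [^] n) [^] m" using x by (simp add: int_pow_pow mult.commute)
    then have "rep (x [^] m) n (\<lambda>j. c j * m)" using r by (simp add: rep_def Pk_pow)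
    then show ?thesis using lam[OF x r i] lam[of "x [^] m", OF _ _ i] x by simp
  qed
  have lam_one: "lam i \<one> = 0" if "i < k" for i
    using lam_pow[of \<one> i 0] that by simp
  have lam_finprod: "lam i (\<Otimes>j\<in>{..<l}. g j [^] (c j :: int)) = (\<Sum>j<l. of_int (c j) * lam i (g j))"
    if "\<And>j. j < l \<Longrightarrow> g j \<in> carrier G" "i < k" for g i c and l :: nat
    using that(1)
  proof (induction l)
    case (Suc l)
    have "(\<Otimes>j\<in>{..<Suc l}. g j [^] c j) = g l [^] c l \<otimes> (\<Otimes>j\<in>{..<l}. g j [^] c j)"
      unfolding lessThan_Suc using Suc.prems by (intro finprod_insert) auto
    moreover have "(\<Otimes>j\<in>{..<l}. g j [^] c j) \<in> carrier G" using Suc.prems by (auto intro!: finprod_closed)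
    ultimately show ?case using Suc that(2) by (simp add: hom lam_pow)
  qed (simp add: lam_one that(2))
  have inj: "x = y" if xy: "x \<in> carrier G" "y \<in> carrier G" "\<forall>i<k. lam i x = lam i y" for x y
  proof -
    let ?z = "x \<otimes> inv y"
    have z: "?z \<in> carrier G" using xy by simp
    have "lam i ?z = 0" if "i < k" for i
      using hom[of ?z y i] xy that by (simp add: mult_inv_cancel)
    moreover obtain n c where r: "rep ?z n c" using rep_ex[OF z] by blast
    moreover have pos: "0 < n" using r by (simp add: rep_def)
    ultimately have "c i = 0" if "i < k" for i using lam[OF z r that] that by simp
    then have "Pk c = Pk (\<lambda>_. 0)" unfolding Pk_def using f by (intro finprod_cong') auto
    also have "\<dots> = \<one>" by (simp add: Pk_def)
    finally have "?z [^] nat n = \<one>" using r pos by (simp add: rep_def flip: int_pow_int)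
    moreover have "1 \<le> nat n" using pos by simp
    ultimately have "?z = \<one>" using tf z unfolding torsion_free_def by blast
    then show ?thesis using neq_inv_mult[OF xy(2,1)] by blast
  qed
  have lin: "lam i (\<alpha> x) = (\<Sum>j<k. lam i (\<alpha> (f j)) * lam j x)"
    if \<alpha>: "\<alpha> \<in> hom G G" and x: "x \<in> carrier G" and i: "i < k" for \<alpha> x i
  proof -
    interpret \<alpha>: group_hom G G \<alpha> using \<alpha> by unfold_locales
    obtain n c where r: "rep x n c" using rep_ex[OF x] by blast
    have pos: "0 < n" using r by (simp add: rep_def)
    have \<alpha>_prod: "\<alpha> (\<Otimes>j\<in>{..<l}. f j [^] (c j :: int)) = (\<Otimes>j\<in>{..<l}. \<alpha> (f j) [^] c j)" if "l \<le> k" for l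
      using that
    proof (induction l)
      case (Suc l)
      have fc: "f j \<in> carrier G" if "j \<le> l" for j using f Suc.prems that by simp
      have "(\<Otimes>j\<in>{..<Suc l}. f j [^] c j) = f l [^] c l \<otimes> (\<Otimes>j\<in>{..<l}. f j [^] c j)"
        unfolding lessThan_Suc using fc by (intro finprod_insert) auto
      moreover have "(\<Otimes>j\<in>{..<Suc l}. \<alpha> (f j) [^] c j) = \<alpha> (f l) [^] c l \<otimes> (\<Otimes>j\<in>{..<l}. \<alpha> (f j) [^] c j)"
        unfolding lessThan_Suc using fc by (intro finprod_insert) auto
      moreover have "(\<Otimes>j\<in>{..<l}. f j [^] c j) \<in> carrier G" using fc by (auto intro!: finprod_closed)
      moreover have "\<alpha> (f l [^] c l) = \<alpha> (f l) [^] c l" using fc by (intro \<alpha>.hom_int_pow) simp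
      ultimately show ?case using Suc fc by simp
    qed simp
    have "of_int n * lam i (\<alpha> x) = lam i (\<alpha> x [^] n)" using lam_pow x i by simp
    also have "\<alpha> x [^] n = \<alpha> (Pk c)" using r \<alpha>.hom_int_pow[OF x, of n] by (simp add: rep_def)
    also have "\<dots> = (\<Otimes>j\<in>{..<k}. \<alpha> (f j) [^] c j)" unfolding Pk_def by (rule \<alpha>_prod) simp
    also have "lam i \<dots> = (\<Sum>j<k. of_int (c j) * lam i (\<alpha> (f j)))"
      using f i by (intro lam_finprod) auto
    also have "\<dots> = (\<Sum>j<k. of_int n * (lam i (\<alpha> (f j)) * lam j x))"
      using lam[OF x r] pos by (intro sum.cong) auto
    finally show ?thesis using pos by (simp flip: sum_distrib_left)
  qed
  show ?thesis
    by (rule exI[of _ k], rule exI[of _ f], rule exI[of _ lam], intro conjI ballI allI impI)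
      (simp_all add: f hom inj lin)
qed

text \<open>Conjugation by \<open>l\<close> restricts to an endomorphism of \<open>N\<close>, whose
  matrix in rational coordinates is supplied by \<open>rational_coordinates\<close>.\<close>

lemma uniformly_boxed_torsion_free:
  fixes G :: "('a, 'm) monoid_scheme" (structure)
  assumes "N \<lhd> G" and A: "comm_group (G\<lparr>carrier := N\<rparr>)" "torsion_free (G\<lparr>carrier := N\<rparr>)"
    "rational_rank (G\<lparr>carrier := N\<rparr>) < \<infinity>"
  shows "uniformly_boxed N G"
proof -
  interpret normal N G by fact
  let ?A = "G\<lparr>carrier := N\<rparr>"
  interpret A: comm_group ?A by fact
  have A_simps: "carrier ?A = N" "mult ?A = mult G" by simp_all
  from A.rational_coordinates[OF A(2) A.int_independent_bounded[OF A(2,3)], unfolded A_simps]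
  obtain k f and lam :: "nat \<Rightarrow> 'a \<Rightarrow> rat" where
    hom: "\<forall>i<k. \<forall>x\<in>N. \<forall>y\<in>N. lam i (x \<otimes> y) = lam i x + lam i y"
    and inj: "\<forall>x\<in>N. \<forall>y\<in>N. (\<forall>i<k. lam i x = lam i y) \<longrightarrow> x = y"
    and lin: "\<forall>\<alpha>\<in>hom ?A ?A. \<forall>x\<in>N. \<forall>i<k. lam i (\<alpha> x) = (\<Sum>j<k. lam i (\<alpha> (f j)) * lam j x)"
    by (elim exE conjE) (rule that)
  show ?thesis
  proof (rule uniformly_boxed_coordinates[OF assms(1), of k lam])
    show "lam i (x \<otimes> y) = lam i x + lam i y" if "i < k" "x \<in> N" "y \<in> N" for i x y
      using hom that by blast
    show "x = y" if "x \<in> N" "y \<in> N" "\<And>i. i < k \<Longrightarrow> lam i x = lam i y" for x y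
      using inj that by blast
    fix l assume l: "l \<in> carrier G"
    have "(\<lambda>x. l \<otimes> x \<otimes> inv l) \<in> hom ?A ?A"
    proof (rule homI)
      fix x assume "x \<in> carrier ?A"
      then show "l \<otimes> x \<otimes> inv l \<in> carrier ?A" using l inv_op_closed2 by simp
    next
      fix x y assume "x \<in> carrier ?A" "y \<in> carrier ?A"
      then have c: "x \<in> carrier G" "y \<in> carrier G" using subset by auto
      have "l \<otimes> (x \<otimes> y) \<otimes> inv l = (l \<otimes> x \<otimes> inv l) \<otimes> (l \<otimes> y \<otimes> inv l)"
        using c l by (simp add: m_assoc inv_cancel)
      then show "l \<otimes> (x \<otimes>\<^bsub>?A\<^esub> y) \<otimes> inv l = (l \<otimes> x \<otimes> inv l) \<otimes>\<^bsub>?A\<^esub> (l \<otimes> y \<otimes> inv l)" by simp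
    qed
    from bspec[OF lin this]
    show "\<exists>A. \<forall>x\<in>N. \<forall>i<k. lam i (l \<otimes> x \<otimes> inv l) = (\<Sum>j<k. A i j * lam j x)"
      by (rule exI[of _ "\<lambda>i j. lam i (l \<otimes> f j \<otimes> inv l)"])
  qed
qed

section \<open>Groups with an admissible normal series\<close>

lemma coarsely_contractible_trivial:
  fixes G :: "('a, 'm) monoid_scheme" (structure)
  assumes "group G" "carrier G = {\<one>}"
  shows "coarsely_contractible G 1"
  unfolding coarsely_contractible_def
proof (intro allI impI, elim conjE)
  interpret group G by fact
  fix F assume F: "finite F" "F \<subseteq> carrier G"
  have "(\<lambda>f. \<one> \<otimes> f) ` F \<subseteq> {\<one>}" using F unfolding assms(2) by auto
  then have c: "card ((\<lambda>f. \<one> \<otimes> f) ` F) \<le> 1" using card_mono[of "{\<one>}"] by fastforce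
  show "\<exists>L. finite L \<and> L \<subseteq> carrier G \<and>
     (\<forall>p. \<exists>W z. finite W \<and> W \<subseteq> carrier G \<and>
        (\<forall>c c'. (\<forall>w\<in>W. c w = c' w) \<longrightarrow> z c = z c') \<and> (\<forall>c. z c \<in> W) \<and>
        (\<forall>c. proper_colouring G L p c \<longrightarrow> card ((\<lambda>f. z (\<lambda>g. c (g \<otimes> f)) \<otimes> f) ` F) \<le> 1))"
    by (rule exI[of _ "{}"], intro conjI allI, simp, simp, rule exI[of _ "{\<one>}"], rule exI[of _ "\<lambda>_. \<one>"])
      (simp add: c[unfolded One_nat_def])
qed

text \<open>The integers are an extension of the trivial group; the kernel is everything, has one
  rational coordinate, and conjugation is trivial.\<close>

lemma coarsely_contractible_integer_group: "\<exists>D. coarsely_contractible integer_group D"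
proof (rule coarsely_contractible_extension)
  let ?Q = "singleton_group ()" and ?\<pi> = "\<lambda>_::int. ()"
  show "group integer_group" "group ?Q" by simp_all
  show "?\<pi> \<in> hom integer_group ?Q" by (auto simp: hom_def singleton_group_def)
  show "?\<pi> ` carrier integer_group = carrier ?Q" by (auto simp: singleton_group_def integer_group_def)
  show "countable (carrier ?Q)" by (simp add: singleton_group_def)
  have "group ?Q" by simp
  then show "coarsely_contractible ?Q 1" by (rule coarsely_contractible_trivial) (simp add: singleton_group_def)
  interpret comm_group integer_group by (rule abelian_integer_group)
  have ker: "kernel integer_group ?Q ?\<pi> = UNIV" by (simp add: kernel_def singleton_group_def)
  have norm: "UNIV \<lhd> integer_group"
    using subgroup_self by (simp add: normal_iff_subgroup)
  have inv: "l + x + m_inv integer_group l = x" for l x :: int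
  proof -
    have "m_inv integer_group l = - l" by (rule inv_equality) simp_all
    then show ?thesis by simp
  qed
  show "uniformly_boxed (kernel integer_group ?Q ?\<pi>) integer_group"
    unfolding ker
  proof (rule uniformly_boxed_coordinates[OF norm, of "1::nat" "\<lambda>_. of_int"])
    fix l :: int
    show "\<exists>A. \<forall>x\<in>UNIV. \<forall>i<1::nat. (of_int (l \<otimes>\<^bsub>integer_group\<^esub> x \<otimes>\<^bsub>integer_group\<^esub> m_inv integer_group l) :: rat) =
      (\<Sum>j<1::nat. A i j * of_int x)"
      using inv by (intro exI[of _ "\<lambda>_ _. 1"]) simp
  qed simp_all
qed

lemma coarsely_contractible_lamplighter: "\<exists>D. coarsely_contractible lamplighter_group D"
proof -
  obtain D where "coarsely_contractible integer_group D" using coarsely_contractible_integer_group ..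
  then show ?thesis
  proof (rule coarsely_contractible_extension[rotated 5])
    show "group lamplighter_group" by (rule group_lamplighter_group)
    show "group integer_group" by simp
    show "snd \<in> hom lamplighter_group integer_group"
      by (auto simp: hom_def lamplighter_simps integer_group_def)
    show "snd ` carrier lamplighter_group = carrier integer_group"
    proof -
      have "(\<lambda>_. 0, k) \<in> carrier lamplighter_group" for k by (auto simp: lamplighter_simps)
      then show ?thesis by (force simp: integer_group_def)
    qed
    show "countable (carrier (integer_group :: int monoid))" by simp
  qed (rule uniformly_boxed_lamplighter)
qed

lemma uniformly_boxed_finite:
  assumes "N \<lhd> G" "finite N"
  shows "uniformly_boxed N G"
  using assms by (intro uniformly_boxed_finite_normal[where F = "\<lambda>_. N"]) auto

text \<open>An isomorphism is an extension with trivial kernel, which is boxed as a finite normal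
  subgroup. The bound may change from \<open>D\<close> to \<open>D'\<close>, which suffices for the
  existence statements that follow.\<close>

lemma coarsely_contractible_iso:
  assumes "group G" "group Q" "G \<cong> Q" "countable (carrier Q)" "coarsely_contractible Q D"
  shows "\<exists>D'. coarsely_contractible G D'"
proof -
  interpret G: group G by fact
  interpret Q: group Q by fact
  obtain h where h: "h \<in> iso G Q" using assms(3) unfolding is_iso_def by blast
  interpret h: group_hom G Q h using h by unfold_locales (simp add: iso_def)
  have bij: "inj_on h (carrier G)" "h ` carrier G = carrier Q" using h by (auto simp: iso_def bij_betw_def)
  have "kernel G Q h = {\<one>\<^bsub>G\<^esub>}" using bij(1) h.inj_iff_trivial_ker by blast
  then have "uniformly_boxed (kernel G Q h) G"
    using h.normal_kernel by (intro uniformly_boxed_finite) auto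
  then show ?thesis
    using assms bij(2) h.homh by (intro coarsely_contractible_extension[of G Q h D]) auto
qed

section \<open>Induction along the quotients of the series\<close>

text \<open>A factor of the series is literally a subgroup of the quotient by \<open>N\<close>.
  Boxes can thus be sought inside \<open>G Mod N\<close>, whose conjugations enter the packing
  bounds, and not just inside the factor by itself.\<close>

lemma FactGroup_subgroup:
  "(G\<lparr>carrier := K\<rparr>) Mod N = (G Mod N)\<lparr>carrier := (\<lambda>x. N #>\<^bsub>G\<^esub> x) ` K\<rparr>"
  by (auto simp: FactGroup_def RCOSETS_def r_coset_def set_mult_def fun_eq_iff)

text \<open>Conjugation by an element of \<open>G\<close> restricts to an automorphism of
  \<open>H\<close> and so preserves \<open>C\<close>. The explicit \<open>restrict\<close> in
  \<open>\<alpha>\<close> is due to \<open>auto\<close> consisting of extensional functions.\<close>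

lemma (in normal) normal_of_characteristic:
  assumes "characteristic C (G\<lparr>carrier := H\<rparr>)"
  shows "C \<lhd> G"
  unfolding normal_inv_iff
proof (intro conjI ballI)
  have C: "subgroup C (G\<lparr>carrier := H\<rparr>)" "\<And>\<alpha>. \<alpha> \<in> auto (G\<lparr>carrier := H\<rparr>) \<Longrightarrow> \<alpha> ` C = C"
    using assms by (simp_all add: characteristic_def)
  have CH: "C \<subseteq> H" using subgroup.subset[OF C(1)] by simp
  show "subgroup C G" using incl_subgroup[OF subgroup_axioms C(1)] .
  fix x h assume x: "x \<in> carrier G" and h: "h \<in> C"
  define \<alpha> where "\<alpha> = restrict (\<lambda>y. x \<otimes> y \<otimes> inv x) H"
  have cl: "x \<otimes> y \<otimes> inv x \<in> H" if "y \<in> H" for y using inv_op_closed2[OF x that] .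
  have "\<alpha> \<in> auto (G\<lparr>carrier := H\<rparr>)"
    unfolding auto_def Bij_def
  proof (intro IntI)
    show "\<alpha> \<in> hom (G\<lparr>carrier := H\<rparr>) (G\<lparr>carrier := H\<rparr>)"
    proof (rule homI)
      show "\<alpha> y \<in> carrier (G\<lparr>carrier := H\<rparr>)" if "y \<in> carrier (G\<lparr>carrier := H\<rparr>)" for y
        using that cl by (simp add: \<alpha>_def)
      show "\<alpha> (y \<otimes>\<^bsub>G\<lparr>carrier := H\<rparr>\<^esub> z) = \<alpha> y \<otimes>\<^bsub>G\<lparr>carrier := H\<rparr>\<^esub> \<alpha> z"
        if "y \<in> carrier (G\<lparr>carrier := H\<rparr>)" "z \<in> carrier (G\<lparr>carrier := H\<rparr>)" for y z
        using that x by (simp add: \<alpha>_def m_assoc inv_cancel)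
    qed
    show "\<alpha> \<in> extensional (carrier (G\<lparr>carrier := H\<rparr>))" by (simp add: \<alpha>_def)
    have "bij_betw \<alpha> H H"
    proof (rule bij_betw_byWitness[where f' = "\<lambda>y. inv x \<otimes> y \<otimes> x"])
      show "\<forall>a\<in>H. inv x \<otimes> \<alpha> a \<otimes> x = a" "\<forall>a'\<in>H. \<alpha> (inv x \<otimes> a' \<otimes> x) = a'"
        using x inv_op_closed1[OF x] by (simp_all add: \<alpha>_def m_assoc inv_cancel)
      show "\<alpha> ` H \<subseteq> H" "(\<lambda>y. inv x \<otimes> y \<otimes> x) ` H \<subseteq> H"
        using cl inv_op_closed1[OF x] by (auto simp: \<alpha>_def)
    qed
    then show "\<alpha> \<in> {f. bij_betw f (carrier (G\<lparr>carrier := H\<rparr>)) (carrier (G\<lparr>carrier := H\<rparr>))}" by simp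
  qed
  then have "\<alpha> h \<in> C" using C(2) h by blast
  then show "x \<otimes> h \<otimes> inv x \<in> C" using h CH by (simp add: \<alpha>_def subsetD)
qed

lemma uniformly_boxed_admissible_factor:
  assumes "N \<lhd> G" "admissible_factor (G\<lparr>carrier := N\<rparr>)"
  shows "uniformly_boxed N G"
proof -
  interpret normal N G by fact
  consider "finite N" | "union_of_characteristic_finite_subgroups (G\<lparr>carrier := N\<rparr>)"
    | "comm_group (G\<lparr>carrier := N\<rparr>)" "torsion_free (G\<lparr>carrier := N\<rparr>)" "rational_rank (G\<lparr>carrier := N\<rparr>) < \<infinity>"
    using assms(2) unfolding admissible_factor_def by auto
  then show ?thesis
  proof cases
    case 1
    then show ?thesis using assms(1) by (intro uniformly_boxed_finite)
  next
    case 2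
    then obtain F :: "nat \<Rightarrow> 'a set" where
      F: "\<And>i. characteristic (F i) (G\<lparr>carrier := N\<rparr>)" "\<And>i. finite (F i)" "\<And>i. F i \<subseteq> F (Suc i)" "N = (\<Union>i. F i)"
      unfolding union_of_characteristic_finite_subgroups_def by auto
    show ?thesis by (rule uniformly_boxed_finite_normal[OF normal_of_characteristic[OF F(1)] F(2-4)])
  next
    case 3
    then show ?thesis using assms(1) by (intro uniformly_boxed_torsion_free)
  qed
qed

text \<open>The canonical map from \<open>G Mod N\<close> to \<open>G Mod K\<close> is
  \<open>C \<mapsto> K <#> C\<close>, with the image of \<open>K\<close> as kernel; the extension
  theorem applies to it.\<close>

lemma coarsely_contractible_FactGroup_step:
  fixes G :: "('a, 'm) monoid_scheme" (structure)
  assumes K: "K \<lhd> G" and N: "N \<lhd> G" "N \<subseteq> K" and "countable (carrier G)"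
    and "coarsely_contractible (G Mod K) D"
    and boxed: "(\<lambda>x. N #> x) ` K \<lhd> G Mod N \<Longrightarrow> uniformly_boxed ((\<lambda>x. N #> x) ` K) (G Mod N)"
  shows "\<exists>D'. coarsely_contractible (G Mod N) D'"
proof -
  interpret K: normal K G by fact
  interpret N: normal N G by fact
  let ?\<pi> = "\<lambda>C. K <#> C"
  have "K <#> N = K"
  proof
    show "K <#> N \<subseteq> K" using N(2) by (auto simp: set_mult_def)
    show "K \<subseteq> K <#> N"
    proof
      fix k assume "k \<in> K"
      then have "k = k \<otimes> \<one>" by simp
      then show "k \<in> K <#> N" using \<open>k \<in> K\<close> N.one_closed unfolding set_mult_def by blast
    qed
  qed
  then have \<pi>: "?\<pi> (N #> x) = K #> x" if "x \<in> carrier G" for x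
    using K.setmult_rcos_assoc[OF K.subset N.subset that] by simp
  have hom: "?\<pi> \<in> hom (G Mod N) (G Mod K)"
  proof (rule homI)
    show "?\<pi> C \<in> carrier (G Mod K)" if "C \<in> carrier (G Mod N)" for C
      using that \<pi> by (auto simp: carrier_FactGroup)
    fix C C' assume "C \<in> carrier (G Mod N)" "C' \<in> carrier (G Mod N)"
    then obtain x y where "C = N #> x" "x \<in> carrier G" "C' = N #> y" "y \<in> carrier G"
      unfolding carrier_FactGroup by blast
    then show "?\<pi> (C \<otimes>\<^bsub>G Mod N\<^esub> C') = ?\<pi> C \<otimes>\<^bsub>G Mod K\<^esub> ?\<pi> C'"
      by (simp add: \<pi> N.rcos_sum K.rcos_sum)
  qed
  have surj: "?\<pi> ` carrier (G Mod N) = carrier (G Mod K)"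
    unfolding carrier_FactGroup image_image using \<pi> by (intro image_cong) auto
  have ker: "kernel (G Mod N) (G Mod K) ?\<pi> = (\<lambda>x. N #> x) ` K"
  proof -
    have "K #> x = K \<longleftrightarrow> x \<in> K" if "x \<in> carrier G" for x
      using that K.coset_join1 K.coset_join2 K.subgroup_axioms by blast
    then have "kernel (G Mod N) (G Mod K) ?\<pi> = (\<lambda>x. N #> x) ` {x \<in> carrier G. x \<in> K}"
      using \<pi> by (auto simp: kernel_def carrier_FactGroup)
    also have "{x \<in> carrier G. x \<in> K} = K" using K.subset by blast
    finally show ?thesis .
  qed
  interpret GN: group "G Mod N" by (rule N.factorgroup_is_group)
  interpret GK: group "G Mod K" by (rule K.factorgroup_is_group)
  interpret \<pi>: group_hom "G Mod N" "G Mod K" ?\<pi> using hom by unfold_locales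
  show ?thesis
  proof (rule coarsely_contractible_extension[OF GN.is_group GK.is_group hom surj _ assms(5)])
    show "countable (carrier (G Mod K))" using assms(4) by (simp add: carrier_FactGroup)
    show "uniformly_boxed (kernel (G Mod N) (G Mod K) ?\<pi>) (G Mod N)"
      using boxed \<pi>.normal_kernel unfolding ker by blast
  qed
qed

text \<open>Induction from the top: contractibility passes from \<open>G Mod H k\<close> to
  \<open>G Mod H (Suc k)\<close>. For \<open>k = 0\<close> the factor is the entire group
  \<open>G Mod H 1\<close>, which is the situation of the boxes from polynomial growth and lets a
  lamplighter group be treated by itself; so the top factor may be more general.\<close>

theorem coarsely_contractible_normal_series:
  fixes G :: "('a, 'm) monoid_scheme" (structure)
  assumes "group G" and "countable (carrier G)" and series: "normal_series G n H"
    and adm: "\<forall>k<n. if k = 0 then admissible_top_factor (series_factor G H k)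
                else admissible_factor (series_factor G H k)"
  shows "\<exists>D. coarsely_contractible G D"
proof -
  interpret group G by fact
  have H: "H 0 = carrier G" "H n = {\<one>}" "\<And>k. k \<le> n \<Longrightarrow> H k \<lhd> G" "\<And>k. k < n \<Longrightarrow> H (Suc k) \<subseteq> H k"
    using series by (simp_all add: normal_series_def)
  have factor: "series_factor G H k = (G Mod H (Suc k))\<lparr>carrier := (\<lambda>x. H (Suc k) #> x) ` H k\<rparr>" for k
    unfolding series_factor_def by (rule FactGroup_subgroup)
  have "\<exists>D. coarsely_contractible (G Mod H k) D" if "k \<le> n" for k
    using that
  proof (induction k)
    case 0
    interpret H0: normal "H 0" G using H(3) by simp
    have "carrier (G Mod H 0) = {\<one>\<^bsub>G Mod H 0\<^esub>}"
    proof -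
      have "H 0 #> x = H 0" if "x \<in> carrier G" for x
        using coset_join2[OF that H0.subgroup_axioms] that by (simp add: H(1))
      then show ?thesis using one_closed unfolding carrier_FactGroup by auto
    qed
    then show ?case using coarsely_contractible_trivial[OF H0.factorgroup_is_group] by blast
  next
    case (Suc k)
    then obtain D where D: "coarsely_contractible (G Mod H k) D" by auto
    have k: "k < n" "k \<le> n" "Suc k \<le> n" using Suc.prems by simp_all
    interpret N: normal "H (Suc k)" G using H(3) k by blast
    interpret Gk: group "G Mod H (Suc k)" by (rule N.factorgroup_is_group)
    have countable: "countable (carrier (G Mod H (Suc k)))" using assms(2) by (simp add: carrier_FactGroup)
    let ?N = "(\<lambda>x. H (Suc k) #> x) ` H k"
    have top: "?N = carrier (G Mod H (Suc k))" if "k = 0"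
      using that H(1) by (simp add: carrier_FactGroup)
    consider "admissible_factor (series_factor G H k)"
      | "k = 0" "uniform_local_polynomial_growth (series_factor G H k)"
      | "k = 0" "series_factor G H k \<cong> lamplighter_group"
      using adm k(1) unfolding admissible_top_factor_def by (metis (full_types))
    then show ?case
    proof cases
      case 1
      show ?thesis
        by (rule coarsely_contractible_FactGroup_step[OF H(3)[OF k(2)] H(3)[OF k(3)] H(4)[OF k(1)] assms(2) D])
          (rule uniformly_boxed_admissible_factor[OF _ 1[unfolded factor]])
    next
      case 2
      have "uniformly_boxed (carrier (G Mod H (Suc k))) (G Mod H (Suc k))"
        using 2(2) unfolding factor top[OF 2(1)]
        by (intro uniformly_boxed_polynomial_growth) (simp_all add: N.factorgroup_is_group)
      then show ?thesis
        by (intro coarsely_contractible_FactGroup_step[OF H(3)[OF k(2)] H(3)[OF k(3)] H(4)[OF k(1)] assms(2) D])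
          (simp add: top[OF 2(1)])
    next
      case 3
      \<comment> \<open>Here \<open>k = 0\<close>, so the factor is the whole quotient
        \<open>G Mod H (Suc k)\<close> and contractibility is transported along the
        isomorphism.\<close>
      obtain D where "coarsely_contractible lamplighter_group D" using coarsely_contractible_lamplighter ..
      moreover have "G Mod H (Suc k) \<cong> lamplighter_group"
        using 3(2) unfolding factor top[OF 3(1)] by simp
      moreover have "countable (carrier lamplighter_group)"
        using countable calculation(2) unfolding is_iso_def iso_def bij_betw_def
        by (metis (mono_tags, lifting) countable_image ex_in_conv mem_Collect_eq)
      ultimately show ?thesis
        using coarsely_contractible_iso[OF N.factorgroup_is_group group_lamplighter_group] by blast
    qed
  qed
  then obtain D where D: "coarsely_contractible (G Mod {\<one>}) D" using H(2) by fastforce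
  interpret T: normal "{\<one>}" G using H(2) H(3)[of n] by simp
  have "G \<cong> G Mod {\<one>}" using trivial_factor_iso T.factorgroup_is_group
    by (meson group.iso_sym is_isoI)
  then show ?thesis
    using D assms(2) by (intro coarsely_contractible_iso[OF assms(1) T.factorgroup_is_group]) (auto simp: carrier_FactGroup)
qed

section \<open>Covers with bounded chains\<close>

text \<open>Chains that stay in \<open>U\<close>, recorded by their product. In contrast to
  \<open>chain_elements\<close> the empty chain counts, and inverses are steps only if
  \<open>F\<close> contains them.\<close>

inductive walk :: "('a, 'm) monoid_scheme \<Rightarrow> ('a \<Rightarrow> 'x \<Rightarrow> 'x) \<Rightarrow> 'a set \<Rightarrow> 'x set \<Rightarrow> 'x \<Rightarrow> 'a \<Rightarrow> bool"
  for G :: "('a, 'm) monoid_scheme" (structure) and \<phi> F U x where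
  walk_one: "x \<in> U \<Longrightarrow> walk G \<phi> F U x \<one>"
| walk_step: "\<lbrakk>walk G \<phi> F U x g; f \<in> F; \<phi> (f \<otimes> g) x \<in> U\<rbrakk> \<Longrightarrow> walk G \<phi> F U x (f \<otimes> g)"

definition reach :: "('a, 'm) monoid_scheme \<Rightarrow> ('a \<Rightarrow> 'x \<Rightarrow> 'x) \<Rightarrow> 'a set \<Rightarrow> 'x set \<Rightarrow> 'a set" where
  "reach G \<phi> F U = {g. \<exists>x. walk G \<phi> F U x g}"

lemma walk_start: "walk G \<phi> F U x g \<Longrightarrow> x \<in> U"
  by (induction rule: walk.induct) auto

lemma walk_mono: "walk G \<phi> F U x g \<Longrightarrow> F \<subseteq> F' \<Longrightarrow> U \<subseteq> U' \<Longrightarrow> walk G \<phi> F' U' x g"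
  by (induction rule: walk.induct) (auto intro: walk.intros)

lemma reach_mono: "F \<subseteq> F' \<Longrightarrow> U \<subseteq> U' \<Longrightarrow> reach G \<phi> F U \<subseteq> reach G \<phi> F' U'"
  unfolding reach_def using walk_mono[of G \<phi> F U _ _ F' U'] by blast

lemma reach_empty [simp]: "reach G \<phi> F {} = {}"
  using walk_start[of G \<phi> F "{}"] by (auto simp: reach_def)

context gspace
begin

lemma walk_closed: "walk G \<phi> F U x g \<Longrightarrow> F \<subseteq> carrier G \<Longrightarrow> g \<in> carrier G"
  by (induction rule: walk.induct) auto

lemma reach_closed: "F \<subseteq> carrier G \<Longrightarrow> reach G \<phi> F U \<subseteq> carrier G"
  unfolding reach_def using walk_closed by blast

lemma walk_end: "walk G \<phi> F U x g \<Longrightarrow> U \<subseteq> X \<Longrightarrow> \<phi> g x \<in> U"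
  by (induction rule: walk.induct) auto

lemma walk_trans:
  assumes "walk G \<phi> F U (\<phi> g x) h" "walk G \<phi> F U x g" "F \<subseteq> carrier G" "U \<subseteq> X"
  shows "walk G \<phi> F U x (h \<otimes> g)"
proof -
  have g: "g \<in> carrier G" "x \<in> X" using walk_closed[OF assms(2,3)] walk_start[OF assms(2)] assms(4) by auto
  show ?thesis
    using assms(1)
  proof (induction rule: walk.induct)
    case walk_one
    then show ?case using assms(2) g by simp
  next
    case (walk_step h f)
    have c: "h \<in> carrier G" "f \<in> carrier G"
      using walk_closed[OF walk_step.hyps(1) assms(3)] subsetD[OF assms(3) walk_step.hyps(2)] .
    have "\<phi> (f \<otimes> (h \<otimes> g)) x \<in> U" using walk_step.hyps(3) g c by (simp add: m_assoc)
    then have "walk G \<phi> F U x (f \<otimes> (h \<otimes> g))" by (rule walk.walk_step[OF walk_step.IH walk_step.hyps(2)])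
    then show ?case using c g by (simp add: m_assoc)
  qed
qed

lemma walk_inv:
  assumes "walk G \<phi> F U x g" "F \<subseteq> carrier G" "\<forall>f\<in>F. inv f \<in> F" "U \<subseteq> X"
  shows "walk G \<phi> F U (\<phi> g x) (inv g)"
  using assms(1)
proof (induction rule: walk.induct)
  case walk_one
  then have "x \<in> X" using assms(4) by blast
  then show ?case using walk.walk_one[OF walk_one] by simp
next
  case (walk_step g f)
  have c: "g \<in> carrier G" "f \<in> carrier G" "x \<in> X"
    using walk_closed[OF walk_step.hyps(1) assms(2)] subsetD[OF assms(2) walk_step.hyps(2)]
      subsetD[OF assms(4) walk_start[OF walk_step.hyps(1)]] .
  have eq: "\<phi> (inv f) (\<phi> (f \<otimes> g) x) = \<phi> g x"
    using c by (simp add: inv_cancel)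
  have "walk G \<phi> F U (\<phi> (f \<otimes> g) x) (inv f \<otimes> \<one>)"
  proof (rule walk.walk_step)
    show "walk G \<phi> F U (\<phi> (f \<otimes> g) x) \<one>" using walk_step.hyps(3) by (rule walk.walk_one)
    show "inv f \<in> F" using assms(3) walk_step.hyps(2) by blast
    have "\<phi> g x \<in> U" using walk_end[OF walk_step.hyps(1) assms(4)] .
    then show "\<phi> (inv f \<otimes> \<one>) (\<phi> (f \<otimes> g) x) \<in> U" using c eq by simp
  qed
  then have 1: "walk G \<phi> F U (\<phi> (f \<otimes> g) x) (inv f)" using c by simp
  have 2: "walk G \<phi> F U (\<phi> (inv f) (\<phi> (f \<otimes> g) x)) (inv g)"
    unfolding eq by (rule walk_step.IH)
  from walk_trans[OF 2 1 assms(2,4)] show ?case using c by (simp add: inv_mult_group)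
qed

text \<open>Which walks start at a point of \<open>U\<close> is decided by its pattern of visits to
  \<open>U\<close> along \<open>reach\<close>, which is finite in the applications. This puts the
  set of points admitting a given walk into the algebra.\<close>

lemma walk_same_pattern:
  assumes "walk G \<phi> F U x g" "y \<in> U"
    and "\<forall>h\<in>reach G \<phi> F U. \<phi> h x \<in> U \<longrightarrow> \<phi> h y \<in> U"
  shows "walk G \<phi> F U y g"
  using assms(1)
proof (induction rule: walk.induct)
  case walk_one
  show ?case using assms(2) by (rule walk.walk_one)
next
  case (walk_step g f)
  have "walk G \<phi> F U x (f \<otimes> g)" by (rule walk.walk_step[OF walk_step.hyps])
  then have "f \<otimes> g \<in> reach G \<phi> F U" unfolding reach_def by blast
  then have "\<phi> (f \<otimes> g) y \<in> U" using assms(3) walk_step.hyps(3) by blast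
  then show ?case by (rule walk.walk_step[OF walk_step.IH walk_step.hyps(2)])
qed

text \<open>A chain through \<open>A \<union> B\<close> is cut at its first and last visit to \<open>B\<close>. In between, excursions
  into \<open>A\<close> become single steps from \<open>F'\<close>.\<close>

lemma finite_reach_Un:
  assumes F: "finite F" "F \<subseteq> carrier G" and AB: "A \<subseteq> X" "B \<subseteq> X"
    and A: "finite (reach G \<phi> F A)" and B: "finite (reach G \<phi> F' B)"
    and F': "F' \<subseteq> carrier G" "F \<subseteq> F'" "\<forall>f\<in>F. \<forall>t\<in>reach G \<phi> F A. \<forall>f'\<in>F. f \<otimes> (t \<otimes> f') \<in> F'"
  shows "finite (reach G \<phi> F (A \<union> B))"
proof -
  let ?T = "reach G \<phi> F A"
  \<comment> \<open>\<open>P\<close> holds the initial parts up to the first visit to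
    \<open>B\<close>, \<open>S\<close> the final parts after the last one; between them lies an
    \<open>F'\<close>-walk in \<open>B\<close>.\<close>
  define P where "P = insert \<one> ((\<lambda>(f, t). f \<otimes> t) ` (F \<times> ?T))"
  define S where "S = insert \<one> ((\<lambda>(t, f). t \<otimes> f) ` (?T \<times> F))"
  define R where "R = (\<lambda>(s, b, a). s \<otimes> (b \<otimes> a)) ` (S \<times> reach G \<phi> F' B \<times> P)"
  have TC: "?T \<subseteq> carrier G" "reach G \<phi> F' B \<subseteq> carrier G" using reach_closed F(2) F'(1) by blast+
  have PC: "P \<subseteq> carrier G" using F(2) TC(1) by (auto simp: P_def)
  have fin: "finite R" unfolding R_def P_def S_def using F(1) A B by simp
  have "g \<in> ?T \<union> R" if g: "walk G \<phi> F (A \<union> B) x g" for x g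
  proof -
    have x: "x \<in> X" using walk_start[OF g] AB by blast
    \<comment> \<open>Three states of a walk: not yet in \<open>B\<close>, currently in
      \<open>B\<close>, or in \<open>A\<close> after a visit to \<open>B\<close>. Returning to
      \<open>B\<close> from the third state completes an excursion
      \<open>f \<otimes> (t \<otimes> f')\<close>, a single step from \<open>F'\<close>.\<close>
    define inA where "inA g \<longleftrightarrow> walk G \<phi> F A x g" for g
    define inB where "inB b a \<longleftrightarrow> a \<in> P \<and> walk G \<phi> F' B (\<phi> a x) b" for b a
    define last where "last t f b a \<longleftrightarrow> f \<in> F \<and> walk G \<phi> F A (\<phi> (f \<otimes> (b \<otimes> a)) x) t \<and> inB b a" for t f b a
    have inB_closed: "a \<in> carrier G" "b \<in> carrier G" if "inB b a" for a b
      using that PC walk_closed[OF _ F'(1)] by (auto simp: inB_def)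
    have inB_step: "inB (f \<otimes> b) a" if "inB b a" "f \<in> F'" "\<phi> (f \<otimes> b \<otimes> a) x \<in> B" for f b a
    proof -
      have f: "f \<in> carrier G" using that(2) F'(1) by blast
      have "\<phi> (f \<otimes> b) (\<phi> a x) \<in> B" using that(3) f inB_closed[OF that(1)] x by simp
      with that(1,2) show ?thesis unfolding inB_def by (elim conjE) (intro conjI walk.walk_step)
    qed
    have "inA g \<or> (\<exists>b a. g = b \<otimes> a \<and> inB b a) \<or> (\<exists>t f b a. g = t \<otimes> (f \<otimes> (b \<otimes> a)) \<and> last t f b a)"
      using g
    proof (induction rule: walk.induct)
      case walk_one
      then consider "x \<in> A" | "x \<in> B" by blast
      then show ?case
      proof cases
        case 1
        then have "inA \<one>" unfolding inA_def by (rule walk.walk_one)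
        then show ?thesis ..
      next
        case 2
        then have "inB \<one> \<one>" using x by (simp add: inB_def P_def walk.walk_one)
        moreover have "\<one> = \<one> \<otimes> \<one>" by simp
        ultimately show ?thesis by blast
      qed
    next
      case (walk_step g f)
      have fC: "f \<in> carrier G" using walk_step.hyps(2) F(2) by blast
      consider "inA g" | b a where "g = b \<otimes> a" "inB b a"
        | t f' b a where "g = t \<otimes> (f' \<otimes> (b \<otimes> a))" "last t f' b a"
        using walk_step.IH by blast
      then show ?case
      proof cases
        case 1
        then have p: "walk G \<phi> F A x g" by (simp add: inA_def)
        then have gT: "g \<in> ?T" unfolding reach_def by blast
        have gC: "g \<in> carrier G" by (rule walk_closed[OF p F(2)])
        show ?thesis
        proof (cases "\<phi> (f \<otimes> g) x \<in> B")
          case True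
          have "f \<otimes> g \<in> P" unfolding P_def using gT walk_step.hyps(2) by blast
          then have "inB \<one> (f \<otimes> g)" using True by (simp add: inB_def walk.walk_one)
          moreover have "f \<otimes> g = \<one> \<otimes> (f \<otimes> g)" using gC fC by simp
          ultimately show ?thesis by blast
        next
          case False
          then have "\<phi> (f \<otimes> g) x \<in> A" using walk_step.hyps(3) by blast
          then have "inA (f \<otimes> g)" using 1 unfolding inA_def by (intro walk.walk_step[OF _ walk_step.hyps(2)])
          then show ?thesis ..
        qed
      next
        case 2
        note c = inB_closed[OF 2(2)]
        show ?thesis
        proof (cases "\<phi> (f \<otimes> g) x \<in> B")
          case True
          then have "inB (f \<otimes> b) a"
            using walk_step.hyps(2) F'(2) c fC 2 by (intro inB_step) (auto simp: m_assoc)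
          moreover have "f \<otimes> g = (f \<otimes> b) \<otimes> a" using c fC 2(1) by (simp add: m_assoc)
          ultimately show ?thesis by blast
        next
          case False
          then have "\<phi> (f \<otimes> (b \<otimes> a)) x \<in> A" using walk_step.hyps(3) 2(1) by blast
          then have "last \<one> f b a" using 2(2) walk_step.hyps(2) by (simp add: last_def walk.walk_one)
          moreover have "f \<otimes> g = \<one> \<otimes> (f \<otimes> (b \<otimes> a))" using c fC 2(1) by simp
          ultimately show ?thesis by blast
        qed
      next
        case 3
        have l: "f' \<in> F" "walk G \<phi> F A (\<phi> (f' \<otimes> (b \<otimes> a)) x) t" "inB b a"
          using 3(2) by (simp_all add: last_def)
        note c = inB_closed[OF l(3)]
        have tT: "t \<in> ?T" unfolding reach_def using l(2) by blast
        have c': "f' \<in> carrier G" "t \<in> carrier G" using l(1) F(2) tT TC(1) by blast+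
        show ?thesis
        proof (cases "\<phi> (f \<otimes> g) x \<in> B")
          case True
          have eq: "f \<otimes> g = (f \<otimes> (t \<otimes> f')) \<otimes> b \<otimes> a" using c c' fC 3(1) by (simp add: m_assoc)
          have "f \<otimes> (t \<otimes> f') \<in> F'" using F'(3) walk_step.hyps(2) tT l(1) by blast
          then have "inB ((f \<otimes> (t \<otimes> f')) \<otimes> b) a"
            using True l(3) unfolding eq by (intro inB_step)
          then show ?thesis using eq by blast
        next
          case False
          then have "\<phi> (f \<otimes> g) x \<in> A" using walk_step.hyps(3) by blast
          moreover have eq: "f \<otimes> g = (f \<otimes> t) \<otimes> (f' \<otimes> (b \<otimes> a))" using c c' fC 3(1) by (simp add: m_assoc)
          ultimately have "\<phi> (f \<otimes> t) (\<phi> (f' \<otimes> (b \<otimes> a)) x) \<in> A" using c c' fC x by simp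
          then have "walk G \<phi> F A (\<phi> (f' \<otimes> (b \<otimes> a)) x) (f \<otimes> t)"
            by (rule walk.walk_step[OF l(2) walk_step.hyps(2)])
          then have "last (f \<otimes> t) f' b a" using l by (simp add: last_def)
          then show ?thesis using eq by blast
        qed
      qed
    qed
    then consider "inA g" | b a where "g = b \<otimes> a" "inB b a"
      | t f b a where "g = t \<otimes> (f \<otimes> (b \<otimes> a))" "last t f b a" by blast
    then show ?thesis
    proof cases
      case 1
      then show ?thesis unfolding inA_def reach_def by blast
    next
      case 2
      have "(\<one>, b, a) \<in> S \<times> reach G \<phi> F' B \<times> P"
        using 2(2) unfolding inB_def S_def reach_def by blast
      then have "\<one> \<otimes> (b \<otimes> a) \<in> R" unfolding R_def by force
      then show ?thesis using 2(1) inB_closed[OF 2(2)] by simp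
    next
      case 3
      have l: "f \<in> F" "t \<in> ?T" "inB b a" using 3(2) unfolding last_def reach_def by blast+
      then have "(t \<otimes> f, b, a) \<in> S \<times> reach G \<phi> F' B \<times> P"
        unfolding inB_def S_def reach_def by blast
      then have "(t \<otimes> f) \<otimes> (b \<otimes> a) \<in> R" unfolding R_def by force
      moreover have "t \<in> carrier G" "f \<in> carrier G" using l TC F(2) by blast+
      ultimately show ?thesis using 3(1) inB_closed[OF l(3)] by (simp add: m_assoc)
    qed
  qed
  then have "reach G \<phi> F (A \<union> B) \<subseteq> ?T \<union> R" unfolding reach_def by blast
  then show ?thesis using fin A by (meson finite_UnI finite_subset)
qed

end

section \<open>Invariant algebras of sets, and covers obtained from contractions\<close>

locale gspace_algebra = gspace G X \<phi> + alg: Sigma_Algebra.algebra X \<A>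
  for G :: "('a, 'm) monoid_scheme" (structure) and X :: "'x set" and \<phi> \<A> +
  assumes preimage: "\<lbrakk>g \<in> carrier G; S \<in> \<A>\<rbrakk> \<Longrightarrow> {x \<in> X. \<phi> g x \<in> S} \<in> \<A>"
begin

text \<open>Finitely many values are required because clopen sets are closed under finite unions
  only.\<close>

definition simple :: "('x \<Rightarrow> 'v) \<Rightarrow> bool" where
  "simple f \<longleftrightarrow> finite (f ` X) \<and> (\<forall>v. {x \<in> X. f x = v} \<in> \<A>)"

lemma simple_shift:
  assumes f: "simple f" and T: "finite T" "T \<subseteq> carrier G"
    and h: "\<And>x y. \<lbrakk>x \<in> X; y \<in> X; \<forall>t\<in>T. f (\<phi> t x) = f (\<phi> t y)\<rbrakk> \<Longrightarrow> h x = h y"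
  shows "simple h"
proof -
  define p where "p x = restrict (\<lambda>t. f (\<phi> t x)) T" for x
  have "p ` X \<subseteq> PiE T (\<lambda>_. f ` X)"
    using T(2) by (auto simp: p_def)
  moreover have "finite (PiE T (\<lambda>_. f ` X))" using T(1) f by (intro finite_PiE) (auto simp: simple_def)
  ultimately have fin: "finite (p ` X)" by (rule finite_subset)
  define q where "q u = h (SOME x. x \<in> X \<and> p x = u)" for u
  have q: "h x = q (p x)" if x: "x \<in> X" for x
    unfolding q_def
  proof (rule h[OF x])
    have "\<exists>y. y \<in> X \<and> p y = p x" using x by blast
    then have *: "(SOME y. y \<in> X \<and> p y = p x) \<in> X \<and> p (SOME y. y \<in> X \<and> p y = p x) = p x"
      by (rule someI_ex)
    then show "(SOME y. y \<in> X \<and> p y = p x) \<in> X" by (rule conjunct1)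
    show "\<forall>t\<in>T. f (\<phi> t x) = f (\<phi> t (SOME y. y \<in> X \<and> p y = p x))"
    proof
      fix t assume "t \<in> T"
      then show "f (\<phi> t x) = f (\<phi> t (SOME y. y \<in> X \<and> p y = p x))"
        using fun_cong[OF conjunct2[OF *], of t] by (simp add: p_def)
    qed
  qed
  have fibre: "{x \<in> X. p x = u} \<in> \<A>" if "u \<in> p ` X" for u
  proof -
    have "u \<in> extensional T" using that by (auto simp: p_def)
    then have "{x \<in> X. p x = u} = {x \<in> X. \<forall>t\<in>T. \<phi> t x \<in> {y \<in> X. f y = u t}}"
      using T(2) by (auto simp: p_def fun_eq_iff extensional_def restrict_def subset_iff)
    also have "\<dots> \<in> \<A>"
    proof (cases "T = {}")
      case True
      then show ?thesis by simp
    next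
      case False
      then show ?thesis
        using T f by (intro alg.sets_Collect_finite_All' preimage) (auto simp: simple_def)
    qed
    finally show ?thesis .
  qed
  show ?thesis
    unfolding simple_def
  proof (intro conjI allI)
    have "h ` X = q ` p ` X" unfolding image_image using q by (intro image_cong) auto
    then show "finite (h ` X)" using fin by simp
    fix v
    have "{x \<in> X. h x = v} = (\<Union>u\<in>{u \<in> p ` X. q u = v}. {x \<in> X. p x = u})" using q by auto
    also have "\<dots> \<in> \<A>" using fin fibre by (intro alg.finite_UN) auto
    finally show "{x \<in> X. h x = v} \<in> \<A>" .
  qed
qed

lemma simple_Pair:
  assumes "simple f" "simple g"
  shows "simple (\<lambda>x. (f x, g x))"
  unfolding simple_def
proof (intro conjI allI)
  have "(\<lambda>x. (f x, g x)) ` X \<subseteq> f ` X \<times> g ` X" by auto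
  moreover have "finite (f ` X \<times> g ` X)" using assms by (simp add: simple_def)
  ultimately show "finite ((\<lambda>x. (f x, g x)) ` X)" by (rule finite_subset)
  fix v
  have "{x \<in> X. (f x, g x) = v} = {x \<in> X. f x = fst v} \<inter> {x \<in> X. g x = snd v}" by auto
  also have "\<dots> \<in> \<A>" using assms by (intro alg.Int) (simp_all add: simple_def)
  finally show "{x \<in> X. (f x, g x) = v} \<in> \<A>" .
qed

lemma simple_mem: "S \<in> \<A> \<Longrightarrow> simple (\<lambda>x. x \<in> S)"
  unfolding simple_def
proof (intro conjI allI)
  assume S: "S \<in> \<A>"
  show "finite ((\<lambda>x. x \<in> S) ` X)" by (rule finite_subset[of _ UNIV]) auto
  show "{x \<in> X. (x \<in> S) = v} \<in> \<A>" for v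
  proof (cases v)
    case True
    then have "{x \<in> X. (x \<in> S) = v} = X \<inter> S" by auto
    then show ?thesis using S alg.Int alg.top by simp
  next
    case False
    then have "{x \<in> X. (x \<in> S) = v} = X - S" by auto
    then show ?thesis using S alg.compl_sets by simp
  qed
qed

lemma simple_Collect: "simple P \<Longrightarrow> {x \<in> X. P x} \<in> \<A>"
  unfolding simple_def by (elim conjE allE[of _ True]) simp

lemma simple_finitary:
  assumes "simple \<gamma>" "coloured.finitary G X \<phi> \<gamma> h"
  shows "simple h"
proof -
  interpret coloured G X \<phi> \<gamma> by unfold_locales
  obtain W where W: "finite W" "W \<subseteq> carrier G"
    "\<And>x y. \<lbrakk>x \<in> X; y \<in> X; \<forall>w\<in>W. \<gamma> (\<phi> w x) = \<gamma> (\<phi> w y)\<rbrakk> \<Longrightarrow> h x = h y"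
    by (rule finitaryE[OF assms(2)]) (rule that)
  show ?thesis by (rule simple_shift[OF assms(1) W])
qed

text \<open>Here \<open>d\<close> is the number of sets, so dimension \<open>d\<close> corresponds
  to \<open>covered F (Suc d)\<close>.\<close>

definition covered :: "'a set \<Rightarrow> nat \<Rightarrow> bool" where
  "covered F d \<longleftrightarrow> (\<exists>U. (\<forall>i<d. U i \<in> \<A> \<and> finite (reach G \<phi> F (U i))) \<and> X = (\<Union>i<d. U i))"

text \<open>The sets \<open>Z j x\<close> of images of the growing balls \<open>T j\<close> have at most \<open>D\<close> elements, hence stop
  growing at some \<open>j < D\<close>; where this happens at \<open>j\<close>, they are constant along chains.\<close>

lemma covered_if_contracting:
  assumes F: "finite F" "F \<subseteq> carrier G"
    and T: "\<And>j. finite (T j)" "\<And>j. T j \<subseteq> carrier G" "T 0 \<noteq> {}"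
      "\<And>j. T j \<subseteq> T (Suc j)" "\<And>j t f. t \<in> T j \<Longrightarrow> f \<in> F \<Longrightarrow> t \<otimes> f \<in> T (Suc j)"
    and z: "simple z" "\<forall>x\<in>X. z x \<in> carrier G"
    and card: "\<forall>x\<in>X. card ((\<lambda>t. z (\<phi> t x) \<otimes> t) ` T D) \<le> D"
  shows "covered F D"
proof -
  define Z where "Z j x = (\<lambda>t. z (\<phi> t x) \<otimes> t) ` T j" for j x
  define U where "U j = {x \<in> X. Z (Suc j) x = Z j x}" for j
  have fin: "finite (Z j x)" for j x unfolding Z_def using T(1) by simp
  have mono: "Z j x \<subseteq> Z (Suc j) x" for j x unfolding Z_def using T(4) by (rule image_mono)
  have simple_Z: "simple (Z j)" for j
  proof (rule simple_shift[OF z(1) T(1,2)[of j]])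
    fix x y assume "\<forall>t\<in>T j. z (\<phi> t x) = z (\<phi> t y)"
    then show "Z j x = Z j y" unfolding Z_def by (intro image_cong) auto
  qed
  have "simple (\<lambda>x. Z (Suc j) x = Z j x)" for j
    by (rule simple_shift[OF simple_Pair[OF simple_Z[of "Suc j"] simple_Z[of j]], of "{\<one>}"]) auto
  then have U: "U j \<in> \<A>" for j unfolding U_def by (rule simple_Collect)
  \<comment> \<open>Each failure enlarges \<open>Z j x\<close> by at least one element; starting
    from a nonempty set, \<open>D\<close> failures would give more than \<open>D\<close>
    elements.\<close>
  have cover: "\<exists>j<D. x \<in> U j" if x: "x \<in> X" for x
  proof (rule ccontr)
    assume neg: "\<not> (\<exists>j<D. x \<in> U j)"
    have "j < card (Z j x)" if "j \<le> D" for j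
      using that
    proof (induction j)
      case 0
      then show ?case using fin[of 0 x] T(3) by (simp add: card_gt_0_iff Z_def)
    next
      case (Suc j)
      then have "Z (Suc j) x \<noteq> Z j x" using neg x by (simp add: U_def)
      then have "Z j x \<subset> Z (Suc j) x" using mono[of j x] by blast
      then have "card (Z j x) < card (Z (Suc j) x)" by (rule psubset_card_mono[OF fin])
      then show ?case using Suc by simp
    qed
    then show False using card x unfolding Z_def by fastforce
  qed
  have reach: "finite (reach G \<phi> F (U j))" for j
  proof -
    let ?V = "(\<lambda>(v, t). v \<otimes> t) ` (z ` X \<times> T j)"
    have fV: "finite ?V" using z(1) T(1) by (simp add: simple_def)
    have "g \<in> (\<lambda>(u, v). inv u \<otimes> v) ` (?V \<times> ?V)" if g: "walk G \<phi> F (U j) x g" for x g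
    proof -
      have UX: "U j \<subseteq> X" by (auto simp: U_def)
      have x: "x \<in> X" using walk_start[OF g] UX by blast
      \<comment> \<open>Invariant along the walk: the images at \<open>\<phi> g x\<close>,
        translated back to \<open>x\<close>, stay in \<open>Z j x\<close>, since inside
        \<open>U j\<close> the larger ball gives no new images. Later \<open>u\<close> and
        \<open>u \<otimes> g\<close> both lie in the finite set \<open>?V\<close>, which leaves
        finitely many \<open>g\<close>.\<close>
      have "g \<in> carrier G \<and> (\<forall>t\<in>T j. z (\<phi> (t \<otimes> g) x) \<otimes> (t \<otimes> g) \<in> Z j x)"
        using g
      proof (induction rule: walk.induct)
        case walk_one
        have "t \<in> carrier G" if "t \<in> T j" for t using that T(2) by blast
        then show ?case by (auto simp: Z_def)
      next
        case (walk_step g f)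
        have c: "g \<in> carrier G" "f \<in> carrier G" "\<phi> g x \<in> U j"
          using walk_closed[OF walk_step.hyps(1) F(2)] subsetD[OF F(2) walk_step.hyps(2)]
            walk_end[OF walk_step.hyps(1) UX] .
        have "z (\<phi> (t \<otimes> (f \<otimes> g)) x) \<otimes> (t \<otimes> (f \<otimes> g)) \<in> Z j x" if t: "t \<in> T j" for t
        proof -
          have tC: "t \<in> carrier G" using t T(2) by blast
          have "z (\<phi> (t \<otimes> f) (\<phi> g x)) \<otimes> (t \<otimes> f) \<in> Z (Suc j) (\<phi> g x)"
            unfolding Z_def using T(5)[OF t walk_step.hyps(2)] by (rule imageI)
          also have "\<dots> = Z j (\<phi> g x)" using c(3) by (simp add: U_def)
          finally obtain s where s: "s \<in> T j" "z (\<phi> (t \<otimes> f) (\<phi> g x)) \<otimes> (t \<otimes> f) = z (\<phi> s (\<phi> g x)) \<otimes> s"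
            unfolding Z_def by (rule imageE) (rule that)
          have sC: "s \<in> carrier G" using s T(2) by blast
          have zC: "z (\<phi> (t \<otimes> f) (\<phi> g x)) \<in> carrier G" "z (\<phi> s (\<phi> g x)) \<in> carrier G"
            using z(2) x c tC sC by simp_all
          have "z (\<phi> (t \<otimes> (f \<otimes> g)) x) \<otimes> (t \<otimes> (f \<otimes> g)) = (z (\<phi> (t \<otimes> f) (\<phi> g x)) \<otimes> (t \<otimes> f)) \<otimes> g"
            using zC tC c x by (simp add: m_assoc)
          also have "\<dots> = z (\<phi> (s \<otimes> g) x) \<otimes> (s \<otimes> g)"
            unfolding s(2) using zC sC c x by (simp add: m_assoc)
          also have "\<dots> \<in> Z j x" using walk_step.IH s(1) by blast
          finally show ?thesis .
        qed
        then show ?case using c by simp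
      qed
      moreover obtain t where t: "t \<in> T j"
      proof -
        have "T 0 \<subseteq> T j" by (rule lift_Suc_mono_le[of T, OF T(4)]) simp
        then show thesis using T(3) that by blast
      qed
      ultimately have gC: "g \<in> carrier G" and in_Z: "z (\<phi> (t \<otimes> g) x) \<otimes> (t \<otimes> g) \<in> Z j x" by blast+
      have tC: "t \<in> carrier G" using t T(2) by blast
      define u where "u = z (\<phi> (t \<otimes> g) x) \<otimes> t"
      have xc: "\<phi> (t \<otimes> g) x \<in> X" using x gC tC by simp
      have zC: "z (\<phi> (t \<otimes> g) x) \<in> carrier G" using z(2) xc by blast
      have u: "u \<in> ?V" unfolding u_def using xc t by force
      have v: "u \<otimes> g \<in> ?V"
      proof -
        have "u \<otimes> g \<in> Z j x" using in_Z zC tC gC unfolding u_def by (simp add: m_assoc)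
        then obtain s where s: "s \<in> T j" "u \<otimes> g = z (\<phi> s x) \<otimes> s" unfolding Z_def by (rule imageE) (rule that)
        then have "\<phi> s x \<in> X" using x T(2) by blast
        then show ?thesis unfolding s(2) using s(1) by force
      qed
      have "g = inv u \<otimes> (u \<otimes> g)" using zC tC gC by (simp add: u_def inv_cancel)
      then show ?thesis using u v by force
    qed
    then have "reach G \<phi> F (U j) \<subseteq> (\<lambda>(u, v). inv u \<otimes> v) ` (?V \<times> ?V)" unfolding reach_def by blast
    then show ?thesis using fV by (meson finite_SigmaI finite_imageI finite_subset)
  qed
  have "X = (\<Union>j<D. U j)"
  proof
    show "X \<subseteq> (\<Union>j<D. U j)"
    proof
      fix x assume "x \<in> X"
      from cover[OF this] show "x \<in> (\<Union>j<D. U j)" by (elim exE conjE) (rule UN_I, rule lessThan_iff[THEN iffD2])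
    qed
    show "(\<Union>j<D. U j) \<subseteq> X" unfolding U_def by (intro UN_least Collect_subset)
  qed
  then show ?thesis
    unfolding covered_def using U reach by (intro exI[of _ U] conjI allI impI)
qed

end

text \<open>One contraction for the outermost ball \<open>T D\<close> serves all smaller balls; it
  can be requested in advance because \<open>D\<close> is fixed before the balls are built.\<close>

lemma (in gspace_algebra) covered_if_contracts:
  assumes F: "finite F" "F \<subseteq> carrier G"
    and z: "\<And>T. finite T \<Longrightarrow> T \<subseteq> carrier G \<Longrightarrow> \<exists>z. simple z \<and> (\<forall>x\<in>X. z x \<in> carrier G) \<and>
      (\<forall>x\<in>X. card ((\<lambda>t. z (\<phi> t x) \<otimes> t) ` T) \<le> D)"
  shows "covered F D"
proof -
  define T where "T = rec_nat {\<one>} (\<lambda>_ S. S \<union> (\<lambda>(t, f). t \<otimes> f) ` (S \<times> F))"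
  have T_Suc: "T (Suc j) = T j \<union> (\<lambda>(t, f). t \<otimes> f) ` (T j \<times> F)" for j by (simp add: T_def)
  have T_0: "T 0 = {\<one>}" by (simp add: T_def)
  have fin: "finite (T j)" for j using F(1) by (induction j) (simp_all add: T_0 T_Suc)
  have sub: "T j \<subseteq> carrier G" for j
  proof (induction j)
    case (Suc j)
    then show ?case using F(2) unfolding T_Suc by auto
  qed (simp add: T_0)
  obtain z where "simple z \<and> (\<forall>x\<in>X. z x \<in> carrier G) \<and>
      (\<forall>x\<in>X. card ((\<lambda>t. z (\<phi> t x) \<otimes> t) ` T D) \<le> D)"
    using z[OF fin[of D] sub[of D]] by (elim exE)
  note z = conjunct1[OF this] conjunct1[OF conjunct2[OF this]] conjunct2[OF conjunct2[OF this]]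
  show ?thesis
  proof (rule covered_if_contracting[where T = T and z = z, OF F fin sub _ _ _ z])
    show "T 0 \<noteq> {}" by (simp add: T_0)
    show "T j \<subseteq> T (Suc j)" for j unfolding T_Suc by blast
    show "t \<otimes> f \<in> T (Suc j)" if "t \<in> T j" "f \<in> F" for j t f
      unfolding T_Suc using that by (intro UnI2 image_eqI[of _ _ "(t, f)"]) auto
  qed
qed

section \<open>Colourable actions and the reduction of the number of covering sets\<close>

locale colourable_gspace = gspace_algebra G X \<phi> \<A>
  for G :: "('a, 'm) monoid_scheme" (structure) and X :: "'x set" and \<phi> \<A> +
  assumes colouring: "\<lbrakk>finite T; T \<subseteq> carrier G\<rbrakk> \<Longrightarrow> \<exists>c :: 'x \<Rightarrow> nat. simple c \<and>
    (\<forall>t\<in>T. t \<noteq> \<one> \<longrightarrow> (\<forall>x\<in>X. c (\<phi> t x) \<noteq> c x))"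
begin

lemma covered_if_contractible:
  assumes "coarsely_contractible G D" and F: "finite F" "F \<subseteq> carrier G"
  shows "covered F D"
proof (rule covered_if_contracts[OF F])
  fix T assume T: "finite T" "T \<subseteq> carrier G"
  obtain L where L: "finite L" "L \<subseteq> carrier G"
    "\<And>p X \<phi> \<gamma>. \<lbrakk>coloured G (X :: 'x set) \<phi>; \<forall>x\<in>X. \<gamma> x < p; \<forall>l\<in>L. l \<noteq> \<one> \<longrightarrow> (\<forall>x\<in>X. \<gamma> (\<phi> l x) \<noteq> \<gamma> x)\<rbrakk>
       \<Longrightarrow> coloured.contracts G X \<phi> \<gamma> T D"
    by (rule coarsely_contractible_contracts[OF assms(1) T]) (rule that)
  obtain c :: "'x \<Rightarrow> nat" where c: "simple c \<and> (\<forall>l\<in>L. l \<noteq> \<one> \<longrightarrow> (\<forall>x\<in>X. c (\<phi> l x) \<noteq> c x))"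
    using colouring[OF L(1,2)] by (elim exE)
  have "finite (c ` X)" using c by (simp add: simple_def)
  then obtain p where "\<forall>n\<in>c ` X. n < p" unfolding finite_nat_set_iff_bounded by (elim exE)
  then have p: "\<forall>x\<in>X. c x < p" by simp
  interpret coloured G X \<phi> c by unfold_locales
  have "contracts T D" using L(3)[OF coloured_axioms p conjunct2[OF c]] .
  then obtain z W where "finite W \<and> W \<subseteq> carrier G \<and> finitary z \<and> (\<forall>x\<in>X. z x \<in> W) \<and>
     (\<forall>x\<in>X. card ((\<lambda>f. z (\<phi> f x) \<otimes> f) ` T) \<le> D)"
    unfolding contracts_def by (elim exE)
  then have z: "W \<subseteq> carrier G" "finitary z" "\<forall>x\<in>X. z x \<in> W" "\<forall>x\<in>X. card ((\<lambda>f. z (\<phi> f x) \<otimes> f) ` T) \<le> D"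
    by simp_all
  have "simple z" using simple_finitary[OF conjunct1[OF c] z(2)] .
  moreover have "\<forall>x\<in>X. z x \<in> carrier G" using z(1,3) by blast
  ultimately show "\<exists>z. simple z \<and> (\<forall>x\<in>X. z x \<in> carrier G) \<and>
      (\<forall>x\<in>X. card ((\<lambda>t. z (\<phi> t x) \<otimes> t) ` T) \<le> D)"
    using z(4) by (intro exI[of _ z] conjI)
qed

text \<open>The components of \<open>U\<close> are finite. Taking the point of least colour of each component as the
  origin identifies the component with a part of \<open>G\<close>.\<close>

lemma chart:
  assumes F: "finite F" "F \<subseteq> carrier G" and U: "U \<in> \<A>"
    and fin: "finite (reach G \<phi> (F \<union> (\<lambda>f. inv f) ` F) U)"
    and V: "carrier G = (\<Union>i<(d::nat). V i)"
  shows "\<exists>W. (\<forall>i<d. W i \<in> \<A> \<and> reach G \<phi> F (W i) \<subseteq> reach G (\<otimes>) F (V i)) \<and> U = (\<Union>i<d. W i)"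
proof -
  define R where "R = F \<union> (\<lambda>f. inv f) ` F"
  have RC: "R \<subseteq> carrier G" using F(2) by (auto simp: R_def)
  have R_inv: "\<forall>f\<in>R. inv f \<in> R"
  proof
    fix f assume "f \<in> R"
    then consider "f \<in> F" | h where "h \<in> F" "f = inv h" unfolding R_def by blast
    then show "inv f \<in> R"
    proof cases
      case 1
      then show ?thesis unfolding R_def by blast
    next
      case 2
      then have "inv f = h" using F(2) by (simp add: subsetD)
      then show ?thesis using 2 unfolding R_def by blast
    qed
  qed
  have UX: "U \<subseteq> X" using alg.sets_into_space[OF U] .
  define K where "K = reach G \<phi> R U"
  have K: "finite K" "K \<subseteq> carrier G" using fin reach_closed[OF RC] unfolding K_def R_def by blast+
  \<comment> \<open>The component of \<open>x\<close> in \<open>U\<close>, seen from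
    \<open>x\<close>. The colouring below separates the points of a component, since their
    differences lie in \<open>?T\<close>; so there is exactly one point of least colour, and
    \<open>z x\<close> leads to it.\<close>
  define C where "C x = {g. walk G \<phi> R U x g}" for x
  have CK: "C x \<subseteq> K" for x unfolding C_def K_def reach_def by blast
  have CC: "g \<in> carrier G" if "g \<in> C x" for g x using that CK K(2) by blast
  let ?T = "(\<lambda>(g, h). g \<otimes> inv h) ` (K \<times> K)"
  have "finite ?T" "?T \<subseteq> carrier G" using K by auto
  from colouring[OF this] obtain c :: "'x \<Rightarrow> nat" where
    c: "simple c \<and> (\<forall>t\<in>?T. t \<noteq> \<one> \<longrightarrow> (\<forall>x\<in>X. c (\<phi> t x) \<noteq> c x))"
    by (elim exE)
  have c_inj: "g = h" if x: "x \<in> X" and gh: "g \<in> C x" "h \<in> C x" and eq: "c (\<phi> g x) = c (\<phi> h x)" for x g h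
  proof (rule ccontr)
    assume "g \<noteq> h"
    have gc: "g \<in> carrier G" "h \<in> carrier G" using gh CC by blast+
    have "(g \<otimes> inv h) \<otimes> h = g" using gc by (rule mult_inv_cancel)
    then have "g \<otimes> inv h \<noteq> \<one>" using \<open>g \<noteq> h\<close> gc by auto
    moreover have "g \<otimes> inv h \<in> ?T" using gh CK by force
    moreover have "\<phi> h x \<in> X" using x gc by simp
    ultimately have "c (\<phi> (g \<otimes> inv h) (\<phi> h x)) \<noteq> c (\<phi> h x)" using conjunct2[OF c] by blast
    then show False using eq gc x by (simp add: mult_inv_cancel)
  qed
  define least where "least x h \<longleftrightarrow> h \<in> C x \<and> (\<forall>g\<in>C x. c (\<phi> h x) \<le> c (\<phi> g x))" for x h
  have least_unique: "h = h'" if "x \<in> X" "least x h" "least x h'" for x h h'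
  proof (rule c_inj[OF that(1)])
    show "h \<in> C x" "h' \<in> C x" using that by (simp_all add: least_def)
    then show "c (\<phi> h x) = c (\<phi> h' x)" using that by (intro order_antisym) (simp_all add: least_def)
  qed
  define z where "z x = (if x \<in> U then SOME h. least x h else \<one>)" for x
  have z: "least x (z x)" if x: "x \<in> U" for x
  proof -
    have "walk G \<phi> R U x \<one>" using x by (rule walk_one)
    then have "C x \<noteq> {}" unfolding C_def by blast
    moreover have "finite (C x)" using CK K(1) finite_subset by blast
    ultimately obtain h where "h \<in> C x" "\<And>g. g \<in> C x \<Longrightarrow> c (\<phi> h x) \<le> c (\<phi> g x)"
      using ex_min_if_finite[of "(\<lambda>g. c (\<phi> g x)) ` C x"] by (auto simp: not_less)
    then have "least x h" by (simp add: least_def)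
    then have "least x (SOME h. least x h)" by (rule someI)
    then show ?thesis using x by (simp add: z_def)
  qed
  have zC: "z x \<in> carrier G" for x
  proof (cases "x \<in> U")
    case True
    then show ?thesis using z[OF True] CC unfolding least_def by blast
  qed (simp add: z_def)
  have "simple z"
  proof (rule simple_shift[OF simple_Pair[OF conjunct1[OF c] simple_mem[OF U]], of "insert \<one> K"])
    fix x y assume xy: "x \<in> X" "y \<in> X"
      and *: "\<forall>t\<in>insert \<one> K. (c (\<phi> t x), \<phi> t x \<in> U) = (c (\<phi> t y), \<phi> t y \<in> U)"
    have eq: "c (\<phi> t x) = c (\<phi> t y)" "\<phi> t x \<in> U \<longleftrightarrow> \<phi> t y \<in> U" if "t \<in> insert \<one> K" for t
      using bspec[OF * that] by simp_all
    have U_iff: "x \<in> U \<longleftrightarrow> y \<in> U" using eq(2)[of \<one>] xy by simp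
    show "z x = z y"
    proof (cases "x \<in> U")
      case True
      then have yU: "y \<in> U" using U_iff by simp
      have C_eq: "C x = C y"
        unfolding C_def using walk_same_pattern[of R U x _ y] walk_same_pattern[of R U y _ x] eq(2) True yU
        unfolding K_def[symmetric] by blast
      have same: "c (\<phi> g x) = c (\<phi> g y)" if "g \<in> C x" for g
        using subsetD[OF CK that] by (intro eq(1)) simp
      have zx: "z x \<in> C x" "\<And>g. g \<in> C x \<Longrightarrow> c (\<phi> (z x) x) \<le> c (\<phi> g x)"
        using z[OF True] unfolding least_def by blast+
      have "c (\<phi> (z x) y) \<le> c (\<phi> g y)" if "g \<in> C x" for g
        using zx(2)[OF that] unfolding same[OF that] same[OF zx(1)] .
      then have "least y (z x)" using zx(1) unfolding least_def C_eq[symmetric] by (intro conjI ballI)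
      then show ?thesis using least_unique[OF xy(2) _ z[OF yU]] by simp
    next
      case False
      then show ?thesis using U_iff by (simp add: z_def)
    qed
  qed (simp_all add: K)
  \<comment> \<open>The origin is the same for all points of a component. Comparing
    \<open>least\<close> at \<open>x\<close> and at \<open>\<phi> h x\<close> requires walking back,
    hence the symmetric step set \<open>R\<close>.\<close>
  have z_shift: "z (\<phi> h x) \<otimes> h = z x" if h: "walk G \<phi> R U x h" for x h
  proof -
    have xU: "x \<in> U" using walk_start[OF h] .
    have hU: "\<phi> h x \<in> U" using walk_end[OF h UX] .
    have x: "x \<in> X" "h \<in> carrier G" using xU UX walk_closed[OF h RC] by auto
    have l: "least (\<phi> h x) (z (\<phi> h x))" using z[OF hU] .
    have "least x (z (\<phi> h x) \<otimes> h)"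
      unfolding least_def
    proof (intro conjI ballI)
      have "walk G \<phi> R U (\<phi> h x) (z (\<phi> h x))" using l by (simp add: least_def C_def)
      from walk_trans[OF this h RC UX] show "z (\<phi> h x) \<otimes> h \<in> C x" by (simp add: C_def)
      fix g assume g: "g \<in> C x"
      then have gC: "g \<in> carrier G" by (rule CC)
      have "walk G \<phi> R U (\<phi> (inv h) (\<phi> h x)) g" using g x by (simp add: C_def)
      from walk_trans[OF this walk_inv[OF h RC R_inv UX] RC UX] have "g \<otimes> inv h \<in> C (\<phi> h x)" by (simp add: C_def)
      then have "c (\<phi> (z (\<phi> h x)) (\<phi> h x)) \<le> c (\<phi> (g \<otimes> inv h) (\<phi> h x))" using l by (simp add: least_def)
      then show "c (\<phi> (z (\<phi> h x) \<otimes> h) x) \<le> c (\<phi> g x)" using x gC zC by (simp add: mult_inv_cancel)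
    qed
    then show ?thesis using least_unique[OF x(1) _ z[OF xU]] by blast
  qed
  \<comment> \<open>\<open>inv (z x)\<close> is the coordinate of \<open>x\<close> relative to the
    origin of its component; in this coordinate a walk in \<open>W i\<close> becomes a walk in
    \<open>V i\<close> with the same product.\<close>
  define W where "W i = {x \<in> X. x \<in> U \<and> inv (z x) \<in> V i}" for i
  show ?thesis
  proof (rule exI[of _ W], intro conjI allI impI)
    fix i assume "i < d"
    have "simple (\<lambda>x. x \<in> U \<and> inv (z x) \<in> V i)"
      by (rule simple_shift[OF simple_Pair[OF \<open>simple z\<close> simple_mem[OF U]], of "{\<one>}"]) auto
    then show "W i \<in> \<A>" unfolding W_def by (rule simple_Collect)
    have WU: "W i \<subseteq> U" by (auto simp: W_def)
    have "walk G (\<otimes>) F (V i) (inv (z x)) g" if "walk G \<phi> F (W i) x g" for x g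
      using that
    proof (induction rule: walk.induct)
      case walk_one
      then show ?case by (intro walk.walk_one) (simp add: W_def)
    next
      case (walk_step g f)
      have w: "walk G \<phi> F (W i) x (f \<otimes> g)" by (rule walk.walk_step[OF walk_step.hyps])
      have c: "f \<otimes> g \<in> carrier G" by (rule walk_closed[OF w F(2)])
      have "walk G \<phi> R U x (f \<otimes> g)" by (rule walk_mono[OF w _ WU]) (simp add: R_def)
      from z_shift[OF this] have e: "z (\<phi> (f \<otimes> g) x) \<otimes> (f \<otimes> g) = z x" .
      have "inv (z (\<phi> (f \<otimes> g) x)) = (f \<otimes> g) \<otimes> inv (z x)"
        unfolding e[symmetric] using c zC by (simp only: inv_mult_group inv_cancel inv_closed m_closed)
      moreover have "inv (z (\<phi> (f \<otimes> g) x)) \<in> V i" using walk_step.hyps(3) by (simp add: W_def)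
      ultimately show ?case by (intro walk.walk_step[OF walk_step.IH walk_step.hyps(2)]) simp
    qed
    then show "reach G \<phi> F (W i) \<subseteq> reach G (\<otimes>) F (V i)" unfolding reach_def by blast
  next
    have "inv (z x) \<in> (\<Union>i<d. V i)" for x using zC unfolding V[symmetric] by simp
    then show "U = (\<Union>i<d. W i)" using UX unfolding W_def by blast
  qed
qed

text \<open>The scale at which the charts of the last set are covered is fixed before the scale \<open>F'\<close> of the
  other sets, so that the two covers can be united.\<close>

lemma covered_if_covered:
  assumes F: "finite F" "F \<subseteq> carrier G"
    and X: "\<And>F. finite F \<Longrightarrow> F \<subseteq> carrier G \<Longrightarrow> covered F D"
    and G: "\<And>F. finite F \<Longrightarrow> F \<subseteq> carrier G \<Longrightarrow>
      \<exists>V. (\<forall>i<d. finite (reach G (\<otimes>) F (V i))) \<and> carrier G = (\<Union>i<d. V i)"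
  shows "covered F d"
proof -
  \<comment> \<open>Induction on the number \<open>k\<close> of sets, for all step sets
    \<open>F\<close> at once: \<open>R\<close> is the scale at which the \<open>k\<close> sets must
    have finite chains in order to be redistributed into \<open>d\<close> sets.\<close>
  have "\<exists>R. finite R \<and> R \<subseteq> carrier G \<and> (\<forall>A. (\<forall>j<k. A j \<in> \<A> \<and> finite (reach G \<phi> R (A j))) \<longrightarrow>
    (\<exists>W. (\<forall>i<d. W i \<in> \<A> \<and> finite (reach G \<phi> F (W i))) \<and> (\<Union>j<k. A j) = (\<Union>i<d. W i)))"
    if "finite F" "F \<subseteq> carrier G" for k :: nat and F
    using that
  proof (induction k arbitrary: F)
    case 0
    show ?case
    proof (rule exI[of _ "{}"], intro conjI allI impI)
      show "\<exists>W. (\<forall>i<d. W i \<in> \<A> \<and> finite (reach G \<phi> F (W i))) \<and> (\<Union>j<0. A j) = (\<Union>i<d. W i)"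
        for A :: "nat \<Rightarrow> 'x set"
        by (rule exI[of _ "\<lambda>_. {}"]) simp
    qed simp_all
  next
    case (Suc k)
    note F = Suc.prems
    obtain V where V: "\<forall>i<d. finite (reach G (\<otimes>) F (V i))" "carrier G = (\<Union>i<d. V i)"
      using G[OF F] by (elim exE conjE) (rule that)
    interpret self: gspace G "carrier G" "(\<otimes>)" by (rule gspace_self)
    \<comment> \<open>\<open>T\<close> bounds the chains of the charted pieces before the set to be
      charted is known, so the enlarged step set \<open>F'\<close> can be passed to the induction
      hypothesis.\<close>
    define T where "T = (\<Union>i<d. reach G (\<otimes>) F (V i))"
    have T: "finite T" "T \<subseteq> carrier G" unfolding T_def using V(1) self.reach_closed[OF F(2)] by auto
    define F' where "F' = F \<union> (\<lambda>(f, t, f'). f \<otimes> (t \<otimes> f')) ` (F \<times> T \<times> F)"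
    have F': "finite F'" "F' \<subseteq> carrier G" using F T by (auto simp: F'_def)
    obtain R where "finite R \<and> R \<subseteq> carrier G \<and> (\<forall>A. (\<forall>j<k. A j \<in> \<A> \<and> finite (reach G \<phi> R (A j))) \<longrightarrow>
    (\<exists>W. (\<forall>i<d. W i \<in> \<A> \<and> finite (reach G \<phi> F' (W i))) \<and> (\<Union>j<k. A j) = (\<Union>i<d. W i)))"
      using Suc.IH[OF F'] by (elim exE)
    then have R: "finite R" "R \<subseteq> carrier G"
      "\<And>A. (\<forall>j<k. A j \<in> \<A> \<and> finite (reach G \<phi> R (A j))) \<Longrightarrow>
        \<exists>W. (\<forall>i<d. W i \<in> \<A> \<and> finite (reach G \<phi> F' (W i))) \<and> (\<Union>j<k. A j) = (\<Union>i<d. W i)"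
      by simp_all
    define S where "S = F \<union> (\<lambda>f. inv f) ` F"
    show ?case
    proof (rule exI[of _ "R \<union> S"], intro conjI allI impI)
      show "finite (R \<union> S)" "R \<union> S \<subseteq> carrier G" using R F by (auto simp: S_def)
      fix A assume A: "\<forall>j<Suc k. A j \<in> \<A> \<and> finite (reach G \<phi> (R \<union> S) (A j))"
      have fin: "finite (reach G \<phi> S (A k))" "\<forall>j<k. A j \<in> \<A> \<and> finite (reach G \<phi> R (A j))"
        using A finite_subset[OF reach_mono[OF Un_upper2[of S R] order_refl, of G \<phi> "A k"]]
          finite_subset[OF reach_mono[OF Un_upper1[of R S] order_refl, of G \<phi> "A j" for j]]
        by simp_all
      have Ak: "A k \<in> \<A>" using A by simp
      obtain C where C: "\<forall>i<d. C i \<in> \<A> \<and> reach G \<phi> F (C i) \<subseteq> reach G (\<otimes>) F (V i)" "A k = (\<Union>i<d. C i)"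
        using chart[OF F Ak fin(1)[unfolded S_def] V(2)] by (elim exE conjE) (rule that)
      obtain B where B: "\<forall>i<d. B i \<in> \<A> \<and> finite (reach G \<phi> F' (B i))" "(\<Union>j<k. A j) = (\<Union>i<d. B i)"
        using R(3)[OF fin(2)] by (elim exE conjE) (rule that)
      show "\<exists>W. (\<forall>i<d. W i \<in> \<A> \<and> finite (reach G \<phi> F (W i))) \<and> (\<Union>j<Suc k. A j) = (\<Union>i<d. W i)"
      proof (rule exI[of _ "\<lambda>i. C i \<union> B i"], intro conjI allI impI)
        fix i assume i: "i < d"
        have CB: "C i \<in> \<A>" "B i \<in> \<A>" using C(1) B(1) i by auto
        show "C i \<union> B i \<in> \<A>" using CB by (rule alg.Un)
        have sub: "reach G \<phi> F (C i) \<subseteq> T" using C(1) i unfolding T_def by blast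
        show "finite (reach G \<phi> F (C i \<union> B i))"
        proof (rule finite_reach_Un[OF F alg.sets_into_space[OF CB(1)] alg.sets_into_space[OF CB(2)] _ _ F'(2)])
          show "finite (reach G \<phi> F (C i))" using finite_subset[OF sub T(1)] .
          show "finite (reach G \<phi> F' (B i))" using B(1) i by blast
          show "F \<subseteq> F'" by (simp add: F'_def)
          show "\<forall>f\<in>F. \<forall>t\<in>reach G \<phi> F (C i). \<forall>f'\<in>F. f \<otimes> (t \<otimes> f') \<in> F'"
            using sub unfolding F'_def by force
        qed
      next
        show "(\<Union>j<Suc k. A j) = (\<Union>i<d. C i \<union> B i)"
          unfolding lessThan_Suc UN_insert B(2) C(2) by blast
      qed
    qed
  qed
  from this[OF F, of D] obtain R where "finite R \<and> R \<subseteq> carrier G \<and> (\<forall>A. (\<forall>j<D. A j \<in> \<A> \<and> finite (reach G \<phi> R (A j))) \<longrightarrow>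
    (\<exists>W. (\<forall>i<d. W i \<in> \<A> \<and> finite (reach G \<phi> F (W i))) \<and> (\<Union>j<D. A j) = (\<Union>i<d. W i)))"
    by (elim exE)
  then have R: "finite R" "R \<subseteq> carrier G"
    "\<And>A. (\<forall>j<D. A j \<in> \<A> \<and> finite (reach G \<phi> R (A j))) \<Longrightarrow>
      \<exists>W. (\<forall>i<d. W i \<in> \<A> \<and> finite (reach G \<phi> F (W i))) \<and> (\<Union>j<D. A j) = (\<Union>i<d. W i)"
    by simp_all
  obtain A where A: "\<forall>j<D. A j \<in> \<A> \<and> finite (reach G \<phi> R (A j))" "X = (\<Union>j<D. A j)"
    using X[OF R(1,2)] unfolding covered_def by (elim exE conjE) (rule that)
  show ?thesis using R(3)[OF A(1)] unfolding covered_def A(2)[symmetric] .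
qed

end

section \<open>Asymptotic dimension and covers\<close>

lemma (in gspace) gspace_algebra_Pow: "gspace_algebra G X \<phi> (Pow X)"
proof (intro gspace_algebra.intro gspace_algebra_axioms.intro)
  show "gspace G X \<phi>" by (rule gspace_axioms)
  show "Sigma_Algebra.algebra X (Pow X)" by (rule algebra_Pow)
qed auto

locale metric_group = group G for G :: "('a, 'm) monoid_scheme" (structure) +
  fixes \<tau> :: "'a \<Rightarrow> 'a \<Rightarrow> real"
  assumes proper_metric: "proper_right_invariant_metric G \<tau>"
begin

sublocale M: Metric_space "carrier G" \<tau>
  using proper_metric by (simp add: proper_right_invariant_metric_def)

lemma finite_ball: "finite {g \<in> carrier G. \<tau> \<one> g \<le> r}"
proof -
  have "M.mcball \<one> r = {g \<in> carrier G. \<tau> \<one> g \<le> r}" by auto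
  then show ?thesis using proper_metric unfolding proper_right_invariant_metric_def by (metis one_closed)
qed

lemma metric_right_shift: "\<lbrakk>g \<in> carrier G; h \<in> carrier G\<rbrakk> \<Longrightarrow> \<tau> \<one> (h \<otimes> inv g) = \<tau> g h"
  using proper_metric one_closed inv_closed m_closed l_one mult_inv_cancel(2)
  unfolding proper_right_invariant_metric_def by metis

text \<open>Sending each \<open>g\<close> to a chosen point of its class is a contraction. The
  displacements are bounded by the diameters of the classes, hence finite in number by properness,
  and the translate of \<open>T\<close> by \<open>g\<close> has at most as many images as the ball
  of radius \<open>r\<close> around \<open>g\<close> meets classes.\<close>

lemma covered_if_asdim:
  assumes asdim: "asdim_at_most P (carrier G) (\<lambda>g h. ennreal (\<tau> g h)) d" and F: "finite F" "F \<subseteq> carrier G"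
  shows "\<exists>V. (\<forall>i<Suc d. finite (reach G (\<otimes>) F (V i))) \<and> carrier G = (\<Union>i<Suc d. V i)"
proof -
  interpret gspace G "carrier G" "(\<otimes>)" by (rule gspace_self)
  interpret gspace_algebra G "carrier G" "(\<otimes>)" "Pow (carrier G)"
    by (rule gspace_algebra_Pow)
  have "covered F (Suc d)"
  proof (rule covered_if_contracts[OF F])
    fix T assume T: "finite T" "T \<subseteq> carrier G"
    define r where "r = Max (insert 1 (\<tau> \<one> ` T))"
    have r: "1 \<le> r" "\<And>t. t \<in> T \<Longrightarrow> \<tau> \<one> t \<le> r" unfolding r_def using T(1) by simp_all
    have "0 < r" using r(1) by simp
    from asdim[unfolded asdim_at_most_def, rule_format, OF this] obtain E where
      E: "equiv (carrier G) E" "uniformly_bounded (carrier G) (\<lambda>g h. ennreal (\<tau> g h)) E"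
      and ball: "\<And>g. g \<in> carrier G \<Longrightarrow>
        finite {C \<in> carrier G // E. C \<inter> ext_cball (carrier G) (\<lambda>g h. ennreal (\<tau> g h)) g r \<noteq> {}} \<and>
        card {C \<in> carrier G // E. C \<inter> ext_cball (carrier G) (\<lambda>g h. ennreal (\<tau> g h)) g r \<noteq> {}} \<le> d + 1"
      by blast
    obtain D where D: "D < \<infinity>" "\<And>C. C \<in> carrier G // E \<Longrightarrow> ext_diameter (\<lambda>g h. ennreal (\<tau> g h)) C \<le> D"
      using E(2) unfolding uniformly_bounded_def by blast
    define b where "b C = (SOME g. g \<in> C)" for C :: "'a set"
    have b: "b (E `` {g}) \<in> E `` {g}" if "g \<in> carrier G" for g
      unfolding b_def using equiv_class_self[OF E(1) that] by (rule someI)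
    have bC: "b (E `` {g}) \<in> carrier G" if "g \<in> carrier G" for g
      using b[OF that] E(1) equiv_class_eq_iff by fastforce
    define z where "z g = b (E `` {g}) \<otimes> inv g" for g
    have "z g \<in> {g \<in> carrier G. \<tau> \<one> g \<le> enn2real D}" if g: "g \<in> carrier G" for g
    proof -
      have "ennreal (\<tau> g (b (E `` {g}))) \<le> ext_diameter (\<lambda>g h. ennreal (\<tau> g h)) (E `` {g})"
        unfolding ext_diameter_def
        using b[OF g] equiv_class_self[OF E(1) g] by (intro SUP_upper2[of g] SUP_upper2[of "b (E `` {g})"]) auto
      also have "\<dots> \<le> D" by (rule D(2)) (rule quotientI[OF g])
      finally have "\<tau> g (b (E `` {g})) \<le> enn2real D"
        using D(1) enn2real_mono[of "ennreal (\<tau> g (b (E `` {g})))" D] by simp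
      then show ?thesis using metric_right_shift[OF g bC[OF g]] bC[OF g] g by (simp add: z_def)
    qed
    then have zim: "z ` carrier G \<subseteq> {g \<in> carrier G. \<tau> \<one> g \<le> enn2real D}" by blast
    have "simple z"
      unfolding simple_def using finite_subset[OF zim finite_ball] by auto
    moreover have "\<forall>g\<in>carrier G. z g \<in> carrier G" using zim by blast
    moreover have "\<forall>g\<in>carrier G. card ((\<lambda>t. z (t \<otimes> g) \<otimes> t) ` T) \<le> Suc d"
    proof
      fix g assume g: "g \<in> carrier G"
      let ?S = "{C \<in> carrier G // E. C \<inter> ext_cball (carrier G) (\<lambda>g h. ennreal (\<tau> g h)) g r \<noteq> {}}"
      have "(\<lambda>t. z (t \<otimes> g) \<otimes> t) ` T \<subseteq> (\<lambda>C. b C \<otimes> inv g) ` ?S"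
      proof (rule image_subsetI)
        fix t assume t: "t \<in> T"
        then have tC: "t \<in> carrier G" using T(2) by blast
        let ?C = "E `` {t \<otimes> g}"
        have "\<tau> g (t \<otimes> g) = \<tau> \<one> t"
          using metric_right_shift[of g "t \<otimes> g"] g tC by (simp add: mult_inv_cancel)
        then have "ennreal (\<tau> g (t \<otimes> g)) \<le> ennreal r" using r(2)[OF t] by (simp only: ennreal_leI)
        moreover have tg: "t \<otimes> g \<in> carrier G" using g tC by (intro m_closed)
        ultimately have "t \<otimes> g \<in> ext_cball (carrier G) (\<lambda>g h. ennreal (\<tau> g h)) g r"
          unfolding ext_cball_def by (intro CollectI conjI)
        with equiv_class_self[OF E(1) tg]
        have "t \<otimes> g \<in> ?C \<inter> ext_cball (carrier G) (\<lambda>g h. ennreal (\<tau> g h)) g r" by (rule IntI)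
        then have ne: "?C \<inter> ext_cball (carrier G) (\<lambda>g h. ennreal (\<tau> g h)) g r \<noteq> {}" by (metis empty_iff)
        have C: "?C \<in> ?S"
          unfolding mem_Collect_eq using quotientI[OF tg, of E] ne by (rule conjI)
        have "z (t \<otimes> g) \<otimes> t = (b ?C \<otimes> (inv g \<otimes> inv t)) \<otimes> t"
          unfolding z_def inv_mult_group[OF tC g] ..
        also have "\<dots> = b ?C \<otimes> inv g" using g tC bC[OF tg] by (simp add: m_assoc del: act_act)
        finally have eq: "z (t \<otimes> g) \<otimes> t = b ?C \<otimes> inv g" .
        show "z (t \<otimes> g) \<otimes> t \<in> (\<lambda>C. b C \<otimes> inv g) ` ?S" unfolding eq using C by (rule imageI)
      qed
      then have "card ((\<lambda>t. z (t \<otimes> g) \<otimes> t) ` T) \<le> card ?S"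
        by (rule surj_card_le[OF conjunct1[OF ball[OF g]]])
      then show "card ((\<lambda>t. z (t \<otimes> g) \<otimes> t) ` T) \<le> Suc d" using ball[OF g] by simp
    qed
    ultimately show "\<exists>z. simple z \<and> (\<forall>x\<in>carrier G. z x \<in> carrier G) \<and>
      (\<forall>x\<in>carrier G. card ((\<lambda>t. z (t \<otimes> x) \<otimes> t) ` T) \<le> Suc d)"
      by (intro exI[of _ z] conjI)
  qed
  then obtain V where "\<forall>i<Suc d. V i \<in> Pow (carrier G) \<and> finite (reach G (\<otimes>) F (V i))"
    "carrier G = (\<Union>i<Suc d. V i)"
    unfolding covered_def by (elim exE conjE) (rule that)
  then show ?thesis by (intro exI[of _ V] conjI) simp_all
qed

end

section \<open>Orbit metrics of free actions\<close>

locale free_gspace = gspace G X \<phi> + metric_group G \<tau>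
  for G :: "('a, 'm) monoid_scheme" (structure) and X :: "'x set" and \<phi> \<tau> +
  assumes free: "\<lbrakk>g \<in> carrier G; x \<in> X; \<phi> g x = x\<rbrakk> \<Longrightarrow> g = \<one>"
begin

lemma orbit_injective:
  assumes gh: "g \<in> carrier G" "h \<in> carrier G" and x: "x \<in> X" and eq: "\<phi> g x = \<phi> h x"
  shows "g = h"
proof -
  have "\<phi> (inv h \<otimes> g) x = \<phi> (inv h) (\<phi> g x)" using gh x by simp
  also have "\<dots> = \<phi> (inv h) (\<phi> h x)" by (simp only: eq)
  also have "\<dots> = x" using gh x by simp
  finally have "inv h \<otimes> g = \<one>" using gh x by (intro free) simp_all
  then have "h \<otimes> (inv h \<otimes> g) = h" using gh by simp
  then show "g = h" using gh by (simp add: inv_cancel)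
qed

lemma orbit_metric_act:
  assumes "g \<in> carrier G" "x \<in> X"
  shows "orbit_metric G \<tau> \<phi> x (\<phi> g x) = ennreal (\<tau> \<one> g)"
proof -
  have "{h \<in> carrier G. \<phi> h x = \<phi> g x} = {g}" using orbit_injective[OF _ assms] assms(1) by blast
  then show ?thesis unfolding orbit_metric_def by simp
qed

lemma orbit_metric_le:
  assumes "orbit_metric G \<tau> \<phi> x y \<le> ennreal r" "0 \<le> r" "x \<in> X"
  obtains g where "g \<in> carrier G" "y = \<phi> g x" "\<tau> \<one> g \<le> r"
proof -
  have "{g \<in> carrier G. \<phi> g x = y} \<noteq> {}"
  proof
    assume "{g \<in> carrier G. \<phi> g x = y} = {}"
    then have "orbit_metric G \<tau> \<phi> x y = \<infinity>" unfolding orbit_metric_def by simp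
    then show False using assms(1) by (simp add: top_unique)
  qed
  then obtain g where g: "g \<in> carrier G" "\<phi> g x = y" by blast
  have "ennreal (\<tau> \<one> g) \<le> ennreal r" using assms(1) unfolding g(2)[symmetric] orbit_metric_act[OF g(1) assms(3)] .
  then have "\<tau> \<one> g \<le> r" using assms(2) by simp
  then show ?thesis using that[OF g(1) g(2)[symmetric]] by blast
qed

lemma orbit_metric_orbit:
  assumes "g \<in> carrier G" "h \<in> carrier G" "x \<in> X"
  shows "orbit_metric G \<tau> \<phi> (\<phi> g x) (\<phi> h x) = ennreal (\<tau> g h)"
proof -
  have eq: "\<phi> (h \<otimes> inv g) (\<phi> g x) = \<phi> h x" using assms by (simp add: mult_inv_cancel)
  have "orbit_metric G \<tau> \<phi> (\<phi> g x) (\<phi> (h \<otimes> inv g) (\<phi> g x)) = ennreal (\<tau> \<one> (h \<otimes> inv g))"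
    using assms by (intro orbit_metric_act) simp_all
  then show ?thesis unfolding eq metric_right_shift[OF assms(1,2)] .
qed

text \<open>By freeness and right invariance an orbit map is an isometric embedding of the group,
  along which the equivalence relations on \<open>X\<close> are pulled back.\<close>

lemma asdim_orbit:
  assumes asdim: "asdim_at_most P X (orbit_metric G \<tau> \<phi>) d" and "X \<noteq> {}"
  shows "asdim_at_most (\<lambda>_. True) (carrier G) (\<lambda>g h. ennreal (\<tau> g h)) d"
  unfolding asdim_at_most_def
proof (intro allI impI)
  fix r :: real assume "0 < r"
  from asdim[unfolded asdim_at_most_def, rule_format, OF this] obtain E where
    E: "equiv X E" "uniformly_bounded X (orbit_metric G \<tau> \<phi>) E"
    and ball: "\<And>x. x \<in> X \<Longrightarrow> finite {C \<in> X // E. C \<inter> ext_cball X (orbit_metric G \<tau> \<phi>) x r \<noteq> {}} \<and>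
      card {C \<in> X // E. C \<inter> ext_cball X (orbit_metric G \<tau> \<phi>) x r \<noteq> {}} \<le> d + 1"
    by blast
  obtain x where x: "x \<in> X" using assms(2) by blast
  have ox: "\<phi> g x \<in> X" if "g \<in> carrier G" for g using that x by simp
  define E' where "E' = {(g, h). g \<in> carrier G \<and> h \<in> carrier G \<and> (\<phi> g x, \<phi> h x) \<in> E}"
  have sym: "(b, a) \<in> E" if "(a, b) \<in> E" for a b using E(1) that by (meson equivE symD)
  have trans: "(a, c) \<in> E" if "(a, b) \<in> E" "(b, c) \<in> E" for a b c using E(1) that by (meson equivE transD)
  have refl: "(a, a) \<in> E" if "a \<in> X" for a using E(1) that equiv_class_self by fastforce
  have E': "equiv (carrier G) E'"
  proof (rule equivI)
    show "E' \<subseteq> carrier G \<times> carrier G" by (auto simp: E'_def)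
    show "refl_on (carrier G) E'" by (auto simp: refl_on_def E'_def intro: refl ox)
    show "sym E'" by (auto simp: sym_def E'_def intro: sym)
    show "trans E'" unfolding trans_def E'_def using trans by blast
  qed
  have quot: "C \<in> carrier G // E' \<longleftrightarrow> (\<exists>h\<in>carrier G. C = E' `` {h})" for C
    unfolding quotient_def by blast
  have img: "E `` ((\<lambda>h. \<phi> h x) ` (E' `` {h})) = E `` {\<phi> h x}" if "h \<in> carrier G" for h
    using that trans refl ox unfolding E'_def by blast
  show "\<exists>E. True \<and> equiv (carrier G) E \<and> uniformly_bounded (carrier G) (\<lambda>g h. ennreal (\<tau> g h)) E \<and>
    (\<forall>g\<in>carrier G. finite {C \<in> carrier G // E. C \<inter> ext_cball (carrier G) (\<lambda>g h. ennreal (\<tau> g h)) g r \<noteq> {}} \<and>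
       card {C \<in> carrier G // E. C \<inter> ext_cball (carrier G) (\<lambda>g h. ennreal (\<tau> g h)) g r \<noteq> {}} \<le> d + 1)"
  proof (rule exI[of _ E'], intro conjI TrueI ballI E')
    obtain D where D: "D < \<infinity>" "\<And>C. C \<in> X // E \<Longrightarrow> ext_diameter (orbit_metric G \<tau> \<phi>) C \<le> D"
      using E(2) unfolding uniformly_bounded_def by blast
    show "uniformly_bounded (carrier G) (\<lambda>g h. ennreal (\<tau> g h)) E'"
      unfolding uniformly_bounded_def
    proof (intro exI[of _ D] conjI D(1) ballI)
      fix C assume "C \<in> carrier G // E'"
      then obtain h where h: "h \<in> carrier G" "C = E' `` {h}" unfolding quot by blast
      show "ext_diameter (\<lambda>g h. ennreal (\<tau> g h)) C \<le> D"
        unfolding ext_diameter_def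
      proof (intro SUP_least)
        fix a b assume "a \<in> C" "b \<in> C"
        then have ab: "a \<in> carrier G" "b \<in> carrier G" "\<phi> a x \<in> E `` {\<phi> h x}" "\<phi> b x \<in> E `` {\<phi> h x}"
          unfolding h(2) by (auto simp: E'_def)
        have "ennreal (\<tau> a b) = orbit_metric G \<tau> \<phi> (\<phi> a x) (\<phi> b x)"
          using orbit_metric_orbit[OF ab(1,2) x] by simp
        also have "\<dots> \<le> ext_diameter (orbit_metric G \<tau> \<phi>) (E `` {\<phi> h x})"
          unfolding ext_diameter_def
          by (rule SUP_upper2[OF ab(3)], rule SUP_upper[OF ab(4)])
        also have "\<dots> \<le> D" by (intro D(2) quotientI ox h)
        finally show "ennreal (\<tau> a b) \<le> D" .
      qed
    qed
    fix g assume g: "g \<in> carrier G"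
    let ?S' = "{C \<in> carrier G // E'. C \<inter> ext_cball (carrier G) (\<lambda>g h. ennreal (\<tau> g h)) g r \<noteq> {}}"
    let ?S = "{C \<in> X // E. C \<inter> ext_cball X (orbit_metric G \<tau> \<phi>) (\<phi> g x) r \<noteq> {}}"
    let ?f = "\<lambda>C. E `` ((\<lambda>h. \<phi> h x) ` C)"
    have inj: "inj_on ?f ?S'"
    proof (rule inj_onI)
      fix C C' assume "C \<in> ?S'" "C' \<in> ?S'" and eq: "?f C = ?f C'"
      then obtain h h' where h: "h \<in> carrier G" "C = E' `` {h}" "h' \<in> carrier G" "C' = E' `` {h'}"
        unfolding quot by blast
      then have "E `` {\<phi> h x} = E `` {\<phi> h' x}" using eq img by simp
      then have "(\<phi> h x, \<phi> h' x) \<in> E" using refl[OF ox[OF h(3)]] by blast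
      then have "(h, h') \<in> E'" using h by (simp add: E'_def)
      then show "C = C'" unfolding h(2,4) by (rule equiv_class_eq[OF E'])
    qed
    have sub: "?f ` ?S' \<subseteq> ?S"
    proof (rule image_subsetI)
      fix C assume "C \<in> ?S'"
      then obtain h k where h: "h \<in> carrier G" "C = E' `` {h}" "k \<in> C"
        "k \<in> ext_cball (carrier G) (\<lambda>g h. ennreal (\<tau> g h)) g r" unfolding quot by blast
      have k: "k \<in> carrier G" "ennreal (\<tau> g k) \<le> ennreal r" using h(4) by (simp_all add: ext_cball_def)
      have "\<phi> k x \<in> ext_cball X (orbit_metric G \<tau> \<phi>) (\<phi> g x) r"
        using k orbit_metric_orbit[OF g k(1) x] ox by (simp add: ext_cball_def)
      moreover have "\<phi> k x \<in> E `` {\<phi> h x}" using h by (simp add: E'_def)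
      moreover have "E `` {\<phi> h x} \<in> X // E" by (intro quotientI ox h)
      ultimately show "?f C \<in> ?S" unfolding h(2) img[OF h(1)] by blast
    qed
    have fin: "finite ?S" "card ?S \<le> d + 1" using ball[OF ox[OF g]] by simp_all
    show "finite ?S'" using inj_on_finite[OF inj sub fin(1)] .
    show "card ?S' \<le> d + 1" using card_inj_on_le[OF inj sub fin(1)] fin(2) by simp
  qed
qed

text \<open>The classes are the components, under \<open>F\<close>-walks, of the covering sets made
  disjoint; finiteness of \<open>reach\<close> bounds their diameters. \<open>F\<close> contains all
  differences of elements of norm at most \<open>r\<close>, so two points of one ball in the same
  \<open>V j\<close> are equivalent, and a ball meets at most \<open>d + 1\<close> classes.
  \<open>P\<close> abstracts what has to be known about the relation, which is a finite union of
  graphs over sets of the algebra.\<close>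

lemma asdim_if_covered:
  assumes alg: "gspace_algebra G X \<phi> \<A>"
    and cov: "\<And>F. \<lbrakk>finite F; F \<subseteq> carrier G\<rbrakk> \<Longrightarrow> gspace_algebra.covered G X \<phi> \<A> F (Suc d)"
    and P: "\<And>K S. \<lbrakk>finite K; K \<subseteq> carrier G; \<forall>g\<in>K. S g \<in> \<A>\<rbrakk> \<Longrightarrow> P (\<Union>g\<in>K. (\<lambda>x. (x, \<phi> g x)) ` S g)"
  shows "asdim_at_most P X (orbit_metric G \<tau> \<phi>) d"
  unfolding asdim_at_most_def
proof (intro allI impI)
  fix r :: real assume r: "0 < r"
  interpret gspace_algebra G X \<phi> \<A> by (rule alg)
  define B where "B = {g \<in> carrier G. \<tau> \<one> g \<le> r}"
  have B: "finite B" "B \<subseteq> carrier G" unfolding B_def by (rule finite_ball) (rule Collect_restrict)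
  define F where "F = (\<lambda>(f, f'). f' \<otimes> inv f) ` (B \<times> B)"
  have F: "finite F" "F \<subseteq> carrier G"
  proof -
    show "finite F" unfolding F_def using B(1) by (intro finite_imageI finite_cartesian_product)
    show "F \<subseteq> carrier G"
    proof
      fix f assume "f \<in> F"
      then obtain a b where "a \<in> B" "b \<in> B" "f = b \<otimes> inv a" unfolding F_def by (elim imageE SigmaE) simp
      moreover from this have "a \<in> carrier G" "b \<in> carrier G" using B(2) by blast+
      ultimately show "f \<in> carrier G" by simp
    qed
  qed
  have F_inv: "\<forall>f\<in>F. inv f \<in> F"
  proof
    fix f assume "f \<in> F"
    then obtain a b where ab: "a \<in> B" "b \<in> B" "f = b \<otimes> inv a" unfolding F_def by (elim imageE SigmaE) simp
    have c: "a \<in> carrier G" "b \<in> carrier G" using ab(1,2) B(2) by blast+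
    have "inv f = a \<otimes> inv b" unfolding ab(3) using c by (simp add: inv_mult_group)
    then show "inv f \<in> F" unfolding F_def using ab(1,2) by (intro image_eqI[of _ _ "(b, a)"]) simp_all
  qed
  obtain U where U: "\<forall>i<Suc d. U i \<in> \<A> \<and> finite (reach G \<phi> F (U i))" "X = (\<Union>i<Suc d. U i)"
    using cov[OF F] unfolding covered_def by (elim exE conjE) (rule that)
  define V where "V j = U j - (\<Union>i<j. U i)" for j
  have V_alg: "V j \<in> \<A>" if "j < Suc d" for j
    unfolding V_def
  proof (rule alg.Diff)
    show "U j \<in> \<A>" using U(1) that by blast
    show "(\<Union>i<j. U i) \<in> \<A>"
    proof (rule alg.finite_UN)
      show "U i \<in> \<A>" if "i \<in> {..<j}" for i using U(1) that \<open>j < Suc d\<close> by (meson lessThan_iff less_trans)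
    qed simp
  qed
  have V_reach: "finite (reach G \<phi> F (V j))" if "j < Suc d" for j
  proof (rule finite_subset)
    show "reach G \<phi> F (V j) \<subseteq> reach G \<phi> F (U j)" by (rule reach_mono) (auto simp: V_def)
    show "finite (reach G \<phi> F (U j))" using U(1) that by blast
  qed
  have VX: "V j \<subseteq> X" if "j < Suc d" for j using V_alg[OF that] alg.sets_into_space by blast
  have V_disj: "i = j" if "y \<in> V i" "y \<in> V j" for i j y
  proof (cases i j rule: linorder_cases)
    case less
    then show ?thesis using that unfolding V_def by blast
  next
    case greater
    then show ?thesis using that unfolding V_def by blast
  qed
  have V_cover: "\<exists>j<Suc d. y \<in> V j" if y: "y \<in> X" for y
  proof -
    define j where "j = (LEAST j. y \<in> U j)"
    obtain i where i: "i < Suc d" "y \<in> U i"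
      using y unfolding U(2) by (elim UN_E) (rule that, simp_all only: lessThan_iff)
    have "y \<in> U j" unfolding j_def using i(2) by (rule LeastI)
    moreover have "j \<le> i" unfolding j_def using i(2) by (rule Least_le)
    moreover have "y \<notin> U i" if "i < j" for i using that unfolding j_def by (rule not_less_Least)
    ultimately have "y \<in> V j" "j < Suc d" using i(1) by (simp_all add: V_def)
    then show ?thesis by (intro exI[of _ j] conjI)
  qed
  define K where "K = (\<Union>j<Suc d. reach G \<phi> F (V j))"
  have K: "finite K" unfolding K_def using V_reach by (intro finite_UN_I) simp_all
  have KC: "K \<subseteq> carrier G" unfolding K_def using reach_closed[OF F(2)] by (intro UN_least)
  define S where "S g = {x \<in> X. \<exists>j<Suc d. walk G \<phi> F (V j) x g}" for g
  have S: "S g \<in> \<A>" for g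
  proof -
    have "simple (\<lambda>x. walk G \<phi> F (V j) x g)" if j: "j < Suc d" for j
    proof (rule simple_shift[OF simple_mem[OF V_alg[OF j]], of "insert \<one> (reach G \<phi> F (V j))"])
      fix x y assume xy: "x \<in> X" "y \<in> X"
        and *: "\<forall>t\<in>insert \<one> (reach G \<phi> F (V j)). (\<phi> t x \<in> V j) = (\<phi> t y \<in> V j)"
      have start: "x \<in> V j \<longleftrightarrow> y \<in> V j" using bspec[OF *, of \<one>] xy by simp
      show "walk G \<phi> F (V j) x g = walk G \<phi> F (V j) y g"
      proof
        assume w: "walk G \<phi> F (V j) x g"
        show "walk G \<phi> F (V j) y g"
          by (rule walk_same_pattern[OF w]) (use * start walk_start[OF w] in blast)+
      next
        assume w: "walk G \<phi> F (V j) y g"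
        show "walk G \<phi> F (V j) x g"
          by (rule walk_same_pattern[OF w]) (use * start walk_start[OF w] in blast)+
      qed
    qed (use V_reach[OF j] reach_closed[OF F(2)] in simp_all)
    then have "(\<Union>j<Suc d. {x \<in> X. walk G \<phi> F (V j) x g}) \<in> \<A>"
      using simple_Collect by (intro alg.finite_UN) auto
    also have "(\<Union>j<Suc d. {x \<in> X. walk G \<phi> F (V j) x g}) = S g" by (auto simp: S_def)
    finally show ?thesis .
  qed
  define E where "E = (\<Union>g\<in>K. (\<lambda>x. (x, \<phi> g x)) ` S g)"
  have EI: "(x, \<phi> g x) \<in> E" if "walk G \<phi> F (V j) x g" "j < Suc d" for x g j
  proof -
    have "g \<in> K" unfolding K_def reach_def using that by (intro UN_I[of j] CollectI exI[of _ x]) simp_all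
    moreover have "x \<in> X" using subsetD[OF VX[OF that(2)] walk_start[OF that(1)]] .
    then have "x \<in> S g" unfolding S_def using that by (intro CollectI conjI exI[of _ j])
    ultimately show ?thesis unfolding E_def by (intro UN_I[of g] image_eqI[of _ _ x]) simp_all
  qed
  have ED: "\<exists>g j. y = \<phi> g x \<and> j < Suc d \<and> walk G \<phi> F (V j) x g \<and> x \<in> X \<and> g \<in> K" if xy: "(x, y) \<in> E" for x y
  proof -
    obtain g where g: "g \<in> K" "x \<in> S g" "y = \<phi> g x" using xy unfolding E_def by auto
    then obtain j where "j < Suc d" "walk G \<phi> F (V j) x g" "x \<in> X" unfolding S_def by blast
    then show ?thesis using g by (intro exI[of _ g] exI[of _ j] conjI)
  qed
  have E: "equiv X E"
  proof (rule equivI)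
    show "E \<subseteq> X \<times> X"
    proof
      fix p assume p: "p \<in> E"
      obtain x y where xy: "p = (x, y)" by (cases p)
      obtain g where g: "y = \<phi> g x" "x \<in> X" "g \<in> K" using ED[OF p[unfolded xy]] by (elim exE conjE) (rule that)
      then have "g \<in> carrier G" using KC by blast
      then show "p \<in> X \<times> X" unfolding xy g(1) using g(2) by simp
    qed
    show "refl_on X E"
      unfolding refl_on_def
    proof (intro ballI)
      fix x assume x: "x \<in> X"
      obtain j where "j < Suc d" "x \<in> V j" using V_cover[OF x] by (elim exE conjE) (rule that)
      then have "(x, \<phi> \<one> x) \<in> E" by (intro EI walk_one)
      then show "(x, x) \<in> E" using x by simp
    qed
    show "sym E"
    proof (rule symI)
      fix x y assume "(x, y) \<in> E"
      then obtain g j where g: "y = \<phi> g x" "j < Suc d" "walk G \<phi> F (V j) x g" "x \<in> X" "g \<in> K"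
        using ED[OF \<open>(x, y) \<in> E\<close>] by (elim exE conjE) (rule that)
      have "(\<phi> g x, \<phi> (inv g) (\<phi> g x)) \<in> E"
        using walk_inv[OF g(3) F(2) F_inv VX[OF g(2)]] g(2) by (rule EI)
      moreover have "g \<in> carrier G" using g(5) KC by blast
      ultimately show "(y, x) \<in> E" using g(1,4) by simp
    qed
    show "trans E"
    proof (rule transI)
      fix x y w assume "(x, y) \<in> E" "(y, w) \<in> E"
      then obtain g j h i where g: "y = \<phi> g x" "j < Suc d" "walk G \<phi> F (V j) x g" "x \<in> X" "g \<in> K"
        and h: "w = \<phi> h y" "i < Suc d" "walk G \<phi> F (V i) y h" "h \<in> K"
        using ED[OF \<open>(x, y) \<in> E\<close>] ED[OF \<open>(y, w) \<in> E\<close>] by (elim exE conjE) (rule that)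
      have "i = j" using V_disj[OF walk_start[OF h(3)], of j] walk_end[OF g(3) VX[OF g(2)]] g(1) by simp
      then have "walk G \<phi> F (V j) (\<phi> g x) h" using h(3) g(1) by simp
      from walk_trans[OF this g(3) F(2) VX[OF g(2)]] have "(x, \<phi> (h \<otimes> g) x) \<in> E" using g(2) by (rule EI)
      moreover have "g \<in> carrier G" "h \<in> carrier G" using g(5) h(4) KC by blast+
      ultimately show "(x, w) \<in> E" using g(1,4) h(1) by simp
    qed
  qed
  show "\<exists>E. P E \<and> equiv X E \<and> uniformly_bounded X (orbit_metric G \<tau> \<phi>) E \<and>
    (\<forall>x\<in>X. finite {C \<in> X // E. C \<inter> ext_cball X (orbit_metric G \<tau> \<phi>) x r \<noteq> {}} \<and>
       card {C \<in> X // E. C \<inter> ext_cball X (orbit_metric G \<tau> \<phi>) x r \<noteq> {}} \<le> d + 1)"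
  proof (rule exI[of _ E], intro conjI E ballI)
    show "P E" unfolding E_def using S by (intro P K KC) simp
    define D where "D = Max (insert 0 (\<tau> \<one> ` K))"
    show "uniformly_bounded X (orbit_metric G \<tau> \<phi>) E"
      unfolding uniformly_bounded_def
    proof (intro exI[of _ "ennreal D"] conjI ballI)
      fix C assume C: "C \<in> X // E"
      show "ext_diameter (orbit_metric G \<tau> \<phi>) C \<le> ennreal D"
        unfolding ext_diameter_def
      proof (intro SUP_least)
        fix x y assume "x \<in> C" "y \<in> C"
        then have "(x, y) \<in> E" by (rule quotient_eq_iff[OF E C C, THEN iffD1, OF _ _ refl])
        from ED[OF this] obtain g where g: "y = \<phi> g x" "x \<in> X" "g \<in> K" by (elim exE conjE) (rule that)
        have "\<tau> \<one> g \<le> D" unfolding D_def using K g(3) by (intro Max_ge) auto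
        moreover have "orbit_metric G \<tau> \<phi> x y = ennreal (\<tau> \<one> g)"
          unfolding g(1) using g KC by (intro orbit_metric_act) auto
        ultimately show "orbit_metric G \<tau> \<phi> x y \<le> ennreal D" by (simp add: ennreal_leI)
      qed
    qed simp
    fix x assume x: "x \<in> X"
    let ?S = "{C \<in> X // E. C \<inter> ext_cball X (orbit_metric G \<tau> \<phi>) x r \<noteq> {}}"
    \<comment> \<open>A class meeting the ball is labelled by some \<open>j\<close> for which
      \<open>V j\<close> contains a point of the class within the ball; by \<open>key_unique\<close>
      different classes have different labels.\<close>
    define key where "key C j \<longleftrightarrow> j < Suc d \<and> (\<exists>f\<in>B. \<phi> f x \<in> C \<and> \<phi> f x \<in> V j)" for C j
    have key: "\<exists>j. key C j" if "C \<in> ?S" for C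
    proof -
      obtain y where y: "y \<in> C" "y \<in> X" "orbit_metric G \<tau> \<phi> x y \<le> ennreal r"
        using \<open>C \<in> ?S\<close> unfolding ext_cball_def by blast
      obtain f where "f \<in> carrier G" "y = \<phi> f x" "\<tau> \<one> f \<le> r"
        using orbit_metric_le[OF y(3) _ x] r by auto
      moreover obtain j where "j < Suc d" "y \<in> V j" using V_cover[OF y(2)] by (elim exE conjE) (rule that)
      ultimately have "key C j" using y(1) unfolding key_def B_def by (intro conjI bexI[of _ f] CollectI) simp_all
      then show ?thesis by blast
    qed
    have key_unique: "C = C'" if C: "C \<in> ?S" "C' \<in> ?S" and j: "key C j" "key C' j" for C C' j
    proof -
      obtain f where f: "f \<in> B" "\<phi> f x \<in> C" "\<phi> f x \<in> V j" "j < Suc d" using j(1) unfolding key_def by blast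
      obtain f' where f': "f' \<in> B" "\<phi> f' x \<in> C'" "\<phi> f' x \<in> V j" using j(2) unfolding key_def by blast
      have c: "f \<in> carrier G" "f' \<in> carrier G" using f(1) f'(1) B(2) by blast+
      have e: "\<phi> (f' \<otimes> inv f) (\<phi> f x) = \<phi> f' x" using c x by (simp add: mult_inv_cancel)
      have "f' \<otimes> inv f \<in> F" unfolding F_def using f(1) f'(1) by (intro image_eqI[of _ _ "(f, f')"]) simp_all
      have "walk G \<phi> F (V j) (\<phi> f x) ((f' \<otimes> inv f) \<otimes> \<one>)"
      proof (rule walk_step)
        show "walk G \<phi> F (V j) (\<phi> f x) \<one>" using f(3) by (rule walk_one)
        show "\<phi> (f' \<otimes> inv f \<otimes> \<one>) (\<phi> f x) \<in> V j" using e f'(3) c by simp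
      qed fact
      then have "(\<phi> f x, \<phi> (f' \<otimes> inv f \<otimes> \<one>) (\<phi> f x)) \<in> E" using f(4) by (rule EI)
      then have "(\<phi> f x, \<phi> f' x) \<in> E" using e c by simp
      then show ?thesis using quotient_eqI[OF E _ _ f(2) f'(2)] C by blast
    qed
    define k where "k C = (SOME j. key C j)" for C
    have k: "key C (k C)" if "C \<in> ?S" for C unfolding k_def using key[OF that] by (rule someI_ex)
    have inj: "inj_on k ?S"
    proof (rule inj_onI)
      fix C C' assume C: "C \<in> ?S" "C' \<in> ?S" "k C = k C'"
      show "C = C'" by (rule key_unique[OF C(1,2) k[OF C(1)]]) (unfold C(3), rule k[OF C(2)])
    qed
    have sub: "k ` ?S \<subseteq> {..<Suc d}"
    proof (rule image_subsetI)
      fix C assume "C \<in> ?S"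
      from k[OF this] show "k C \<in> {..<Suc d}" unfolding key_def by simp
    qed
    show "finite ?S" using inj_on_finite[OF inj sub] by simp
    show "card ?S \<le> d + 1" using card_inj_on_le[OF inj sub] by simp
  qed
qed

end

section \<open>Colourings\<close>

context gspace_algebra
begin

text \<open>Points carrying the index \<open>i\<close> are coloured according to their finitely many neighbours of
  smaller index.\<close>

lemma colouring_from_index:
  assumes T: "finite T" "T \<subseteq> carrier G"
    and idx: "\<And>i::nat. {x \<in> X. idx x = i} \<in> \<A>" "\<forall>x\<in>X. \<forall>t\<in>T. t \<noteq> \<one> \<longrightarrow> idx (\<phi> t x) \<noteq> idx x"
    and glue: "\<And>S. \<lbrakk>S \<subseteq> X; \<And>i. {x \<in> S. idx x = i} \<in> \<A>\<rbrakk> \<Longrightarrow> S \<in> \<A>"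
  shows "\<exists>c :: 'x \<Rightarrow> nat. simple c \<and> (\<forall>t\<in>T. t \<noteq> \<one> \<longrightarrow> (\<forall>x\<in>X. c (\<phi> t x) \<noteq> c x))"
proof -
  define S where "S = insert \<one> (T \<union> (\<lambda>t. inv t) ` T)"
  have S: "finite S" "S \<subseteq> carrier G" using T unfolding S_def by auto
  have S_inv: "\<forall>t\<in>S. inv t \<in> S"
  proof
    fix t assume "t \<in> S"
    then consider "t = \<one>" | "t \<in> T" | s where "s \<in> T" "t = inv s" unfolding S_def by blast
    then show "inv t \<in> S"
    proof cases
      case 3
      then have "inv t = s" using T(2) by auto
      then show ?thesis using 3 by (simp add: S_def)
    qed (simp_all add: S_def)
  qed
  have S_idx: "\<forall>x\<in>X. \<forall>t\<in>S. t \<noteq> \<one> \<longrightarrow> idx (\<phi> t x) \<noteq> idx x"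
  proof (intro ballI impI)
    fix x t assume x: "x \<in> X" and t: "t \<in> S" "t \<noteq> \<one>"
    then consider "t \<in> T" | s where "s \<in> T" "t = inv s" unfolding S_def by blast
    then show "idx (\<phi> t x) \<noteq> idx x"
    proof cases
      case 1
      then show ?thesis using idx(2) x t(2) by blast
    next
      case 2
      have s: "s \<in> carrier G" "s \<noteq> \<one>" using 2 T(2) t(2) by auto
      then have y: "\<phi> t x \<in> X" "\<phi> s (\<phi> t x) = x" using x 2(2) by simp_all
      have "idx (\<phi> s (\<phi> t x)) \<noteq> idx (\<phi> t x)" using idx(2) y(1) 2(1) s(2) by blast
      then show ?thesis unfolding y(2) by (rule not_sym)
    qed
  qed
  obtain c :: "'x \<Rightarrow> nat" where c: "\<forall>x\<in>X. c x \<le> card S \<and> (\<forall>t\<in>S. t \<noteq> \<one> \<longrightarrow> c (\<phi> t x) \<noteq> c x) \<and>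
      c x = (LEAST k. \<forall>t\<in>S. idx (\<phi> t x) < idx x \<longrightarrow> c (\<phi> t x) \<noteq> k)"
    using greedy_colouring[OF S S_inv S_idx] by (elim exE)
  \<comment> \<open>For fixed \<open>i\<close> this refers only to colours at points of index below
    \<open>i\<close>, whose classes are in the algebra by induction; \<open>P_iff\<close> identifies
    it with the recursive condition when \<open>i\<close> is the index of \<open>x\<close>.\<close>
  define P where "P i k x \<longleftrightarrow> (\<forall>t\<in>S. \<not> (\<exists>j\<in>{..<i}. \<phi> t x \<in> {y \<in> X. idx y = j \<and> c y = k}))" for i k x
  have P_iff: "P (idx x) k x \<longleftrightarrow> (\<forall>t\<in>S. idx (\<phi> t x) < idx x \<longrightarrow> c (\<phi> t x) \<noteq> k)" if x: "x \<in> X" for k x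
  proof -
    have "\<phi> t x \<in> X" if "t \<in> S" for t using that S(2) x by blast
    then show ?thesis unfolding P_def by auto
  qed
  have c_Least: "c x = (LEAST k. P (idx x) k x)" if x: "x \<in> X" for x
    unfolding P_iff[OF x] using c x by blast
  have P_ex: "\<exists>k. P (idx x) k x" if x: "x \<in> X" for x
  proof -
    have "finite ((\<lambda>t. c (\<phi> t x)) ` S)" using S(1) by simp
    then obtain k where "k \<notin> (\<lambda>t. c (\<phi> t x)) ` S" using ex_new_if_finite infinite_UNIV_nat by blast
    then show ?thesis unfolding P_iff[OF x] by (intro exI[of _ k]) auto
  qed
  have c_eq: "c x = k \<longleftrightarrow> P (idx x) k x \<and> (\<forall>k'\<in>{..<k}. \<not> P (idx x) k' x)" if x: "x \<in> X" for x k
  proof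
    assume "c x = k"
    then have k: "k = (LEAST k. P (idx x) k x)" using c_Least[OF x] by simp
    show "P (idx x) k x \<and> (\<forall>k'\<in>{..<k}. \<not> P (idx x) k' x)"
    proof (intro conjI ballI)
      show "P (idx x) k x" unfolding k using P_ex[OF x] by (rule LeastI_ex)
      show "\<not> P (idx x) k' x" if "k' \<in> {..<k}" for k'
        using that unfolding k lessThan_iff by (rule not_less_Least)
    qed
  next
    assume *: "P (idx x) k x \<and> (\<forall>k'\<in>{..<k}. \<not> P (idx x) k' x)"
    show "c x = k"
      unfolding c_Least[OF x]
    proof (rule Least_equality)
      show "P (idx x) k x" using * by simp
      show "k \<le> k'" if "P (idx x) k' x" for k' using * that by (meson lessThan_iff not_le)
    qed
  qed
  have level: "{x \<in> X. idx x = i \<and> c x = k} \<in> \<A>" for i k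
  proof (induction i arbitrary: k rule: less_induct)
    case (less i)
    have Q: "{x \<in> X. P i k' x} \<in> \<A>" for k'
      unfolding P_def
    proof (rule alg.sets_Collect_finite_All')
      fix t assume "t \<in> S"
      then have "t \<in> carrier G" using S(2) by blast
      then show "{x \<in> X. \<not> (\<exists>j\<in>{..<i}. \<phi> t x \<in> {y \<in> X. idx y = j \<and> c y = k'})} \<in> \<A>"
        using less.IH by (intro alg.sets_Collect_neg alg.sets_Collect_finite_Ex preimage) simp_all
    qed (use S(1) in \<open>simp_all add: S_def\<close>)
    have "{x \<in> X. P i k x \<and> \<not> (\<exists>k'\<in>{..<k}. P i k' x)} \<in> \<A>"
      by (intro alg.sets_Collect_conj alg.sets_Collect_neg alg.sets_Collect_finite_Ex Q) simp
    then have "{x \<in> X. idx x = i} \<inter> {x \<in> X. P i k x \<and> \<not> (\<exists>k'\<in>{..<k}. P i k' x)} \<in> \<A>"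
      using idx(1) by (intro alg.Int)
    also have "{x \<in> X. idx x = i} \<inter> {x \<in> X. P i k x \<and> \<not> (\<exists>k'\<in>{..<k}. P i k' x)} = {x \<in> X. idx x = i \<and> c x = k}"
      using c_eq by blast
    finally show ?case .
  qed
  have "{x \<in> X. c x = k} \<in> \<A>" for k
  proof (rule glue)
    have "{x \<in> {x \<in> X. c x = k}. idx x = i} = {x \<in> X. idx x = i \<and> c x = k}" for i by blast
    then show "{x \<in> {x \<in> X. c x = k}. idx x = i} \<in> \<A>" for i using level by simp
  qed blast
  moreover have "finite (c ` X)" by (rule finite_subset[of _ "{..card S}"]) (use c in auto)
  ultimately have "simple c" unfolding simple_def by blast
  moreover have "\<forall>t\<in>T. t \<noteq> \<one> \<longrightarrow> (\<forall>x\<in>X. c (\<phi> t x) \<noteq> c x)"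
  proof (intro ballI impI)
    fix t x assume "t \<in> T" "t \<noteq> \<one>" "x \<in> X"
    moreover from this have "t \<in> S" by (simp add: S_def)
    ultimately show "c (\<phi> t x) \<noteq> c x" using c by blast
  qed
  ultimately show ?thesis by (intro exI[of _ c] conjI)
qed

text \<open>A choice \<open>\<beta>\<close> of a separating set for each nontrivial \<open>t\<close>
  defines the set \<open>W \<beta>\<close> of points \<open>x\<close> with \<open>x\<close> in
  \<open>\<beta> t\<close> and \<open>\<phi> t x\<close> outside it, so no such translate of a point
  of \<open>W \<beta>\<close> lies in \<open>W \<beta>\<close> again. There are countably many
  choices, and the index of a point is the position of the first \<open>W \<beta>\<close> containing
  it.\<close>

lemma index_exists:
  assumes T: "finite T" "T \<subseteq> carrier G"
    and free: "\<And>t x. \<lbrakk>t \<in> T; t \<noteq> \<one>; x \<in> X\<rbrakk> \<Longrightarrow> \<phi> t x \<noteq> x"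
    and \<B>: "countable \<B>" "\<B> \<subseteq> \<A>" "\<And>x y. \<lbrakk>x \<in> X; y \<in> X; x \<noteq> y\<rbrakk> \<Longrightarrow> \<exists>B\<in>\<B>. x \<in> B \<and> y \<notin> B"
  shows "\<exists>idx :: 'x \<Rightarrow> nat. (\<forall>i. {x \<in> X. idx x = i} \<in> \<A>) \<and>
    (\<forall>x\<in>X. \<forall>t\<in>T. t \<noteq> \<one> \<longrightarrow> idx (\<phi> t x) \<noteq> idx x)"
proof (cases "T - {\<one>} = {} \<or> X = {}")
  case True
  have "{x \<in> X. (0::nat) = i} \<in> \<A>" for i by (cases "i = 0") simp_all
  then show ?thesis using True by (intro exI[of _ "\<lambda>_. 0"]) auto
next
  case False
  let ?T = "T - {\<one>}"
  define \<Phi> where "\<Phi> = PiE ?T (\<lambda>_. \<B>)"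
  have "countable \<Phi>" unfolding \<Phi>_def using T(1) \<B>(1) by (intro countable_PiE) auto
  define W where "W \<beta> = {x \<in> X. \<forall>t\<in>?T. x \<in> \<beta> t \<and> \<not> \<phi> t x \<in> \<beta> t}" for \<beta> :: "'a \<Rightarrow> 'x set"
  have W_alg: "W \<beta> \<in> \<A>" if "\<beta> \<in> \<Phi>" for \<beta>
    unfolding W_def
  proof (rule alg.sets_Collect_finite_All')
    fix t assume t: "t \<in> ?T"
    then have b: "\<beta> t \<in> \<A>" "t \<in> carrier G" using that T(2) \<B>(2) unfolding \<Phi>_def by auto
    have "{x \<in> X. x \<in> \<beta> t} = \<beta> t" using alg.sets_into_space[OF b(1)] by blast
    then show "{x \<in> X. x \<in> \<beta> t \<and> \<not> \<phi> t x \<in> \<beta> t} \<in> \<A>"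
      using b by (intro alg.sets_Collect_conj alg.sets_Collect_neg preimage) simp_all
  qed (use T(1) False in auto)
  have cover: "\<exists>\<beta>\<in>\<Phi>. x \<in> W \<beta>" if x: "x \<in> X" for x
  proof -
    have "\<forall>t\<in>?T. \<exists>B. B \<in> \<B> \<and> x \<in> B \<and> \<phi> t x \<notin> B"
    proof
      fix t assume t: "t \<in> ?T"
      then have "\<phi> t x \<in> X" "x \<noteq> \<phi> t x" using T(2) x free[of t x] by auto
      then show "\<exists>B. B \<in> \<B> \<and> x \<in> B \<and> \<phi> t x \<notin> B" using \<B>(3)[OF x] by blast
    qed
    from bchoice[OF this] obtain \<beta> where \<beta>: "\<forall>t\<in>?T. \<beta> t \<in> \<B> \<and> x \<in> \<beta> t \<and> \<phi> t x \<notin> \<beta> t" by (elim exE)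
    then have "restrict \<beta> ?T \<in> \<Phi>" unfolding \<Phi>_def by auto
    moreover have "x \<in> W (restrict \<beta> ?T)" using \<beta> x unfolding W_def by simp
    ultimately show ?thesis by blast
  qed
  then have ne: "\<Phi> \<noteq> {}" using False by blast
  define V where "V n = W (from_nat_into \<Phi> n)" for n
  have V_alg: "V n \<in> \<A>" for n unfolding V_def using from_nat_into[OF ne] by (rule W_alg)
  have V_cover: "\<exists>n. x \<in> V n" if x: "x \<in> X" for x
  proof -
    obtain \<beta> where "\<beta> \<in> \<Phi>" "x \<in> W \<beta>" using cover[OF x] by blast
    then show ?thesis unfolding V_def using from_nat_into_surj[OF \<open>countable \<Phi>\<close>] by metis
  qed
  define idx where "idx x = (LEAST n. x \<in> V n)" for x
  have idx: "x \<in> V (idx x)" if "x \<in> X" for x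
    unfolding idx_def using V_cover[OF that] by (rule LeastI_ex)
  have idx_eq: "idx x = i \<longleftrightarrow> x \<in> V i \<and> \<not> (\<exists>j\<in>{..<i}. x \<in> V j)" if x: "x \<in> X" for x i
  proof
    assume i: "idx x = i"
    have "x \<notin> V j" if "j < i" for j using that unfolding i[symmetric] idx_def by (rule not_less_Least)
    then show "x \<in> V i \<and> \<not> (\<exists>j\<in>{..<i}. x \<in> V j)" using idx[OF x] i by auto
  next
    assume *: "x \<in> V i \<and> \<not> (\<exists>j\<in>{..<i}. x \<in> V j)"
    show "idx x = i"
      unfolding idx_def
    proof (rule Least_equality)
      show "x \<in> V i" using * by simp
      show "i \<le> j" if "x \<in> V j" for j using * that by (meson lessThan_iff not_le)
    qed
  qed
  have V_mem: "{x \<in> X. x \<in> V n} \<in> \<A>" for n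
  proof -
    have "{x \<in> X. x \<in> V n} = V n" unfolding V_def W_def by blast
    then show ?thesis using V_alg by simp
  qed
  have "{x \<in> X. idx x = i} \<in> \<A>" for i
  proof -
    have "{x \<in> X. x \<in> V i \<and> \<not> (\<exists>j\<in>{..<i}. x \<in> V j)} \<in> \<A>"
      by (intro alg.sets_Collect_conj alg.sets_Collect_neg alg.sets_Collect_finite_Ex V_mem) simp
    also have "{x \<in> X. x \<in> V i \<and> \<not> (\<exists>j\<in>{..<i}. x \<in> V j)} = {x \<in> X. idx x = i}" using idx_eq by blast
    finally show ?thesis .
  qed
  moreover have "idx (\<phi> t x) \<noteq> idx x" if x: "x \<in> X" and t: "t \<in> T" "t \<noteq> \<one>" for x t
  proof
    assume eq: "idx (\<phi> t x) = idx x"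
    define \<beta> where "\<beta> = from_nat_into \<Phi> (idx x)"
    have tx: "\<phi> t x \<in> X" using t(1) T(2) x by blast
    have "x \<in> W \<beta>" using idx[OF x] by (simp add: V_def \<beta>_def)
    moreover have "\<phi> t x \<in> W \<beta>" using idx[OF tx] unfolding eq by (simp add: V_def \<beta>_def)
    moreover have "t \<in> ?T" using t by simp
    ultimately show False unfolding W_def by blast
  qed
  ultimately show ?thesis by (intro exI[of _ idx] conjI allI ballI impI)
qed

text \<open>The hypothesis \<open>glue\<close> is what both algebras offer beyond finite operations:
  a set that belongs to the algebra level by level along an index belongs to the algebra. For Borel
  sets this is a countable union; for clopen sets the complement too is a union of open
  levels.\<close>

lemma colourable:
  assumes free: "\<And>g x. \<lbrakk>g \<in> carrier G; g \<noteq> \<one>; x \<in> X\<rbrakk> \<Longrightarrow> \<phi> g x \<noteq> x"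
    and \<B>: "countable \<B>" "\<B> \<subseteq> \<A>" "\<And>x y. \<lbrakk>x \<in> X; y \<in> X; x \<noteq> y\<rbrakk> \<Longrightarrow> \<exists>B\<in>\<B>. x \<in> B \<and> y \<notin> B"
    and glue: "\<And>(idx :: 'x \<Rightarrow> nat) S. \<lbrakk>\<And>i. {x \<in> X. idx x = i} \<in> \<A>; S \<subseteq> X; \<And>i. {x \<in> S. idx x = i} \<in> \<A>\<rbrakk> \<Longrightarrow> S \<in> \<A>"
  shows "colourable_gspace G X \<phi> \<A>"
proof (intro colourable_gspace.intro colourable_gspace_axioms.intro)
  show "gspace_algebra G X \<phi> \<A>" by (rule gspace_algebra_axioms)
  fix T assume T: "finite T" "T \<subseteq> carrier G"
  have "\<exists>idx :: 'x \<Rightarrow> nat. (\<forall>i. {x \<in> X. idx x = i} \<in> \<A>) \<and>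
    (\<forall>x\<in>X. \<forall>t\<in>T. t \<noteq> \<one> \<longrightarrow> idx (\<phi> t x) \<noteq> idx x)"
  proof (rule index_exists[OF T _ \<B>(1,2)])
    show "\<phi> t x \<noteq> x" if "t \<in> T" "t \<noteq> \<one>" "x \<in> X" for t x using free that T(2) by blast
    show "\<exists>B\<in>\<B>. x \<in> B \<and> y \<notin> B" if "x \<in> X" "y \<in> X" "x \<noteq> y" for x y by (rule \<B>(3)[OF that])
  qed
  then obtain idx :: "'x \<Rightarrow> nat" where
    idx: "\<forall>i. {x \<in> X. idx x = i} \<in> \<A>" "\<forall>x\<in>X. \<forall>t\<in>T. t \<noteq> \<one> \<longrightarrow> idx (\<phi> t x) \<noteq> idx x"
    by (elim exE conjE) (rule that)
  show "\<exists>c :: 'x \<Rightarrow> nat. simple c \<and> (\<forall>t\<in>T. t \<noteq> \<one> \<longrightarrow> (\<forall>x\<in>X. c (\<phi> t x) \<noteq> c x))"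
    by (rule colouring_from_index[OF T spec[OF idx(1)] idx(2) glue[OF spec[OF idx(1)]]])
qed

end

lemma (in gspace_algebra) covered_Suc: "covered F D \<Longrightarrow> covered F (Suc D)"
proof -
  assume "covered F D"
  then obtain U where U: "\<forall>i<D. U i \<in> \<A> \<and> finite (reach G \<phi> F (U i))" "X = (\<Union>i<D. U i)"
    unfolding covered_def by (elim exE conjE) (rule that)
  show "covered F (Suc D)"
    unfolding covered_def
  proof (rule exI[of _ "\<lambda>i. if i < D then U i else {}"], intro conjI allI impI)
    show "X = (\<Union>i<Suc D. if i < D then U i else {})" by (subst U(2)) (auto simp: less_Suc_eq)
  qed (use U(1) in auto)
qed

lemma (in group) colourable_self:
  assumes "countable (carrier G)"
  shows "colourable_gspace G (carrier G) (\<otimes>) (Pow (carrier G))"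
proof -
  interpret self: gspace G "carrier G" "(\<otimes>)" by (rule gspace_self)
  interpret self: gspace_algebra G "carrier G" "(\<otimes>)" "Pow (carrier G)" by (rule self.gspace_algebra_Pow)
  show ?thesis
  proof (rule self.colourable[of "(\<lambda>g. {g}) ` carrier G"])
    show "g \<otimes> x \<noteq> x" if "g \<in> carrier G" "g \<noteq> \<one>" "x \<in> carrier G" for g x using that by simp
    show "\<exists>B\<in>(\<lambda>g. {g}) ` carrier G. x \<in> B \<and> y \<notin> B" if "x \<in> carrier G" "y \<in> carrier G" "x \<noteq> y" for x y
      using that by (intro bexI[of _ "{x}"]) auto
  qed (use assms in auto)
qed

section \<open>Borel and clopen algebras\<close>

lemma metrizable_separable_separating:
  assumes "metrizable_space X" "separable_space X"
  shows "\<exists>\<B>. countable \<B> \<and> (\<forall>B\<in>\<B>. openin X B) \<and>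
    (\<forall>x\<in>topspace X. \<forall>y\<in>topspace X. x \<noteq> y \<longrightarrow> (\<exists>B\<in>\<B>. x \<in> B \<and> y \<notin> B))"
proof -
  obtain S d where "Metric_space S d" and X: "X = Metric_space.mtopology S d"
    using assms(1) unfolding metrizable_space_def by blast
  interpret Metric_space S d by fact
  obtain C where C: "countable C" "C \<subseteq> S" "mtopology closure_of C = S"
    using assms(2) unfolding separable_space_def X by auto
  define \<B> where "\<B> = (\<lambda>(c, n). mball c (inverse (real (Suc n)))) ` (C \<times> UNIV)"
  have "\<exists>B\<in>\<B>. x \<in> B \<and> y \<notin> B" if xy: "x \<in> S" "y \<in> S" "x \<noteq> y" for x y
  proof -
    have "0 < d x y / 2" using mdist_pos_eq xy by simp
    then obtain n where n: "inverse (real (Suc n)) < d x y / 2" using reals_Archimedean by blast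
    have "x \<in> mtopology closure_of C" using C(3) xy(1) by simp
    then have "\<forall>r>0. \<exists>c\<in>C. c \<in> mball x r" unfolding metric_closure_of mem_Collect_eq by (rule conjunct2)
    moreover have "0 < inverse (real (Suc n))" by simp
    ultimately have "\<exists>c\<in>C. c \<in> mball x (inverse (real (Suc n)))" by (elim allE[of _ "inverse (real (Suc n))"] mp)
    then obtain c where c: "c \<in> C" "c \<in> mball x (inverse (real (Suc n)))" by (elim bexE) (rule that)
    then have "x \<in> mball c (inverse (real (Suc n)))" by (simp add: commute)
    moreover have "d x y \<le> d x c + d c y" using c(2) xy by (intro triangle) auto
    then have "y \<notin> mball c (inverse (real (Suc n)))" using n c(2) by auto
    moreover have "mball c (inverse (real (Suc n))) \<in> \<B>"
      unfolding \<B>_def using c(1) by (intro image_eqI[of _ _ "(c, n)"]) simp_all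
    ultimately show ?thesis by (intro bexI[of _ "mball c (inverse (real (Suc n)))"] conjI)
  qed
  moreover have "countable \<B>" unfolding \<B>_def using C(1) by simp
  moreover have "\<forall>B\<in>\<B>. openin X B" unfolding \<B>_def X by auto
  ultimately show ?thesis
    unfolding X topspace_mtopology by (intro exI[of _ \<B>] conjI ballI impI) simp_all
qed

lemma standard_borel_separating:
  assumes "standard_borel M"
  obtains \<B> where "countable \<B>" "\<B> \<subseteq> sets M"
    "\<And>x y. \<lbrakk>x \<in> space M; y \<in> space M; x \<noteq> y\<rbrakk> \<Longrightarrow> \<exists>B\<in>\<B>. x \<in> B \<and> y \<notin> B"
proof -
  obtain X where X: "completely_metrizable_space X" "separable_space X" "topspace X = space M"
    "sets M = sigma_sets (space M) {U. openin X U}"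
    using assms unfolding standard_borel_def polish_space_def by blast
  obtain \<B> where \<B>: "countable \<B>" "\<forall>B\<in>\<B>. openin X B"
    "\<forall>x\<in>topspace X. \<forall>y\<in>topspace X. x \<noteq> y \<longrightarrow> (\<exists>B\<in>\<B>. x \<in> B \<and> y \<notin> B)"
    using metrizable_separable_separating[OF completely_metrizable_imp_metrizable_space[OF X(1)] X(2)]
    by (elim exE conjE) (rule that)
  show ?thesis
  proof (rule that[OF \<B>(1)])
    show "\<B> \<subseteq> sets M"
    proof
      fix B assume "B \<in> \<B>"
      then have "openin X B" using \<B>(2) by (rule bspec[rotated])
      then show "B \<in> sets M" unfolding X(4) by (intro sigma_sets.Basic CollectI)
    qed
    show "\<exists>B\<in>\<B>. x \<in> B \<and> y \<notin> B" if "x \<in> space M" "y \<in> space M" "x \<noteq> y" for x y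
      using \<B>(3)[unfolded X(3), THEN bspec, OF that(1), THEN bspec, OF that(2), THEN mp, OF that(3)] .
  qed
qed

lemma free_actionD: "\<lbrakk>free_action G X \<phi>; g \<in> carrier G; g \<noteq> \<one>\<^bsub>G\<^esub>; x \<in> X\<rbrakk> \<Longrightarrow> \<phi> g x \<noteq> x"
  by (simp add: free_action_def)

lemma gspace_algebra_borel:
  assumes "borel_action G M \<phi>"
  shows "gspace_algebra G (space M) \<phi> (sets M)"
proof (intro gspace_algebra.intro gspace_algebra_axioms.intro)
  show "gspace G (space M) \<phi>"
    using assms unfolding borel_action_def by (intro gspace_if_group_action) simp
  show "Sigma_Algebra.algebra (space M) (sets M)" by (rule sets.algebra_axioms)
  fix g S assume g: "g \<in> carrier G" and S: "S \<in> sets M"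
  have "Pair g \<in> M \<rightarrow>\<^sub>M count_space (carrier G) \<Otimes>\<^sub>M M" using g by (intro measurable_Pair1') simp
  moreover have "(\<lambda>(g, x). \<phi> g x) \<in> count_space (carrier G) \<Otimes>\<^sub>M M \<rightarrow>\<^sub>M M"
    using assms by (simp add: borel_action_def)
  ultimately have "(\<lambda>x. (\<lambda>(g, x). \<phi> g x) (g, x)) \<in> M \<rightarrow>\<^sub>M M" by (rule measurable_compose)
  then have "\<phi> g -` S \<inter> space M \<in> sets M" using S by (simp add: measurable_sets)
  also have "\<phi> g -` S \<inter> space M = {x \<in> space M. \<phi> g x \<in> S}" by blast
  finally show "{x \<in> space M. \<phi> g x \<in> S} \<in> sets M" .
qed

lemma colourable_borel:
  fixes M :: "'x measure"
  assumes "standard_borel M" "borel_action G M \<phi>" "free_action G (space M) \<phi>"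
  shows "colourable_gspace G (space M) \<phi> (sets M)"
proof -
  note alg = gspace_algebra_borel[OF assms(2)]
  obtain \<B> where \<B>: "countable \<B>" "\<B> \<subseteq> sets M"
    "\<And>x y. \<lbrakk>x \<in> space M; y \<in> space M; x \<noteq> y\<rbrakk> \<Longrightarrow> \<exists>B\<in>\<B>. x \<in> B \<and> y \<notin> B"
    by (rule standard_borel_separating[OF assms(1)]) (rule that)
  show ?thesis
  proof (rule gspace_algebra.colourable[OF alg free_actionD[OF assms(3)] \<B>])
    fix idx :: "'x \<Rightarrow> nat" and S
    assume "\<And>i. {x \<in> S. idx x = i} \<in> sets M"
    then have "(\<Union>i. {x \<in> S. idx x = i}) \<in> sets M" by (intro sets.countable_UN) auto
    also have "(\<Union>i. {x \<in> S. idx x = i}) = S" by (intro equalityI subsetI) simp_all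
    finally show "S \<in> sets M" .
  qed
qed

text \<open>The complement of a graph is a countable union of rectangles, by a countable separating family.\<close>

lemma borel_graph:
  assumes "standard_borel M" "borel_action G M \<phi>"
    and K: "finite K" "K \<subseteq> carrier G" "\<forall>g\<in>K. S g \<in> sets M"
  shows "(\<Union>g\<in>K. (\<lambda>x. (x, \<phi> g x)) ` S g) \<in> sets (M \<Otimes>\<^sub>M M)"
proof (rule sets.finite_UN[OF K(1)])
  note alg = gspace_algebra_borel[OF assms(2)]
  obtain \<B> where \<B>: "countable \<B>" "\<B> \<subseteq> sets M"
    "\<And>x y. \<lbrakk>x \<in> space M; y \<in> space M; x \<noteq> y\<rbrakk> \<Longrightarrow> \<exists>B\<in>\<B>. x \<in> B \<and> y \<notin> B"
    by (rule standard_borel_separating[OF assms(1)]) (rule that)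
  fix g assume "g \<in> K"
  then have g: "g \<in> carrier G" "S g \<in> sets M" using K by auto
  have Sx: "x \<in> space M" if "x \<in> S g" for x by (rule subsetD[OF sets.sets_into_space[OF g(2)] that])
  have gx: "\<phi> g x \<in> space M" if "x \<in> S g" for x
    by (rule gspace.act_closed[OF gspace_algebra.axioms(1)[OF alg] g(1) Sx[OF that]])
  let ?R = "\<lambda>B. {x \<in> space M. \<phi> g x \<in> B} \<times> (space M - B)"
  have "(\<Union>B\<in>\<B>. ?R B) \<in> sets (M \<Otimes>\<^sub>M M)"
  proof (rule sets.countable_UN''[OF \<B>(1)])
    fix B assume "B \<in> \<B>"
    then have "B \<in> sets M" by (rule subsetD[OF \<B>(2)])
    then show "?R B \<in> sets (M \<Otimes>\<^sub>M M)"
      by (intro pair_measureI gspace_algebra.preimage[OF alg g(1)] sets.compl_sets)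
  qed
  then have "S g \<times> space M - (\<Union>B\<in>\<B>. ?R B) \<in> sets (M \<Otimes>\<^sub>M M)"
    using g(2) by (intro sets.Diff pair_measureI sets.top)
  also have "S g \<times> space M - (\<Union>B\<in>\<B>. ?R B) = (\<lambda>x. (x, \<phi> g x)) ` S g"
  proof (intro equalityI subsetI)
    fix p assume p_in: "p \<in> S g \<times> space M - (\<Union>B\<in>\<B>. ?R B)"
    obtain x y where p: "p = (x, y)" by (cases p)
    have xy: "x \<in> S g" "y \<in> space M" "(x, y) \<notin> (\<Union>B\<in>\<B>. ?R B)" using p_in unfolding p by simp_all
    have "\<phi> g x = y"
    proof (rule ccontr)
      assume "\<phi> g x \<noteq> y"
      then obtain B where B: "B \<in> \<B>" "\<phi> g x \<in> B" "y \<notin> B" using \<B>(3)[OF gx[OF xy(1)] xy(2)] by blast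
      then have "(x, y) \<in> ?R B" using Sx[OF xy(1)] xy(2) by simp
      with B(1) have "(x, y) \<in> (\<Union>B\<in>\<B>. ?R B)" by (rule UN_I)
      with xy(3) show False by (rule notE)
    qed
    then show "p \<in> (\<lambda>x. (x, \<phi> g x)) ` S g" unfolding p using xy(1) by (intro image_eqI[of _ _ x]) simp_all
  next
    fix p assume "p \<in> (\<lambda>x. (x, \<phi> g x)) ` S g"
    then obtain x where x: "p = (x, \<phi> g x)" "x \<in> S g" by (elim imageE) (rule that)
    then show "p \<in> S g \<times> space M - (\<Union>B\<in>\<B>. ?R B)" using gx[OF x(2)] by simp
  qed
  finally show "(\<lambda>x. (x, \<phi> g x)) ` S g \<in> sets (M \<Otimes>\<^sub>M M)" .
qed

section \<open>The clopen algebra of a zero-dimensional space\<close>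

text \<open>A countable family is extracted from an arbitrary clopen base: for each pair of members
  of a countable base one clopen set between them is chosen whenever there is one.\<close>

lemma clopen_separating:
  assumes "zero_dimensional_space X" "second_countable X" "Hausdorff_space X"
  obtains \<B> where "countable \<B>" "\<B> \<subseteq> {S. openin X S \<and> closedin X S}"
    "\<And>x y. \<lbrakk>x \<in> topspace X; y \<in> topspace X; x \<noteq> y\<rbrakk> \<Longrightarrow> \<exists>B\<in>\<B>. x \<in> B \<and> y \<notin> B"
proof -
  obtain \<V> where \<V>: "\<And>V. V \<in> \<V> \<Longrightarrow> openin X V \<and> closedin X V"
    "\<And>U x. openin X U \<Longrightarrow> x \<in> U \<Longrightarrow> \<exists>V\<in>\<V>. x \<in> V \<and> V \<subseteq> U"
    using assms(1) unfolding zero_dimensional_space_def by meson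
  obtain \<O> where \<O>: "countable \<O>"
    "\<And>U x. openin X U \<Longrightarrow> x \<in> U \<Longrightarrow> \<exists>V\<in>\<O>. x \<in> V \<and> V \<subseteq> U"
    "\<And>V. V \<in> \<O> \<Longrightarrow> openin X V"
    using assms(2) unfolding second_countable_def by meson
  define sep where "sep p V \<longleftrightarrow> V \<in> \<V> \<and> fst p \<subseteq> V \<and> V \<subseteq> snd p" for p V
  define \<P> where "\<P> = {p \<in> \<O> \<times> \<O>. \<exists>V. sep p V}"
  define \<B> where "\<B> = (\<lambda>p. SOME V. sep p V) ` \<P>"
  have sep: "sep p (SOME V. sep p V)" if "p \<in> \<P>" for p using that unfolding \<P>_def by (auto intro: someI_ex)
  show ?thesis
  proof (rule that[of \<B>])
    have "countable \<P>" unfolding \<P>_def using \<O>(1) by (intro countable_subset[OF Collect_restrict]) simp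
    then show "countable \<B>" unfolding \<B>_def by simp
    show "\<B> \<subseteq> {S. openin X S \<and> closedin X S}"
    proof
      fix B assume "B \<in> \<B>"
      then obtain p where p: "p \<in> \<P>" "B = (SOME V. sep p V)" unfolding \<B>_def by (elim imageE) (rule that)
      then have "sep p B" using sep by simp
      then show "B \<in> {S. openin X S \<and> closedin X S}" unfolding sep_def using \<V>(1) by simp
    qed
    fix x y assume xy: "x \<in> topspace X" "y \<in> topspace X" "x \<noteq> y"
    then obtain U where "openin X U" "x \<in> U" "y \<notin> U"
      using assms(3) unfolding Hausdorff_space_def by (meson disjnt_iff)
    then obtain O2 where O2: "O2 \<in> \<O>" "x \<in> O2" "y \<notin> O2" "openin X O2" using \<O>(2,3) by blast
    then obtain V where V: "V \<in> \<V>" "x \<in> V" "V \<subseteq> O2" using \<V>(2) by blast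
    then obtain O1 where O1: "O1 \<in> \<O>" "x \<in> O1" "O1 \<subseteq> V" using \<O>(2) \<V>(1) by blast
    have p: "(O1, O2) \<in> \<P>" unfolding \<P>_def sep_def using O1 O2 V by auto
    show "\<exists>B\<in>\<B>. x \<in> B \<and> y \<notin> B"
      using sep[OF p] O1(2) O2(3) p unfolding \<B>_def sep_def by (intro bexI[OF _ imageI[OF p]]) auto
  qed
qed

lemma gspace_algebra_clopen:
  assumes "continuous_action G X \<phi>"
  shows "gspace_algebra G (topspace X) \<phi> {S. openin X S \<and> closedin X S}"
proof (intro gspace_algebra.intro gspace_algebra_axioms.intro)
  show "gspace G (topspace X) \<phi>"
    using assms unfolding continuous_action_def by (intro gspace_if_group_action) simp
  show "Sigma_Algebra.algebra (topspace X) {S. openin X S \<and> closedin X S}"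
    unfolding algebra_iff_Un by (auto dest: openin_subset simp: openin_diff closedin_diff)
  fix g S assume g: "g \<in> carrier G" and S: "S \<in> {S. openin X S \<and> closedin X S}"
  have "continuous_map X (prod_topology (discrete_topology (carrier G)) X) (\<lambda>x. (g, x))"
    using g by (intro continuous_map_pairedI) auto
  moreover have "continuous_map (prod_topology (discrete_topology (carrier G)) X) X (\<lambda>(g, x). \<phi> g x)"
    using assms by (simp add: continuous_action_def)
  ultimately have "continuous_map X X ((\<lambda>(g, x). \<phi> g x) \<circ> (\<lambda>x. (g, x)))" by (rule continuous_map_compose)
  then have "continuous_map X X (\<phi> g)" by (simp add: o_def)
  then show "{x \<in> topspace X. \<phi> g x \<in> S} \<in> {S. openin X S \<and> closedin X S}"
    using S openin_continuous_map_preimage closedin_continuous_map_preimage by blast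
qed

lemma colourable_clopen:
  fixes X :: "'x topology"
  assumes "zero_dimensional_space X" "second_countable X" "Hausdorff_space X"
    and "continuous_action G X \<phi>" "free_action G (topspace X) \<phi>"
  shows "colourable_gspace G (topspace X) \<phi> {S. openin X S \<and> closedin X S}"
proof -
  note alg = gspace_algebra_clopen[OF assms(4)]
  obtain \<B> where \<B>: "countable \<B>" "\<B> \<subseteq> {S. openin X S \<and> closedin X S}"
    "\<And>x y. \<lbrakk>x \<in> topspace X; y \<in> topspace X; x \<noteq> y\<rbrakk> \<Longrightarrow> \<exists>B\<in>\<B>. x \<in> B \<and> y \<notin> B"
    by (rule clopen_separating[OF assms(1-3)]) (rule that)
  show ?thesis
  proof (rule gspace_algebra.colourable[OF alg free_actionD[OF assms(5)] \<B>])
    fix idx :: "'x \<Rightarrow> nat" and S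
    assume idx: "\<And>i. {x \<in> topspace X. idx x = i} \<in> {S. openin X S \<and> closedin X S}"
      and S: "S \<subseteq> topspace X" "\<And>i. {x \<in> S. idx x = i} \<in> {S. openin X S \<and> closedin X S}"
    have "openin X {x \<in> S. idx x = i}" for i using S(2)[of i] by simp
    then have "openin X (\<Union>i. {x \<in> S. idx x = i})" by (intro openin_Union) (elim imageE, simp)
    also have "(\<Union>i. {x \<in> S. idx x = i}) = S" by (intro equalityI subsetI) simp_all
    finally have "openin X S" .
    moreover have "openin X ({x \<in> topspace X. idx x = i} - {x \<in> S. idx x = i})" for i
      using S(2)[of i] idx[of i] by (intro openin_diff) simp_all
    then have "openin X (\<Union>i. {x \<in> topspace X. idx x = i} - {x \<in> S. idx x = i})"
      by (intro openin_Union) (elim imageE, simp)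
    moreover have "(\<Union>i. {x \<in> topspace X. idx x = i} - {x \<in> S. idx x = i}) = topspace X - S"
      by (intro equalityI subsetI) simp_all
    ultimately show "S \<in> {S. openin X S \<and> closedin X S}" using S(1) by (simp add: closedin_def)
  qed
qed

section \<open>Assembly of the two dimension statements\<close>

lemma chain_elements_subset_reach:
  "chain_elements G \<phi> B U \<subseteq> reach G \<phi> (B \<union> (\<lambda>h. inv\<^bsub>G\<^esub> h) ` B) U"
proof
  fix g assume "g \<in> chain_elements G \<phi> B U"
  then obtain x m b where x: "x \<in> U" "g = left_word G b m"
    and b: "\<forall>k\<in>{1..m}. b k \<in> B \<union> (\<lambda>h. inv\<^bsub>G\<^esub> h) ` B" "\<forall>k\<in>{1..m}. \<phi> (left_word G b k) x \<in> U"
    unfolding chain_elements_def by blast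
  have "walk G \<phi> (B \<union> (\<lambda>h. inv\<^bsub>G\<^esub> h) ` B) U x (left_word G b k)" if "k \<le> m" for k
    using that
  proof (induction k)
    case 0
    show ?case unfolding left_word.simps using x(1) by (rule walk_one)
  next
    case (Suc k)
    then have k: "Suc k \<in> {1..m}" by simp
    show ?case
      unfolding left_word.simps
    proof (rule walk_step)
      show "walk G \<phi> (B \<union> (\<lambda>h. inv\<^bsub>G\<^esub> h) ` B) U x (left_word G b k)" using Suc by simp
      show "b (Suc k) \<in> B \<union> (\<lambda>h. inv\<^bsub>G\<^esub> h) ` B" using bspec[OF b(1) k] .
      show "\<phi> (b (Suc k) \<otimes>\<^bsub>G\<^esub> left_word G b k) x \<in> U" using bspec[OF b(2) k] by simp
    qed
  qed
  then have "walk G \<phi> (B \<union> (\<lambda>h. inv\<^bsub>G\<^esub> h) ` B) U x g" using x(2) by simp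
  then show "g \<in> reach G \<phi> (B \<union> (\<lambda>h. inv\<^bsub>G\<^esub> h) ` B) U" unfolding reach_def by blast
qed

lemma free_gspace_if_free_action:
  assumes "gspace G X \<phi>" "metric_group G \<tau>" "free_action G X \<phi>"
  shows "free_gspace G X \<phi> \<tau>"
  using assms(1,2)
proof (intro free_gspace.intro free_gspace_axioms.intro)
  show "g = \<one>\<^bsub>G\<^esub>" if "g \<in> carrier G" "x \<in> X" "\<phi> g x = x" for g x
    using free_actionD[OF assms(3) that(1) _ that(2)] that(3) by metis
qed

text \<open>Trades the \<open>D\<close> sets supplied by contractibility for \<open>Suc d\<close>,
  where \<open>d\<close> bounds the dimension of the group itself and the number of sets no longer
  refers to \<open>D\<close>.\<close>

lemma (in metric_group) covered_if_group_asdim: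
  assumes "colourable_gspace G X \<phi> \<A>" and D: "coarsely_contractible G D"
    and d: "asdim_at_most P (carrier G) (\<lambda>g h. ennreal (\<tau> g h)) d"
    and F: "finite F" "F \<subseteq> carrier G"
  shows "gspace_algebra.covered G X \<phi> \<A> F (Suc d)"
proof -
  interpret colourable_gspace G X \<phi> \<A> by fact
  show ?thesis
    by (rule covered_if_covered[OF F covered_if_contractible[OF D] covered_if_asdim[OF d]])
qed

lemma Inf_enat_attained:
  assumes "P d"
  obtains e where "Inf {enat d | d. P d} = enat e" "P e"
proof -
  have "{enat d | d. P d} \<noteq> {}" using assms by blast
  then have "Inf {enat d | d. P d} = (LEAST x. x \<in> {enat d | d. P d})" unfolding Inf_enat_def by (rule if_not_P)
  moreover have "(LEAST x. x \<in> {enat d | d. P d}) \<in> {enat d | d. P d}"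
    using assms by (intro LeastI[of "\<lambda>x. x \<in> {enat d | d. P d}" "enat d"]) blast
  ultimately show ?thesis using that by auto
qed

text \<open>Contractibility gives bounds in terms of \<open>D\<close>. Applied to the group acting
  on itself it shows finiteness, so that a least \<open>d\<close> exists, and this \<open>d\<close>
  then replaces \<open>D\<close> for every action. The lower bound for Borel actions comes from a
  single orbit, which is where a point of \<open>space M\<close> is chosen.\<close>

theorem theorem1p3:
  fixes G :: "('a, 'm) monoid_scheme" (structure)
    and n :: nat and H :: "nat \<Rightarrow> 'a set" and \<tau> :: "'a \<Rightarrow> 'a \<Rightarrow> real"
  assumes "group G" and "countable (carrier G)"
    and "normal_series G n H"
    and "\<forall>k<n. if k = 0 then admissible_top_factor (series_factor G H k)
                else admissible_factor (series_factor G H k)"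
    and "proper_right_invariant_metric G \<tau>"
  shows "group_asdim G \<tau> < \<infinity> \<and>
    (\<forall>(M :: 'b measure) \<phi>.
       standard_borel M \<and> space M \<noteq> {} \<and> borel_action G M \<phi> \<and> free_action G (space M) \<phi> \<longrightarrow>
       action_borel_asdim G \<tau> M \<phi> = group_asdim G \<tau>) \<and>
    (\<forall>(X :: 'c topology) \<psi>.
       locally_compact_space X \<and> zero_dimensional_space X \<and> second_countable X \<and>
       Hausdorff_space X \<and> continuous_action G X \<psi> \<and> free_action G (topspace X) \<psi> \<longrightarrow>
       dynamic_asdim G X \<psi> \<le> group_asdim G \<tau>)"
proof -
  interpret G: group G by fact
  interpret metric_group G \<tau> using assms(5) by unfold_locales
  obtain D where D: "coarsely_contractible G D" using coarsely_contractible_normal_series[OF assms(1-4)] by (elim exE) (rule that)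
  interpret self: colourable_gspace G "carrier G" "(\<otimes>)" "Pow (carrier G)"
    by (rule G.colourable_self[OF assms(2)])
  interpret self: free_gspace G "carrier G" "(\<otimes>)" \<tau> by unfold_locales simp
  \<comment> \<open>An empty set is added to obtain the form \<open>Suc D\<close> expected by
    \<open>asdim_if_covered\<close>, also when \<open>D\<close> is 0.\<close>
  have "self.covered F (Suc D)" if "finite F" "F \<subseteq> carrier G" for F
    by (rule self.covered_Suc[OF self.covered_if_contractible[OF D that]])
  \<comment> \<open>For left translation of the group on itself the orbit metric is
    \<open>\<tau>\<close>; the passage from one to the other is the orbit of a point under
    \<open>asdim_orbit\<close>.\<close>
  then have "asdim_at_most (\<lambda>_. True) (carrier G) (orbit_metric G \<tau> (\<otimes>)) D"
    by (intro self.asdim_if_covered[OF self.gspace_algebra_axioms]) simp_all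
  then have "asdim_at_most (\<lambda>_. True) (carrier G) (\<lambda>g h. ennreal (\<tau> g h)) D"
    by (rule self.asdim_orbit) (metis G.one_closed empty_iff)
  then obtain d where Inf_d: "Inf {enat d | d. asdim_at_most (\<lambda>_. True) (carrier G) (\<lambda>g h. ennreal (\<tau> g h)) d} = enat d"
    and at_most: "asdim_at_most (\<lambda>_. True) (carrier G) (\<lambda>g h. ennreal (\<tau> g h)) d"
    by (rule Inf_enat_attained) (rule that)
  have d: "group_asdim G \<tau> = enat d" unfolding group_asdim_def asdim_def by (rule Inf_d)
  have least: "d \<le> e" if "asdim_at_most (\<lambda>_. True) (carrier G) (\<lambda>g h. ennreal (\<tau> g h)) e" for e
  proof -
    have "group_asdim G \<tau> \<le> enat e" unfolding group_asdim_def asdim_def using that by (intro Inf_lower CollectI exI[of _ e] conjI refl)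
    then show ?thesis using d by simp
  qed
  have borel: "action_borel_asdim G \<tau> M \<phi> = group_asdim G \<tau>"
    if M: "standard_borel M" "space M \<noteq> {}" "borel_action G M \<phi>" "free_action G (space M) \<phi>"
    for M :: "'b measure" and \<phi>
  proof (rule antisym)
    interpret colourable_gspace G "space M" \<phi> "sets M" by (rule colourable_borel[OF M(1,3,4)])
    interpret free_gspace G "space M" \<phi> \<tau>
      by (rule free_gspace_if_free_action[OF gspace_axioms metric_group_axioms M(4)])
    have "asdim_at_most (\<lambda>E. E \<in> sets (M \<Otimes>\<^sub>M M)) (space M) (orbit_metric G \<tau> \<phi>) d"
    proof (rule asdim_if_covered[OF gspace_algebra_axioms])
      show "covered F (Suc d)" if "finite F" "F \<subseteq> carrier G" for F
        by (rule covered_if_group_asdim[OF colourable_gspace_axioms D at_most that])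
      show "(\<Union>g\<in>K. (\<lambda>x. (x, \<phi> g x)) ` S g) \<in> sets (M \<Otimes>\<^sub>M M)"
        if "finite K" "K \<subseteq> carrier G" "\<forall>g\<in>K. S g \<in> sets M" for K S
        by (rule borel_graph[OF M(1,3) that])
    qed
    then show "action_borel_asdim G \<tau> M \<phi> \<le> group_asdim G \<tau>"
      unfolding d action_borel_asdim_def borel_asdim_def by (intro Inf_lower CollectI exI[of _ d] conjI refl)
    show "group_asdim G \<tau> \<le> action_borel_asdim G \<tau> M \<phi>"
      unfolding d action_borel_asdim_def borel_asdim_def
    proof (rule Inf_greatest)
      fix y assume "y \<in> {enat d | d. asdim_at_most (\<lambda>E. E \<in> sets (M \<Otimes>\<^sub>M M)) (space M) (orbit_metric G \<tau> \<phi>) d}"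
      then obtain e where e: "y = enat e"
        "asdim_at_most (\<lambda>E. E \<in> sets (M \<Otimes>\<^sub>M M)) (space M) (orbit_metric G \<tau> \<phi>) e"
        unfolding mem_Collect_eq by (elim exE conjE) (rule that)
      show "enat d \<le> y" using least[OF asdim_orbit[OF e(2) M(2)]] e(1) by simp
    qed
  qed
  have dynamic: "dynamic_asdim G X \<psi> \<le> group_asdim G \<tau>"
    if X: "zero_dimensional_space X" "second_countable X" "Hausdorff_space X"
      "continuous_action G X \<psi>" "free_action G (topspace X) \<psi>" for X :: "'c topology" and \<psi>
  proof -
    interpret colourable_gspace G "topspace X" \<psi> "{S. openin X S \<and> closedin X S}"
      by (rule colourable_clopen[OF X])
    have "dad_at_most G X \<psi> d"
      unfolding dad_at_most_def
    proof (intro allI impI, elim conjE)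
      fix K B assume K: "compactin X K" and B: "finite B" "B \<subseteq> carrier G"
      let ?F = "B \<union> (\<lambda>h. inv h) ` B"
      have F: "finite ?F" "?F \<subseteq> carrier G" using B by auto
      obtain U where U: "\<forall>i<Suc d. U i \<in> {S. openin X S \<and> closedin X S} \<and> finite (reach G \<psi> ?F (U i))"
        "topspace X = (\<Union>i<Suc d. U i)"
        using covered_if_group_asdim[OF colourable_gspace_axioms D at_most F] unfolding covered_def by (elim exE conjE) (rule that)
      show "\<exists>U :: nat \<Rightarrow> 'c set. (\<forall>i\<le>d. openin X (U i)) \<and> K \<subseteq> (\<Union>i\<le>d. U i) \<and>
        (\<forall>i\<le>d. finite (chain_elements G \<psi> B (U i)))"
      proof (rule exI[of _ U], intro conjI allI impI)
        show "openin X (U i)" if "i \<le> d" for i using U(1) that by simp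
        show "K \<subseteq> (\<Union>i\<le>d. U i)"
          using compactin_subset_topspace[OF K] U(2) unfolding lessThan_Suc_atMost by simp
        show "finite (chain_elements G \<psi> B (U i))" if "i \<le> d" for i
          using U(1) that by (intro finite_subset[OF chain_elements_subset_reach]) simp
      qed
    qed
    then show ?thesis unfolding d dynamic_asdim_def by (intro Inf_lower CollectI exI[of _ d] conjI refl)
  qed
  show ?thesis
  proof (intro conjI allI impI)
    show "group_asdim G \<tau> < \<infinity>" unfolding d by simp
  next
    fix M :: "'b measure" and \<phi>
    assume "standard_borel M \<and> space M \<noteq> {} \<and> borel_action G M \<phi> \<and> free_action G (space M) \<phi>"
    then show "action_borel_asdim G \<tau> M \<phi> = group_asdim G \<tau>" by (elim conjE) (rule borel)
  next
    fix X :: "'c topology" and \<psi>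
    assume "locally_compact_space X \<and> zero_dimensional_space X \<and> second_countable X \<and>
       Hausdorff_space X \<and> continuous_action G X \<psi> \<and> free_action G (topspace X) \<psi>"
    then show "dynamic_asdim G X \<psi> \<le> group_asdim G \<tau>" by (elim conjE) (rule dynamic)
  qed
qed

end
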